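(* Let $T=k\langle x_1,\dots,x_n\rangle/(\alpha_{ij}x_ix_j+x_jx_i)_{1\leq i,j\leq n,\,i\neq j}$ be a skew polynomial algebra, where $\alpha_{ij}\in k$ satisfy $\alpha_{ij}\alpha_{ji}=1$ for all $i\neq j$ and $\deg x_i=1$ for all $i$, and put $S=T/(x_1^2,\dots,x_{n-1}^2)$. Let $f=x_n^2\in S_2$, so that $A=S/(f)$ is a skew exterior algebra, and let $E\subset\mathbb P^{n-1}$ be the set of points $p$ such that $N_p$ is a co-point module over $A$. (1) For $p\in E$, $N_p\in\operatorname{TR}^0_S(A)$ if and only if $p\notin\mathcal V(x_n)$. (2) If $M\in\operatorname{grmod}A$ is an $r$-extension of co-point modules $N_{p_i}$ with $p_i\in E\setminus\mathcal V(x_n)$, then there exists $\phi\in\operatorname{NMF}^0_S(f)$ of rank $r$ such that $M\cong\operatorname{Coker}\phi$.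
   Context: $k$ is a fixed field. $\operatorname{grmod}A$ is the category of finitely generated graded right $A$-modules with degree-preserving homomorphisms; $M(n)_i=M_{n+i}$. The element $f=x_n^2\in S_2$ is regular (neither left nor right zero divisor) and normal ($Sf=fS$). Co-point modules: $M\in\operatorname{grmod}A$ is a co-point module over $A$ if it has a linear free resolution $\cdots\to A(-3)\to A(-2)\to A(-1)\to A\to M\to0$. For $p=(a_1,\dots,a_n)\in\mathbb P^{n-1}$, $N_p:=A/(a_1x_1+\cdots+a_nx_n)A\in\operatorname{grmod}A$. $\mathcal V(x_n)=\{(a_1,\dots,a_n)\in\mathbb P^{n-1}\mid a_n=0\}$. $M$ is an $r$-extension of co-point modules $N_{p_i}$ if it has a filtration $M=M_0\supset M_1\supset\cdots\supset M_r=0$ by graded submodules such that each $M_i/M_{i+1}$ ($0\leq i\leq r-1$) is isomorphic to one of the modules $N_{p_i}$. A graded right $A$-module $M$ is totally reflexive if $\operatorname{Ext}^i_A(M,A)=0$ and $\operatorname{Ext}^i_{A^o}(\operatorname{Hom}_A(M,A),A)=0$ for all $i\geq1$ and the natural map $M\to\operatorname{Hom}_{A^o}(\operatorname{Hom}_A(M,A),A)$ is an isomorphism. $\operatorname{TR}^0_S(A)$ is the full subcategory of $\operatorname{grmod}A$ of totally reflexive modules $M$ with $\operatorname{projdim}_S(M)<\infty$ and $M=M_0A$. A noncommutative graded right matrix factorization of $f\in S_d$ (here $d=2$) over $S$ is a sequence $\{\phi^i:F^{i+1}\to F^i\}_{i\in\mathbb Z}$ of graded right $S$-module homomorphisms,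 where for some $r\in\mathbb N$ (the rank) all $F^i$ are graded free right $S$-modules of rank $r$, such that for every $i$ there are isomorphisms $F^{i+2}\cong\bigoplus_{s=1}^rS(-m_{i+2,s})=\bigoplus_{s=1}^rS(-m_{is}-d)$ and $F^i\cong\bigoplus_{s=1}^rS(-m_{is})$ under which $\phi^i\phi^{i+1}$ corresponds to left multiplication by $f$. $\operatorname{NMF}^0_S(f)$ consists of those with $F^0\cong S^r$, i.e. $F^0$ generated in degree $0$. $\operatorname{Coker}\phi:=(\operatorname{Coker}\phi^0)\otimes_SA\in\operatorname{grmod}A$. *)

theory Defs
  imports "HOL-Algebra.QuotRing" "HOL-Algebra.Generated_Groups"
begin

section \<open>Graded rings and graded right modules\<close>

record 'a gring = "'a ring" +
  rpart :: "int \<Rightarrow> 'a set"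

text \<open>
  As for the library's record \<open>module\<close>, the additive group of a module is carried by a \<open>ring\<close> record
  whose fields \<open>mult\<close> and \<open>one\<close> are irrelevant and never used.
\<close>

record ('a, 'm) rmod = "'m ring" +
  ract :: "'m \<Rightarrow> 'a \<Rightarrow> 'm"  (infixl "\<triangleleft>\<index>" 70)

record ('a, 'm) gmod = "('a, 'm) rmod" +
  mpart :: "int \<Rightarrow> 'm set"

locale right_module = R?: ring R + M?: abelian_group M
  for R :: "('a, 'x) ring_scheme" (structure) and M :: "('a, 'm, 'z) rmod_scheme" (structure) +
  assumes ract_closed: "\<lbrakk>x \<in> carrier M; a \<in> carrier R\<rbrakk> \<Longrightarrow> x \<triangleleft>\<^bsub>M\<^esub> a \<in> carrier M"
    and ract_add_left: "\<lbrakk>x \<in> carrier M; y \<in> carrier M; a \<in> carrier R\<rbrakk> \<Longrightarrow>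
      (x \<oplus>\<^bsub>M\<^esub> y) \<triangleleft>\<^bsub>M\<^esub> a = x \<triangleleft>\<^bsub>M\<^esub> a \<oplus>\<^bsub>M\<^esub> y \<triangleleft>\<^bsub>M\<^esub> a"
    and ract_add_right: "\<lbrakk>x \<in> carrier M; a \<in> carrier R; b \<in> carrier R\<rbrakk> \<Longrightarrow>
      x \<triangleleft>\<^bsub>M\<^esub> (a \<oplus>\<^bsub>R\<^esub> b) = x \<triangleleft>\<^bsub>M\<^esub> a \<oplus>\<^bsub>M\<^esub> x \<triangleleft>\<^bsub>M\<^esub> b"
    and ract_assoc: "\<lbrakk>x \<in> carrier M; a \<in> carrier R; b \<in> carrier R\<rbrakk> \<Longrightarrow>
      x \<triangleleft>\<^bsub>M\<^esub> (a \<otimes>\<^bsub>R\<^esub> b) = (x \<triangleleft>\<^bsub>M\<^esub> a) \<triangleleft>\<^bsub>M\<^esub> b"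
    and ract_one: "x \<in> carrier M \<Longrightarrow> x \<triangleleft>\<^bsub>M\<^esub> \<one>\<^bsub>R\<^esub> = x"

locale graded_right_module = right_module R M
  for R :: "('a, 'x) gring_scheme" (structure) and M :: "('a, 'm, 'z) gmod_scheme" (structure) +
  assumes mpart_subgroup: "additive_subgroup (mpart M i) M"
    and mpart_decomp: "x \<in> carrier M \<Longrightarrow>
      \<exists>!c. (\<forall>i. c i \<in> mpart M i) \<and> finite {i. c i \<noteq> \<zero>\<^bsub>M\<^esub>} \<and>
           x = (\<Oplus>\<^bsub>M\<^esub>i\<in>{i. c i \<noteq> \<zero>\<^bsub>M\<^esub>}. c i)"
    and mpart_ract: "\<lbrakk>x \<in> mpart M i; a \<in> rpart R j\<rbrakk> \<Longrightarrow> x \<triangleleft>\<^bsub>M\<^esub> a \<in> mpart M (i + j)"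

definition rsubmodule :: "('a, 'x) ring_scheme \<Rightarrow> ('a, 'm, 'z) rmod_scheme \<Rightarrow> 'm set \<Rightarrow> bool" where
  "rsubmodule R M H \<longleftrightarrow>
     additive_subgroup H M \<and> (\<forall>x\<in>H. \<forall>a\<in>carrier R. x \<triangleleft>\<^bsub>M\<^esub> a \<in> H)"

definition mspan :: "('a, 'x) ring_scheme \<Rightarrow> ('a, 'm, 'z) rmod_scheme \<Rightarrow> 'm set \<Rightarrow> 'm set" where
  "mspan R M U = \<Inter> {H. rsubmodule R M H \<and> U \<subseteq> H}"

definition grmod :: "('a, 'x) gring_scheme \<Rightarrow> ('a, 'm) gmod set" where
  "grmod R = {M. graded_right_module R M \<and>
     (\<exists>U. finite U \<and> U \<subseteq> carrier M \<and> mspan R M U = carrier M)}"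

definition right_hom ::
    "('a, 'x) ring_scheme \<Rightarrow> ('a, 'm, 'z) rmod_scheme \<Rightarrow> ('a, 'n, 'w) rmod_scheme \<Rightarrow> ('m \<Rightarrow> 'n) set" where
  "right_hom R M N = {h \<in> carrier M \<rightarrow> carrier N.
     (\<forall>x\<in>carrier M. \<forall>y\<in>carrier M. h (x \<oplus>\<^bsub>M\<^esub> y) = h x \<oplus>\<^bsub>N\<^esub> h y) \<and>
     (\<forall>x\<in>carrier M. \<forall>a\<in>carrier R. h (x \<triangleleft>\<^bsub>M\<^esub> a) = h x \<triangleleft>\<^bsub>N\<^esub> a)}"

definition graded_hom ::
    "('a, 'x) ring_scheme \<Rightarrow> ('a, 'm, 'z) gmod_scheme \<Rightarrow> ('a, 'n, 'w) gmod_scheme \<Rightarrow> ('m \<Rightarrow> 'n) set" where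
  "graded_hom R M N = {h \<in> right_hom R M N. \<forall>i. h ` mpart M i \<subseteq> mpart N i}"

definition graded_iso ::
    "('a, 'x) ring_scheme \<Rightarrow> ('a, 'm, 'z) gmod_scheme \<Rightarrow> ('a, 'n, 'w) gmod_scheme \<Rightarrow> ('m \<Rightarrow> 'n) set" where
  "graded_iso R M N = {h \<in> graded_hom R M N. bij_betw h (carrier M) (carrier N)}"

definition graded_isomorphic ::
    "('a, 'x) ring_scheme \<Rightarrow> ('a, 'm, 'z) gmod_scheme \<Rightarrow> ('a, 'n, 'w) gmod_scheme \<Rightarrow> bool" where
  "graded_isomorphic R M N \<longleftrightarrow> graded_iso R M N \<noteq> {}"

definition regular_module :: "('a, 'x) gring_scheme \<Rightarrow> ('a, 'a) gmod" where
  "regular_module R = \<lparr>carrier = carrier R, mult = mult R, one = \<one>\<^bsub>R\<^esub>, zero = \<zero>\<^bsub>R\<^esub>, add = add R,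
     ract = mult R, mpart = rpart R\<rparr>"

definition twist :: "('a, 'm) gmod \<Rightarrow> int \<Rightarrow> ('a, 'm) gmod" where
  "twist M n = M\<lparr>mpart := \<lambda>i. mpart M (n + i)\<rparr>"

definition graded_submodule_of :: "('a, 'm) gmod \<Rightarrow> 'm set \<Rightarrow> ('a, 'm) gmod" where
  "graded_submodule_of M H = M\<lparr>carrier := H, mpart := \<lambda>i. H \<inter> mpart M i\<rparr>"

definition graded_submodule :: "('a, 'x) gring_scheme \<Rightarrow> ('a, 'm) gmod \<Rightarrow> 'm set \<Rightarrow> bool" where
  "graded_submodule R M H \<longleftrightarrow>
     rsubmodule R M H \<and> graded_right_module R (graded_submodule_of M H)"

text \<open>The quotient of a graded module by a graded submodule; compare \<^const>\<open>FactRing\<close>.\<close>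

definition quot_module :: "('a, 'm) gmod \<Rightarrow> 'm set \<Rightarrow> ('a, 'm set) gmod" where
  "quot_module M H = \<lparr>carrier = a_rcosets\<^bsub>M\<^esub> H, mult = undefined, one = undefined,
     zero = H, add = set_add M,
     ract = (\<lambda>U a. \<Union>x\<in>U. H +>\<^bsub>M\<^esub> (x \<triangleleft>\<^bsub>M\<^esub> a)),
     mpart = (\<lambda>i. (\<lambda>x. H +>\<^bsub>M\<^esub> x) ` mpart M i)\<rparr>"

text \<open>The graded free module \<open>R(-m\<^sub>0) \<oplus> \<dots> \<oplus> R(-m\<^sub>r\<^sub>-\<^sub>1)\<close>.\<close>

definition graded_free :: "('a, 'x) gring_scheme \<Rightarrow> nat \<Rightarrow> (nat \<Rightarrow> int) \<Rightarrow> ('a, nat \<Rightarrow> 'a) gmod" where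
  "graded_free R r m = \<lparr>carrier = ({..<r} \<rightarrow>\<^sub>E carrier R), mult = undefined, one = undefined,
     zero = (\<lambda>s\<in>{..<r}. \<zero>\<^bsub>R\<^esub>), add = (\<lambda>u v. \<lambda>s\<in>{..<r}. u s \<oplus>\<^bsub>R\<^esub> v s),
     ract = (\<lambda>u a. \<lambda>s\<in>{..<r}. u s \<otimes>\<^bsub>R\<^esub> a),
     mpart = (\<lambda>i. \<Pi>\<^sub>E s\<in>{..<r}. mpart (twist (regular_module R) (- m s)) i)\<rparr>"


section \<open>Change of rings\<close>

definition restrict_scalars ::
    "('s \<Rightarrow> 'a) \<Rightarrow> ('a, 'm, 'z) rmod_scheme \<Rightarrow> ('s, 'm) rmod" where
  "restrict_scalars \<pi> M = \<lparr>carrier = carrier M, mult = mult M, one = \<one>\<^bsub>M\<^esub>, zero = \<zero>\<^bsub>M\<^esub>,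
     add = add M, ract = (\<lambda>x s. x \<triangleleft>\<^bsub>M\<^esub> \<pi> s)\<rparr>"

text \<open>
  The tensor product \<open>M \<otimes>\<^sub>S A\<close>, where \<open>\<pi> : S \<rightarrow> A\<close> is a ring homomorphism: the free abelian group on
  \<open>M \<times> A\<close> (finitely supported integer valued functions) modulo the balanced bilinear relations.
  Although \<open>pre_tensor\<close> is not itself a module (\<open>(m,b)\<cdot>(a+a') \<noteq> (m,b)\<cdot>a + (m,b)\<cdot>a'\<close>), the quotient is.
  Its component of degree \<open>i\<close> is generated by the pairs \<open>(m,b)\<close> with \<open>deg m + deg b = i\<close>.
\<close>

definition pure_tensor :: "'m \<Rightarrow> 'a \<Rightarrow> ('m \<times> 'a \<Rightarrow> int)" where
  "pure_tensor m b = (\<lambda>p. if p = (m, b) then 1 else 0)"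

definition pre_tensor ::
    "('s, 'm) gmod \<Rightarrow> ('a, 'y) gring_scheme \<Rightarrow> ('a, 'm \<times> 'a \<Rightarrow> int) gmod" where
  "pre_tensor M A =
    \<lparr>carrier = {c. finite {p. c p \<noteq> 0} \<and> {p. c p \<noteq> 0} \<subseteq> carrier M \<times> carrier A},
     mult = undefined, one = undefined,
     zero = (\<lambda>p. 0), add = (\<lambda>c c' p. c p + c' p),
     ract = (\<lambda>c a (m, b'). \<Sum>b\<in>{b. c (m, b) \<noteq> 0 \<and> b \<otimes>\<^bsub>A\<^esub> a = b'}. c (m, b)),
     mpart = (\<lambda>i. {c. finite {p. c p \<noteq> 0} \<and>
        {p. c p \<noteq> 0} \<subseteq> (\<Union>j. mpart M j \<times> rpart A (i - j))})\<rparr>"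

definition tensor_relations ::
    "('s, 'x) ring_scheme \<Rightarrow> ('a, 'y) ring_scheme \<Rightarrow> ('s \<Rightarrow> 'a) \<Rightarrow> ('s, 'm) gmod \<Rightarrow>
     ('m \<times> 'a \<Rightarrow> int) set" where
  "tensor_relations S A \<pi> M =
     {(\<lambda>p. pure_tensor (x \<oplus>\<^bsub>M\<^esub> y) b p - pure_tensor x b p - pure_tensor y b p) | x y b.
        x \<in> carrier M \<and> y \<in> carrier M \<and> b \<in> carrier A} \<union>
     {(\<lambda>p. pure_tensor x (b \<oplus>\<^bsub>A\<^esub> b') p - pure_tensor x b p - pure_tensor x b' p) | x b b'.
        x \<in> carrier M \<and> b \<in> carrier A \<and> b' \<in> carrier A} \<union>
     {(\<lambda>p. pure_tensor (x \<triangleleft>\<^bsub>M\<^esub> s) b p - pure_tensor x (\<pi> s \<otimes>\<^bsub>A\<^esub> b) p) | x s b.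
        x \<in> carrier M \<and> s \<in> carrier S \<and> b \<in> carrier A}"

definition extend_scalars ::
    "('s, 'x) ring_scheme \<Rightarrow> ('a, 'y) gring_scheme \<Rightarrow> ('s \<Rightarrow> 'a) \<Rightarrow> ('s, 'm) gmod \<Rightarrow>
     ('a, ('m \<times> 'a \<Rightarrow> int) set) gmod" where
  "extend_scalars S A \<pi> M = quot_module (pre_tensor M A)
     (generate (add_monoid (pre_tensor M A)) (tensor_relations S A \<pi> M))"


section \<open>Projective resolutions, Ext, and projective dimension\<close>

definition free_module :: "('a, 'x) ring_scheme \<Rightarrow> 'i set \<Rightarrow> ('a, 'i \<Rightarrow> 'a) rmod" where
  "free_module R I = \<lparr>carrier = {u \<in> I \<rightarrow>\<^sub>E carrier R. finite {i \<in> I. u i \<noteq> \<zero>\<^bsub>R\<^esub>}},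
     mult = undefined, one = undefined,
     zero = (\<lambda>i\<in>I. \<zero>\<^bsub>R\<^esub>), add = (\<lambda>u v. \<lambda>i\<in>I. u i \<oplus>\<^bsub>R\<^esub> v i),
     ract = (\<lambda>u a. \<lambda>i\<in>I. u i \<otimes>\<^bsub>R\<^esub> a)\<rparr>"

text \<open>
  \<open>P\<close> is projective if it is a direct summand of a free module. It suffices to consider the free
  module on the set underlying \<open>P\<close>, since \<open>P\<close> is a quotient of it.
\<close>

definition projective :: "('a, 'x) ring_scheme \<Rightarrow> ('a, 'm, 'z) rmod_scheme \<Rightarrow> bool" where
  "projective R P \<longleftrightarrow> right_module R P \<and>
     (\<exists>\<iota> \<in> right_hom R P (free_module R (carrier P)).
      \<exists>\<rho> \<in> right_hom R (free_module R (carrier P)) P. \<forall>x\<in>carrier P. \<rho> (\<iota> x) = x)"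

text \<open>
  The modules in a resolution have elements in the type \<open>nat \<Rightarrow> 'a\<close>. For cardinality reasons this
  type accommodates a projective resolution of every finitely generated module over a ring with
  elements in \<open>'a\<close>. Here \<open>d i : P (i + 1) \<rightarrow> P i\<close> and \<open>\<epsilon> : P 0 \<rightarrow> M\<close>.
\<close>

definition projective_resolution ::
    "('a, 'x) ring_scheme \<Rightarrow> (nat \<Rightarrow> ('a, nat \<Rightarrow> 'a) rmod) \<Rightarrow> (nat \<Rightarrow> (nat \<Rightarrow> 'a) \<Rightarrow> (nat \<Rightarrow> 'a)) \<Rightarrow>
     ((nat \<Rightarrow> 'a) \<Rightarrow> 'm) \<Rightarrow> ('a, 'm, 'z) rmod_scheme \<Rightarrow> bool" where
  "projective_resolution R P d \<epsilon> M \<longleftrightarrow>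
     (\<forall>i. projective R (P i)) \<and>
     (\<forall>i. d i \<in> right_hom R (P (Suc i)) (P i)) \<and> \<epsilon> \<in> right_hom R (P 0) M \<and>
     \<epsilon> ` carrier (P 0) = carrier M \<and>
     d 0 ` carrier (P 1) = {x \<in> carrier (P 0). \<epsilon> x = \<zero>\<^bsub>M\<^esub>} \<and>
     (\<forall>i. d (Suc i) ` carrier (P (Suc (Suc i))) = {x \<in> carrier (P (Suc i)). d i x = \<zero>\<^bsub>P i\<^esub>})"

text \<open>
  \<open>Ext\<^sup>i\<^sub>R(M,N) = 0\<close>: the \<open>i\<close>-th cohomology of \<open>Hom\<^sub>R(P,N)\<close> vanishes for a projective resolution
  \<open>P\<close> of \<open>M\<close> (the choice of which does not matter).
\<close>

definition Ext_cocycles ::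
    "('a, 'x) ring_scheme \<Rightarrow> (nat \<Rightarrow> ('a, 'p) rmod) \<Rightarrow> (nat \<Rightarrow> 'p \<Rightarrow> 'p) \<Rightarrow>
     ('a, 'n, 'w) rmod_scheme \<Rightarrow> nat \<Rightarrow> ('p \<Rightarrow> 'n) set" where
  "Ext_cocycles R P d N i =
     {h \<in> right_hom R (P i) N. \<forall>x\<in>carrier (P (Suc i)). h (d i x) = \<zero>\<^bsub>N\<^esub>}"

definition Ext_coboundaries ::
    "('a, 'x) ring_scheme \<Rightarrow> (nat \<Rightarrow> ('a, 'p) rmod) \<Rightarrow> (nat \<Rightarrow> 'p \<Rightarrow> 'p) \<Rightarrow>
     ('a, 'n, 'w) rmod_scheme \<Rightarrow> nat \<Rightarrow> ('p \<Rightarrow> 'n) set" where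
  "Ext_coboundaries R P d N i = (case i of
     0 \<Rightarrow> {h \<in> right_hom R (P 0) N. \<forall>x\<in>carrier (P 0). h x = \<zero>\<^bsub>N\<^esub>}
   | Suc j \<Rightarrow> {h \<in> right_hom R (P (Suc j)) N.
        \<exists>g \<in> right_hom R (P j) N. \<forall>x\<in>carrier (P (Suc j)). h x = g (d j x)})"

definition Ext_vanishes ::
    "('a, 'x) ring_scheme \<Rightarrow> nat \<Rightarrow> ('a, 'm, 'z) rmod_scheme \<Rightarrow> ('a, 'n, 'w) rmod_scheme \<Rightarrow> bool" where
  "Ext_vanishes R i M N \<longleftrightarrow> (\<exists>P d \<epsilon>. projective_resolution R P d \<epsilon> M \<and>
     Ext_cocycles R P d N i = Ext_coboundaries R P d N i)"

definition finite_projdim :: "('a, 'x) ring_scheme \<Rightarrow> ('a, 'm, 'z) rmod_scheme \<Rightarrow> bool" where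
  "finite_projdim R M \<longleftrightarrow> (\<exists>P d \<epsilon> N. projective_resolution R P d \<epsilon> M \<and>
     (\<forall>i>N. carrier (P i) = {\<zero>\<^bsub>P i\<^esub>}))"


section \<open>Totally reflexive modules\<close>

definition opposite :: "('a, 'x) ring_scheme \<Rightarrow> ('a, 'x) ring_scheme" where
  "opposite R = R\<lparr>mult := \<lambda>a b. b \<otimes>\<^bsub>R\<^esub> a\<rparr>"

text \<open>\<open>Hom\<^sub>R(M,R)\<close>, a left module over \<open>R\<close>, viewed as a right module over the opposite ring.\<close>

definition dual_module ::
    "('a, 'x) gring_scheme \<Rightarrow> ('a, 'm, 'z) rmod_scheme \<Rightarrow> ('a, 'm \<Rightarrow> 'a) rmod" where
  "dual_module R M = \<lparr>carrier = right_hom R M (regular_module R) \<inter> extensional (carrier M),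
     mult = undefined, one = undefined,
     zero = (\<lambda>x\<in>carrier M. \<zero>\<^bsub>R\<^esub>), add = (\<lambda>g h. \<lambda>x\<in>carrier M. g x \<oplus>\<^bsub>R\<^esub> h x),
     ract = (\<lambda>h a. \<lambda>x\<in>carrier M. a \<otimes>\<^bsub>R\<^esub> h x)\<rparr>"

definition biduality_map ::
    "('a, 'x) gring_scheme \<Rightarrow> ('a, 'm, 'z) rmod_scheme \<Rightarrow> 'm \<Rightarrow> ('m \<Rightarrow> 'a) \<Rightarrow> 'a" where
  "biduality_map R M x = (\<lambda>h\<in>carrier (dual_module R M). h x)"

definition totally_reflexive :: "('a, 'x) gring_scheme \<Rightarrow> ('a, 'm, 'z) gmod_scheme \<Rightarrow> bool" where
  "totally_reflexive R M \<longleftrightarrow>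
     (\<forall>i\<ge>1. Ext_vanishes R i M (regular_module R)) \<and>
     (\<forall>i\<ge>1. Ext_vanishes (opposite R) i (dual_module R M) (regular_module (opposite R))) \<and>
     biduality_map R M \<in> right_hom R M (dual_module (opposite R) (dual_module R M)) \<and>
     bij_betw (biduality_map R M) (carrier M)
       (carrier (dual_module (opposite R) (dual_module R M)))"

definition TR0 ::
    "('s, 'x) gring_scheme \<Rightarrow> ('a, 'y) gring_scheme \<Rightarrow> ('s \<Rightarrow> 'a) \<Rightarrow> ('a, 'm) gmod set" where
  "TR0 S A \<pi> = {M \<in> grmod A. totally_reflexive A M \<and>
     finite_projdim S (restrict_scalars \<pi> M) \<and> mspan A M (mpart M 0) = carrier M}"


section \<open>Noncommutative graded right matrix factorizations\<close>

text \<open>Here \<open>\<phi> i : F (i + 1) \<rightarrow> F i\<close>, and \<open>m i s\<close> is the twist \<open>m\<^sub>i\<^sub>s\<close>.\<close>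

definition NMF ::
    "('s, 'x) gring_scheme \<Rightarrow> int \<Rightarrow> 's \<Rightarrow> nat \<Rightarrow>
     ((int \<Rightarrow> ('s, 'p) gmod) \<times> (int \<Rightarrow> 'p \<Rightarrow> 'p)) set" where
  "NMF S d f r = {(F, \<phi>).
     (\<forall>i. graded_right_module S (F i)) \<and>
     (\<forall>i. \<phi> i \<in> graded_hom S (F (i + 1)) (F i)) \<and>
     (\<exists>m. \<forall>i. (\<forall>s<r. m (i + 2) s = m i s + d) \<and>
        (\<exists>g \<in> graded_iso S (F (i + 2)) (graded_free S r (m (i + 2))).
         \<exists>h \<in> graded_iso S (F i) (graded_free S r (m i)).
           \<forall>v\<in>carrier (F (i + 2)).
             h (\<phi> i (\<phi> (i + 1) v)) = (\<lambda>s\<in>{..<r}. f \<otimes>\<^bsub>S\<^esub> g v s)))}"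

definition NMF0 ::
    "('s, 'x) gring_scheme \<Rightarrow> int \<Rightarrow> 's \<Rightarrow> nat \<Rightarrow>
     ((int \<Rightarrow> ('s, 'p) gmod) \<times> (int \<Rightarrow> 'p \<Rightarrow> 'p)) set" where
  "NMF0 S d f r = {(F, \<phi>) \<in> NMF S d f r. graded_isomorphic S (F 0) (graded_free S r (\<lambda>s. 0))}"

definition NMF_coker ::
    "('s, 'x) ring_scheme \<Rightarrow> ('a, 'y) gring_scheme \<Rightarrow> ('s \<Rightarrow> 'a) \<Rightarrow>
     (int \<Rightarrow> ('s, 'p) gmod) \<times> (int \<Rightarrow> 'p \<Rightarrow> 'p) \<Rightarrow> ('a, ('p set \<times> 'a \<Rightarrow> int) set) gmod" where
  "NMF_coker S A \<pi> = (\<lambda>(F, \<phi>).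
     extend_scalars S A \<pi> (quot_module (F 0) (\<phi> 0 ` carrier (F 1))))"


section \<open>The algebras\<close>

text \<open>
  The free algebra \<open>k\<langle>x\<^sub>1, \<dots>, x\<^sub>n\<rangle>\<close>: finitely supported functions on words in the letters \<open>1, \<dots>, n\<close>.
\<close>

definition free_algebra :: "nat \<Rightarrow> (nat list \<Rightarrow> 'k::field) gring" where
  "free_algebra n = \<lparr>carrier = {u. finite {w. u w \<noteq> 0} \<and> {w. u w \<noteq> 0} \<subseteq> lists {1..n}},
     mult = (\<lambda>u v w. \<Sum>j\<le>length w. u (take j w) * v (drop j w)),
     one = (\<lambda>w. if w = [] then 1 else 0),
     zero = (\<lambda>w. 0), add = (\<lambda>u v w. u w + v w),
     rpart = (\<lambda>i. {u. finite {w. u w \<noteq> 0} \<and> {w. u w \<noteq> 0} \<subseteq> {w \<in> lists {1..n}. int (length w) = i}})\<rparr>"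

definition scalar :: "'k::field \<Rightarrow> nat list \<Rightarrow> 'k" where
  "scalar c = (\<lambda>w. if w = [] then c else 0)"

definition gen :: "nat \<Rightarrow> nat list \<Rightarrow> 'k::field" where
  "gen i = (\<lambda>w. if w = [i] then 1 else 0)"

definition graded_quot :: "('a, 'x) gring_scheme \<Rightarrow> 'a set \<Rightarrow> 'a set gring" where
  "graded_quot R I =
     ring.extend (R Quot I) (gring.fields (\<lambda>i. (\<lambda>a. I +>\<^bsub>R\<^esub> a) ` rpart R i))"

definition skew_ideal :: "nat \<Rightarrow> (nat \<Rightarrow> nat \<Rightarrow> 'k::field) \<Rightarrow> (nat list \<Rightarrow> 'k) set" where
  "skew_ideal n \<alpha> = (let F = free_algebra n in
     genideal F {(scalar (\<alpha> i j) \<otimes>\<^bsub>F\<^esub> gen i \<otimes>\<^bsub>F\<^esub> gen j) \<oplus>\<^bsub>F\<^esub> (gen j \<otimes>\<^bsub>F\<^esub> gen i) | i j.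
       i \<in> {1..n} \<and> j \<in> {1..n} \<and> i \<noteq> j})"

definition algT :: "nat \<Rightarrow> (nat \<Rightarrow> nat \<Rightarrow> 'k::field) \<Rightarrow> (nat list \<Rightarrow> 'k) set gring" where
  "algT n \<alpha> = graded_quot (free_algebra n) (skew_ideal n \<alpha>)"

definition projT :: "nat \<Rightarrow> (nat \<Rightarrow> nat \<Rightarrow> 'k::field) \<Rightarrow> (nat list \<Rightarrow> 'k) \<Rightarrow> (nat list \<Rightarrow> 'k) set" where
  "projT n \<alpha> u = skew_ideal n \<alpha> +>\<^bsub>free_algebra n\<^esub> u"

definition squares_ideal :: "nat \<Rightarrow> (nat \<Rightarrow> nat \<Rightarrow> 'k::field) \<Rightarrow> (nat list \<Rightarrow> 'k) set set" where
  "squares_ideal n \<alpha> =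
     genideal (algT n \<alpha>) {projT n \<alpha> (gen i) \<otimes>\<^bsub>algT n \<alpha>\<^esub> projT n \<alpha> (gen i) | i. i \<in> {1..<n}}"

definition algS :: "nat \<Rightarrow> (nat \<Rightarrow> nat \<Rightarrow> 'k::field) \<Rightarrow> (nat list \<Rightarrow> 'k) set set gring" where
  "algS n \<alpha> = graded_quot (algT n \<alpha>) (squares_ideal n \<alpha>)"

definition projS :: "nat \<Rightarrow> (nat \<Rightarrow> nat \<Rightarrow> 'k::field) \<Rightarrow> (nat list \<Rightarrow> 'k) \<Rightarrow> (nat list \<Rightarrow> 'k) set set" where
  "projS n \<alpha> u = squares_ideal n \<alpha> +>\<^bsub>algT n \<alpha>\<^esub> projT n \<alpha> u"

definition elem_f :: "nat \<Rightarrow> (nat \<Rightarrow> nat \<Rightarrow> 'k::field) \<Rightarrow> (nat list \<Rightarrow> 'k) set set" where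
  "elem_f n \<alpha> = projS n \<alpha> (gen n) \<otimes>\<^bsub>algS n \<alpha>\<^esub> projS n \<alpha> (gen n)"

definition algA :: "nat \<Rightarrow> (nat \<Rightarrow> nat \<Rightarrow> 'k::field) \<Rightarrow> (nat list \<Rightarrow> 'k) set set set gring" where
  "algA n \<alpha> = graded_quot (algS n \<alpha>) (genideal (algS n \<alpha>) {elem_f n \<alpha>})"

definition S_to_A ::
    "nat \<Rightarrow> (nat \<Rightarrow> nat \<Rightarrow> 'k::field) \<Rightarrow> (nat list \<Rightarrow> 'k) set set \<Rightarrow> (nat list \<Rightarrow> 'k) set set set" where
  "S_to_A n \<alpha> s = genideal (algS n \<alpha>) {elem_f n \<alpha>} +>\<^bsub>algS n \<alpha>\<^esub> s"


section \<open>Points and co-point modules\<close>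

text \<open>Homogeneous coordinates \<open>(a\<^sub>1, \<dots>, a\<^sub>n) \<noteq> 0\<close>, extended by \<open>0\<close> outside \<open>{1..n}\<close>.\<close>

definition homog_coords :: "nat \<Rightarrow> (nat \<Rightarrow> 'k::field) set" where
  "homog_coords n = {a. (\<forall>i. i \<notin> {1..n} \<longrightarrow> a i = 0) \<and> (\<exists>i. a i \<noteq> 0)}"

definition proj_space :: "nat \<Rightarrow> (nat \<Rightarrow> 'k::field) set set" where
  "proj_space n = homog_coords n //
     {(a, b). a \<in> homog_coords n \<and> b \<in> homog_coords n \<and> (\<exists>c. c \<noteq> 0 \<and> b = (\<lambda>i. c * a i))}"

definition vanishing_locus :: "nat \<Rightarrow> (nat \<Rightarrow> 'k::field) set set" where
  "vanishing_locus n = {p \<in> proj_space n. \<forall>a\<in>p. a n = 0}"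

definition linear_form ::
    "nat \<Rightarrow> (nat \<Rightarrow> nat \<Rightarrow> 'k::field) \<Rightarrow> (nat \<Rightarrow> 'k) \<Rightarrow> (nat list \<Rightarrow> 'k) set set set" where
  "linear_form n \<alpha> a = S_to_A n \<alpha> (projS n \<alpha>
     (\<Oplus>\<^bsub>free_algebra n\<^esub>i\<in>{1..n}. scalar (a i) \<otimes>\<^bsub>free_algebra n\<^esub> gen i))"

text \<open>The module \<open>N\<^sub>p\<close>; it does not depend on the chosen homogeneous coordinates of \<open>p\<close>.\<close>

definition point_module ::
    "nat \<Rightarrow> (nat \<Rightarrow> nat \<Rightarrow> 'k::field) \<Rightarrow> (nat \<Rightarrow> 'k) set \<Rightarrow>
     ((nat list \<Rightarrow> 'k) set set set, (nat list \<Rightarrow> 'k) set set set set) gmod" where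
  "point_module n \<alpha> p = quot_module (regular_module (algA n \<alpha>))
     {linear_form n \<alpha> (SOME a. a \<in> p) \<otimes>\<^bsub>algA n \<alpha>\<^esub> b | b. b \<in> carrier (algA n \<alpha>)}"

text \<open>A linear free resolution \<open>\<dots> \<rightarrow> A(-2) \<rightarrow> A(-1) \<rightarrow> A \<rightarrow> M \<rightarrow> 0\<close>, with \<open>d i : A(-(i + 1)) \<rightarrow> A(-i)\<close>.\<close>

definition copoint_module :: "('a, 'x) gring_scheme \<Rightarrow> ('a, 'm) gmod \<Rightarrow> bool" where
  "copoint_module A M \<longleftrightarrow> M \<in> grmod A \<and>
     (\<exists>d \<epsilon>.
       (\<forall>i. d i \<in> graded_hom A (twist (regular_module A) (- int (Suc i)))
                               (twist (regular_module A) (- int i))) \<and>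
       \<epsilon> \<in> graded_hom A (regular_module A) M \<and>
       \<epsilon> ` carrier A = carrier M \<and>
       d 0 ` carrier A = {x \<in> carrier A. \<epsilon> x = \<zero>\<^bsub>M\<^esub>} \<and>
       (\<forall>i. d (Suc i) ` carrier A = {x \<in> carrier A. d i x = \<zero>\<^bsub>A\<^esub>}))"

definition copoint_locus :: "nat \<Rightarrow> (nat \<Rightarrow> nat \<Rightarrow> 'k::field) \<Rightarrow> (nat \<Rightarrow> 'k) set set" where
  "copoint_locus n \<alpha> = {p \<in> proj_space n. copoint_module (algA n \<alpha>) (point_module n \<alpha> p)}"

text \<open>\<open>M\<close> is an \<open>r\<close>-extension of modules taken from the family \<open>N q\<close> with \<open>q \<in> Q\<close>.\<close>

definition is_extension ::
    "('a, 'x) gring_scheme \<Rightarrow> nat \<Rightarrow> 'q set \<Rightarrow> ('q \<Rightarrow> ('a, 'n) gmod) \<Rightarrow> ('a, 'm) gmod \<Rightarrow> bool" where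
  "is_extension A r Q N M \<longleftrightarrow>
     (\<exists>L :: nat \<Rightarrow> 'm set. L 0 = carrier M \<and> L r = {\<zero>\<^bsub>M\<^esub>} \<and>
       (\<forall>i\<le>r. graded_submodule A M (L i)) \<and>
       (\<forall>i<r. L (Suc i) \<subseteq> L i \<and>
          (\<exists>q\<in>Q. graded_isomorphic A (quot_module (graded_submodule_of M (L i)) (L (Suc i))) (N q))))"

end

theory Submission
  imports Defs "HOL-Library.Multiset"
begin

text \<open>
  Words in the letters \<open>1, \<dots>, n\<close> are straightened to monomials, which gives the algebras bases of
  monomials with a product twisted by a bicharacter. If \<open>N\<^sub>p\<close> is a co-point module, the form \<open>\<theta>\<close> of \<open>p\<close>
  satisfies \<open>\<theta>\<theta>' = 0\<close> in \<open>A\<close> for some linear form \<open>\<theta>' \<noteq> 0\<close>; comparing coefficients makes the scalars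
  \<open>\<alpha>\<^sub>i\<^sub>j\<close> multiplicative on the support of \<open>p\<close>, and then \<open>\<theta>\<close> extends to a sequence \<open>\<theta>\<^sub>m\<close>, \<open>m \<in> \<int>\<close>, of
  linear forms of \<open>S\<close> whose consecutive products are all \<open>f\<close> (after scaling) if \<open>p \<notin> \<V>(x\<^sub>n)\<close>, and all
  \<open>0\<close> otherwise. In the first case regularity of \<open>f\<close> makes multiplication by the \<open>\<theta>\<^sub>m\<close> exact on \<open>A\<close> from
  both sides and \<open>S\<close> a two-term resolution of \<open>N\<^sub>p\<close>. In the second case the left annihilator of
  \<open>\<theta>\<^sub>m\<^sub>+\<^sub>1\<close> in \<open>S\<close> is \<open>S\<theta>\<^sub>m\<close>, and the class of the generator of \<open>N\<^sub>p\<close> can be shifted through any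
  projective resolution without ever vanishing. For an extension, lifting generators of the layers
  gives a free cover whose kernel is free with triangular presentation matrix \<open>\<Phi>\<^sub>0\<close>; it divides \<open>f\<close>, say
  \<open>\<Phi>\<^sub>0\<Phi>\<^sub>1 = f\<close>, and twisting \<open>\<Phi>\<^sub>0, \<Phi>\<^sub>1\<close> by powers of the automorphism normalizing \<open>f\<close> yields the matrix
  factorization.
\<close>

section \<open>Convolution of finitely supported functions on words\<close>

section \<open>The free algebra\<close>

text \<open>The relation \<theta>\<theta>' = 0 in \<open>A\<close>, read off at the mixed monomials,
  says \<open>a i * b j = \<alpha> i j * a j * b i\<close>. It determines \<open>b\<close> from
  \<open>a\<close> up to a scalar as a diagonal rescaling of \<open>a\<close>, by the scalars
  \<open>gam\<close>, and the rescaling can be repeated any number of times in either direction;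
  this is where the two-sided sequence comes from. In \<open>S\<close> the letter x_n is the only
  one with nonzero square, so the consecutive products are multiples of f, and whether they are
  nonzero is decided by the coordinate a_n alone. This is the dichotomy of (1). In (2) the obstacle
  is that f need not be central. Left multiplication by f is right linear, but it commutes with a
  matrix over \<open>S\<close> only up to the normalizing automorphism, so \<Phi>_0 \<Phi>_1 = f
  does not give \<Phi>_1 \<Phi>_0 = f; it gives \<Phi>_1 \<Phi>_0' = f for the twist \<Phi>_0' of
  \<Phi>_0. Hence one more power of the automorphism in each period. The tensor product with
  \<open>A\<close> does not change the cokernel, since f already kills it, but this has to be proved
  for the tensor product as constructed from generators and relations.\<close>

fun conv :: "('a list \<Rightarrow> 'k::semiring_0) \<Rightarrow> ('a list \<Rightarrow> 'k) \<Rightarrow> 'a list \<Rightarrow> 'k" where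
  "conv u v [] = u [] * v []"
| "conv u v (x # w) = u [] * v (x # w) + conv (\<lambda>w. u (x # w)) v w"

lemma conv_eq_sum: "conv u v w = (\<Sum>j\<le>length w. u (take j w) * v (drop j w))"
  by (induction w arbitrary: u) (simp_all add: sum.atMost_Suc_shift del: sum.atMost_Suc)

lemma conv_add_left: "conv (\<lambda>w. u w + u' w) v w = conv u v w + conv u' v w"
  by (induction w arbitrary: u u') (simp_all add: algebra_simps)

lemma conv_add_right: "conv u (\<lambda>w. v w + v' w) w = conv u v w + conv u v' w"
  by (induction w arbitrary: u) (simp_all add: algebra_simps)

lemma conv_scale_left: "conv (\<lambda>w. c * u w) v w = c * conv u v w"
  by (induction w arbitrary: u) (simp_all add: algebra_simps)

lemma conv_zero [simp]: "conv (\<lambda>w. 0) v w = 0" "conv u (\<lambda>w. 0) w = 0"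
  by (induction w arbitrary: u) simp_all

text \<open>Splitting off the head of the word on which both sides are evaluated replaces
  \<open>u\<close> by its left derivative \<open>\<lambda>w. u (x # w)\<close>, and associativity
  becomes an induction that never touches a triple sum.\<close>

lemma conv_assoc: "conv (conv u v) z w = conv u (conv v z) w"
proof (induction w arbitrary: u v)
  case (Cons x w)
  have "conv (conv u v) z (x # w) = u [] * v [] * z (x # w)
     + conv (\<lambda>w. u [] * v (x # w) + conv (\<lambda>w. u (x # w)) v w) z w"
    by simp
  also have "\<dots> = u [] * (v [] * z (x # w) + conv (\<lambda>w. v (x # w)) z w) + conv (\<lambda>w. u (x # w)) (conv v z) w"
    using Cons.IH[of "\<lambda>w. u (x # w)" v]
    by (simp add: conv_add_left conv_scale_left distrib_left add.assoc mult.assoc)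
  finally show ?case by simp
qed (simp add: mult.assoc)

definition single :: "nat list \<Rightarrow> 'k::field \<Rightarrow> nat list \<Rightarrow> 'k" where
  "single w c = (\<lambda>v. if v = w then c else 0)"

lemma conv_single_left: "conv (single w c) v x = (if take (length w) x = w then c * v (drop (length w) x) else 0)"
proof (induction x arbitrary: w)
  case (Cons a x)
  show ?case
  proof (cases w)
    case (Cons b w')
    have "(\<lambda>w. single (b # w') c (a # w)) = (if a = b then single w' c else (\<lambda>w. 0))"
      by (auto simp: single_def fun_eq_iff)
    then show ?thesis using Cons.IH[of w'] Cons by (auto simp: single_def)
  qed (auto simp: single_def)
qed (auto simp: single_def)

lemma conv_single_single: "conv (single w c) (single v d) = single (w @ v) (c * d)"
  by (rule ext, auto simp: conv_single_left) (auto simp: single_def append_eq_conv_conj, metis append_take_drop_id)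

lemma conv_one_left: "conv (single [] 1) v = v"
  by (rule ext) (simp add: conv_single_left)

lemma conv_one_right: "conv v (single [] (1::'k::field)) = v"
proof
  show "conv v (single [] 1) w = v w" for w
    by (induction w arbitrary: v) (simp_all add: single_def)
qed

abbreviation supp :: "('a \<Rightarrow> 'k::zero) \<Rightarrow> 'a set" where
  "supp u \<equiv> {w. u w \<noteq> 0}"

lemma free_algebra_simps:
  "carrier (free_algebra n) = {u. finite (supp u) \<and> supp u \<subseteq> lists {1..n}}"
  "u \<otimes>\<^bsub>free_algebra n\<^esub> v = conv u v"
  "\<one>\<^bsub>free_algebra n\<^esub> = single [] 1"
  "\<zero>\<^bsub>free_algebra n\<^esub> = (\<lambda>w. 0)"
  "u \<oplus>\<^bsub>free_algebra n\<^esub> v = (\<lambda>w. u w + v w)"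
  "rpart (free_algebra n) i = {u. finite (supp u) \<and> supp u \<subseteq> {w \<in> lists {1..n}. int (length w) = i}}"
  by (auto simp: free_algebra_def conv_eq_sum single_def fun_eq_iff)

lemma supp_conv: "supp (conv u v) \<subseteq> (\<lambda>(a, b). a @ b) ` (supp u \<times> supp v)"
proof
  fix w assume "w \<in> supp (conv u v)"
  then obtain j where "u (take j w) * v (drop j w) \<noteq> 0"
    unfolding conv_eq_sum mem_Collect_eq by (meson sum.not_neutral_contains_not_neutral)
  then show "w \<in> (\<lambda>(a, b). a @ b) ` (supp u \<times> supp v)"
    by (intro image_eqI[of _ _ "(take j w, drop j w)"]) auto
qed

lemma free_carrier_conv:
  assumes "u \<in> carrier (free_algebra n)" "v \<in> carrier (free_algebra n)"
  shows "conv u v \<in> carrier (free_algebra n)"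
proof -
  have "finite (supp (conv u v))"
    using assms by (intro finite_subset[OF supp_conv]) (auto simp: free_algebra_simps)
  moreover have "supp (conv u v) \<subseteq> lists {1..n}"
    using assms by (intro order_trans[OF supp_conv]) (fastforce simp: free_algebra_simps)
  ultimately show ?thesis by (simp add: free_algebra_simps)
qed

lemma free_carrier_add:
  assumes "u \<in> carrier (free_algebra n)" "v \<in> carrier (free_algebra n)"
  shows "(\<lambda>w. u w + v w) \<in> carrier (free_algebra n)"
proof -
  have "supp (\<lambda>w. u w + v w) \<subseteq> supp u \<union> supp v" by auto
  then show ?thesis using assms unfolding free_algebra_simps by (blast intro: finite_subset)
qed

lemma free_carrier_single: "w \<in> lists {1..n} \<Longrightarrow> single w c \<in> carrier (free_algebra n)"
  by (auto simp: free_algebra_simps single_def)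

lemma ring_free_algebra: "ring (free_algebra n :: (nat list \<Rightarrow> 'k::field) gring)"
proof (rule ringI)
  show "abelian_group (free_algebra n :: (nat list \<Rightarrow> 'k) gring)"
  proof (rule abelian_groupI)
    fix x :: "nat list \<Rightarrow> 'k" assume "x \<in> carrier (free_algebra n)"
    then show "\<exists>y\<in>carrier (free_algebra n). y \<oplus>\<^bsub>free_algebra n\<^esub> x = \<zero>\<^bsub>free_algebra n\<^esub>"
      by (intro bexI[of _ "\<lambda>w. - x w"]) (auto simp: free_algebra_simps)
  qed (auto simp: free_carrier_add free_algebra_simps(4,5) algebra_simps, simp add: free_algebra_simps(1))
  show "Group.monoid (free_algebra n :: (nat list \<Rightarrow> 'k) gring)"
    by (rule monoidI)
      (auto simp: free_carrier_conv free_carrier_single free_algebra_simps(2,3) conv_assoc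
        conv_one_left conv_one_right fun_eq_iff)
qed (auto simp: free_algebra_simps(2,5) conv_add_left conv_add_right)

lemma free_algebra_induct [consumes 1, case_names zero add]:
  fixes u :: "nat list \<Rightarrow> 'k::field"
  assumes "u \<in> carrier (free_algebra n)" and "P (\<lambda>w. 0)"
    and "\<And>u w c. u \<in> carrier (free_algebra n) \<Longrightarrow> w \<in> lists {1..n} \<Longrightarrow> P u \<Longrightarrow> P (\<lambda>v. u v + single w c v)"
  shows "P u"
proof -
  have "P u" if "finite W" "supp u = W" "W \<subseteq> lists {1..n}" for W and u :: "nat list \<Rightarrow> 'k"
    using that
  proof (induction W arbitrary: u rule: finite_induct)
    case empty
    then have "u = (\<lambda>w. 0)" by auto
    then show ?case using assms(2) by simp
  next
    case (insert w W)
    have *: "supp (u(w := 0)) = W" using insert by (auto split: if_splits)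
    then have "P (u(w := 0))" using insert by blast
    then have "P (\<lambda>v. (u(w := 0)) v + single w (u w) v)"
      using * insert by (intro assms(3)) (auto simp: free_algebra_simps(1))
    moreover have "(\<lambda>v. (u(w := 0)) v + single w (u w) v) = u" by (auto simp: single_def)
    ultimately show ?case by simp
  qed
  then show ?thesis using assms(1) by (auto simp: free_algebra_simps(1))
qed

section \<open>Monomials as multisets, and the linear map from words to monomial
  coefficients\<close>

section \<open>Normal forms of words\<close>

lemma finite_words_of_mset: "finite {w. mset w = e}"
  using ex_mset[of e] by (metis mset_eq_finite)

text \<open>Every submultiset is the content of a prefix of some word with content \<open>e\<close>,
  so finiteness is inherited from words.\<close>

lemma finite_submultisets: "finite {d. d \<subseteq># e}"
proof (rule finite_subset)
  show "{d. d \<subseteq># e} \<subseteq> (\<lambda>(w, j). mset (take j w)) ` ({w. mset w = e} \<times> {..size e})"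
  proof
    fix d assume "d \<in> {d. d \<subseteq># e}"
    then obtain d' where "e = d + d'" by (auto simp: subset_mset.le_iff_add)
    moreover obtain w v where "mset w = d" "mset v = d'" by (meson ex_mset)
    ultimately show "d \<in> (\<lambda>(w, j). mset (take j w)) ` ({w. mset w = e} \<times> {..size e})"
      by (intro image_eqI[of _ _ "(w @ v, length w)"]) auto
  qed
  show "finite ((\<lambda>(w, j). mset (take j w)) ` ({w. mset w = e} \<times> {..size e}))"
    using finite_words_of_mset by blast
qed

text \<open>
  A monomial in commuting-up-to-scalars letters is given by the multiset of its letters;
  \<open>swap j i\<close> is the scalar with \<open>x\<^sub>j x\<^sub>i = swap j i \<cdot> x\<^sub>i x\<^sub>j\<close> for \<open>i \<le> j\<close> (and \<open>1\<close> for \<open>j < i\<close>), so that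
  \<open>bichar\<close> is the cocycle with \<open>x\<^sup>d x\<^sup>e = bichar d e \<cdot> x\<^sup>d\<^sup>+\<^sup>e\<close>.
\<close>

locale skew_data =
  fixes n :: nat and \<alpha> :: "nat \<Rightarrow> nat \<Rightarrow> 'k::field"
  assumes alpha_inv: "\<And>i j. i \<in> {1..n} \<Longrightarrow> j \<in> {1..n} \<Longrightarrow> i \<noteq> j \<Longrightarrow> \<alpha> i j * \<alpha> j i = 1"
begin

abbreviation "FA \<equiv> (free_algebra n :: (nat list \<Rightarrow> 'k) gring)"

definition swap :: "nat \<Rightarrow> nat \<Rightarrow> 'k" where
  "swap j i = (if i < j \<and> i \<in> {1..n} \<and> j \<in> {1..n} then - \<alpha> i j else 1)"

definition bichar :: "nat multiset \<Rightarrow> nat multiset \<Rightarrow> 'k" where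
  "bichar d e = (\<Prod>j\<in>#d. \<Prod>i\<in>#e. swap j i)"

lemma swap_nonzero: "swap j i \<noteq> 0"
  using alpha_inv[of i j] by (auto simp: swap_def)

lemma bichar_nonzero: "bichar d e \<noteq> 0"
  by (auto simp: bichar_def prod_mset_zero_iff swap_nonzero)

lemma bichar_simps [simp]:
  "bichar {#} e = 1" "bichar d {#} = 1"
  "bichar (d + d') e = bichar d e * bichar d' e"
  "bichar d (e + e') = bichar d e * bichar d e'"
  "bichar {#j#} {#i#} = swap j i"
  by (simp_all add: bichar_def prod_mset.distrib)

lemma bichar_add_mset:
  "bichar (add_mset i d) e = bichar {#i#} e * bichar d e"
  "bichar d (add_mset i e) = bichar d {#i#} * bichar d e"
  by (simp_all add: bichar_def prod_mset.distrib)

text \<open>In any algebra where the letters commute up to \<open>swap\<close>, a word equals this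
  scalar times the monomial of its letters; \<open>word_coeff_append\<close> says that these scalars
  trivialize the cocycle \<open>bichar\<close> on words.\<close>

fun word_coeff :: "nat list \<Rightarrow> 'k" where
  "word_coeff [] = 1"
| "word_coeff (a # w) = bichar {#a#} (mset w) * word_coeff w"

lemma word_coeff_append: "word_coeff (w @ v) = word_coeff w * word_coeff v * bichar (mset w) (mset v)"
  by (induction w) (simp_all add: mult_ac bichar_add_mset(1)[of _ "mset _"])

definition admissible :: "nat set \<Rightarrow> nat multiset \<Rightarrow> bool" where
  "admissible Q e \<longleftrightarrow> set_mset e \<subseteq> {1..n} \<and> (\<forall>i\<in>Q. count e i \<le> 1)"

lemma admissible_mono: "admissible Q e \<Longrightarrow> d \<subseteq># e \<Longrightarrow> admissible Q d"
  by (auto simp: admissible_def subseteq_mset_def dest: mset_subset_eqD[of d e, unfolded subseteq_mset_def]) 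
     (meson le_trans)

text \<open>The coefficients of the image of \<open>u\<close> in the monomial basis of the algebra
  in which the letters of \<open>Q\<close> square to zero. One parameter covers all three algebras:
  \<open>Q\<close> is empty for \<open>T\<close>, {1..n-1} for \<open>S\<close> and {1..n} for
  \<open>A\<close>. Being defined directly on the free algebra, it requires no confluence argument
  for the rewriting of words.\<close>

definition nf :: "nat set \<Rightarrow> (nat list \<Rightarrow> 'k) \<Rightarrow> nat multiset \<Rightarrow> 'k" where
  "nf Q u e = (if admissible Q e then \<Sum>w | mset w = e. word_coeff w * u w else 0)"

text \<open>The twisted convolution that the product of the algebra becomes in the monomial
  basis.\<close>

definition tconv :: "(nat multiset \<Rightarrow> 'k) \<Rightarrow> (nat multiset \<Rightarrow> 'k) \<Rightarrow> nat multiset \<Rightarrow> 'k" where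
  "tconv x y e = (\<Sum>d | d \<subseteq># e. bichar d (e - d) * x d * y (e - d))"

lemma nf_zero [simp]: "nf Q (\<lambda>w. 0) = (\<lambda>e. 0)"
  by (simp add: nf_def fun_eq_iff)

lemma nf_add: "nf Q (\<lambda>w. u w + v w) e = nf Q u e + nf Q v e"
  by (simp add: nf_def distrib_left sum.distrib)

lemma nf_uminus: "nf Q (\<lambda>w. - u w) e = - nf Q u e"
  by (simp add: nf_def sum_negf)

lemma nf_single: "nf Q (single w c) e = (if e = mset w \<and> admissible Q e then word_coeff w * c else 0)"
proof -
  have "(\<Sum>v | mset v = e. word_coeff v * single w c v)
      = (\<Sum>v | mset v = e. if w = v then word_coeff w * c else 0)"
    by (intro sum.cong) (auto simp: single_def)
  then show ?thesis by (auto simp: nf_def finite_words_of_mset)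
qed

text \<open>A word with content \<open>e\<close> together with a cut amounts to a submultiset
  \<open>d\<close>, a word with content \<open>d\<close> and a word with content
  \<open>e - d\<close>; the weights match because \<open>word_coeff\<close> turns concatenation into
  \<open>bichar\<close>. Truncation is compatible with products since divisors of admissible
  monomials are admissible.\<close>

lemma nf_conv: "nf Q (conv u v) e = (if admissible Q e then tconv (nf Q u) (nf Q v) e else 0)"
proof (cases "admissible Q e")
  case True
  have dr: "mset (drop j w) = mset w - mset (take j w)" "mset (take j w) \<subseteq># mset w" for j and w :: "nat list"
    by (metis add_diff_cancel_left' append_take_drop_id mset_append, metis append_take_drop_id mset_append mset_subset_eq_add_left)
  have wc: "word_coeff (drop j w) * (word_coeff (take j w) * bichar (mset (take j w)) (mset w - mset (take j w))) = word_coeff w" for j w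
    using word_coeff_append[of "take j w" "drop j w"] by (simp add: dr mult_ac)
  have "nf Q (conv u v) e
      = (\<Sum>w | mset w = e. \<Sum>j\<le>length w. word_coeff w * (u (take j w) * v (drop j w)))"
    using True by (simp add: nf_def conv_eq_sum sum_distrib_left)
  also have "\<dots> = (\<Sum>(w, j)\<in>(SIGMA w:{w. mset w = e}. {..length w}).
      word_coeff w * (u (take j w) * v (drop j w)))"
    by (rule sum.Sigma) (auto simp: finite_words_of_mset)
  also have "\<dots> = (\<Sum>(d, a, b)\<in>(SIGMA d:{d. d \<subseteq># e}. {a. mset a = d} \<times> {b. mset b = e - d}).
      bichar d (e - d) * (word_coeff a * u a) * (word_coeff b * v b))"
    by (rule sum.reindex_bij_witness[where j = "\<lambda>(w, j). (mset (take j w), take j w, drop j w)"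
          and i = "\<lambda>(d, a, b). (a @ b, length a)"])
       (auto simp: dr wc mult_ac)
  also have "\<dots> = (\<Sum>d | d \<subseteq># e. \<Sum>(a, b)\<in>{a. mset a = d} \<times> {b. mset b = e - d}.
      bichar d (e - d) * (word_coeff a * u a) * (word_coeff b * v b))"
    by (subst sum.Sigma) (auto simp: finite_words_of_mset finite_submultisets)
  also have "\<dots> = tconv (nf Q u) (nf Q v) e"
    unfolding tconv_def
  proof (rule sum.cong, simp)
    fix d assume "d \<in> {d. d \<subseteq># e}"
    then have "admissible Q d" "admissible Q (e - d)" using True by (auto intro: admissible_mono)
    then show "(\<Sum>(a, b)\<in>{a. mset a = d} \<times> {b. mset b = e - d}.
        bichar d (e - d) * (word_coeff a * u a) * (word_coeff b * v b))
      = bichar d (e - d) * nf Q u d * nf Q v (e - d)"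
      unfolding mult.assoc
      by (simp add: nf_def sum.cartesian_product[symmetric] sum_product) (simp add: sum_distrib_left mult.assoc)
  qed
  finally show ?thesis using True by simp
qed (simp add: nf_def)

lemma tconv_zero [simp]: "tconv (\<lambda>e. 0) y e = 0" "tconv x (\<lambda>e. 0) e = 0"
  by (simp_all add: tconv_def)

lemma nf_finite: 
  assumes "u \<in> carrier FA" 
  shows "finite (supp (nf Q u))"
proof (rule finite_subset)
  show "supp (nf Q u) \<subseteq> mset ` supp u"
  proof
    fix e assume "e \<in> supp (nf Q u)"
    then have "(\<Sum>w | mset w = e. word_coeff w * u w) \<noteq> 0" by (auto simp: nf_def split: if_splits)
    then obtain w where "mset w = e" "word_coeff w * u w \<noteq> 0"
      by (metis (mono_tags, lifting) mem_Collect_eq sum.neutral)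
    then show "e \<in> mset ` supp u" by auto
  qed
qed (use assms in \<open>simp add: free_algebra_simps\<close>)

text \<open>This carries the linear independence of the monomials: an ideal whose generators have
  normal form zero lies in this kernel, so the relations identify no more than \<open>nf\<close>
  does.\<close>

lemma nf_kernel_ideal: "ideal {u \<in> carrier FA. nf Q u = (\<lambda>e. 0)} FA"
proof (rule idealI)
  interpret ring FA by (rule ring_free_algebra)
  show "ring FA" by (rule ring_free_algebra)
  let ?K = "{u \<in> carrier FA. nf Q u = (\<lambda>e. 0)}"
  have neg: "\<ominus>\<^bsub>FA\<^esub> u = (\<lambda>w. - u w)" if "u \<in> carrier FA" for u
    using that by (intro minus_equality) (auto simp: free_algebra_simps)
  show "subgroup ?K (add_monoid FA)"
  proof (rule add.subgroupI)
    show "?K \<subseteq> carrier FA" by auto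
    show "?K \<noteq> {}" using zero_closed by (auto simp: free_algebra_simps(4) intro!: exI[of _ "\<lambda>w. 0"])
    show "\<ominus>\<^bsub>FA\<^esub> u \<in> ?K" if "u \<in> ?K" for u
      using that a_inv_closed[of u] by (auto simp: neg nf_uminus fun_eq_iff)
    show "u \<oplus>\<^bsub>FA\<^esub> v \<in> ?K" if "u \<in> ?K" "v \<in> ?K" for u v
      using that a_closed[of u v] by (auto simp: free_algebra_simps(5) nf_add fun_eq_iff)
  qed
  show "x \<otimes>\<^bsub>FA\<^esub> u \<in> ?K" if "u \<in> ?K" "x \<in> carrier FA" for u x
    using that m_closed[of x u] by (auto simp: free_algebra_simps(2) nf_conv)
  show "u \<otimes>\<^bsub>FA\<^esub> x \<in> ?K" if "u \<in> ?K" "x \<in> carrier FA" for u x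
    using that m_closed[of u x] by (auto simp: free_algebra_simps(2) nf_conv)
qed

end

section \<open>From generators and relations to coordinates\<close>

section \<open>Coordinates on quotients of the free algebra\<close>

lemma ring_change_record:
  assumes "ring R" and eq: "carrier R' = carrier R" "monoid.mult R' = monoid.mult R" "\<one>\<^bsub>R'\<^esub> = \<one>\<^bsub>R\<^esub>" "\<zero>\<^bsub>R'\<^esub> = \<zero>\<^bsub>R\<^esub>" "add R' = add R"
  shows "ring R'"
proof -
  interpret R: ring R by fact
  show ?thesis
  proof (rule ringI)
    show "abelian_group R'"
      by (rule abelian_groupI) (auto simp: eq R.a_ac intro: R.a_inv_closed R.l_neg)
    show "Group.monoid R'"
      by (rule monoidI) (auto simp: eq R.m_assoc)
  qed (auto simp: eq R.l_distr R.r_distr)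
qed

lemma graded_quot_simps:
  "carrier (graded_quot R I) = a_rcosets\<^bsub>R\<^esub> I"
  "monoid.mult (graded_quot R I) = rcoset_mult R I"
  "\<one>\<^bsub>graded_quot R I\<^esub> = I +>\<^bsub>R\<^esub> \<one>\<^bsub>R\<^esub>"
  "\<zero>\<^bsub>graded_quot R I\<^esub> = I"
  "add (graded_quot R I) = set_add R"
  "rpart (graded_quot R I) i = (\<lambda>a. I +>\<^bsub>R\<^esub> a) ` rpart R i"
  by (simp_all add: graded_quot_def ring.defs gring.defs FactRing_def)

lemma ring_graded_quot: "ideal I R \<Longrightarrow> ring (graded_quot R I)"
  by (rule ring_change_record[OF ideal.quotient_is_ring]) (simp_all add: graded_quot_simps FactRing_def)

lemma graded_quot_hom: "ideal I R \<Longrightarrow> (+>\<^bsub>R\<^esub>) I \<in> ring_hom R (graded_quot R I)"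
  using ideal.rcos_ring_hom[of I R] by (simp add: ring_hom_def graded_quot_simps FactRing_def)

lemma (in ideal) coset_eq_zero_iff: "a \<in> carrier R \<Longrightarrow> I +> a = I \<longleftrightarrow> a \<in> I"
  by (metis a_rcos_const a_rcos_self)

lemma (in ring) ideal_hom_image:
  assumes h: "h \<in> ring_hom R S" "h ` carrier R = carrier S" "ring S" and K: "ideal K R"
  shows "ideal (h ` K) S"
proof -
  interpret S: ring S by fact
  interpret h: ring_hom_ring R S h using h(1) by (unfold_locales)
  interpret K: ideal K R by fact
  show ?thesis
  proof (rule idealI[OF h(3)])
    show "subgroup (h ` K) (add_monoid S)"
    proof (rule S.add.subgroupI)
      show "h ` K \<subseteq> carrier S" using K.a_subset by auto
      show "h ` K \<noteq> {}" using additive_subgroup.zero_closed[OF K.is_additive_subgroup] by blast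
      show "\<ominus>\<^bsub>S\<^esub> x \<in> h ` K" if x: "x \<in> h ` K" for x
      proof -
        obtain u where "x = h u" "u \<in> K" using x by (rule imageE)
        then show ?thesis by (intro image_eqI[of _ _ "\<ominus> u"] K.a_inv_closed) (simp_all only: h.hom_a_inv K.a_Hcarr)
      qed
      show "x \<oplus>\<^bsub>S\<^esub> y \<in> h ` K" if xy: "x \<in> h ` K" "y \<in> h ` K" for x y
      proof -
        obtain u v where "x = h u" "u \<in> K" "y = h v" "v \<in> K" using xy by (elim imageE)
        then show ?thesis by (intro image_eqI[of _ _ "u \<oplus> v"] K.a_closed) (simp_all only: h.hom_add K.a_Hcarr)
      qed
    qed
  next
    fix a x assume "a \<in> h ` K" "x \<in> carrier S"
    then obtain u v where *: "u \<in> K" "a = h u" "v \<in> carrier R" "x = h v" using h(2) by blast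
    then show "x \<otimes>\<^bsub>S\<^esub> a \<in> h ` K"
      by (intro image_eqI[of _ _ "v \<otimes> u"]) (auto simp: K.I_l_closed)
    from * show "a \<otimes>\<^bsub>S\<^esub> x \<in> h ` K"
      by (intro image_eqI[of _ _ "u \<otimes> v"]) (auto simp: K.I_r_closed)
  qed
qed

text \<open>\<open>K\<close> contains the kernel of \<open>h\<close>, so it is the full preimage of
  its image, and this image is an ideal containing \<open>G\<close>. Ideals of iterated quotients
  are thereby studied in the free algebra.\<close>

lemma (in ring) mem_genideal_imp_mem:
  assumes h: "h \<in> ring_hom R S" "h ` carrier R = carrier S" "ring S" and K: "ideal K R"
    and ker: "\<And>u. u \<in> carrier R \<Longrightarrow> h u = \<zero>\<^bsub>S\<^esub> \<Longrightarrow> u \<in> K" and G: "G \<subseteq> h ` K"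
    and u: "u \<in> carrier R" "h u \<in> genideal S G"
  shows "u \<in> K"
proof -
  interpret S: ring S by fact
  interpret h: ring_hom_ring R S h using h(1) by (unfold_locales)
  interpret K: ideal K R by fact
  have "genideal S G \<subseteq> h ` K"
    by (rule S.genideal_minimal[OF ideal_hom_image[OF h K] G])
  then obtain z where z: "z \<in> K" "h u = h z" using u(2) by blast
  then have "h (u \<ominus> z) = \<zero>\<^bsub>S\<^esub>" using u(1) by (simp add: a_minus_def S.r_neg)
  then have "u \<ominus> z \<in> K" using ker z u(1) by auto
  then have "u \<ominus> z \<oplus> z \<in> K" using z by blast
  then show ?thesis using z(1) u(1) by (simp add: a_minus_def a_assoc l_neg)
qed

context skew_data
begin

lemma single_carrier [simp]: "set w \<subseteq> {1..n} \<Longrightarrow> single w c \<in> carrier FA"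
  by (rule free_carrier_single) auto

text \<open>The letter \<open>a\<close> moves right past each smaller letter of the sorted word, and
  each exchange costs one factor \<open>swap\<close>; it stops at the first letter not below it, and
  from there on all factors of \<open>bichar\<close> are 1.\<close>

lemma word_insort:
  assumes h: "ring_hom_ring FA R h"
    and comm: "\<And>i j. i \<in> {1..n} \<Longrightarrow> j \<in> {1..n} \<Longrightarrow> i < j \<Longrightarrow> h (single [j, i] 1) = h (single [i, j] (- \<alpha> i j))"
    and "sorted w" "a \<in> {1..n}" "set w \<subseteq> {1..n}"
  shows "h (single (a # w) c) = h (single (insort a w) (bichar {#a#} (mset w) * c))"
  using assms(3-)
proof (induction w arbitrary: c)
  case (Cons b w)
  interpret h: ring_hom_ring FA R h by fact
  have mult: "h (single (u @ v) (c * d)) = h (single u c) \<otimes>\<^bsub>R\<^esub> h (single v d)"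
    if "set u \<subseteq> {1..n}" "set v \<subseteq> {1..n}" for u v c d
    using h.hom_mult[of "single u c" "single v d"] that
    by (simp add: free_algebra_simps(2) conv_single_single)
  show ?case
  proof (cases "a \<le> b")
    case True
    then have "bichar {#a#} (mset (b # w)) = 1"
      using Cons.prems by (fastforce simp: bichar_def swap_def intro!: prod_mset.neutral)
    then show ?thesis using True by simp
  next
    case False
    then have ba: "b < a" "b \<in> {1..n}" using Cons.prems by auto
    have "h (single (a # b # w) c) = h (single ([a, b] @ w) (1 * c))" by simp
    also have "\<dots> = h (single [b, a] (- \<alpha> b a)) \<otimes>\<^bsub>R\<^esub> h (single w c)"
      using ba Cons.prems by (subst mult) (auto simp: comm)
    also have "\<dots> = h (single ([b, a] @ w) (- \<alpha> b a * c))"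
      using ba Cons.prems by (intro mult[symmetric]) auto
    also have "\<dots> = h (single [b] 1) \<otimes>\<^bsub>R\<^esub> h (single (a # w) (- \<alpha> b a * c))"
      using ba Cons.prems mult[of "[b]" "a # w" 1 "- \<alpha> b a * c"] by simp
    also have "\<dots> = h (single [b] 1) \<otimes>\<^bsub>R\<^esub> h (single (insort a w) (bichar {#a#} (mset w) * (- \<alpha> b a * c)))"
      using Cons by simp
    also have "\<dots> = h (single ([b] @ insort a w) (1 * (bichar {#a#} (mset w) * (- \<alpha> b a * c))))"
      using ba Cons.prems by (intro mult[symmetric]) (auto simp: set_insort_key)
    also have "bichar {#a#} (mset w) * (- \<alpha> b a * c) = bichar {#a#} (mset (b # w)) * c"
      using ba Cons.prems by (simp add: bichar_add_mset(2)[of _ b "mset w"] swap_def)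
    finally show ?thesis using ba by simp
  qed
qed simp

text \<open>Insertion sort: the factors collected by the insertions multiply up to
  \<open>word_coeff\<close>, which follows the same recursion.\<close>

lemma word_sort:
  assumes h: "ring_hom_ring FA R h"
    and comm: "\<And>i j. i \<in> {1..n} \<Longrightarrow> j \<in> {1..n} \<Longrightarrow> i < j \<Longrightarrow> h (single [j, i] 1) = h (single [i, j] (- \<alpha> i j))"
    and "set w \<subseteq> {1..n}"
  shows "h (single w c) = h (single (sort w) (word_coeff w * c))"
  using assms(3)
proof (induction w arbitrary: c)
  case (Cons a w)
  interpret h: ring_hom_ring FA R h by fact
  have mult: "h (single (a # v) c) = h (single [a] 1) \<otimes>\<^bsub>R\<^esub> h (single v c)"
    if "set v \<subseteq> {1..n}" for v c
    using h.hom_mult[of "single [a] 1" "single v c"] that Cons.prems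
    by (simp add: free_algebra_simps(2) conv_single_single)
  have "h (single (a # w) c) = h (single [a] 1) \<otimes>\<^bsub>R\<^esub> h (single (sort w) (word_coeff w * c))"
    using Cons.prems Cons.IH[of c] by (subst mult) simp_all
  also have "\<dots> = h (single (a # sort w) (word_coeff w * c))"
    using Cons.prems by (intro mult[symmetric]) auto
  also have "\<dots> = h (single (insort a (sort w)) (bichar {#a#} (mset w) * (word_coeff w * c)))"
    using Cons.prems by (subst word_insort[OF h comm]) auto
  finally show ?case by (simp add: mult_ac)
qed simp

text \<open>In a sorted word equal letters are adjacent, so a repeated letter \<open>i\<close> shows
  up as a factor [i, i].\<close>

lemma sorted_square_zero:
  assumes h: "ring_hom_ring FA R h" and sq: "h (single [i, i] 1) = \<zero>\<^bsub>R\<^esub>" and i: "i \<in> {1..n}"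
    and "sorted w" "set w \<subseteq> {1..n}" "count (mset w) i > 1"
  shows "h (single w c) = \<zero>\<^bsub>R\<^esub>"
  using assms(4-)
proof (induction w)
  case (Cons b w)
  interpret h: ring_hom_ring FA R h by fact
  have mult: "h (single (u @ v) (c * d)) = h (single u c) \<otimes>\<^bsub>R\<^esub> h (single v d)"
    if "set u \<subseteq> {1..n}" "set v \<subseteq> {1..n}" for u v c d
    using h.hom_mult[of "single u c" "single v d"] that
    by (simp add: free_algebra_simps(2) conv_single_single)
  show ?case
  proof (cases "b = i")
    case True
    then have "i \<in> set w" using Cons.prems count_greater_zero_iff[of "mset w" i] by simp
    moreover have "\<forall>x\<in>set w. i \<le> x" using Cons.prems True by simp
    moreover have "sorted w" using Cons.prems by simp
    ultimately obtain v where v: "w = i # v"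
      by (cases w) (simp, metis list.set_intros(1) order_antisym set_ConsD sorted_simps(2))
    then have "h (single (b # w) c) = h (single ([i, i] @ v) (1 * c))" using True by simp
    also have "\<dots> = \<zero>\<^bsub>R\<^esub>" using v Cons.prems i by (subst mult) (auto simp: sq)
    finally show ?thesis .
  next
    case False
    then have "h (single w c) = \<zero>\<^bsub>R\<^esub>" using Cons by simp
    then show ?thesis using Cons.prems mult[of "[b]" w 1 c] by simp
  qed
qed simp

text \<open>The admissible sorted words span: modulo the relations every element equals its sorted
  form \<open>N u\<close>, and \<open>N u\<close> depends only on \<open>nf Q u\<close>. This is the
  counterpart of \<open>nf_kernel_ideal\<close>; the two together replace the diamond lemma.\<close>

lemma nf_zero_imp_hom_zero:
  assumes h: "ring_hom_ring FA R h"
    and comm: "\<And>i j. i \<in> {1..n} \<Longrightarrow> j \<in> {1..n} \<Longrightarrow> i < j \<Longrightarrow> h (single [j, i] 1) = h (single [i, j] (- \<alpha> i j))"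
    and sq: "\<And>i. i \<in> Q \<Longrightarrow> i \<in> {1..n} \<and> h (single [i, i] 1) = \<zero>\<^bsub>R\<^esub>"
    and u: "u \<in> carrier FA" "nf Q u = (\<lambda>e. 0)"
  shows "h u = \<zero>\<^bsub>R\<^esub>"
proof -
  interpret h: ring_hom_ring FA R h by fact
  define N where "N u = (\<lambda>w. if sorted w then nf Q u (mset w) else 0)" for u
  have "N u \<in> carrier FA \<and> h u = h (N u)"
    using u(1)
  proof (induction rule: free_algebra_induct)
    case zero
    have "N (\<lambda>w. 0) = (\<lambda>w. 0)" by (simp add: N_def fun_eq_iff)
    then show ?case using h.R.zero_closed by (simp add: free_algebra_simps(4))
  next
    case (add u w c)
    have w: "set w \<subseteq> {1..n}" using add by auto
    have ws: "h (single w c) = h (single (sort w) (word_coeff w * c))"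
      using w comm by (intro word_sort[OF h]) auto
    have N: "N (\<lambda>v. u v + single w c v) = (\<lambda>v. N u v + N (single w c) v)"
      by (auto simp: N_def nf_add)
    have sort: "v = sort w" if "sorted v" "mset v = mset w" for v
      using that properties_for_sort by metis
    have "N (single w c) v = (if admissible Q (mset w) then single (sort w) (word_coeff w * c) else (\<lambda>v. 0)) v" for v
      using sort[of v] by (cases "v = sort w") (auto simp: N_def nf_single, auto simp: single_def)
    then have "N (single w c) = (if admissible Q (mset w) then single (sort w) (word_coeff w * c) else (\<lambda>v. 0))"
      by (rule ext)
    moreover have "h (single w c) = \<zero>\<^bsub>R\<^esub>" if nadm: "\<not> admissible Q (mset w)"
    proof -
      obtain i where "i \<in> Q" "count (mset w) i > 1" using w nadm by (force simp: admissible_def)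
      then have "h (single (sort w) (word_coeff w * c)) = \<zero>\<^bsub>R\<^esub>"
        using sq[OF \<open>i \<in> Q\<close>] w \<open>count (mset w) i > 1\<close> by - (rule sorted_square_zero[OF h, of i], simp_all)
      then show ?thesis unfolding ws .
    qed
    ultimately have *: "N (single w c) \<in> carrier FA" "h (single w c) = h (N (single w c))"
      using w h.R.zero_closed h.hom_zero ws
      by (auto simp: free_algebra_simps(4))
    then show ?case
      using add h.hom_add[of "N u" "N (single w c)"] h.hom_add[of u "single w c"] free_carrier_add[of "N u" n "N (single w c)"]
        w unfolding N by (simp add: free_algebra_simps(5))
  qed
  moreover have "N u = (\<lambda>w. 0)" using u(2) by (auto simp: N_def)
  ultimately show ?thesis using h.hom_zero by (simp add: free_algebra_simps(4))
qed

end

text \<open>All that is kept of a quotient of the free algebra is the projection \<open>h\<close>,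
  its kernel described by \<open>nf\<close>, and the grading. The elements of \<open>T\<close>,
  \<open>S\<close> and \<open>A\<close> are cosets of cosets; behind this interface they are
  coefficient vectors.\<close>

locale presentation = skew_data n \<alpha> + R?: ring R
  for n and \<alpha> :: "nat \<Rightarrow> nat \<Rightarrow> 'k::field" and R :: "'b gring" (structure) +
  fixes Q :: "nat set" and h :: "(nat list \<Rightarrow> 'k) \<Rightarrow> 'b"
  assumes hom: "h \<in> ring_hom (free_algebra n) R"
    and surj: "h ` carrier (free_algebra n) = carrier R"
    and hom_zero_iff: "u \<in> carrier (free_algebra n) \<Longrightarrow> h u = \<zero> \<longleftrightarrow> nf Q u = (\<lambda>e. 0)"
    and rpart_eq: "rpart R i = h ` rpart (free_algebra n) i"

text \<open>The two descriptions of the kernel meet here: elements of the ideal have normal form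
  zero since the generators do, and normal form zero implies vanishing since the relations suffice
  for sorting words and for killing squares.\<close>

lemma (in skew_data) presentation_quot:
  fixes R :: "'b gring"
  assumes "ring R" and h: "h \<in> ring_hom FA R" "h ` carrier FA = carrier R"
    and ker: "\<And>u. u \<in> carrier FA \<Longrightarrow> h u = \<zero>\<^bsub>R\<^esub> \<Longrightarrow> nf Q u = (\<lambda>e. 0)"
    and rpart: "\<And>i. rpart R i = h ` rpart FA i"
    and G: "\<And>g. g \<in> G \<Longrightarrow> \<exists>z\<in>carrier FA. g = h z \<and> nf Q z = (\<lambda>e. 0)"
    and comm: "\<And>i j. i \<in> {1..n} \<Longrightarrow> j \<in> {1..n} \<Longrightarrow> i < j \<Longrightarrow> 
       h (single [j, i] 1) \<ominus>\<^bsub>R\<^esub> h (single [i, j] (- \<alpha> i j)) \<in> genideal R G"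
    and sq: "\<And>i. i \<in> Q \<Longrightarrow> i \<in> {1..n} \<and> h (single [i, i] 1) \<in> genideal R G"
  shows "presentation n \<alpha> (graded_quot R (genideal R G)) Q (\<lambda>u. genideal R G +>\<^bsub>R\<^esub> h u)"
proof -
  interpret R: ring R by fact
  interpret F: ring FA by (rule ring_free_algebra)
  interpret h: ring_hom_ring FA R h using h(1) by unfold_locales
  have "G \<subseteq> carrier R" using G by fastforce
  then interpret I: ideal "genideal R G" R by (rule R.genideal_ideal)
  let ?I = "genideal R G" and ?h = "\<lambda>u. genideal R G +>\<^bsub>R\<^esub> h u"
  have hom: "?h \<in> ring_hom FA (graded_quot R ?I)"
    using ring_hom_trans[OF h(1) graded_quot_hom[OF I.ideal_axioms]] by (simp add: comp_def)
  interpret g: ring_hom_ring FA "graded_quot R ?I" ?h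
    by (rule ring_hom_ringI2[OF F.ring_axioms ring_graded_quot[OF I.ideal_axioms] hom])
  show ?thesis
  proof (intro presentation.intro presentation_axioms.intro)
    show "skew_data n \<alpha>" by (rule skew_data_axioms)
    show "ring (graded_quot R ?I)" by (rule ring_graded_quot[OF I.ideal_axioms])
    show "?h \<in> ring_hom FA (graded_quot R ?I)" by (rule hom)
    show "?h ` carrier FA = carrier (graded_quot R ?I)"
      unfolding graded_quot_simps A_RCOSETS_def' h(2)[symmetric] by blast
    show "rpart (graded_quot R ?I) i = ?h ` rpart FA i" for i
      by (auto simp: graded_quot_simps rpart)
    fix u assume u: "u \<in> carrier FA"
    have "nf Q u = (\<lambda>e. 0)" if "?h u = ?I"
    proof -
      have "h u \<in> ?I" using that u by (simp add: I.coset_eq_zero_iff)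
      then have "u \<in> {u \<in> carrier FA. nf Q u = (\<lambda>e. 0)}"
        using ker G u F.mem_genideal_imp_mem[OF h R.ring_axioms nf_kernel_ideal[of Q], of G u] by fastforce
      then show ?thesis by simp
    qed
    moreover have "?h u = ?I" if "nf Q u = (\<lambda>e. 0)"
    proof -
      have "?h u = \<zero>\<^bsub>graded_quot R ?I\<^esub>"
      proof (rule nf_zero_imp_hom_zero[OF g.ring_hom_ring_axioms])
        show "?h (single [j, i] 1) = ?h (single [i, j] (- \<alpha> i j))"
          if "i \<in> {1..n}" "j \<in> {1..n}" "i < j" for i j
        proof -
          have "h (single [j, i] 1) \<in> ?h (single [i, j] (- \<alpha> i j))"
            using comm[OF that] that by (subst I.a_rcos_module_minus[OF R.ring_axioms]) auto
          then show ?thesis using that by (intro I.a_repr_independence'[symmetric]) auto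
        qed
        show "i \<in> {1..n} \<and> ?h (single [i, i] 1) = \<zero>\<^bsub>graded_quot R ?I\<^esub>" if "i \<in> Q" for i
          using sq[OF that] by (simp add: I.a_rcos_const graded_quot_simps)
      qed (use u that in auto)
      then show ?thesis by (simp add: graded_quot_simps)
    qed
    ultimately show "?h u = \<zero>\<^bsub>graded_quot R ?I\<^esub> \<longleftrightarrow> nf Q u = (\<lambda>e. 0)"
      by (auto simp: graded_quot_simps)
  qed
qed

context skew_data
begin

lemma tconv_delta_left:
  "tconv (\<lambda>d. if d = m then c else 0) y e = (if m \<subseteq># e then bichar m (e - m) * c * y (e - m) else 0)"
proof -
  have "tconv (\<lambda>d. if d = m then c else 0) y e
      = (\<Sum>d | d \<subseteq># e. if m = d then bichar m (e - m) * c * y (e - m) else 0)"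
    unfolding tconv_def by (intro sum.cong) auto
  then show ?thesis by (simp add: finite_submultisets)
qed

lemma mset_diff_eq_iff: "d \<subseteq># e \<Longrightarrow> e - d = m \<longleftrightarrow> m \<subseteq># e \<and> d = e - m" for e :: "'c multiset"
  by (auto simp: subset_mset.le_iff_add)

lemma mset_diff_diff: "d \<subseteq># e \<Longrightarrow> e - (e - d) = d" for e :: "'c multiset"
  by (metis mset_diff_eq_iff)

lemma tconv_delta_right:
  "tconv y (\<lambda>d. if d = m then c else 0) e = (if m \<subseteq># e then bichar (e - m) m * y (e - m) * c else 0)"
proof -
  have "tconv y (\<lambda>d. if d = m then c else 0) e
      = (\<Sum>d | d \<subseteq># e. if e - m = d then (if m \<subseteq># e then bichar (e - m) m * y (e - m) * c else 0) else 0)"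
    unfolding tconv_def by (intro sum.cong) (auto simp: mset_diff_eq_iff mset_diff_diff)
  then show ?thesis by (simp add: finite_submultisets)
qed

lemma tconv_linear_left:
  assumes "\<And>d. size d \<noteq> 1 \<Longrightarrow> x d = 0"
  shows "tconv x y e = (\<Sum>i\<in>set_mset e. bichar {#i#} (e - {#i#}) * x {#i#} * y (e - {#i#}))"
proof -
  have "tconv x y e = (\<Sum>d\<in>(\<lambda>i. {#i#}) ` set_mset e. bichar d (e - d) * x d * y (e - d))"
    unfolding tconv_def
  proof (rule sum.mono_neutral_right)
    have "x d = 0" if "d \<subseteq># e" "d \<notin> (\<lambda>i. {#i#}) ` set_mset e" for d
    proof (rule assms, rule notI)
      assume "size d = 1"
      then obtain i where "d = {#i#}" using size_1_singleton_mset by blast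
      then show False using that by auto
    qed
    then show "\<forall>d\<in>{d. d \<subseteq># e} - (\<lambda>i. {#i#}) ` set_mset e. bichar d (e - d) * x d * y (e - d) = 0"
      by simp
  qed (auto simp: finite_submultisets)
  then show ?thesis by (simp add: sum.reindex inj_on_def)
qed

lemma tconv_linear_right:
  assumes "\<And>d. size d \<noteq> 1 \<Longrightarrow> x d = 0"
  shows "tconv y x e = (\<Sum>i\<in>set_mset e. bichar (e - {#i#}) {#i#} * y (e - {#i#}) * x {#i#})"
proof -
  have inj: "inj_on (\<lambda>i. e - {#i#}) (set_mset e)"
    by (auto simp: inj_on_def) (metis add_mset_remove_trivial_eq add_mset_add_single diff_single_eq_union single_eq_single union_left_cancel)
  have "tconv y x e = (\<Sum>d\<in>(\<lambda>i. e - {#i#}) ` set_mset e. bichar d (e - d) * y d * x (e - d))"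
    unfolding tconv_def
  proof (rule sum.mono_neutral_right)
    have "x (e - d) = 0" if d: "d \<subseteq># e" "d \<notin> (\<lambda>i. e - {#i#}) ` set_mset e" for d
    proof (rule assms, rule notI)
      assume "size (e - d) = 1"
      then obtain i where "e - d = {#i#}" using size_1_singleton_mset by blast
      then have "d = e - {#i#}" "i \<in># e" using d(1)
        by (simp_all add: mset_diff_eq_iff)
      then show False using d by auto
    qed
    then show "\<forall>d\<in>{d. d \<subseteq># e} - (\<lambda>i. e - {#i#}) ` set_mset e. bichar d (e - d) * y d * x (e - d) = 0"
      by simp
  qed (auto simp: finite_submultisets)
  also have "\<dots> = (\<Sum>i\<in>set_mset e. bichar (e - {#i#}) {#i#} * y (e - {#i#}) * x {#i#})"
    unfolding sum.reindex[OF inj] comp_def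
    by (intro sum.cong) (auto simp: mset_diff_diff)
  finally show ?thesis .
qed

end

section \<open>Coefficient vectors of the elements of a presented algebra\<close>

context presentation
begin

interpretation F: ring FA by (rule ring_free_algebra)

sublocale h: ring_hom_ring FA R h
  by (rule ring_hom_ringI2[OF ring_free_algebra ring_axioms hom])

text \<open>Independent of the chosen representative, because \<open>nf Q\<close> separates exactly
  the fibres of \<open>h\<close> (\<open>h_eq_iff\<close>).\<close>

definition coord :: "'b \<Rightarrow> nat multiset \<Rightarrow> 'k" where
  "coord r = nf Q (SOME u. u \<in> carrier FA \<and> h u = r)"

lemma FA_minus: "u \<in> carrier FA \<Longrightarrow> \<ominus>\<^bsub>FA\<^esub> u = (\<lambda>w. - u w)"
  by (intro F.minus_equality) (auto simp: free_algebra_simps)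

lemma h_eq_iff:
  assumes "u \<in> carrier FA" "v \<in> carrier FA"
  shows "h u = h v \<longleftrightarrow> nf Q u = nf Q v"
proof -
  have "h u = h v \<longleftrightarrow> h (u \<ominus>\<^bsub>FA\<^esub> v) = \<zero>"
    using assms by (simp add: a_minus_def) (metis h.hom_closed minus_equality minus_minus r_neg a_inv_closed)
  also have "\<dots> \<longleftrightarrow> (\<forall>e. nf Q u e + - nf Q v e = 0)"
    using assms F.minus_closed[of u v]
    by (subst hom_zero_iff)
       (simp_all add: a_minus_def FA_minus free_algebra_simps(5) nf_add nf_uminus fun_eq_iff nf_add[of Q u "\<lambda>w. - v w", simplified])
  finally show ?thesis by (auto simp: fun_eq_iff)
qed

lemma coord_h: "u \<in> carrier FA \<Longrightarrow> coord (h u) = nf Q u"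
  unfolding coord_def by (rule someI2[of _ u]) (auto simp: h_eq_iff[symmetric])

lemma ex_word: "r \<in> carrier R \<Longrightarrow> \<exists>u\<in>carrier FA. r = h u"
  using surj by blast

lemma coord_inject: "r \<in> carrier R \<Longrightarrow> s \<in> carrier R \<Longrightarrow> coord r = coord s \<longleftrightarrow> r = s"
  using ex_word[of r] ex_word[of s] by (auto simp: coord_h h_eq_iff)

lemma coord_add: "r \<in> carrier R \<Longrightarrow> s \<in> carrier R \<Longrightarrow> coord (r \<oplus> s) e = coord r e + coord s e"
  using ex_word[of r] ex_word[of s]
  by (auto simp: coord_h nf_add free_algebra_simps(5) free_carrier_add simp flip: h.hom_add)

lemma coord_zero [simp]: "coord \<zero> e = 0"
  using coord_h[of "\<zero>\<^bsub>FA\<^esub>"] F.zero_closed h.hom_zero by (simp add: free_algebra_simps(4))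

lemma coord_minus: "r \<in> carrier R \<Longrightarrow> coord (\<ominus> r) e = - coord r e"
  using coord_add[of r "\<ominus> r" e] by (simp add: r_neg add_eq_0_iff)

lemma coord_mult: "r \<in> carrier R \<Longrightarrow> s \<in> carrier R \<Longrightarrow>
    coord (r \<otimes> s) e = (if admissible Q e then tconv (coord r) (coord s) e else 0)"
  using ex_word[of r] ex_word[of s]
  by (auto simp: coord_h nf_conv free_algebra_simps(2) free_carrier_conv simp flip: h.hom_mult)

lemma coord_one: "coord \<one> = (\<lambda>e. if e = {#} then 1 else 0)"
  using coord_h[of "\<one>\<^bsub>FA\<^esub>"] h.hom_one by (simp add: free_algebra_simps(3) nf_single fun_eq_iff admissible_def)

lemma coord_admissible: "coord r e \<noteq> 0 \<Longrightarrow> admissible Q e"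
  by (auto simp: coord_def nf_def split: if_splits)

lemma coord_finite: "r \<in> carrier R \<Longrightarrow> finite (supp (coord r))"
  using ex_word[of r] by (auto simp: coord_h nf_finite)

lemma eq_zero_iff: "r \<in> carrier R \<Longrightarrow> r = \<zero> \<longleftrightarrow> (\<forall>e. admissible Q e \<longrightarrow> coord r e = 0)"
  using coord_inject[of r \<zero>] coord_admissible by (auto simp: fun_eq_iff)

text \<open>The inverse of \<open>coord\<close>: the coefficients are placed on the sorted words,
  whose \<open>word_coeff\<close> is 1. Quotients, truncations and twists of elements are all
  constructed by prescribing coefficients.\<close>

definition elt :: "(nat multiset \<Rightarrow> 'k) \<Rightarrow> 'b" where
  "elt x = h (\<lambda>w. if sorted w then x (mset w) else 0)"

lemma word_coeff_sorted: "sorted w \<Longrightarrow> word_coeff w = 1"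
  by (induction w) (force simp: bichar_def swap_def intro!: prod_mset.neutral)+

lemma elt:
  assumes "finite (supp x)" "\<And>e. x e \<noteq> 0 \<Longrightarrow> admissible Q e"
  shows elt_closed: "elt x \<in> carrier R" and coord_elt: "coord (elt x) = x"
    and elt_rpart: "(\<And>e. x e \<noteq> 0 \<Longrightarrow> int (size e) = d) \<Longrightarrow> elt x \<in> rpart R d"
proof -
  let ?u = "\<lambda>w. if sorted w then x (mset w) else 0"
  have fin: "finite (supp ?u)"
  proof (rule finite_subset)
    show "supp ?u \<subseteq> sorted_list_of_multiset ` supp x"
    proof
      fix w assume "w \<in> supp ?u"
      then show "w \<in> sorted_list_of_multiset ` supp x"
        by (intro image_eqI[of _ _ "mset w"]) (auto split: if_splits simp: sorted_sort_id)
    qed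
  qed (use assms in simp)
  have u: "?u \<in> carrier FA" 
    using assms(2) fin by (fastforce simp: free_algebra_simps admissible_def split: if_splits)
  then show "elt x \<in> carrier R" unfolding elt_def by simp
  have "nf Q ?u e = x e" for e
  proof -
    have "(\<Sum>w | mset w = e. word_coeff w * ?u w) = (\<Sum>w | mset w = e. if sorted_list_of_multiset e = w then x e else 0)"
      by (intro sum.cong) (auto simp: word_coeff_sorted sorted_sort_id, metis sorted_sort)
    also have "\<dots> = x e" by (simp add: finite_words_of_mset)
    finally show ?thesis using assms(2)[of e] by (auto simp: nf_def)
  qed
  then show "coord (elt x) = x" using u by (simp only: elt_def coord_h ext)
  show "elt x \<in> rpart R d" if d: "\<And>e. x e \<noteq> 0 \<Longrightarrow> int (size e) = d"
  proof -
    have "?u \<in> rpart FA d"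
      using u fin d[of "mset _"] unfolding free_algebra_simps by (auto split: if_splits)
    then show ?thesis unfolding elt_def rpart_eq by blast
  qed
qed

lemma rpart_iff: "r \<in> rpart R d \<longleftrightarrow> r \<in> carrier R \<and> (\<forall>e. coord r e \<noteq> 0 \<longrightarrow> int (size e) = d)"
proof (intro iffI conjI allI impI)
  assume "r \<in> rpart R d"
  then obtain u where u: "u \<in> rpart FA d" "r = h u" unfolding rpart_eq by blast
  then have uc: "u \<in> carrier FA" by (auto simp: free_algebra_simps)
  then show "r \<in> carrier R" using u by simp
  fix e assume "coord r e \<noteq> 0"
  then have "(\<Sum>w | mset w = e. word_coeff w * u w) \<noteq> 0" 
    using u uc by (auto simp: coord_h nf_def split: if_splits)
  then obtain w where "mset w = e" "word_coeff w * u w \<noteq> 0"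
    by (metis (mono_tags, lifting) mem_Collect_eq sum.neutral)
  then show "int (size e) = d" using u by (auto simp: free_algebra_simps)
next
  assume r: "r \<in> carrier R \<and> (\<forall>e. coord r e \<noteq> 0 \<longrightarrow> int (size e) = d)"
  then have "elt (coord r) = r"
    using coord_elt[of "coord r"] elt_closed[of "coord r"] coord_finite coord_admissible coord_inject by auto
  then show "r \<in> rpart R d"
    using elt_rpart[of "coord r" d] r coord_finite coord_admissible by auto
qed

text \<open>Since only multisets of size 1 enter, the sum over \<open>e\<close> is the coefficient
  at its only letter; this form avoids choosing that letter.\<close>

definition lin :: "(nat \<Rightarrow> 'k) \<Rightarrow> 'b" where
  "lin a = elt (\<lambda>e. if size e = 1 \<and> set_mset e \<subseteq> {1..n} then \<Sum>i\<in>#e. a i else 0)"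

lemma lin:
  shows lin_rpart: "lin a \<in> rpart R 1" and coord_lin: "coord (lin a) =
    (\<lambda>e. if size e = 1 \<and> set_mset e \<subseteq> {1..n} then \<Sum>i\<in>#e. a i else 0)"
proof -
  let ?x = "\<lambda>e. if size e = 1 \<and> set_mset e \<subseteq> {1..n} then \<Sum>i\<in>#e. a i else 0"
  have "supp ?x \<subseteq> (\<lambda>i. {#i#}) ` {1..n}"
    using size_1_singleton_mset by (auto split: if_splits) fastforce
  then have fin: "finite (supp ?x)" by (rule finite_subset) simp
  have adm: "admissible Q e" if "?x e \<noteq> 0" for e
    using that size_1_singleton_mset[of e] by (auto simp: admissible_def split: if_splits)
  show "lin a \<in> rpart R 1"
    unfolding lin_def using fin adm by (rule elt_rpart) (auto split: if_splits)
  show "coord (lin a) = ?x"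
    unfolding lin_def using fin adm by (rule coord_elt)
qed

lemma lin_closed [simp]: "lin a \<in> carrier R"
  using lin_rpart rpart_iff by blast

lemma coord_lin_single [simp]: "coord (lin a) {#i#} = (if i \<in> {1..n} then a i else 0)"
  by (simp add: coord_lin)

lemma coord_lin_mult: "s \<in> carrier R \<Longrightarrow> admissible Q e \<Longrightarrow>
    coord (lin a \<otimes> s) e = (\<Sum>i\<in>set_mset e. bichar {#i#} (e - {#i#}) * a i * coord s (e - {#i#}))"
  by (auto simp: coord_mult tconv_linear_left coord_lin admissible_def intro!: sum.cong)

lemma coord_mult_lin: "s \<in> carrier R \<Longrightarrow> admissible Q e \<Longrightarrow>
    coord (s \<otimes> lin a) e = (\<Sum>i\<in>set_mset e. bichar (e - {#i#}) {#i#} * coord s (e - {#i#}) * a i)"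
  by (auto simp: coord_mult tconv_linear_right coord_lin admissible_def intro!: sum.cong)

end

section \<open>Graded pieces and the projections onto them\<close>

section \<open>Gradings given by component maps\<close>

text \<open>The axiom of \<open>graded_right_module\<close> asks for a unique decomposition, which
  is awkward to verify directly. Additive projections with the right values on homogeneous elements
  force uniqueness (\<open>components_unique\<close>), pass to free modules coordinatewise and
  commute with graded maps.\<close>

definition components :: "('m, 'z) ring_scheme \<Rightarrow> (int \<Rightarrow> 'm set) \<Rightarrow> ('m \<Rightarrow> int \<Rightarrow> 'm) \<Rightarrow> bool" where
  "components M P c \<longleftrightarrow> (\<forall>i. additive_subgroup (P i) M) \<and>
     (\<forall>x\<in>carrier M. \<forall>i. c x i \<in> P i) \<and>
     (\<forall>x\<in>carrier M. \<forall>y\<in>carrier M. \<forall>i. c (x \<oplus>\<^bsub>M\<^esub> y) i = c x i \<oplus>\<^bsub>M\<^esub> c y i) \<and>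
     (\<forall>j. \<forall>x\<in>P j. \<forall>i. c x i = (if i = j then x else \<zero>\<^bsub>M\<^esub>)) \<and>
     (\<forall>x\<in>carrier M. finite {i. c x i \<noteq> \<zero>\<^bsub>M\<^esub>} \<and> x = (\<Oplus>\<^bsub>M\<^esub>i\<in>{i. c x i \<noteq> \<zero>\<^bsub>M\<^esub>}. c x i))"

lemma (in abelian_group) additive_map_finsum:
  fixes N (structure)
  assumes "abelian_group N" "h \<in> carrier G \<rightarrow> carrier N"
    and add: "\<And>x y. x \<in> carrier G \<Longrightarrow> y \<in> carrier G \<Longrightarrow> h (x \<oplus> y) = h x \<oplus>\<^bsub>N\<^esub> h y"
    and f: "f \<in> I \<rightarrow> carrier G" and "finite I"
  shows "h (\<Oplus>i\<in>I. f i) = (\<Oplus>\<^bsub>N\<^esub>i\<in>I. h (f i))"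
proof -
  interpret N: abelian_group N by fact
  have "h \<zero> \<oplus>\<^bsub>N\<^esub> h \<zero> = h \<zero>" using add[of \<zero> \<zero>] by simp
  then have zero: "h \<zero> = \<zero>\<^bsub>N\<^esub>"
    using N.add.l_cancel_one[of "h \<zero>" "h \<zero>"] assms(2) by (simp add: Pi_iff)
  show ?thesis using \<open>finite I\<close> f
  proof (induction I rule: finite_induct)
    case (insert i I)
    then have "h (finsum G f (insert i I)) = h (f i) \<oplus>\<^bsub>N\<^esub> h (finsum G f I)"
      using add[of "f i" "finsum G f I"] by (simp add: finsum_insert Pi_iff finsum_closed)
    also have "\<dots> = finsum N (\<lambda>i. h (f i)) (insert i I)"
      using insert assms(2) by (subst N.finsum_insert) (auto simp: Pi_iff)
    finally show ?case .
  qed (simp add: zero)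
qed

lemma (in abelian_group) additive_subgroup_finsum:
  assumes "additive_subgroup H G" "finite I" "\<And>i. i \<in> I \<Longrightarrow> f i \<in> H"
  shows "(\<Oplus>i\<in>I. f i) \<in> H"
proof -
  interpret H: additive_subgroup H G by fact
  show ?thesis using assms(2,3)
    by (induction I rule: finite_induct) (auto simp: finsum_insert)
qed

text \<open>Applying the projection to degree \<open>j\<close> to any decomposition returns its
  summand of degree \<open>j\<close>.\<close>

lemma components_unique:
  assumes "abelian_group M" and c: "components M P c" and x: "x \<in> carrier M"
  shows "\<exists>!b. (\<forall>i. b i \<in> P i) \<and> finite {i. b i \<noteq> \<zero>\<^bsub>M\<^esub>} \<and> x = (\<Oplus>\<^bsub>M\<^esub>i\<in>{i. b i \<noteq> \<zero>\<^bsub>M\<^esub>}. b i)"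
proof (rule ex1I)
  show "(\<forall>i. c x i \<in> P i) \<and> finite {i. c x i \<noteq> \<zero>\<^bsub>M\<^esub>} \<and> x = (\<Oplus>\<^bsub>M\<^esub>i\<in>{i. c x i \<noteq> \<zero>\<^bsub>M\<^esub>}. c x i)"
    using c x unfolding components_def by blast
next
  interpret M: abelian_group M by fact
  have sub: "P i \<subseteq> carrier M" for i
    using c additive_subgroup.a_subset unfolding components_def by blast
  fix b assume b: "(\<forall>i. b i \<in> P i) \<and> finite {i. b i \<noteq> \<zero>\<^bsub>M\<^esub>} \<and> x = (\<Oplus>\<^bsub>M\<^esub>i\<in>{i. b i \<noteq> \<zero>\<^bsub>M\<^esub>}. b i)"
  have bc: "b i \<in> carrier M" for i using b sub by blast
  have cc: "c y j \<in> carrier M" if "y \<in> carrier M" for y j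
    using c sub[of j] that unfolding components_def by blast
  have "c x j = b j" for j
  proof -
    have "c x j = (\<Oplus>\<^bsub>M\<^esub>i\<in>{i. b i \<noteq> \<zero>\<^bsub>M\<^esub>}. c (b i) j)"
      using c sub b by (subst b[THEN conjunct2, THEN conjunct2], intro M.additive_map_finsum)
         (auto simp: M.abelian_group_axioms components_def cc)
    also have "\<dots> = (\<Oplus>\<^bsub>M\<^esub>i\<in>{i. b i \<noteq> \<zero>\<^bsub>M\<^esub>}. if j = i then b i else \<zero>\<^bsub>M\<^esub>)"
      using c b bc by (intro M.finsum_cong') (auto simp: components_def)
    also have "\<dots> = b j"
    proof (cases "b j = \<zero>\<^bsub>M\<^esub>")
      case True
      then have "(\<Oplus>\<^bsub>M\<^esub>i\<in>{i. b i \<noteq> \<zero>\<^bsub>M\<^esub>}. if j = i then b i else \<zero>\<^bsub>M\<^esub>) = (\<Oplus>\<^bsub>M\<^esub>i\<in>{i. b i \<noteq> \<zero>\<^bsub>M\<^esub>}. \<zero>\<^bsub>M\<^esub>)"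
        by (intro M.finsum_cong') auto
      then show ?thesis using True by simp
    next
      case False
      then show ?thesis using b bc by (intro M.finsum_singleton) auto
    qed
    finally show ?thesis .
  qed
  then show "b = c x" by auto
qed

context presentation
begin

lemma coord_finsum:
  assumes "finite I" "f \<in> I \<rightarrow> carrier R"
  shows "coord (\<Oplus>i\<in>I. f i) e = (\<Sum>i\<in>I. coord (f i) e)"
  using assms by (induction I rule: finite_induct) (auto simp: finsum_insert coord_add)

definition comp :: "'b \<Rightarrow> int \<Rightarrow> 'b" where
  "comp r d = elt (\<lambda>e. if int (size e) = d then coord r e else 0)"

lemma comp:
  assumes "r \<in> carrier R"
  shows comp_rpart: "comp r d \<in> rpart R d"
    and coord_comp: "coord (comp r d) = (\<lambda>e. if int (size e) = d then coord r e else 0)"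
proof -
  let ?x = "\<lambda>e. if int (size e) = d then coord r e else 0"
  have fin: "finite (supp ?x)" by (rule finite_subset[OF _ coord_finite[OF assms]]) auto
  have adm: "\<And>e. ?x e \<noteq> 0 \<Longrightarrow> admissible Q e" by (auto dest: coord_admissible split: if_splits)
  show "comp r d \<in> rpart R d"
    unfolding comp_def using fin adm by (rule elt_rpart) (auto split: if_splits)
  show "coord (comp r d) = ?x"
    unfolding comp_def using fin adm by (rule coord_elt)
qed

lemma rpart_subgroup: "additive_subgroup (rpart R d) R"
proof (rule additive_subgroupI, rule add.subgroupI)
  show "rpart R d \<subseteq> carrier R" by (auto simp: rpart_iff)
  show "rpart R d \<noteq> {}"
  proof -
    have "\<zero> \<in> rpart R d" by (simp add: rpart_iff)
    then show ?thesis by blast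
  qed
  show "\<ominus> x \<in> rpart R d" if "x \<in> rpart R d" for x
    using that by (auto simp: rpart_iff coord_minus)
  show "x \<oplus> y \<in> rpart R d" if xy: "x \<in> rpart R d" "y \<in> rpart R d" for x y
  proof -
    have "coord x e \<noteq> 0 \<or> coord y e \<noteq> 0" if "coord (x \<oplus> y) e \<noteq> 0" for e
      using that xy by (auto simp: rpart_iff coord_add)
    then show ?thesis using xy unfolding rpart_iff by blast
  qed
qed

lemma rpart_one: "\<one> \<in> rpart R 0"
  by (auto simp: rpart_iff coord_one)

lemma rpart_mult:
  assumes "x \<in> rpart R i" "y \<in> rpart R j"
  shows "x \<otimes> y \<in> rpart R (i + j)"
proof -
  have "int (size e) = i + j" if e: "coord (x \<otimes> y) e \<noteq> 0" for e
  proof -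
    from e have "tconv (coord x) (coord y) e \<noteq> 0"
      using assms by (auto simp: rpart_iff coord_mult split: if_splits)
    then obtain d where d: "d \<subseteq># e" "coord x d \<noteq> 0" "coord y (e - d) \<noteq> 0"
      unfolding tconv_def by (metis (mono_tags, lifting) mem_Collect_eq mult_eq_0_iff sum.neutral)
    then have "int (size d) = i" "int (size (e - d)) = j" using assms unfolding rpart_iff by blast+
    then show ?thesis using d(1) by (simp add: size_Diff_submset size_mset_mono of_nat_diff)
  qed
  then show ?thesis using assms by (auto simp: rpart_iff)
qed

lemma components_comp: "components R (rpart R) comp"
  unfolding components_def
proof (intro conjI allI ballI)
  show "additive_subgroup (rpart R i) R" for i by (rule rpart_subgroup)
  show c: "comp x i \<in> rpart R i" if "x \<in> carrier R" for x i using that by (rule comp_rpart)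
  have cc: "comp x i \<in> carrier R" if "x \<in> carrier R" for x i using c[OF that] rpart_iff by blast
  show "comp (x \<oplus> y) i = comp x i \<oplus> comp y i" if "x \<in> carrier R" "y \<in> carrier R" for x y i
    using that cc by (subst coord_inject[symmetric]) (auto simp: coord_comp coord_add fun_eq_iff)
  show "comp x i = (if i = j then x else \<zero>)" if "x \<in> rpart R j" for x i j
    using that cc by (subst coord_inject[symmetric]) (auto simp: rpart_iff coord_comp fun_eq_iff)
  fix x assume x: "x \<in> carrier R"
  have nz: "comp x i \<noteq> \<zero> \<longleftrightarrow> (\<exists>e. int (size e) = i \<and> coord x e \<noteq> 0)" for i
    using cc[OF x] coord_admissible[of x] by (auto simp: eq_zero_iff coord_comp x)
  have "{i. comp x i \<noteq> \<zero>} \<subseteq> (\<lambda>e. int (size e)) ` supp (coord x)" using nz by auto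
  then show fin: "finite {i. comp x i \<noteq> \<zero>}" by (rule finite_subset) (simp add: coord_finite x)
  have "coord (\<Oplus>i\<in>{i. comp x i \<noteq> \<zero>}. comp x i) e = coord x e" for e
  proof -
    have "coord (\<Oplus>i\<in>{i. comp x i \<noteq> \<zero>}. comp x i) e
        = (\<Sum>i\<in>{i. comp x i \<noteq> \<zero>}. if int (size e) = i then coord x e else 0)"
      using fin x cc by (subst coord_finsum) (auto simp: coord_comp)
    then show ?thesis using fin nz by auto
  qed
  then show "x = (\<Oplus>i\<in>{i. comp x i \<noteq> \<zero>}. comp x i)"
    using x cc by (subst coord_inject[symmetric]) (auto intro!: finsum_closed)
qed

end

section \<open>Products of linear forms and their annihilators\<close>

section \<open>Linear forms\<close>

lemma mset_size_2_cases:
  assumes "size e = 2"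
  obtains i j where "e = {#i, j#}" "i \<le> (j::nat)"
proof -
  obtain i j where "e = {#i, j#}" 
    using assms by (metis One_nat_def Suc_1 size_eq_Suc_imp_eq_union size_1_singleton_mset add_mset_add_single size_mset_SucE union_commute)
  then show ?thesis using that[of i j] that[of j i] by (cases "i \<le> j") (auto simp: add_mset_commute)
qed

context presentation
begin

text \<open>The hypothesis cancels the coefficients of the mixed monomials, so only squares survive;
  \<open>Min (set_mset e)\<close> merely names the letter of such a square.\<close>

lemma coord_lin_lin:
  assumes ab: "\<And>i j. i \<in> {1..n} \<Longrightarrow> j \<in> {1..n} \<Longrightarrow> i < j \<Longrightarrow> a i * b j = \<alpha> i j * a j * b i"
  shows "coord (lin a \<otimes> lin b) e = (if admissible Q e \<and> (\<exists>i. e = {#i, i#}) then a (Min (set_mset e)) * b (Min (set_mset e)) else 0)"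
proof (cases "admissible Q e \<and> size e = 2")
  case False
  have "lin a \<otimes> lin b \<in> rpart R (1 + 1)" by (intro rpart_mult lin_rpart)
  then have "coord (lin a \<otimes> lin b) e = 0"
    using False coord_admissible[of "lin a \<otimes> lin b" e] by (auto simp: rpart_iff)
  then show ?thesis using False by auto
next
  case True
  then obtain i j where e: "e = {#i, j#}" "i \<le> j" by (metis mset_size_2_cases)
  have ij: "i \<in> {1..n}" "j \<in> {1..n}" using True e by (auto simp: admissible_def)
  show ?thesis
  proof (cases "i = j")
    case True
    then show ?thesis using e ij \<open>admissible Q e \<and> _\<close> by (subst coord_lin_mult) (auto simp: swap_def)
  next
    case False
    then have "coord (lin a \<otimes> lin b) e = a i * b j + - \<alpha> i j * a j * b i"
      using e ij \<open>admissible Q e \<and> _\<close> by (subst coord_lin_mult) (auto simp: swap_def)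
    also have "\<dots> = 0" using ab[of i j] ij e False by simp
    finally show ?thesis using e False by (auto simp: add_eq_conv_ex)
  qed
qed

text \<open>A mixed monomial is square-free, hence admissible, so its coefficient in the product
  must vanish. For j < i the relation is that of the pair (j, i) multiplied by
  \<open>\<alpha> i j\<close>.\<close>

lemma lin_lin_zero_imp:
  assumes "{1..n} \<inter> Q = Q" "lin a \<otimes> lin b = \<zero>" and ij: "i \<in> {1..n}" "j \<in> {1..n}" "i \<noteq> j"
  shows "a i * b j = \<alpha> i j * a j * b i"
proof -
  have *: "a i * b j = \<alpha> i j * a j * b i" if ij: "i \<in> {1..n}" "j \<in> {1..n}" "i < j" for i j
  proof -
    have "admissible Q {#i, j#}" using ij by (auto simp: admissible_def)
    then have "coord (lin a \<otimes> lin b) {#i, j#} = a i * b j + - \<alpha> i j * a j * b i"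
      using ij by (subst coord_lin_mult) (auto simp: swap_def)
    then show ?thesis by (simp add: assms(2))
  qed
  show ?thesis
  proof (cases "i < j")
    case False
    then have "\<alpha> i j * a j * b i = \<alpha> i j * (\<alpha> j i * a i * b j)" using *[of j i] ij by (simp add: mult_ac)
    also have "\<dots> = a i * b j" using alpha_inv[of i j] ij by (simp add: mult.assoc[symmetric])
    finally show ?thesis by simp
  qed (use * ij in auto)
qed

lemma rpart_one_lin: "r \<in> rpart R 1 \<Longrightarrow> r = lin (\<lambda>i. coord r {#i#})"
proof -
  assume r: "r \<in> rpart R 1"
  have "coord r e = coord (lin (\<lambda>i. coord r {#i#})) e" for e
  proof (cases "size e = 1 \<and> set_mset e \<subseteq> {1..n}")
    case True
    then show ?thesis using size_1_singleton_mset[of e] by auto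
  next
    case False
    then have "coord r e = 0" using r coord_admissible[of r e] by (auto simp: rpart_iff admissible_def)
    then show ?thesis using False by (auto simp: coord_lin)
  qed
  then have "coord r = coord (lin (\<lambda>i. coord r {#i#}))" by (rule ext)
  then show ?thesis using r coord_inject lin_closed unfolding rpart_iff by blast
qed

lemma lin_cong: "(\<And>i. i \<in> {1..n} \<Longrightarrow> a i = b i) \<Longrightarrow> lin a = lin b"
  by (subst coord_inject[symmetric])
     (auto simp: coord_lin fun_eq_iff subset_iff intro!: arg_cong[of _ _ sum_mset] image_mset_cong)

lemma lin_zero: "lin (\<lambda>i. 0) = \<zero>"
  by (subst coord_inject[symmetric]) (auto simp: coord_lin fun_eq_iff)

definition sc :: "'k \<Rightarrow> 'b" where
  "sc c = elt (\<lambda>e. if e = {#} then c else 0)"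

lemma sc: 
  shows sc_rpart: "sc c \<in> rpart R 0" and coord_sc: "coord (sc c) = (\<lambda>e. if e = {#} then c else 0)"
proof -
  let ?x = "\<lambda>e::nat multiset. if e = {#} then c else 0"
  have fin: "finite (supp ?x)" by (rule finite_subset[of _ "{{#}}"]) auto
  have adm: "\<And>e. ?x e \<noteq> 0 \<Longrightarrow> admissible Q e" by (auto simp: admissible_def split: if_splits)
  show "sc c \<in> rpart R 0"
    unfolding sc_def using fin adm by (rule elt_rpart) (auto split: if_splits)
  show "coord (sc c) = ?x"
    unfolding sc_def using fin adm by (rule coord_elt)
qed

lemma sc_closed [simp]: "sc c \<in> carrier R"
  using sc_rpart rpart_iff by blast

lemma coord_sc_mult: "r \<in> carrier R \<Longrightarrow> coord (sc c \<otimes> r) e = c * coord r e"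
  using coord_admissible[of r e] by (auto simp: coord_mult coord_sc tconv_delta_left)

lemma coord_mult_sc: "r \<in> carrier R \<Longrightarrow> coord (r \<otimes> sc c) e = c * coord r e"
  using coord_admissible[of r e] by (auto simp: coord_mult coord_sc tconv_delta_right)

lemma sc_comm: "r \<in> carrier R \<Longrightarrow> sc c \<otimes> r = r \<otimes> sc c"
  by (subst coord_inject[symmetric]) (auto simp: coord_sc_mult coord_mult_sc fun_eq_iff)

lemma sc_mult: "sc c \<otimes> sc d = sc (c * d)"
  by (subst coord_inject[symmetric]) (auto simp: coord_sc_mult coord_sc fun_eq_iff)

lemma sc_one: "sc 1 = \<one>"
  by (subst coord_inject[symmetric]) (auto simp: coord_one coord_sc fun_eq_iff)

lemma sc_lin: "sc c \<otimes> lin a = lin (\<lambda>i. c * a i)"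
  by (subst coord_inject[symmetric]) (auto simp: coord_sc_mult coord_lin fun_eq_iff sum_mset_distrib_left)

lemma rpart_zero_sc: 
  assumes "r \<in> rpart R 0" 
  shows "r = sc (coord r {#})"
proof -
  have "coord r e = coord (sc (coord r {#})) e" for e
    using assms by (cases "e = {#}") (auto simp: coord_sc rpart_iff)
  then have "coord r = coord (sc (coord r {#}))" by (rule ext)
  then show ?thesis using assms coord_inject sc_closed unfolding rpart_iff by blast
qed

text \<open>When all squares vanish, the monomial containing every letter once is killed by each
  linear form. This socle element shows that multiplication by a linear form is never injective on
  \<open>A\<close>.\<close>

lemma lin_has_annihilator:
  assumes "Q = {1..n}"
  obtains r where "r \<in> carrier R" "r \<noteq> \<zero>" "lin a \<otimes> r = \<zero>"
proof -
  let ?m = "mset_set {1..n}" let ?x = "\<lambda>e. if e = ?m then (1::'k) else 0"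
  have fin: "finite (supp ?x)" by (rule finite_subset[of _ "{?m}"]) auto
  have adm: "\<And>e. ?x e \<noteq> 0 \<Longrightarrow> admissible Q e" by (auto simp: admissible_def count_mset_set' split: if_splits)
  have "elt ?x \<in> carrier R" by (rule elt_closed[OF fin]) (rule adm)
  moreover have "coord (elt ?x) = ?x" by (rule coord_elt[OF fin]) (rule adm)
  ultimately have x: "elt ?x \<in> carrier R" "coord (elt ?x) = ?x" .
  have "coord (elt ?x) ?m \<noteq> 0" unfolding x(2) by simp
  then have "elt ?x \<noteq> \<zero>" by (metis coord_zero)
  moreover have "coord (lin a \<otimes> elt ?x) e = 0" if e: "admissible Q e" for e
  proof -
    have "coord (elt ?x) (e - {#i#}) = 0" if i: "i \<in> set_mset e" for i
    proof -
      have "e - {#i#} \<noteq> ?m"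
      proof
        assume "e - {#i#} = ?m"
        then have "count e i = Suc (count ?m i)" using i by (metis count_add_mset insert_DiffM)
        moreover have "i \<in> {1..n}" using e i by (auto simp: admissible_def)
        moreover have "count e i \<le> 1" using calculation(2) e assms unfolding admissible_def by blast
        ultimately show False by (simp add: count_mset_set')
      qed
      then show ?thesis by (subst x(2)) simp
    qed
    then show ?thesis using e x(1) by (subst coord_lin_mult) (auto intro!: sum.neutral)
  qed
  ultimately show ?thesis using that[of "elt ?x"] x(1) by (simp add: eq_zero_iff)
qed

text \<open>
  Modulo the left multiples of \<open>\<theta> = lin a\<close>, every element is free of the letter \<open>i\<close>; such an
  element is killed by \<open>lin b\<close> only if it vanishes, as the \<open>x\<^sub>i\<close>-part of the product shows.
\<close>

lemma left_annihilator_lin: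
  assumes i: "i \<in> Q" "i \<in> {1..n}" "a i \<noteq> 0" "b i \<noteq> 0" and ab: "lin a \<otimes> lin b = \<zero>"
    and s: "s \<in> carrier R" "s \<otimes> lin b = \<zero>"
  obtains t where "t \<in> carrier R" "s = t \<otimes> lin a"
proof -
  \<comment> \<open>The product of \<open>t\<close> and \<open>lin a\<close> has to agree with
    \<open>s\<close> at every monomial containing \<open>i\<close>. If \<open>t\<close> involves
    only monomials free of \<open>i\<close>, the coefficient at \<open>e\<close> reduces to the term
    that removes \<open>i\<close>, and \<open>x\<close> solves this equation; a i \<noteq> 0 enters
    here.\<close>
  define x where "x d = (if i \<in># d then 0 else coord s (add_mset i d) / (bichar d {#i#} * a i))" for d
  have "supp x \<subseteq> (\<lambda>e. e - {#i#}) ` supp (coord s)"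
  proof
    fix d assume "d \<in> supp x"
    then show "d \<in> (\<lambda>e. e - {#i#}) ` supp (coord s)"
      by (intro image_eqI[of _ _ "add_mset i d"]) (auto simp: x_def split: if_splits)
  qed
  then have fin: "finite (supp x)" using coord_finite[OF s(1)] finite_subset by blast
  have adm: "admissible Q d" if "x d \<noteq> 0" for d
  proof -
    have "coord s (add_mset i d) \<noteq> 0" using that by (auto simp: x_def split: if_splits)
    then show ?thesis using coord_admissible admissible_mono[of Q "add_mset i d" d] by simp
  qed
  define t where "t = elt x"
  have t: "t \<in> carrier R" "coord t = x" unfolding t_def using elt_closed[OF fin adm] coord_elt[OF fin adm] by auto
  define u where "u = s \<ominus> t \<otimes> lin a"
  have u: "u \<in> carrier R" using s t by (simp add: u_def)
  have u_free: "coord u e = 0" if ie: "i \<in># e" for e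
  proof (cases "admissible Q e")
    case True
    have "count e i = 1" using True i ie by (auto simp: admissible_def) (metis One_nat_def count_greater_zero_iff le_antisym Suc_leI)
    then have ni: "i \<notin># e - {#i#}" by (simp add: not_in_iff)
    have xj: "x (e - {#j#}) = 0" if "j \<noteq> i" for j
      using that ie by (simp add: x_def in_diff_count)
    have "coord (t \<otimes> lin a) e = (\<Sum>j\<in>set_mset e. if i = j then bichar (e - {#i#}) {#i#} * x (e - {#i#}) * a i else 0)"
      unfolding coord_mult_lin[OF t(1) True] t(2) by (rule sum.cong) (auto simp: xj)
    also have "\<dots> = coord s e"
      using ie ni i by (simp add: x_def bichar_nonzero)
    finally show ?thesis using s t by (simp add: u_def a_minus_def coord_add coord_minus)
  qed (use coord_admissible in blast)
  have "u \<otimes> lin b = s \<otimes> lin b \<ominus> t \<otimes> (lin a \<otimes> lin b)"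
    using s t by (simp add: u_def a_minus_def l_distr l_minus m_assoc)
  then have ub: "u \<otimes> lin b = \<zero>" using s t ab by (simp add: a_minus_def)
  have "coord u e = 0" if e: "admissible Q e" "i \<notin># e" for e
  proof -
    \<comment> \<open>As \<open>i\<close> lies in \<open>Q\<close> but not in \<open>e\<close>,
      adding one \<open>i\<close> keeps the monomial admissible only because \<open>e\<close> is
      free of \<open>i\<close>. In the coefficient of the product there, every summand except that
      of \<open>i\<close> involves a coefficient of \<open>u\<close> at a monomial containing
      \<open>i\<close>, which vanishes.\<close>
    have ae: "admissible Q (add_mset i e)" using e i by (auto simp: admissible_def not_in_iff)
    have "0 = coord (u \<otimes> lin b) (add_mset i e)" by (simp add: ub)
    also have "\<dots> = (\<Sum>j\<in>set_mset (add_mset i e). if i = j then bichar e {#i#} * coord u e * b i else 0)"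
      using u e by (subst coord_mult_lin[OF u ae], intro sum.cong) (auto simp: u_free)
    also have "\<dots> = bichar e {#i#} * coord u e * b i" by simp
    finally show ?thesis using i by (simp add: bichar_nonzero)
  qed
  then have "u = \<zero>" using u u_free by (auto simp: eq_zero_iff)
  then have "s = t \<otimes> lin a" using s t by (simp add: u_def) (metis m_closed lin_closed minus_equality minus_minus r_neg a_minus_def a_inv_closed)
  then show ?thesis using that t by blast
qed

end

section \<open>The algebras T, S and A; regularity and normality of f\<close>

section \<open>The algebras\<close>

lemma gen_eq_single: "gen i = single [i] 1" and scalar_eq_single: "scalar c = single [] c"
  by (auto simp: gen_def scalar_def single_def)

locale skew_algebra = skew_data n \<alpha> for n and \<alpha> :: "nat \<Rightarrow> nat \<Rightarrow> 'k::field" +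
  assumes n_pos: "n \<ge> 1"
begin

lemma presentation_T: "presentation n \<alpha> (algT n \<alpha>) {} (projT n \<alpha>)"
proof -
  interpret F: ring FA by (rule ring_free_algebra)
  define G where "G = {(scalar (\<alpha> i j) \<otimes>\<^bsub>FA\<^esub> gen i \<otimes>\<^bsub>FA\<^esub> gen j) \<oplus>\<^bsub>FA\<^esub> (gen j \<otimes>\<^bsub>FA\<^esub> gen i) | i j.
       i \<in> {1..n} \<and> j \<in> {1..n} \<and> i \<noteq> j}"
  have I: "skew_ideal n \<alpha> = genideal FA G" by (simp add: skew_ideal_def G_def Let_def)
  have G: "G = {(\<lambda>w. single [i, j] (\<alpha> i j) w + single [j, i] 1 w) | i j. i \<in> {1..n} \<and> j \<in> {1..n} \<and> i \<noteq> j}"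
    unfolding G_def gen_eq_single scalar_eq_single free_algebra_simps(2,5) conv_single_single by simp
  have GF: "G \<subseteq> carrier FA" unfolding G by (auto intro!: free_carrier_add)
  have "presentation n \<alpha> (graded_quot FA (genideal FA G)) {} (\<lambda>u. genideal FA G +>\<^bsub>FA\<^esub> id u)"
  proof (rule presentation_quot[OF F.ring_axioms])
    fix g assume "g \<in> G"
    then obtain i j where g: "g = (\<lambda>w. single [i, j] (\<alpha> i j) w + single [j, i] 1 w)"
      and ij: "i \<in> {1..n}" "j \<in> {1..n}" "i \<noteq> j" unfolding G by auto
    \<comment> \<open>For i < j the two terms carry the scalars \<alpha> i j and - \<alpha> i j. For
      i > j sorting puts the scalar - \<alpha> j i on the first term, and \<alpha> i j \<alpha> j i
      = 1 makes the sum vanish.\<close>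
    have "nf {} g e = 0" for e
      unfolding g nf_add nf_single using ij alpha_inv[of i j]
      by (auto simp: add_mset_commute swap_def not_less mult.commute)
    then show "\<exists>z\<in>carrier FA. g = id z \<and> nf {} z = (\<lambda>e. 0)" using \<open>g \<in> G\<close> GF by auto
  next
    fix i j assume ij: "i \<in> {1..n}" "j \<in> {1..n}" "i < j"
    have "\<ominus>\<^bsub>FA\<^esub> single [i, j] (- \<alpha> i j) = single [i, j] (\<alpha> i j)"
      using ij by (intro F.minus_equality) (auto simp: free_algebra_simps single_def)
    then have "id (single [j, i] 1) \<ominus>\<^bsub>FA\<^esub> id (single [i, j] (- \<alpha> i j)) = (\<lambda>w. single [i, j] (\<alpha> i j) w + single [j, i] 1 w)"
      by (simp add: a_minus_def free_algebra_simps add.commute)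
    then have "id (single [j, i] 1) \<ominus>\<^bsub>FA\<^esub> id (single [i, j] (- \<alpha> i j)) \<in> G"
      unfolding G by (intro CollectI exI[of _ i] exI[of _ j]) (use ij in auto)
    then show "id (single [j, i] 1) \<ominus>\<^bsub>FA\<^esub> id (single [i, j] (- \<alpha> i j)) \<in> genideal FA G"
      using F.genideal_self[OF GF] by blast
  qed (auto simp: free_algebra_simps(4) intro: ring_hom_memI)
  then show ?thesis by (simp add: algT_def projT_def[abs_def] I)
qed

sublocale T: presentation n \<alpha> "algT n \<alpha>" "{}" "projT n \<alpha>"
  by (rule presentation_T)

lemma hom_square: 
  assumes "presentation n \<alpha> R Q h" "i \<in> {1..n}"
  shows "h (gen i) \<otimes>\<^bsub>R\<^esub> h (gen i) = h (single [i, i] 1)"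
proof -
  interpret presentation n \<alpha> R Q h by fact
  show ?thesis using assms(2) h.hom_mult[of "gen i" "gen i"]
    by (simp add: gen_eq_single free_algebra_simps(2) conv_single_single)
qed

text \<open>The squares of the letters in \<open>J\<close> are killed on top of those of
  \<open>Q\<close>: \<open>J\<close> is {1..n-1} when passing from \<open>T\<close> to
  \<open>S\<close>, and {n} when passing from \<open>S\<close> to \<open>A\<close>, where the only
  generator is f itself.\<close>

lemma presentation_next:
  assumes P: "presentation n \<alpha> R Q h" and J: "J \<subseteq> {1..n}"
  shows "presentation n \<alpha> (graded_quot R (genideal R {h (gen i) \<otimes>\<^bsub>R\<^esub> h (gen i) | i. i \<in> J})) (Q \<inter> {1..n} \<union> J)
     (\<lambda>u. genideal R {h (gen i) \<otimes>\<^bsub>R\<^esub> h (gen i) | i. i \<in> J} +>\<^bsub>R\<^esub> h u)"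
proof -
  interpret presentation n \<alpha> R Q h by fact
  define G where "G = {h (gen i) \<otimes>\<^bsub>R\<^esub> h (gen i) | i. i \<in> J}"
  have G: "G = {h (single [i, i] 1) | i. i \<in> J}" 
    unfolding G_def Setcompr_eq_image by (intro image_cong refl hom_square[OF P]) (use J in auto)
  have GR: "G \<subseteq> carrier R" unfolding G using J by auto
  interpret I: ideal "genideal R G" R by (rule genideal_ideal[OF GR])
  have "presentation n \<alpha> (graded_quot R (genideal R G)) (Q \<inter> {1..n} \<union> J) (\<lambda>u. genideal R G +>\<^bsub>R\<^esub> h u)"
  proof (rule presentation_quot[OF ring_axioms hom surj])
    fix u assume u: "u \<in> carrier FA" "h u = \<zero>\<^bsub>R\<^esub>"
    then have z: "nf Q u = (\<lambda>e. 0)" by (simp add: hom_zero_iff)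
    have "admissible Q e" if e: "admissible (Q \<inter> {1..n} \<union> J) e" for e
    proof -
      have "count e i \<le> 1" if "i \<in> Q" for i
      proof (cases "i \<in> {1..n}")
        case False
        then have "count e i = 0" using e unfolding admissible_def by (meson not_in_iff subsetD)
        then show ?thesis by simp
      qed (use e that in \<open>auto simp: admissible_def\<close>)
      then show ?thesis using e by (simp add: admissible_def)
    qed
    then have "nf (Q \<inter> {1..n} \<union> J) u e = 0" for e
      using fun_cong[OF z, of e] by (auto simp: nf_def)
    then show "nf (Q \<inter> {1..n} \<union> J) u = (\<lambda>e. 0)" by auto
  next
    show "rpart R i = h ` rpart FA i" for i by (rule rpart_eq)
  next
    fix g assume "g \<in> G"
    then obtain i where i: "i \<in> J" "g = h (single [i, i] 1)" unfolding G by auto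
    moreover have "nf (Q \<inter> {1..n} \<union> J) (single [i, i] 1) e = 0" for e
      using i by (auto simp: nf_single admissible_def dest!: bspec[of _ _ i])
    ultimately show "\<exists>z\<in>carrier FA. g = h z \<and> nf (Q \<inter> {1..n} \<union> J) z = (\<lambda>e. 0)"
      using J by (intro bexI[of _ "single [i, i] 1"]) auto
  next
    fix i j assume ij: "i \<in> {1..n}" "j \<in> {1..n}" "i < j"
    have "nf Q (single [j, i] 1) = nf Q (single [i, j] (- \<alpha> i j))"
      using ij by (auto simp: nf_single fun_eq_iff add_mset_commute swap_def)
    then have "h (single [j, i] 1) = h (single [i, j] (- \<alpha> i j))" using ij by (simp add: h_eq_iff)
    then show "h (single [j, i] 1) \<ominus>\<^bsub>R\<^esub> h (single [i, j] (- \<alpha> i j)) \<in> genideal R G"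
      using ij I.zero_closed by (simp add: a_minus_def r_neg)
  next
    fix i assume i: "i \<in> Q \<inter> {1..n} \<union> J"
    then have "h (single [i, i] 1) \<in> genideal R G"
    proof
      assume "i \<in> J"
      then show ?thesis using genideal_self[OF GR] unfolding G by blast
    next
      assume "i \<in> Q \<inter> {1..n}"
      then have "nf Q (single [i, i] 1) e = 0" for e
        by (auto simp: nf_single admissible_def dest!: bspec[of _ _ i])
      then have "nf Q (single [i, i] 1) = (\<lambda>e. 0)" by (rule ext)
      then show ?thesis using \<open>i \<in> Q \<inter> {1..n}\<close> hom_zero_iff[of "single [i, i] 1"] I.zero_closed by simp
    qed
    then show "i \<in> {1..n} \<and> h (single [i, i] 1) \<in> genideal R G" using i J by auto
  qed
  then show ?thesis by (simp add: G_def)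
qed

definition "QS = {1..<n}"
definition "QA = {1..n}"

lemma QS_iff: "i \<in> QS \<longleftrightarrow> 1 \<le> i \<and> i < n" and QA_iff: "i \<in> QA \<longleftrightarrow> 1 \<le> i \<and> i \<le> n"
  by (auto simp: QS_def QA_def)

lemma presentation_S: "presentation n \<alpha> (algS n \<alpha>) QS (projS n \<alpha>)"
proof -
  have QS: "QS \<subseteq> {1..n}" by (auto simp: QS_def)
  have "{} \<inter> {1..n} \<union> QS = QS" by simp
  then show ?thesis using presentation_next[OF presentation_T QS]
    by (simp add: algS_def projS_def[abs_def] squares_ideal_def QS_def)
qed

lemma presentation_A: "presentation n \<alpha> (algA n \<alpha>) QA (\<lambda>u. S_to_A n \<alpha> (projS n \<alpha> u))"
proof -
  have QA: "{n} \<subseteq> {1..n}" "QS \<inter> {1..n} \<union> {n} = QA" using n_pos by (auto simp: QA_def QS_def)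
  show ?thesis using presentation_next[OF presentation_S QA(1)] unfolding QA(2)
    by (simp add: algA_def S_to_A_def[abs_def] elem_f_def)
qed

sublocale S: presentation n \<alpha> "algS n \<alpha>" QS "projS n \<alpha>"
  by (rule presentation_S)

sublocale A: presentation n \<alpha> "algA n \<alpha>" QA "\<lambda>u. S_to_A n \<alpha> (projS n \<alpha> u)"
  by (rule presentation_A)

abbreviation "Sa \<equiv> algS n \<alpha>"
abbreviation "Aa \<equiv> algA n \<alpha>"
abbreviation "pr \<equiv> S_to_A n \<alpha>"
abbreviation "ff \<equiv> elem_f n \<alpha>"

lemma ff: 
  shows ff_rpart: "ff \<in> rpart Sa 2" and coord_ff: "S.coord ff = (\<lambda>e. if e = {#n, n#} then 1 else 0)"
proof -
  have "ff = projS n \<alpha> (single [n, n] 1)"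
    unfolding elem_f_def by (rule hom_square[OF presentation_S]) (use n_pos in auto)
  moreover have "projS n \<alpha> (single [n, n] 1) \<in> projS n \<alpha> ` rpart FA 2"
    using n_pos by (intro imageI) (auto simp: free_algebra_simps single_def)
  moreover have "S.coord (projS n \<alpha> (single [n, n] 1)) = nf QS (single [n, n] 1)"
    using n_pos by (intro S.coord_h) auto
  ultimately show "ff \<in> rpart Sa 2" "S.coord ff = (\<lambda>e. if e = {#n, n#} then 1 else 0)"
    using n_pos by (auto simp: S.rpart_eq nf_single swap_def admissible_def QS_iff QA_iff fun_eq_iff)
qed

lemma ff_closed [simp]: "ff \<in> carrier Sa"
  using ff_rpart S.rpart_iff by blast

lemma coord_ff_mult: "s \<in> carrier Sa \<Longrightarrow> S.coord (ff \<otimes>\<^bsub>Sa\<^esub> s) e =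
    (if {#n, n#} \<subseteq># e then bichar {#n, n#} (e - {#n, n#}) * S.coord s (e - {#n, n#}) else 0)"
proof -
  assume s: "s \<in> carrier Sa"
  have "S.coord s (e - {#n, n#}) = 0" if e: "\<not> admissible QS e" "{#n, n#} \<subseteq># e"
  proof -
    obtain d where "e = {#n, n#} + d" using e(2) by (auto simp: subset_mset.le_iff_add)
    then show ?thesis using e(1) n_pos S.coord_admissible[of s d] by (force simp: admissible_def QS_iff QA_iff)
  qed
  then show ?thesis using s by (auto simp: S.coord_mult coord_ff tconv_delta_left)
qed

lemma coord_mult_ff: "s \<in> carrier Sa \<Longrightarrow> S.coord (s \<otimes>\<^bsub>Sa\<^esub> ff) e =
    (if {#n, n#} \<subseteq># e then bichar (e - {#n, n#}) {#n, n#} * S.coord s (e - {#n, n#}) else 0)"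
proof -
  assume s: "s \<in> carrier Sa"
  have "S.coord s (e - {#n, n#}) = 0" if e: "\<not> admissible QS e" "{#n, n#} \<subseteq># e"
  proof -
    obtain d where "e = {#n, n#} + d" using e(2) by (auto simp: subset_mset.le_iff_add)
    then show ?thesis using e(1) n_pos S.coord_admissible[of s d] by (force simp: admissible_def QS_iff QA_iff)
  qed
  then show ?thesis using s by (auto simp: S.coord_mult coord_ff tconv_delta_right)
qed

text \<open>In coordinates multiplication by f, on either side, shifts exponents by {n, n} with a
  nonzero scalar; the shift preserves admissibility because x_n is not among the letters of square
  zero in \<open>S\<close>.\<close>

lemma ff_regular:
  assumes "s \<in> carrier Sa" "ff \<otimes>\<^bsub>Sa\<^esub> s = \<zero>\<^bsub>Sa\<^esub> \<or> s \<otimes>\<^bsub>Sa\<^esub> ff = \<zero>\<^bsub>Sa\<^esub>"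
  shows "s = \<zero>\<^bsub>Sa\<^esub>"
proof -
  have "S.coord s e = 0" for e
    using coord_ff_mult[OF assms(1), of "{#n, n#} + e"] coord_mult_ff[OF assms(1), of "{#n, n#} + e"] assms(2)
    by (auto simp: bichar_nonzero simp del: bichar_simps)
  then show ?thesis using assms(1) by (simp add: S.eq_zero_iff)
qed

text \<open>\<open>tau j\<close> is the \<open>j\<close>-th power of the normalizing automorphism of \<open>f\<close>: \<open>s f = f tau 1 s\<close>.\<close>

definition tau :: "int \<Rightarrow> (nat list \<Rightarrow> 'k) set set \<Rightarrow> (nat list \<Rightarrow> 'k) set set" where
  "tau j s = S.elt (\<lambda>e. (bichar e {#n, n#} / bichar {#n, n#} e) powi j * S.coord s e)"

lemma tau:
  assumes "s \<in> carrier Sa"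
  shows tau_closed: "tau j s \<in> carrier Sa"
    and coord_tau: "S.coord (tau j s) = (\<lambda>e. (bichar e {#n, n#} / bichar {#n, n#} e) powi j * S.coord s e)"
    and tau_rpart: "s \<in> rpart Sa d \<Longrightarrow> tau j s \<in> rpart Sa d"
proof -
  let ?x = "\<lambda>e. (bichar e {#n, n#} / bichar {#n, n#} e) powi j * S.coord s e"
  have fin: "finite (supp ?x)" by (rule finite_subset[OF _ S.coord_finite[OF assms]]) auto
  have adm: "\<And>e. ?x e \<noteq> 0 \<Longrightarrow> admissible QS e" by (auto dest: S.coord_admissible)
  show c: "tau j s \<in> carrier Sa" unfolding tau_def by (rule S.elt_closed[OF fin]) (rule adm)
  show x: "S.coord (tau j s) = ?x" unfolding tau_def by (rule S.coord_elt[OF fin]) (rule adm)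
  show "tau j s \<in> rpart Sa d" if "s \<in> rpart Sa d" using that c by (auto simp: S.rpart_iff x)
qed

text \<open>The ratio of the two \<open>bichar\<close> values is a character of multisets, so
  rescaling coefficients by a power of it respects the product.\<close>

lemma tau_hom: "tau j \<in> ring_hom Sa Sa"
proof (rule ring_hom_memI)
  show "tau j s \<in> carrier Sa" if "s \<in> carrier Sa" for s using that by (rule tau_closed)
  fix s t assume st: "s \<in> carrier Sa" "t \<in> carrier Sa"
  let ?b = "\<lambda>e. bichar e {#n, n#} / bichar {#n, n#} e"
  have b: "?b (e - d) * ?b d = ?b e" if de: "d \<subseteq># e" for d e
  proof -
    obtain d' where "e = d + d'" using de by (auto simp: subset_mset.le_iff_add)
    then show ?thesis by (simp add: mult.commute)
  qed
  have "tconv (\<lambda>e. ?b e powi j * S.coord s e) (\<lambda>e. ?b e powi j * S.coord t e) e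
      = ?b e powi j * tconv (S.coord s) (S.coord t) e" for e
    unfolding tconv_def sum_distrib_left
  proof (rule sum.cong[OF refl])
    fix d assume "d \<in> {d. d \<subseteq># e}"
    then have "?b e powi j = ?b (e - d) powi j * ?b d powi j" by (simp flip: b power_int_mult_distrib)
    then show "bichar d (e - d) * (?b d powi j * S.coord s d) * (?b (e - d) powi j * S.coord t (e - d))
      = ?b e powi j * (bichar d (e - d) * S.coord s d * S.coord t (e - d))" by (simp only: mult_ac)
  qed
  then show "tau j (s \<otimes>\<^bsub>Sa\<^esub> t) = tau j s \<otimes>\<^bsub>Sa\<^esub> tau j t"
    using st by (subst S.coord_inject[symmetric]) (auto simp: coord_tau tau_closed S.coord_mult)
  show "tau j (s \<oplus>\<^bsub>Sa\<^esub> t) = tau j s \<oplus>\<^bsub>Sa\<^esub> tau j t"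
    using st by (subst S.coord_inject[symmetric]) (auto simp: coord_tau tau_closed S.coord_add fun_eq_iff distrib_left)
next
  show "tau j \<one>\<^bsub>Sa\<^esub> = \<one>\<^bsub>Sa\<^esub>"
    by (subst S.coord_inject[symmetric]) (auto simp: coord_tau tau_closed S.coord_one)
qed

lemma tau_simps:
  assumes "s \<in> carrier Sa"
  shows "tau 0 s = s" "tau i (tau j s) = tau (i + j) s" "s \<otimes>\<^bsub>Sa\<^esub> ff = ff \<otimes>\<^bsub>Sa\<^esub> tau 1 s"
proof -
  note simps = coord_tau tau_closed fun_eq_iff power_int_add bichar_nonzero coord_ff_mult coord_mult_ff
  show "tau 0 s = s" using assms by (subst S.coord_inject[symmetric]) (auto simp: simps)
  show "tau i (tau j s) = tau (i + j) s"
    using assms by (subst S.coord_inject[symmetric]) (auto simp: simps)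
  show "s \<otimes>\<^bsub>Sa\<^esub> ff = ff \<otimes>\<^bsub>Sa\<^esub> tau 1 s"
    using assms by (subst S.coord_inject[symmetric]) (auto simp: simps)
qed

lemma tau_ff: "tau j ff = ff"
  by (subst S.coord_inject[symmetric]) (auto simp: coord_tau tau_closed coord_ff bichar_nonzero)

lemma pr_hom: "pr \<in> ring_hom Sa Aa"
  unfolding S_to_A_def[abs_def] algA_def
  by (rule graded_quot_hom, rule S.genideal_ideal) auto

lemma pr_surj: "pr ` carrier Sa = carrier Aa"
  using S.surj A.surj by (simp add: image_image[symmetric] flip: S.surj A.surj)

lemma rpart_A: "rpart Aa i = pr ` rpart Sa i"
  by (simp add: A.rpart_eq S.rpart_eq image_image)

lemma pr_closed [simp]: "s \<in> carrier Sa \<Longrightarrow> pr s \<in> carrier Aa"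
  using pr_surj by blast

lemma coord_pr: 
  assumes "s \<in> carrier Sa" 
  shows "A.coord (pr s) e = (if admissible QA e then S.coord s e else 0)"
proof -
  obtain u where u: "u \<in> carrier FA" "s = projS n \<alpha> u" using assms S.ex_word by blast
  show ?thesis unfolding u(2) A.coord_h[OF u(1)] S.coord_h[OF u(1)]
    by (auto simp: nf_def admissible_def QS_iff QA_iff)
qed

lemma pr_lin: "pr (S.lin a) = A.lin a"
proof -
  have "A.coord (pr (S.lin a)) e = A.coord (A.lin a) e" for e
  proof (cases "\<exists>i. e = {#i#}")
    case True
    then obtain i where e: "e = {#i#}" by blast
    have "i \<in> {1..n} \<longleftrightarrow> admissible QA e" by (auto simp: e admissible_def)
    then show ?thesis by (simp add: coord_pr e)
  next
    case False
    then have "size e \<noteq> 1" using size_1_singleton_mset by blast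
    then show ?thesis by (simp add: coord_pr A.coord_lin S.coord_lin)
  qed
  then have "A.coord (pr (S.lin a)) = A.coord (A.lin a)" by (rule ext)
  then show ?thesis by (simp add: A.coord_inject)
qed

text \<open>A monomial that is admissible for \<open>S\<close> but not for \<open>A\<close> contains
  x_n twice, so whatever dies in \<open>A\<close> is divisible by f on the left; the two-sided ideal
  generated by f is just f S.\<close>

lemma pr_zero_iff:
  assumes "s \<in> carrier Sa"
  shows "pr s = \<zero>\<^bsub>Aa\<^esub> \<longleftrightarrow> (\<exists>t\<in>carrier Sa. s = ff \<otimes>\<^bsub>Sa\<^esub> t)"
proof
  assume z: "pr s = \<zero>\<^bsub>Aa\<^esub>"
  have s0: "S.coord s e = 0" if "\<not> {#n, n#} \<subseteq># e" for e
  proof (cases "admissible QS e")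
    case True
    have "count e n \<le> 1"
    proof (rule ccontr)
      assume "\<not> count e n \<le> 1"
      then have "{#n, n#} \<subseteq># e" by (auto simp: subseteq_mset_def)
      then show False using that by simp
    qed
    then have "admissible QA e" using True unfolding admissible_def Ball_def QS_iff QA_iff
      by (metis le_neq_implies_less)
    then show ?thesis using coord_pr[OF assms, of e] z by simp
  qed (use S.coord_admissible in blast)
  \<comment> \<open>Division by f: exponents are lowered by {n, n}, and the scalar created by the
    multiplication with f is undone.\<close>
  let ?x = "\<lambda>e. S.coord s ({#n, n#} + e) / bichar {#n, n#} e"
  have "supp ?x \<subseteq> (\<lambda>e. e - {#n, n#}) ` supp (S.coord s)"
  proof
    fix e assume "e \<in> supp ?x"
    then show "e \<in> (\<lambda>e. e - {#n, n#}) ` supp (S.coord s)"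
      by (intro image_eqI[of _ _ "{#n, n#} + e"]) auto
  qed
  then have fin: "finite (supp ?x)" using S.coord_finite[OF assms] finite_subset by blast
  have adm: "admissible QS e" if "?x e \<noteq> 0" for e
  proof -
    have "S.coord s ({#n, n#} + e) \<noteq> 0" using that by auto
    then show ?thesis using S.coord_admissible admissible_mono[of _ "{#n, n#} + e" e] by fastforce
  qed
  define t where "t = S.elt ?x"
  have t: "t \<in> carrier Sa" unfolding t_def by (rule S.elt_closed[OF fin]) (rule adm)
  have ct: "S.coord t = ?x" unfolding t_def by (rule S.coord_elt[OF fin]) (rule adm)
  have "S.coord s e = S.coord (ff \<otimes>\<^bsub>Sa\<^esub> t) e" for e
  proof (cases "{#n, n#} \<subseteq># e")
    case True
    then have "{#n, n#} + (e - {#n, n#}) = e" by (rule subset_mset.add_diff_inverse)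
    then show ?thesis using True unfolding coord_ff_mult[OF t] ct by (simp add: bichar_nonzero)
  qed (simp add: coord_ff_mult[OF t] s0)
  then have "S.coord s = S.coord (ff \<otimes>\<^bsub>Sa\<^esub> t)" by (rule ext)
  then have "s = ff \<otimes>\<^bsub>Sa\<^esub> t" using assms t S.coord_inject by simp
  then show "\<exists>t\<in>carrier Sa. s = ff \<otimes>\<^bsub>Sa\<^esub> t" using t by blast
next
  assume "\<exists>t\<in>carrier Sa. s = ff \<otimes>\<^bsub>Sa\<^esub> t"
  then obtain t where t: "t \<in> carrier Sa" "s = ff \<otimes>\<^bsub>Sa\<^esub> t" by blast
  have "S.coord s e = 0" if "admissible QA e" for e
  proof -
    have "count e n \<le> 1" using that n_pos by (auto simp: admissible_def QS_iff QA_iff)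
    then have "\<not> {#n, n#} \<subseteq># e" by (auto simp: subseteq_mset_def intro!: exI[of _ n])
    then show ?thesis using t by (simp add: coord_ff_mult)
  qed
  then show "pr s = \<zero>\<^bsub>Aa\<^esub>" using assms by (simp add: A.eq_zero_iff coord_pr)
qed

text \<open>Links the form of a point, defined as a sum of scaled generators pushed through three
  quotients, to its coefficients.\<close>

lemma linear_form_eq: "linear_form n \<alpha> a = A.lin a"
proof -
  let ?h = "\<lambda>u. pr (projS n \<alpha> u)"
  interpret F: ring FA by (rule ring_free_algebra)
  have u: "(\<lambda>i. single [i] (a i)) \<in> {1..n} \<rightarrow> carrier FA" by auto
  have "linear_form n \<alpha> a = ?h (\<Oplus>\<^bsub>FA\<^esub>i\<in>{1..n}. single [i] (a i))"
    by (simp add: linear_form_def gen_eq_single scalar_eq_single free_algebra_simps(2) conv_single_single)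
  also have "\<dots> = (\<Oplus>\<^bsub>Aa\<^esub>i\<in>{1..n}. ?h (single [i] (a i)))"
    using u A.h.homh by (intro abelian_group.additive_map_finsum[OF ring.is_abelian_group[OF ring_free_algebra]]) (auto simp: A.abelian_group_axioms A.h.hom_add simp del: S.h.hom_add)
  finally have eq: "linear_form n \<alpha> a = (\<Oplus>\<^bsub>Aa\<^esub>i\<in>{1..n}. ?h (single [i] (a i)))" .
  have hc: "(\<lambda>i. ?h (single [i] (a i))) \<in> {1..n} \<rightarrow> carrier Aa" using u A.h.hom_closed by blast
  have "A.coord (linear_form n \<alpha> a) e = A.coord (A.lin a) e" for e
  proof -
    have "A.coord (linear_form n \<alpha> a) e = (\<Sum>i\<in>{1..n}. if e = {#i#} then a i else 0)"
      unfolding eq using hc by (subst A.coord_finsum) (auto simp: A.coord_h nf_single admissible_def QS_iff QA_iff intro!: sum.cong)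
    also have "\<dots> = A.coord (A.lin a) e"
    proof (cases "\<exists>i. e = {#i#}")
      case True
      then show ?thesis by auto
    next
      case False
      then have "size e \<noteq> 1" using size_1_singleton_mset by blast
      then show ?thesis using False by (simp add: A.coord_lin)
    qed
    finally show ?thesis .
  qed
  moreover have "linear_form n \<alpha> a \<in> carrier Aa" unfolding eq using hc by (rule A.finsum_closed)
  ultimately show ?thesis using A.coord_inject[of "linear_form n \<alpha> a" "A.lin a"] by (simp add: ext)
qed

end

section \<open>Generalities on right modules and their homomorphisms\<close>

section \<open>Right modules\<close>

context right_module
begin

lemma ract_zero_right [simp]: "x \<in> carrier M \<Longrightarrow> x \<triangleleft>\<^bsub>M\<^esub> \<zero>\<^bsub>R\<^esub> = \<zero>\<^bsub>M\<^esub>"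
  using ract_add_right[of x "\<zero>\<^bsub>R\<^esub>" "\<zero>\<^bsub>R\<^esub>"] M.add.l_cancel_one[of "x \<triangleleft>\<^bsub>M\<^esub> \<zero>\<^bsub>R\<^esub>" "x \<triangleleft>\<^bsub>M\<^esub> \<zero>\<^bsub>R\<^esub>"]
  by (simp add: ract_closed)

lemma ract_zero_left [simp]: "a \<in> carrier R \<Longrightarrow> \<zero>\<^bsub>M\<^esub> \<triangleleft>\<^bsub>M\<^esub> a = \<zero>\<^bsub>M\<^esub>"
  using ract_add_left[of "\<zero>\<^bsub>M\<^esub>" "\<zero>\<^bsub>M\<^esub>" a] M.add.l_cancel_one[of "\<zero>\<^bsub>M\<^esub> \<triangleleft>\<^bsub>M\<^esub> a" "\<zero>\<^bsub>M\<^esub> \<triangleleft>\<^bsub>M\<^esub> a"]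
  by (simp add: ract_closed)

lemma ract_minus_left: "x \<in> carrier M \<Longrightarrow> a \<in> carrier R \<Longrightarrow> (\<ominus>\<^bsub>M\<^esub> x) \<triangleleft>\<^bsub>M\<^esub> a = \<ominus>\<^bsub>M\<^esub> (x \<triangleleft>\<^bsub>M\<^esub> a)"
  by (rule M.minus_equality[symmetric]) (simp_all add: ract_closed M.l_neg flip: ract_add_left)

lemma ract_minus_right: "x \<in> carrier M \<Longrightarrow> a \<in> carrier R \<Longrightarrow> x \<triangleleft>\<^bsub>M\<^esub> (\<ominus>\<^bsub>R\<^esub> a) = \<ominus>\<^bsub>M\<^esub> (x \<triangleleft>\<^bsub>M\<^esub> a)"
  by (rule M.minus_equality[symmetric]) (simp_all add: ract_closed R.l_neg flip: ract_add_right)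

end

lemma right_homD:
  assumes "h \<in> right_hom R M N"
  shows "x \<in> carrier M \<Longrightarrow> h x \<in> carrier N"
    and "x \<in> carrier M \<Longrightarrow> y \<in> carrier M \<Longrightarrow> h (x \<oplus>\<^bsub>M\<^esub> y) = h x \<oplus>\<^bsub>N\<^esub> h y"
    and "x \<in> carrier M \<Longrightarrow> a \<in> carrier R \<Longrightarrow> h (x \<triangleleft>\<^bsub>M\<^esub> a) = h x \<triangleleft>\<^bsub>N\<^esub> a"
  using assms by (auto simp: right_hom_def)

lemma right_homI:
  assumes "\<And>x. x \<in> carrier M \<Longrightarrow> h x \<in> carrier N"
    and "\<And>x y. x \<in> carrier M \<Longrightarrow> y \<in> carrier M \<Longrightarrow> h (x \<oplus>\<^bsub>M\<^esub> y) = h x \<oplus>\<^bsub>N\<^esub> h y"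
    and "\<And>x a. x \<in> carrier M \<Longrightarrow> a \<in> carrier R \<Longrightarrow> h (x \<triangleleft>\<^bsub>M\<^esub> a) = h x \<triangleleft>\<^bsub>N\<^esub> a"
  shows "h \<in> right_hom R M N"
  using assms by (auto simp: right_hom_def)

lemma right_hom_zero:
  assumes h: "h \<in> right_hom R M N" and "abelian_group M" "abelian_group N"
  shows "h \<zero>\<^bsub>M\<^esub> = \<zero>\<^bsub>N\<^esub>"
proof -
  interpret M: abelian_group M by fact
  interpret N: abelian_group N by fact
  have "h \<zero>\<^bsub>M\<^esub> \<oplus>\<^bsub>N\<^esub> h \<zero>\<^bsub>M\<^esub> = h \<zero>\<^bsub>M\<^esub>" using right_homD(2)[OF h, of "\<zero>\<^bsub>M\<^esub>" "\<zero>\<^bsub>M\<^esub>"] by simp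
  then show ?thesis using N.add.l_cancel_one right_homD(1)[OF h] by simp
qed

lemma right_hom_minus:
  assumes h: "h \<in> right_hom R M N" and "abelian_group M" "abelian_group N" and x: "x \<in> carrier M"
  shows "h (\<ominus>\<^bsub>M\<^esub> x) = \<ominus>\<^bsub>N\<^esub> h x"
proof -
  interpret M: abelian_group M by fact
  interpret N: abelian_group N by fact
  have "h (\<ominus>\<^bsub>M\<^esub> x) \<oplus>\<^bsub>N\<^esub> h x = \<zero>\<^bsub>N\<^esub>"
    using right_homD(2)[OF h, of "\<ominus>\<^bsub>M\<^esub> x" x] right_hom_zero[OF assms(1-3)] x by (simp add: M.l_neg)
  then show ?thesis using right_homD(1)[OF h] x by (simp add: N.minus_equality)
qed

lemma right_hom_diff:
  assumes h: "h \<in> right_hom R M N" and "abelian_group M" "abelian_group N" and x: "x \<in> carrier M" "y \<in> carrier M"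
  shows "h (x \<ominus>\<^bsub>M\<^esub> y) = h x \<ominus>\<^bsub>N\<^esub> h y"
proof -
  interpret M: abelian_group M by fact
  show ?thesis using x by (simp add: a_minus_def right_homD(2)[OF h] right_hom_minus[OF assms(1-3)])
qed

lemma (in abelian_group) minus_eq_zero_iff: "x \<in> carrier G \<Longrightarrow> y \<in> carrier G \<Longrightarrow> x \<ominus> y = \<zero> \<longleftrightarrow> x = y"
  by (metis a_minus_def minus_equality minus_minus r_neg a_inv_closed)

lemma regular_module_simps [simp]:
  "carrier (regular_module R) = carrier R" "\<zero>\<^bsub>regular_module R\<^esub> = \<zero>\<^bsub>R\<^esub>"
  "add (regular_module R) = add R" "x \<triangleleft>\<^bsub>regular_module R\<^esub> a = x \<otimes>\<^bsub>R\<^esub> a" "mpart (regular_module R) = rpart R"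
  by (simp_all add: regular_module_def)

lemma abelian_group_change_record:
  assumes "abelian_group R" and eq: "carrier R' = carrier R" "\<zero>\<^bsub>R'\<^esub> = \<zero>\<^bsub>R\<^esub>" "add R' = add R"
  shows "abelian_group R'"
proof -
  interpret R: abelian_group R by fact
  show ?thesis by (rule abelian_groupI) (auto simp: eq R.a_ac intro: R.a_inv_closed R.l_neg)
qed

lemma right_module_regular: "ring R \<Longrightarrow> right_module R (regular_module R)"
proof -
  assume "ring R"
  then interpret ring R .
  show ?thesis
    by (intro right_module.intro right_module_axioms.intro \<open>ring R\<close> abelian_group_change_record[OF abelian_group_axioms])
       (auto simp: l_distr r_distr m_assoc)
qed

section \<open>Rank-one free modules and resolutions of cyclic modules\<close>

subsection \<open>Free modules of rank one\<close>

lemma free_module_simps: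
  "carrier (free_module R I) = {u \<in> I \<rightarrow>\<^sub>E carrier R. finite {i \<in> I. u i \<noteq> \<zero>\<^bsub>R\<^esub>}}"
  "\<zero>\<^bsub>free_module R I\<^esub> = (\<lambda>i\<in>I. \<zero>\<^bsub>R\<^esub>)"
  "u \<oplus>\<^bsub>free_module R I\<^esub> v = (\<lambda>i\<in>I. u i \<oplus>\<^bsub>R\<^esub> v i)"
  "u \<triangleleft>\<^bsub>free_module R I\<^esub> a = (\<lambda>i\<in>I. u i \<otimes>\<^bsub>R\<^esub> a)"
  by (simp_all add: free_module_def)

lemma right_module_free:
  assumes "ring R"
  shows "right_module R (free_module R I)"
proof -
  interpret ring R by fact
  have add: "u \<oplus>\<^bsub>free_module R I\<^esub> v \<in> carrier (free_module R I)"
    if "u \<in> carrier (free_module R I)" "v \<in> carrier (free_module R I)" for u v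
    using that unfolding free_module_simps
    by (auto intro: rev_finite_subset[of "{i \<in> I. u i \<noteq> \<zero>\<^bsub>R\<^esub>} \<union> {i \<in> I. v i \<noteq> \<zero>\<^bsub>R\<^esub>}"])
  have "abelian_group (free_module R I)"
  proof (rule abelian_groupI)
    fix u assume u: "u \<in> carrier (free_module R I)"
    have "{i \<in> I. \<ominus>\<^bsub>R\<^esub> u i \<noteq> \<zero>\<^bsub>R\<^esub>} = {i \<in> I. u i \<noteq> \<zero>\<^bsub>R\<^esub>}" using u by (auto simp: free_module_simps PiE_iff)
    then show "\<exists>v\<in>carrier (free_module R I). v \<oplus>\<^bsub>free_module R I\<^esub> u = \<zero>\<^bsub>free_module R I\<^esub>"
      using u by (intro bexI[of _ "\<lambda>i\<in>I. \<ominus>\<^bsub>R\<^esub> u i"]) (auto simp: free_module_simps l_neg PiE_iff intro!: restrict_ext cong: conj_cong)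
    show "\<zero>\<^bsub>free_module R I\<^esub> \<oplus>\<^bsub>free_module R I\<^esub> u = u"
      using u by (auto simp: free_module_simps PiE_iff extensional_def)
  qed (auto simp: add, auto simp: free_module_simps PiE_iff a_ac intro!: restrict_ext)
  then show ?thesis
  proof (intro right_module.intro right_module_axioms.intro assms)
    show "u \<triangleleft>\<^bsub>free_module R I\<^esub> a \<in> carrier (free_module R I)"
      if "u \<in> carrier (free_module R I)" "a \<in> carrier R" for u a
      using that unfolding free_module_simps
      by (auto intro: rev_finite_subset[of "{i \<in> I. u i \<noteq> \<zero>\<^bsub>R\<^esub>}"])
    show "u \<triangleleft>\<^bsub>free_module R I\<^esub> \<one>\<^bsub>R\<^esub> = u" if "u \<in> carrier (free_module R I)" for u
      using that by (auto simp: free_module_simps PiE_iff extensional_def)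
  qed (auto simp: free_module_simps PiE_iff l_distr r_distr m_assoc intro!: restrict_ext)
qed

text \<open>Resolutions have to consist of modules with elements in
  \<open>nat \<Rightarrow> 'a\<close>; \<open>vec\<close> identifies the ring with its free module
  on the index set {0}.\<close>

definition vec :: "'a \<Rightarrow> nat \<Rightarrow> 'a" where
  "vec a = (\<lambda>_\<in>{0}. a)"

lemma vec_0 [simp]: "vec a 0 = a"
  by (simp add: vec_def)

lemma vec_in_free [simp]: "vec a \<in> carrier (free_module R {0}) \<longleftrightarrow> a \<in> carrier R"
  by (auto simp: vec_def free_module_simps)

lemma free_rank_one: "u \<in> carrier (free_module R {0::nat}) \<longleftrightarrow> u 0 \<in> carrier R \<and> u = vec (u 0)"
  by (auto simp: vec_def free_module_simps PiE_iff extensional_def fun_eq_iff)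

lemma free_rank_oneE:
  assumes "u \<in> carrier (free_module R {0::nat})"
  obtains a where "a \<in> carrier R" "u = vec a"
  using assms free_rank_one by blast

lemma free_rank_one_simps:
  "\<zero>\<^bsub>free_module R {0}\<^esub> = vec \<zero>\<^bsub>R\<^esub>"
  "u \<oplus>\<^bsub>free_module R {0}\<^esub> v = vec (u 0 \<oplus>\<^bsub>R\<^esub> v 0)"
  "u \<triangleleft>\<^bsub>free_module R {0}\<^esub> a = vec (u 0 \<otimes>\<^bsub>R\<^esub> a)"
  by (auto simp: vec_def free_module_simps)

lemma vec_eq_iff [simp]: "vec a = vec b \<longleftrightarrow> a = b"
  by (metis vec_0)

lemma projective_free_rank_one:
  assumes "ring R"
  shows "projective R (free_module R {0::nat})"
proof -
  interpret ring R by fact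
  let ?P = "free_module R {0::nat}" and ?e = "vec \<one>\<^bsub>R\<^esub> :: nat \<Rightarrow> 'a"
  \<comment> \<open>The module is embedded as the multiples of the basis vector indexed by its own
    generator \<open>?e\<close>; the retraction reads off the coefficient at
    \<open>?e\<close>.\<close>
  let ?\<iota> = "\<lambda>u. \<lambda>v\<in>carrier ?P. if v = ?e then u 0 else \<zero>\<^bsub>R\<^esub>"
  let ?\<rho> = "\<lambda>w. vec (w ?e)"
  have "?\<iota> \<in> right_hom R ?P (free_module R (carrier ?P))"
  proof (rule right_homI)
    fix u assume "u \<in> carrier ?P"
    then show "?\<iota> u \<in> carrier (free_module R (carrier ?P))"
      unfolding free_module_simps(1)[of R "carrier ?P"]
      by (auto elim!: free_rank_oneE intro: rev_finite_subset[of "{?e}"])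
  qed (auto simp: free_module_simps(3,4)[of R "carrier ?P"] free_rank_one_simps elim!: free_rank_oneE intro!: restrict_ext)
  moreover have "?\<rho> \<in> right_hom R (free_module R (carrier ?P)) ?P"
    by (rule right_homI) (auto simp: free_rank_one_simps free_module_simps(1,3,4)[of R "carrier ?P"])
  moreover have "\<forall>u\<in>carrier ?P. ?\<rho> (?\<iota> u) = u"
    by (auto elim!: free_rank_oneE)
  ultimately show ?thesis
    unfolding projective_def
    by (intro conjI right_module_free[OF assms], elim bexI[where x = ?\<iota>, rotated] bexI[where x = ?\<rho>, rotated])
qed

text \<open>The zero module in the shape that resolutions prescribe; finite resolutions are
  continued by it.\<close>

lemma projective_trivial:
  assumes "ring R"
  shows "projective R (free_module R {} :: ('a, nat \<Rightarrow> 'a) rmod)"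
proof -
  interpret ring R by fact
  let ?P = "free_module R {} :: ('a, nat \<Rightarrow> 'a) rmod"
  interpret F: right_module R "free_module R (carrier ?P)" by (rule right_module_free[OF assms])
  have P: "carrier ?P = {\<lambda>_\<in>{}. \<zero>\<^bsub>R\<^esub>}" by (auto simp: free_module_simps)
  let ?\<iota> = "\<lambda>_. \<zero>\<^bsub>free_module R (carrier ?P)\<^esub>" and ?\<rho> = "\<lambda>_. \<lambda>_\<in>{}. \<zero>\<^bsub>R\<^esub>"
  have "?\<iota> \<in> right_hom R ?P (free_module R (carrier ?P))"
    by (rule right_homI) auto
  moreover have "?\<rho> \<in> right_hom R (free_module R (carrier ?P)) ?P"
    by (rule right_homI) (auto simp: P, auto simp: free_module_simps)
  moreover have "\<forall>u\<in>carrier ?P. ?\<rho> (?\<iota> u) = u"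
    by (simp add: P)
  ultimately show ?thesis
    unfolding projective_def
    by (intro conjI right_module_free[OF assms], elim bexI[where x = ?\<iota>, rotated] bexI[where x = ?\<rho>, rotated])
qed

lemma left_mult_right_hom:
  assumes "ring R" "t \<in> carrier R"
  shows "(\<lambda>u. vec (t \<otimes>\<^bsub>R\<^esub> u 0)) \<in> right_hom R (free_module R {0::nat}) (free_module R {0})"
proof -
  interpret ring R by fact
  show ?thesis using assms(2)
    by (intro right_homI) (auto elim!: free_rank_oneE simp: free_rank_one_simps r_distr m_assoc)
qed

lemma generator_right_hom:
  assumes "right_module R M" "g \<in> carrier M"
  shows "(\<lambda>u. g \<triangleleft>\<^bsub>M\<^esub> u 0) \<in> right_hom R (free_module R {0::nat}) M"
proof -
  interpret right_module R M by fact
  show ?thesis using assms(2)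
    by (intro right_homI) (auto elim!: free_rank_oneE simp: free_rank_one_simps ract_closed ract_add_right ract_assoc)
qed

lemma image_free_rank_one: "h ` carrier (free_module R {0::nat}) = (\<lambda>a. h (vec a)) ` carrier R"
  by (auto elim!: free_rank_oneE simp: image_iff)

text \<open>By \<open>ker\<close> and \<open>ex\<close>, copies of the ring with left multiplication
  by \<open>t i\<close> as differentials resolve the cyclic module \<open>M\<close>. Applying Hom
  into the ring turns these into right multiplications, whose exactness is \<open>coex\<close>. The
  ring is kept arbitrary so that \<open>A\<close> and its opposite are both covered.\<close>

lemma Ext_vanishes_chain:
  fixes R :: "('a, 'x) gring_scheme" and M :: "('a, 'm, 'z) rmod_scheme"
  assumes M: "right_module R M" and g: "g \<in> carrier M" and t: "\<And>i. t i \<in> carrier R"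
    and gen: "\<And>x. x \<in> carrier M \<Longrightarrow> \<exists>a\<in>carrier R. x = g \<triangleleft>\<^bsub>M\<^esub> a"
    and ker: "\<And>a. a \<in> carrier R \<Longrightarrow> g \<triangleleft>\<^bsub>M\<^esub> a = \<zero>\<^bsub>M\<^esub> \<longleftrightarrow> (\<exists>b\<in>carrier R. a = t 0 \<otimes>\<^bsub>R\<^esub> b)"
    and ex: "\<And>i a. a \<in> carrier R \<Longrightarrow> t i \<otimes>\<^bsub>R\<^esub> a = \<zero>\<^bsub>R\<^esub> \<longleftrightarrow> (\<exists>b\<in>carrier R. a = t (Suc i) \<otimes>\<^bsub>R\<^esub> b)"
    and coex: "\<And>i a. a \<in> carrier R \<Longrightarrow> a \<otimes>\<^bsub>R\<^esub> t (Suc i) = \<zero>\<^bsub>R\<^esub> \<Longrightarrow> \<exists>b\<in>carrier R. a = b \<otimes>\<^bsub>R\<^esub> t i"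
    and "i \<ge> 1"
  shows "Ext_vanishes R i M (regular_module R)"
proof -
  interpret right_module R M by fact
  let ?F = "free_module R {0::nat}"
  define d where "d = (\<lambda>i (u :: nat \<Rightarrow> 'a). vec (t i \<otimes>\<^bsub>R\<^esub> u 0))"
  define \<epsilon> where "\<epsilon> = (\<lambda>u :: nat \<Rightarrow> 'a. g \<triangleleft>\<^bsub>M\<^esub> u 0)"
  have d: "d i \<in> right_hom R ?F ?F" for i
    unfolding d_def by (rule left_mult_right_hom[OF R.ring_axioms t])
  have res: "projective_resolution R (\<lambda>_. ?F) d \<epsilon> M"
    unfolding projective_resolution_def
  proof (intro conjI allI)
    show "projective R ?F" by (rule projective_free_rank_one[OF R.ring_axioms])
    show "d i \<in> right_hom R ?F ?F" for i by (rule d)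
    show "\<epsilon> \<in> right_hom R ?F M" unfolding \<epsilon>_def by (rule generator_right_hom[OF M g])
    show "\<epsilon> ` carrier ?F = carrier M"
      unfolding image_free_rank_one using gen g by (force simp: \<epsilon>_def ract_closed)
    have mem: "vec (t i \<otimes>\<^bsub>R\<^esub> b) \<in> carrier ?F" if "b \<in> carrier R" for i b using that t by simp
    show "d 0 ` carrier ?F = {x \<in> carrier ?F. \<epsilon> x = \<zero>\<^bsub>M\<^esub>}"
    proof (intro equalityI subsetI)
      fix x assume "x \<in> d 0 ` carrier ?F"
      then obtain b where "b \<in> carrier R" "x = vec (t 0 \<otimes>\<^bsub>R\<^esub> b)"
        unfolding image_free_rank_one by (auto simp: d_def)
      then show "x \<in> {x \<in> carrier ?F. \<epsilon> x = \<zero>\<^bsub>M\<^esub>}" using t ker by (auto simp: \<epsilon>_def)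
    next
      fix x assume x: "x \<in> {x \<in> carrier ?F. \<epsilon> x = \<zero>\<^bsub>M\<^esub>}"
      then have "x 0 \<in> carrier R" "x = vec (x 0)" "g \<triangleleft>\<^bsub>M\<^esub> x 0 = \<zero>\<^bsub>M\<^esub>"
        using free_rank_one by (auto simp: \<epsilon>_def)
      then show "x \<in> d 0 ` carrier ?F"
        using ker[of "x 0"] unfolding image_free_rank_one d_def by force
    qed
    show "d (Suc i) ` carrier ?F = {x \<in> carrier ?F. d i x = \<zero>\<^bsub>?F\<^esub>}" for i
    proof (intro equalityI subsetI)
      fix x assume "x \<in> d (Suc i) ` carrier ?F"
      then obtain b where "b \<in> carrier R" "x = vec (t (Suc i) \<otimes>\<^bsub>R\<^esub> b)"
        unfolding image_free_rank_one by (auto simp: d_def)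
      then show "x \<in> {x \<in> carrier ?F. d i x = \<zero>\<^bsub>?F\<^esub>}" using t ex
        by (auto simp: d_def free_rank_one_simps)
    next
      fix x assume x: "x \<in> {x \<in> carrier ?F. d i x = \<zero>\<^bsub>?F\<^esub>}"
      then have "x 0 \<in> carrier R" "x = vec (x 0)" "t i \<otimes>\<^bsub>R\<^esub> x 0 = \<zero>\<^bsub>R\<^esub>"
        using free_rank_one by (auto simp: d_def free_rank_one_simps)
      then show "x \<in> d (Suc i) ` carrier ?F"
        using ex[of "x 0"] unfolding image_free_rank_one d_def by force
    qed
  qed
  obtain j where i: "i = Suc j" using \<open>i \<ge> 1\<close> by (cases i) auto
  have "Ext_cocycles R (\<lambda>_. ?F) d (regular_module R) (Suc j) \<subseteq> Ext_coboundaries R (\<lambda>_. ?F) d (regular_module R) (Suc j)"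
  proof
    fix h assume h: "h \<in> Ext_cocycles R (\<lambda>_. ?F) d (regular_module R) (Suc j)"
    then have hom: "h \<in> right_hom R ?F (regular_module R)" by (simp add: Ext_cocycles_def)
    \<comment> \<open>A homomorphism from the ring to itself is left multiplication by its value at
      1.\<close>
    define a where "a = h (vec \<one>\<^bsub>R\<^esub>)"
    have a: "a \<in> carrier R" using right_homD(1)[OF hom, of "vec \<one>\<^bsub>R\<^esub>"] by (simp add: a_def)
    have ha: "h u = a \<otimes>\<^bsub>R\<^esub> u 0" if "u \<in> carrier ?F" for u
    proof -
      have u: "u 0 \<in> carrier R" "u = vec (u 0)" using that free_rank_one by auto
      then have "u = vec \<one>\<^bsub>R\<^esub> \<triangleleft>\<^bsub>?F\<^esub> u 0" by (simp add: free_rank_one_simps)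
      then show ?thesis using right_homD(3)[OF hom, of "vec \<one>\<^bsub>R\<^esub>" "u 0"] u by (simp add: a_def)
    qed
    have "h (d (Suc j) (vec \<one>\<^bsub>R\<^esub>)) = \<zero>\<^bsub>R\<^esub>" using h by (simp add: Ext_cocycles_def)
    then have "a \<otimes>\<^bsub>R\<^esub> t (Suc j) = \<zero>\<^bsub>R\<^esub>" using t by (subst (asm) ha) (auto simp: d_def)
    then obtain b where b: "b \<in> carrier R" "a = b \<otimes>\<^bsub>R\<^esub> t j" using coex a by blast
    have "(\<lambda>u. b \<otimes>\<^bsub>R\<^esub> u 0) \<in> right_hom R ?F (regular_module R)"
      using b by (intro right_homI) (auto elim!: free_rank_oneE simp: free_rank_one_simps R.r_distr R.m_assoc)
    moreover have "h x = b \<otimes>\<^bsub>R\<^esub> (d j x) 0" if "x \<in> carrier ?F" for x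
      using that b t by (auto elim!: free_rank_oneE simp: ha d_def R.m_assoc)
    ultimately show "h \<in> Ext_coboundaries R (\<lambda>_. ?F) d (regular_module R) (Suc j)"
      unfolding Ext_coboundaries_def using hom by auto
  qed
  moreover have "Ext_coboundaries R (\<lambda>_. ?F) d (regular_module R) (Suc j) \<subseteq> Ext_cocycles R (\<lambda>_. ?F) d (regular_module R) (Suc j)"
  proof
    fix h assume "h \<in> Ext_coboundaries R (\<lambda>_. ?F) d (regular_module R) (Suc j)"
    then obtain k where h: "h \<in> right_hom R ?F (regular_module R)" and k: "k \<in> right_hom R ?F (regular_module R)"
      and hk: "\<forall>x\<in>carrier ?F. h x = k (d j x)" by (auto simp: Ext_coboundaries_def)
    have "h (d (Suc j) x) = \<zero>\<^bsub>R\<^esub>" if x: "x \<in> carrier ?F" for x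
    proof -
      have "d j (d (Suc j) x) = \<zero>\<^bsub>?F\<^esub>"
        using res x unfolding projective_resolution_def by blast
      then show ?thesis using hk right_homD(1)[OF d x]
          right_hom_zero[OF k right_module.axioms(2)[OF right_module_free[OF R.ring_axioms]]
            right_module.axioms(2)[OF right_module_regular[OF R.ring_axioms]]] by simp
    qed
    then show "h \<in> Ext_cocycles R (\<lambda>_. ?F) d (regular_module R) (Suc j)"
      using h by (simp add: Ext_cocycles_def)
  qed
  ultimately show ?thesis unfolding Ext_vanishes_def i using res by blast
qed

text \<open>Left multiplication by \<open>t\<close> is injective with cokernel \<open>M\<close>,
  which gives a resolution of length 1, padded with zero modules.\<close>

lemma finite_projdim_cyclic:
  fixes M :: "('a, 'm, 'z) rmod_scheme"
  assumes M: "right_module R M" and g: "g \<in> carrier M" and t: "t \<in> carrier R"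
    and gen: "\<And>x. x \<in> carrier M \<Longrightarrow> \<exists>a\<in>carrier R. x = g \<triangleleft>\<^bsub>M\<^esub> a"
    and ker: "\<And>a. a \<in> carrier R \<Longrightarrow> g \<triangleleft>\<^bsub>M\<^esub> a = \<zero>\<^bsub>M\<^esub> \<longleftrightarrow> (\<exists>b\<in>carrier R. a = t \<otimes>\<^bsub>R\<^esub> b)"
    and inj: "\<And>a. a \<in> carrier R \<Longrightarrow> t \<otimes>\<^bsub>R\<^esub> a = \<zero>\<^bsub>R\<^esub> \<Longrightarrow> a = \<zero>\<^bsub>R\<^esub>"
  shows "finite_projdim R M"
proof -
  interpret right_module R M by fact
  let ?F = "free_module R {0::nat}" and ?O = "free_module R {} :: ('a, nat \<Rightarrow> 'a) rmod"
  interpret F: right_module R ?F by (rule right_module_free[OF R.ring_axioms])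
  interpret O: right_module R ?O by (rule right_module_free[OF R.ring_axioms])
  define P where "P = (\<lambda>i::nat. if i < 2 then ?F else ?O)"
  define d where "d = (\<lambda>i (u :: nat \<Rightarrow> 'a). if i = 0 then vec (t \<otimes>\<^bsub>R\<^esub> u 0) else \<zero>\<^bsub>P i\<^esub>)"
  define \<epsilon> where "\<epsilon> = (\<lambda>u :: nat \<Rightarrow> 'a. g \<triangleleft>\<^bsub>M\<^esub> u 0)"
  have O: "carrier ?O = {\<zero>\<^bsub>?O\<^esub>}" by (auto simp: free_module_simps)
  have "projective_resolution R P d \<epsilon> M"
    unfolding projective_resolution_def
  proof (intro conjI allI)
    show "projective R (P i)" for i
      using projective_free_rank_one[OF R.ring_axioms] projective_trivial[OF R.ring_axioms] by (simp add: P_def)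
    show "d i \<in> right_hom R (P (Suc i)) (P i)" for i
    proof (cases "i = 0")
      case True
      then show ?thesis using left_mult_right_hom[OF R.ring_axioms t] by (simp add: P_def d_def)
    next
      case False
      interpret Pi: right_module R "P i" using F.right_module_axioms O.right_module_axioms by (simp add: P_def)
      show ?thesis using False by (intro right_homI) (auto simp: d_def)
    qed
    show "\<epsilon> \<in> right_hom R (P 0) M" unfolding \<epsilon>_def P_def using generator_right_hom[OF M g] by simp
    show "\<epsilon> ` carrier (P 0) = carrier M"
      unfolding P_def using gen g by (simp add: image_free_rank_one) (force simp: \<epsilon>_def ract_closed)
    show "d 0 ` carrier (P 1) = {x \<in> carrier (P 0). \<epsilon> x = \<zero>\<^bsub>M\<^esub>}"
    proof (intro equalityI subsetI)
      fix x assume "x \<in> d 0 ` carrier (P 1)"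
      then obtain b where "b \<in> carrier R" "x = vec (t \<otimes>\<^bsub>R\<^esub> b)"
        unfolding P_def by (auto simp: d_def image_free_rank_one)
      then show "x \<in> {x \<in> carrier (P 0). \<epsilon> x = \<zero>\<^bsub>M\<^esub>}" using t ker by (auto simp: \<epsilon>_def P_def)
    next
      fix x assume x: "x \<in> {x \<in> carrier (P 0). \<epsilon> x = \<zero>\<^bsub>M\<^esub>}"
      then have "x 0 \<in> carrier R" "x = vec (x 0)" "g \<triangleleft>\<^bsub>M\<^esub> x 0 = \<zero>\<^bsub>M\<^esub>"
        using free_rank_one[of x R] by (auto simp: \<epsilon>_def P_def)
      then show "x \<in> d 0 ` carrier (P 1)"
        using ker[of "x 0"] by (simp add: P_def image_free_rank_one d_def) force
    qed
    show "d (Suc i) ` carrier (P (Suc (Suc i))) = {x \<in> carrier (P (Suc i)). d i x = \<zero>\<^bsub>P i\<^esub>}" for i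
    proof -
      have "x = \<zero>\<^bsub>P (Suc i)\<^esub>" if x: "x \<in> carrier (P (Suc i))" "d i x = \<zero>\<^bsub>P i\<^esub>" for x
      proof (cases "i = 0")
        case True
        then have "t \<otimes>\<^bsub>R\<^esub> x 0 = \<zero>\<^bsub>R\<^esub>" "x 0 \<in> carrier R" "x = vec (x 0)"
          using x free_rank_one[of x R] by (auto simp: P_def d_def free_rank_one_simps)
        then show ?thesis using inj[of "x 0"] True by (simp add: P_def free_rank_one_simps)
      qed (use x O in \<open>auto simp: P_def\<close>)
      moreover have "d i \<zero>\<^bsub>P (Suc i)\<^esub> = \<zero>\<^bsub>P i\<^esub>"
        using t by (auto simp: d_def P_def free_rank_one_simps)
      moreover have "\<zero>\<^bsub>P (Suc i)\<^esub> \<in> carrier (P (Suc i))" by (auto simp: P_def)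
      moreover have "carrier (P (Suc (Suc i))) = {\<zero>\<^bsub>?O\<^esub>}" by (simp add: P_def O)
      ultimately have "{x \<in> carrier (P (Suc i)). d i x = \<zero>\<^bsub>P i\<^esub>} = {\<zero>\<^bsub>P (Suc i)\<^esub>}"
        "carrier (P (Suc (Suc i))) = {\<zero>\<^bsub>?O\<^esub>}" by blast+
      then show ?thesis by (simp add: d_def)
    qed
  qed
  moreover have "\<forall>i>1. carrier (P i) = {\<zero>\<^bsub>P i\<^esub>}" using O by (simp add: P_def)
  ultimately show ?thesis unfolding finite_projdim_def by blast
qed

section \<open>Obstruction classes that survive in every syzygy\<close>

subsection \<open>Infinite projective dimension\<close>

text \<open>For a free module the claim holds coordinatewise by \<open>ann\<close>, and it passes to
  direct summands.\<close>

lemma projective_annihilator: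
  assumes P: "projective R P" and x: "x \<in> carrier P" "x \<triangleleft>\<^bsub>P\<^esub> z = \<zero>\<^bsub>P\<^esub>"
    and yz: "y \<in> carrier R" "z \<in> carrier R"
    and ann: "\<And>s. s \<in> carrier R \<Longrightarrow> s \<otimes>\<^bsub>R\<^esub> z = \<zero>\<^bsub>R\<^esub> \<Longrightarrow> \<exists>t\<in>carrier R. s = t \<otimes>\<^bsub>R\<^esub> y"
  shows "\<exists>x'\<in>carrier P. x = x' \<triangleleft>\<^bsub>P\<^esub> y"
proof -
  interpret P: right_module R P using P by (simp add: projective_def)
  let ?F = "free_module R (carrier P)"
  interpret F: right_module R ?F by (rule right_module_free[OF P.R.ring_axioms])
  obtain \<iota> \<rho> where \<iota>: "\<iota> \<in> right_hom R P ?F" and \<rho>: "\<rho> \<in> right_hom R ?F P"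
    and \<rho>\<iota>: "\<And>x. x \<in> carrier P \<Longrightarrow> \<rho> (\<iota> x) = x"
    using P unfolding projective_def by blast
  define u where "u = \<iota> x"
  have u: "u \<in> carrier ?F" using right_homD(1)[OF \<iota>] x by (simp add: u_def)
  have uc: "u i \<in> carrier R" if "i \<in> carrier P" for i using u that by (auto simp: free_module_simps)
  have "u \<triangleleft>\<^bsub>?F\<^esub> z = \<zero>\<^bsub>?F\<^esub>"
    using right_homD(3)[OF \<iota> x(1) yz(2)] x right_hom_zero[OF \<iota> P.M.abelian_group_axioms F.M.abelian_group_axioms]
    by (simp add: u_def)
  then have "u i \<otimes>\<^bsub>R\<^esub> z = \<zero>\<^bsub>R\<^esub>" if "i \<in> carrier P" for i
    using that by (auto simp: free_module_simps fun_eq_iff dest!: spec[of _ i])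
  \<comment> \<open>Where a coordinate is zero its quotient by \<open>y\<close> is taken to be zero;
    this keeps the support of \<open>w\<close> finite.\<close>
  then have "\<exists>t. t \<in> carrier R \<and> u i = t \<otimes>\<^bsub>R\<^esub> y \<and> (u i = \<zero>\<^bsub>R\<^esub> \<longrightarrow> t = \<zero>\<^bsub>R\<^esub>)" if "i \<in> carrier P" for i
    using ann[of "u i"] uc that yz by (cases "u i = \<zero>\<^bsub>R\<^esub>") auto
  then obtain t where t: "\<And>i. i \<in> carrier P \<Longrightarrow> t i \<in> carrier R \<and> u i = t i \<otimes>\<^bsub>R\<^esub> y \<and> (u i = \<zero>\<^bsub>R\<^esub> \<longrightarrow> t i = \<zero>\<^bsub>R\<^esub>)"
    by metis
  define w where "w = (\<lambda>i\<in>carrier P. t i)"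
  have "{i \<in> carrier P. w i \<noteq> \<zero>\<^bsub>R\<^esub>} \<subseteq> {i \<in> carrier P. u i \<noteq> \<zero>\<^bsub>R\<^esub>}" using t by (auto simp: w_def)
  then have "finite {i \<in> carrier P. w i \<noteq> \<zero>\<^bsub>R\<^esub>}" using u by (auto simp: free_module_simps elim: finite_subset)
  then have w: "w \<in> carrier ?F" using t unfolding free_module_simps mem_Collect_eq by (simp add: w_def)
  have "u i = (w \<triangleleft>\<^bsub>?F\<^esub> y) i" for i
    using t[of i] u by (cases "i \<in> carrier P") (auto simp: free_module_simps w_def PiE_iff extensional_def)
  then have "u = w \<triangleleft>\<^bsub>?F\<^esub> y" by (rule ext)
  then have "x = \<rho> w \<triangleleft>\<^bsub>P\<^esub> y" using \<rho>\<iota>[OF x(1)] right_homD(3)[OF \<rho> w yz(1)] by (simp add: u_def)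
  then show ?thesis using right_homD(1)[OF \<rho> w] by blast
qed

text \<open>Dimension shifting by one step, with witness p b. It lies in the kernel of
  \<open>h\<close>, and \<open>c\<close> kills it since b c = 0. If it were k' b with k' in the
  kernel, p - k' would be killed by \<open>b\<close>, hence be a multiple of \<open>a\<close>, and h
  p would be a multiple of \<open>a\<close> as well.\<close>

lemma projective_cover_step:
  assumes P: "projective R P" and X: "right_module R X" and h: "h \<in> right_hom R P X"
    and abc: "a \<in> carrier R" "b \<in> carrier R" "c \<in> carrier R" "b \<otimes>\<^bsub>R\<^esub> c = \<zero>\<^bsub>R\<^esub>"
    and ann: "\<And>s. s \<in> carrier R \<Longrightarrow> s \<otimes>\<^bsub>R\<^esub> b = \<zero>\<^bsub>R\<^esub> \<Longrightarrow> \<exists>t\<in>carrier R. s = t \<otimes>\<^bsub>R\<^esub> a"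
    and p: "p \<in> carrier P" "h p \<triangleleft>\<^bsub>X\<^esub> b = \<zero>\<^bsub>X\<^esub>" "\<And>p'. p' \<in> carrier P \<Longrightarrow> h p \<noteq> h p' \<triangleleft>\<^bsub>X\<^esub> a"
  shows "\<exists>k\<in>carrier P. h k = \<zero>\<^bsub>X\<^esub> \<and> k \<triangleleft>\<^bsub>P\<^esub> c = \<zero>\<^bsub>P\<^esub> \<and>
    (\<forall>k'\<in>carrier P. h k' = \<zero>\<^bsub>X\<^esub> \<longrightarrow> k \<noteq> k' \<triangleleft>\<^bsub>P\<^esub> b)"
proof (intro bexI conjI ballI impI notI)
  interpret P: right_module R P using P by (simp add: projective_def)
  interpret X: right_module R X by (rule X)
  show "p \<triangleleft>\<^bsub>P\<^esub> b \<in> carrier P" using p abc by (simp add: P.ract_closed)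
  show "h (p \<triangleleft>\<^bsub>P\<^esub> b) = \<zero>\<^bsub>X\<^esub>" using p abc right_homD(3)[OF h] by simp
  show "p \<triangleleft>\<^bsub>P\<^esub> b \<triangleleft>\<^bsub>P\<^esub> c = \<zero>\<^bsub>P\<^esub>" using p abc by (simp flip: P.ract_assoc)
  fix k assume k: "k \<in> carrier P" "h k = \<zero>\<^bsub>X\<^esub>" "p \<triangleleft>\<^bsub>P\<^esub> b = k \<triangleleft>\<^bsub>P\<^esub> b"
  have "(p \<ominus>\<^bsub>P\<^esub> k) \<triangleleft>\<^bsub>P\<^esub> b = \<zero>\<^bsub>P\<^esub>"
    using p k abc by (simp add: a_minus_def P.ract_add_left P.ract_minus_left P.ract_closed P.M.r_neg)
  then obtain p' where p': "p' \<in> carrier P" "p \<ominus>\<^bsub>P\<^esub> k = p' \<triangleleft>\<^bsub>P\<^esub> a"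
    using projective_annihilator[OF P _ _ abc(1,2) ann, of "p \<ominus>\<^bsub>P\<^esub> k"] p k by blast
  have "h (p \<ominus>\<^bsub>P\<^esub> k) = h p \<ominus>\<^bsub>X\<^esub> h k"
    using p k by (intro right_hom_diff[OF h P.M.abelian_group_axioms X.M.abelian_group_axioms])
  also have "\<dots> = h p" using p k right_homD(1)[OF h] by (simp add: a_minus_def)
  finally have "h p = h p' \<triangleleft>\<^bsub>X\<^esub> a" using p' right_homD(3)[OF h p'(1) abc(1)] by simp
  then show False using p p' by blast
qed

text \<open>
  The classes of \<open>{m. m t\<^sub>i\<^sub>+\<^sub>1 = 0}\<close> modulo \<open>M t\<^sub>i\<close> vanish on projectives, and the connecting maps of a
  resolution move a nonzero class at \<open>i\<close> to a nonzero class at \<open>i + 1\<close> in the next syzygy.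
\<close>

lemma infinite_projdim:
  assumes M: "right_module R M" and t: "\<And>i. t i \<in> carrier R" "\<And>i. t i \<otimes>\<^bsub>R\<^esub> t (Suc i) = \<zero>\<^bsub>R\<^esub>"
    and ann: "\<And>i s. s \<in> carrier R \<Longrightarrow> s \<otimes>\<^bsub>R\<^esub> t (Suc i) = \<zero>\<^bsub>R\<^esub> \<Longrightarrow> \<exists>u\<in>carrier R. s = u \<otimes>\<^bsub>R\<^esub> t i"
    and m: "m \<in> carrier M" "m \<triangleleft>\<^bsub>M\<^esub> t 1 = \<zero>\<^bsub>M\<^esub>" "\<And>m'. m' \<in> carrier M \<Longrightarrow> m \<noteq> m' \<triangleleft>\<^bsub>M\<^esub> t 0"
  shows "\<not> finite_projdim R M"
proof
  assume "finite_projdim R M"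
  then obtain P d \<epsilon> N where res: "projective_resolution R P d \<epsilon> M" and N: "\<And>i. i > N \<Longrightarrow> carrier (P i) = {\<zero>\<^bsub>P i\<^esub>}"
    unfolding finite_projdim_def by blast
  note res = res[unfolded projective_resolution_def]
  have P: "projective R (P i)" for i using res[THEN conjunct1] ..
  have Pm: "right_module R (P i)" for i using P[of i] by (simp add: projective_def)
  have d: "d i \<in> right_hom R (P (Suc i)) (P i)" for i using res[THEN conjunct2, THEN conjunct1] ..
  have \<epsilon>: "\<epsilon> \<in> right_hom R (P 0) M" "\<epsilon> ` carrier (P 0) = carrier M" using res by simp_all
  \<comment> \<open>\<open>Z i\<close> is the syzygy inside \<open>P i\<close>, written as a kernel;
    the augmentation takes the place of the differential at i = 0.\<close>
  define Z where "Z i = {x \<in> carrier (P i). if i = 0 then \<epsilon> x = \<zero>\<^bsub>M\<^esub> else d (i - 1) x = \<zero>\<^bsub>P (i - 1)\<^esub>}" for i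
  have Z: "Z i = d i ` carrier (P (Suc i))" for i
    using res by (cases i) (simp_all add: Z_def)
  have "\<exists>k\<in>Z i. k \<triangleleft>\<^bsub>P i\<^esub> t (i + 2) = \<zero>\<^bsub>P i\<^esub> \<and> (\<forall>k'\<in>Z i. k \<noteq> k' \<triangleleft>\<^bsub>P i\<^esub> t (i + 1))" for i
  proof (induction i)
    case 0
    have "m \<in> \<epsilon> ` carrier (P 0)" using \<epsilon>(2) m(1) by simp
    then obtain p where p: "p \<in> carrier (P 0)" "\<epsilon> p = m" by (elim imageE) simp
    have "\<exists>k\<in>carrier (P 0). \<epsilon> k = \<zero>\<^bsub>M\<^esub> \<and> k \<triangleleft>\<^bsub>P 0\<^esub> t 2 = \<zero>\<^bsub>P 0\<^esub> \<and>
       (\<forall>k'\<in>carrier (P 0). \<epsilon> k' = \<zero>\<^bsub>M\<^esub> \<longrightarrow> k \<noteq> k' \<triangleleft>\<^bsub>P 0\<^esub> t 1)"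
    proof (rule projective_cover_step[OF P M \<epsilon>(1), where a = "t 0" and p = p])
      show "t 1 \<otimes>\<^bsub>R\<^esub> t 2 = \<zero>\<^bsub>R\<^esub>" using t(2)[of 1] by (simp add: numeral_2_eq_2)
      show "\<exists>u\<in>carrier R. s = u \<otimes>\<^bsub>R\<^esub> t 0" if "s \<in> carrier R" "s \<otimes>\<^bsub>R\<^esub> t 1 = \<zero>\<^bsub>R\<^esub>" for s
        using ann[of s 0] that by simp
      show "\<epsilon> p \<noteq> \<epsilon> p' \<triangleleft>\<^bsub>M\<^esub> t 0" if "p' \<in> carrier (P 0)" for p'
        using m(3) right_homD(1)[OF \<epsilon>(1)] that p by blast
    qed (use p m t in auto)
    then show ?case by (auto simp: Z_def numeral_2_eq_2)
  next
    case (Suc i)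
    then obtain k where k: "k \<in> Z i" "k \<triangleleft>\<^bsub>P i\<^esub> t (i + 2) = \<zero>\<^bsub>P i\<^esub>" "\<And>k'. k' \<in> Z i \<Longrightarrow> k \<noteq> k' \<triangleleft>\<^bsub>P i\<^esub> t (i + 1)"
      by blast
    obtain p where p: "p \<in> carrier (P (Suc i))" "d i p = k" using k(1) unfolding Z by blast
    have "\<exists>k\<in>carrier (P (Suc i)). d i k = \<zero>\<^bsub>P i\<^esub> \<and> k \<triangleleft>\<^bsub>P (Suc i)\<^esub> t (i + 3) = \<zero>\<^bsub>P (Suc i)\<^esub> \<and>
       (\<forall>k'\<in>carrier (P (Suc i)). d i k' = \<zero>\<^bsub>P i\<^esub> \<longrightarrow> k \<noteq> k' \<triangleleft>\<^bsub>P (Suc i)\<^esub> t (i + 2))"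
    proof (rule projective_cover_step[OF P Pm d, where a = "t (i + 1)" and p = p])
      show "t (i + 2) \<otimes>\<^bsub>R\<^esub> t (i + 3) = \<zero>\<^bsub>R\<^esub>" using t(2)[of "i + 2"] by (simp add: numeral_3_eq_3)
      show "\<exists>u\<in>carrier R. s = u \<otimes>\<^bsub>R\<^esub> t (i + 1)" if "s \<in> carrier R" "s \<otimes>\<^bsub>R\<^esub> t (i + 2) = \<zero>\<^bsub>R\<^esub>" for s
        using ann[of s "i + 1"] that by simp
      show "d i p \<noteq> d i p' \<triangleleft>\<^bsub>P i\<^esub> t (i + 1)" if "p' \<in> carrier (P (Suc i))" for p'
        using k(3)[of "d i p'"] that p unfolding Z by blast
    qed (use p k t in auto)
    then show ?case by (auto simp: Z_def numeral_3_eq_3)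
  qed
  then obtain k where k: "k \<in> Z (Suc N)" "\<forall>k'\<in>Z (Suc N). k \<noteq> k' \<triangleleft>\<^bsub>P (Suc N)\<^esub> t (Suc N + 1)" by blast
  interpret PN: right_module R "P (Suc N)" by (rule Pm)
  \<comment> \<open>The resolution vanishes beyond \<open>N\<close>, so \<open>k\<close> is an
    element of a zero module and thus trivially a multiple of t (N + 2), against its choice.\<close>
  have "k = \<zero>\<^bsub>P (Suc N)\<^esub>" using k(1) N[of "Suc N"] by (auto simp: Z_def)
  then have "k = k \<triangleleft>\<^bsub>P (Suc N)\<^esub> t (Suc N + 1)" using t by simp
  then show False using k by blast
qed

section \<open>Two-sided exact sequences of multiplications, duals and biduality\<close>

subsection \<open>Total reflexivity of cyclic modules\<close>

lemma opposite_simps [simp]: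
  "carrier (opposite R) = carrier R" "\<zero>\<^bsub>opposite R\<^esub> = \<zero>\<^bsub>R\<^esub>" "\<one>\<^bsub>opposite R\<^esub> = \<one>\<^bsub>R\<^esub>"
  "add (opposite R) = add R" "a \<otimes>\<^bsub>opposite R\<^esub> b = b \<otimes>\<^bsub>R\<^esub> a"
  by (simp_all add: opposite_def)

lemma ring_opposite: "ring R \<Longrightarrow> ring (opposite R)"
proof -
  assume "ring R"
  then interpret ring R .
  show ?thesis
  proof (rule ringI)
    show "abelian_group (opposite R)"
      by (rule abelian_group_change_record[OF abelian_group_axioms]) simp_all
    show "Group.monoid (opposite R)"
      by (rule monoidI) (auto simp: m_assoc)
  qed (auto simp: l_distr r_distr)
qed

lemma dual_module_simps:
  "carrier (dual_module R M) = right_hom R M (regular_module R) \<inter> extensional (carrier M)"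
  "\<zero>\<^bsub>dual_module R M\<^esub> = (\<lambda>x\<in>carrier M. \<zero>\<^bsub>R\<^esub>)"
  "g \<oplus>\<^bsub>dual_module R M\<^esub> h = (\<lambda>x\<in>carrier M. g x \<oplus>\<^bsub>R\<^esub> h x)"
  "h \<triangleleft>\<^bsub>dual_module R M\<^esub> a = (\<lambda>x\<in>carrier M. a \<otimes>\<^bsub>R\<^esub> h x)"
  by (simp_all add: dual_module_def)

lemma right_module_dual:
  fixes R :: "('a, 'x) gring_scheme" and M :: "('a, 'm, 'z) rmod_scheme"
  assumes "right_module R M"
  shows "right_module (opposite R) (dual_module R M)"
proof -
  interpret right_module R M by fact
  let ?D = "dual_module R M"
  have DD: "h x \<in> carrier R" if "h \<in> carrier ?D" "x \<in> carrier M" for h x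
    using that right_homD(1)[of h R M "regular_module R"] by (auto simp: dual_module_simps)
  have D: "h \<in> carrier ?D"
    if "\<And>x. x \<in> carrier M \<Longrightarrow> h x \<in> carrier R" "h \<in> extensional (carrier M)"
      "\<And>x y. x \<in> carrier M \<Longrightarrow> y \<in> carrier M \<Longrightarrow> h (x \<oplus>\<^bsub>M\<^esub> y) = h x \<oplus>\<^bsub>R\<^esub> h y"
      "\<And>x a. x \<in> carrier M \<Longrightarrow> a \<in> carrier R \<Longrightarrow> h (x \<triangleleft>\<^bsub>M\<^esub> a) = h x \<otimes>\<^bsub>R\<^esub> a" for h
    unfolding dual_module_simps by (intro IntI right_homI) (simp_all add: that)
  have Dadd: "h (x \<oplus>\<^bsub>M\<^esub> y) = h x \<oplus>\<^bsub>R\<^esub> h y" if "h \<in> carrier ?D" "x \<in> carrier M" "y \<in> carrier M" for h x y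
    using that right_homD(2)[of h R M "regular_module R"] by (auto simp: dual_module_simps)
  have Dract: "h (x \<triangleleft>\<^bsub>M\<^esub> a) = h x \<otimes>\<^bsub>R\<^esub> a" if "h \<in> carrier ?D" "x \<in> carrier M" "a \<in> carrier R" for h x a
    using that right_homD(3)[of h R M "regular_module R"] by (auto simp: dual_module_simps)
  note ops = dual_module_simps(2-4)
  have Dext: "h \<in> extensional (carrier M)" if "h \<in> carrier ?D" for h using that by (auto simp: dual_module_simps)
  have "abelian_group ?D"
  proof (rule abelian_groupI)
    fix h assume h: "h \<in> carrier ?D"
    have "(\<lambda>x\<in>carrier M. \<ominus>\<^bsub>R\<^esub> h x) \<in> carrier ?D"
      using h by (intro D) (auto simp: DD Dadd Dract R.minus_add R.l_minus ract_closed)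
    moreover have "(\<lambda>x\<in>carrier M. \<ominus>\<^bsub>R\<^esub> h x) \<oplus>\<^bsub>?D\<^esub> h = \<zero>\<^bsub>?D\<^esub>"
      using h by (auto simp: ops DD R.l_neg intro!: restrict_ext)
    ultimately show "\<exists>y\<in>carrier ?D. y \<oplus>\<^bsub>?D\<^esub> h = \<zero>\<^bsub>?D\<^esub>" by blast
    show "\<zero>\<^bsub>?D\<^esub> \<oplus>\<^bsub>?D\<^esub> h = h"
      using Dext[OF h] h by (auto simp: ops DD extensional_def)
    fix k assume k: "k \<in> carrier ?D"
    show "h \<oplus>\<^bsub>?D\<^esub> k \<in> carrier ?D"
      using h k by (intro D) (auto simp: ops DD Dadd Dract R.l_distr ract_closed R.a_ac)
  qed (auto simp: ops DD R.a_ac ract_closed intro!: restrict_ext D)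
  then show ?thesis
  proof (intro right_module.intro right_module_axioms.intro ring_opposite R.ring_axioms)
    show "h \<triangleleft>\<^bsub>?D\<^esub> a \<in> carrier ?D" if "h \<in> carrier ?D" "a \<in> carrier (opposite R)" for h a
      using that by (intro D) (auto simp: ops DD Dadd Dract R.r_distr R.m_assoc ract_closed)
    show "h \<triangleleft>\<^bsub>?D\<^esub> \<one>\<^bsub>opposite R\<^esub> = h" if "h \<in> carrier ?D" for h
      using Dext[OF that] that by (auto simp: ops DD extensional_def)
  qed (auto simp: ops DD R.l_distr R.r_distr R.m_assoc intro!: restrict_ext)
qed

text \<open>A map from \<open>N\<close> to \<open>A\<close> is given by the image y of the
  generator, subject to y \<theta> 0 = 0; by \<open>exl\<close> these y form the left ideal
  generated by \<theta> (-1), whose relations come from \<theta> (-2). So the dual is again cyclic,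
  over the opposite ring and with the sequence reversed, and both Ext conditions are instances of
  \<open>Ext_vanishes_chain\<close>. A functional on the dual is determined by its value at the
  generator, which \<theta> (-2) kills from the left; by \<open>exr\<close> this value lies in
  \<theta> (-1) A, so the functional is evaluation at an element of \<open>N\<close>.\<close>

lemma totally_reflexive_cyclic:
  fixes A :: "('a, 'x) gring_scheme" and N :: "('a, 'm, 'z) gmod_scheme" and \<theta> :: "int \<Rightarrow> 'a"
  assumes N: "right_module A N" and g: "g \<in> carrier N" and \<theta>: "\<And>i. \<theta> i \<in> carrier A"
    and gen: "\<And>x. x \<in> carrier N \<Longrightarrow> \<exists>a\<in>carrier A. x = g \<triangleleft>\<^bsub>N\<^esub> a"
    and ker: "\<And>a. a \<in> carrier A \<Longrightarrow> g \<triangleleft>\<^bsub>N\<^esub> a = \<zero>\<^bsub>N\<^esub> \<longleftrightarrow> (\<exists>b\<in>carrier A. a = \<theta> 0 \<otimes>\<^bsub>A\<^esub> b)"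
    and exr: "\<And>i a. a \<in> carrier A \<Longrightarrow> \<theta> i \<otimes>\<^bsub>A\<^esub> a = \<zero>\<^bsub>A\<^esub> \<longleftrightarrow> (\<exists>b\<in>carrier A. a = \<theta> (i + 1) \<otimes>\<^bsub>A\<^esub> b)"
    and exl: "\<And>i a. a \<in> carrier A \<Longrightarrow> a \<otimes>\<^bsub>A\<^esub> \<theta> i = \<zero>\<^bsub>A\<^esub> \<longleftrightarrow> (\<exists>b\<in>carrier A. a = b \<otimes>\<^bsub>A\<^esub> \<theta> (i - 1))"
  shows "totally_reflexive A N"
proof -
  interpret N: right_module A N by fact
  let ?D = "dual_module A N" and ?O = "opposite A"
  interpret D: right_module ?O ?D by (rule right_module_dual[OF N])
  have D: "h x \<in> carrier A" "h (g \<triangleleft>\<^bsub>N\<^esub> a) = h g \<otimes>\<^bsub>A\<^esub> a" "h (x \<oplus>\<^bsub>N\<^esub> y) = h x \<oplus>\<^bsub>A\<^esub> h y" "h (x \<triangleleft>\<^bsub>N\<^esub> a) = h x \<otimes>\<^bsub>A\<^esub> a"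
    if "h \<in> carrier ?D" "x \<in> carrier N" "a \<in> carrier A" "y \<in> carrier N" for h x y a
    using that g right_homD[of h A N "regular_module A"] by (auto simp: dual_module_simps)
  have D_add: "h (x \<oplus>\<^bsub>N\<^esub> y) = h x \<oplus>\<^bsub>A\<^esub> h y" if "h \<in> carrier ?D" "x \<in> carrier N" "y \<in> carrier N" for h x y
    using D(3)[OF that(1,2) N.R.one_closed that(3)] .
  have Dext: "h \<in> extensional (carrier N)" if "h \<in> carrier ?D" for h using that by (auto simp: dual_module_simps)
  have D_eqI: "h = k" if "h \<in> carrier ?D" "k \<in> carrier ?D" "h g = k g" for h k
  proof (rule extensionalityI[OF Dext Dext])
    fix x assume "x \<in> carrier N"
    then obtain a where "a \<in> carrier A" "x = g \<triangleleft>\<^bsub>N\<^esub> a" using gen by blast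
    then show "h x = k x" using that D(2)[of h g a g] D(2)[of k g a g] g by simp
  qed (use that in auto)
  \<comment> \<open>\<open>lift y\<close> is meant to send the generator to \<open>y\<close>; the
    chosen \<open>a\<close> is unique up to multiples of \<theta> 0, and these are killed by the
    admissible \<open>y\<close>.\<close>
  define lift where "lift y = (\<lambda>x\<in>carrier N. y \<otimes>\<^bsub>A\<^esub> (SOME a. a \<in> carrier A \<and> x = g \<triangleleft>\<^bsub>N\<^esub> a))" for y
  have lift_g: "lift y (g \<triangleleft>\<^bsub>N\<^esub> a) = y \<otimes>\<^bsub>A\<^esub> a" if y: "y \<in> carrier A" "y \<otimes>\<^bsub>A\<^esub> \<theta> 0 = \<zero>\<^bsub>A\<^esub>" and a: "a \<in> carrier A" for y a
  proof -
    define b where "b = (SOME b. b \<in> carrier A \<and> g \<triangleleft>\<^bsub>N\<^esub> a = g \<triangleleft>\<^bsub>N\<^esub> b)"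
    have b: "b \<in> carrier A" "g \<triangleleft>\<^bsub>N\<^esub> a = g \<triangleleft>\<^bsub>N\<^esub> b"
      unfolding b_def using someI[of "\<lambda>b. b \<in> carrier A \<and> g \<triangleleft>\<^bsub>N\<^esub> a = g \<triangleleft>\<^bsub>N\<^esub> b" a] a by auto
    have "g \<triangleleft>\<^bsub>N\<^esub> (b \<ominus>\<^bsub>A\<^esub> a) = \<zero>\<^bsub>N\<^esub>"
      using a b g by (simp add: a_minus_def N.ract_add_right N.ract_minus_right N.ract_closed N.M.r_neg)
    then obtain c where c: "c \<in> carrier A" "b \<ominus>\<^bsub>A\<^esub> a = \<theta> 0 \<otimes>\<^bsub>A\<^esub> c" using ker a b by blast
    have "y \<otimes>\<^bsub>A\<^esub> b \<ominus>\<^bsub>A\<^esub> y \<otimes>\<^bsub>A\<^esub> a = y \<otimes>\<^bsub>A\<^esub> (b \<ominus>\<^bsub>A\<^esub> a)"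
      using a b y by (simp add: a_minus_def N.R.r_distr N.R.r_minus)
    also have "\<dots> = \<zero>\<^bsub>A\<^esub>" using c y \<theta> by (simp flip: N.R.m_assoc)
    finally have "y \<otimes>\<^bsub>A\<^esub> b = y \<otimes>\<^bsub>A\<^esub> a" using a b y by (simp add: N.R.minus_eq_zero_iff)
    then show ?thesis using a g by (simp add: lift_def b_def N.ract_closed)
  qed
  have lift_D: "lift y \<in> carrier ?D" if y: "y \<in> carrier A" "y \<otimes>\<^bsub>A\<^esub> \<theta> 0 = \<zero>\<^bsub>A\<^esub>" for y
    unfolding dual_module_simps
  proof (intro IntI right_homI)
    show "lift y \<in> extensional (carrier N)" by (simp add: lift_def)
    fix x assume "x \<in> carrier N"
    then obtain a where a: "a \<in> carrier A" "x = g \<triangleleft>\<^bsub>N\<^esub> a" using gen by blast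
    then show "lift y x \<in> carrier (regular_module A)" using y by (simp add: lift_g)
    { fix x' assume "x' \<in> carrier N"
      then obtain a' where a': "a' \<in> carrier A" "x' = g \<triangleleft>\<^bsub>N\<^esub> a'" using gen by blast
      then show "lift y (x \<oplus>\<^bsub>N\<^esub> x') = lift y x \<oplus>\<^bsub>regular_module A\<^esub> lift y x'"
        using a y g by (simp add: lift_g N.R.r_distr flip: N.ract_add_right) }
    { fix b assume "b \<in> carrier A"
      then show "lift y (x \<triangleleft>\<^bsub>N\<^esub> b) = lift y x \<triangleleft>\<^bsub>regular_module A\<^esub> b"
        using a y g by (simp add: lift_g N.R.m_assoc flip: N.ract_assoc) }
  qed
  have lift_at_g: "lift y g = y" if y: "y \<in> carrier A" "y \<otimes>\<^bsub>A\<^esub> \<theta> 0 = \<zero>\<^bsub>A\<^esub>" for y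
    using lift_g[OF y, of "\<one>\<^bsub>A\<^esub>"] y g by (simp add: N.ract_one)
  \<comment> \<open>\<eta> will generate the dual: it sends \<open>g\<close> to \<theta> (-1), which
    kills \<theta> 0 from the left.\<close>
  define \<eta> where "\<eta> = lift (\<theta> (- 1))"
  have \<theta>\<theta>: "\<theta> (i - 1) \<otimes>\<^bsub>A\<^esub> \<theta> i = \<zero>\<^bsub>A\<^esub>" for i
    using exl[of "\<theta> (i - 1)" i] \<theta> by (metis N.R.l_one N.R.one_closed)
  have \<eta>: "\<eta> \<in> carrier ?D" "\<eta> g = \<theta> (- 1)" unfolding \<eta>_def using lift_D lift_at_g \<theta> \<theta>\<theta>[of 0] by auto
  have D_kills: "h g \<otimes>\<^bsub>A\<^esub> \<theta> 0 = \<zero>\<^bsub>A\<^esub>" if "h \<in> carrier ?D" for h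
  proof -
    have "g \<triangleleft>\<^bsub>N\<^esub> \<theta> 0 = \<zero>\<^bsub>N\<^esub>" using ker[of "\<theta> 0"] \<theta> by (metis N.R.r_one N.R.one_closed)
    moreover have "h \<zero>\<^bsub>N\<^esub> = \<zero>\<^bsub>A\<^esub>"
      using that right_hom_zero[of h A N "regular_module A"] right_module.axioms(2)[OF right_module_regular[OF N.R.ring_axioms]] N.M.abelian_group_axioms
      by (simp add: dual_module_simps)
    ultimately show ?thesis using D(2)[OF that g \<theta> g] by metis
  qed
  have D_ract_g: "(h \<triangleleft>\<^bsub>?D\<^esub> a) g = a \<otimes>\<^bsub>A\<^esub> h g" if "h \<in> carrier ?D" "a \<in> carrier A" for h a
    using g by (simp add: dual_module_simps)
  have D_gen: "\<exists>a\<in>carrier ?O. h = \<eta> \<triangleleft>\<^bsub>?D\<^esub> a" if h: "h \<in> carrier ?D" for h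
  proof -
    obtain b where "b \<in> carrier A" "h g = b \<otimes>\<^bsub>A\<^esub> \<theta> (0 - 1)" using exl[of "h g" 0] D(1)[OF h g \<theta> g] D_kills[OF h] by blast
    then show ?thesis using h \<eta> by (intro bexI[of _ b] D_eqI) (auto simp: D_ract_g D.ract_closed)
  qed
  have D_zero: "\<zero>\<^bsub>?D\<^esub> g = \<zero>\<^bsub>A\<^esub>" using g by (simp add: dual_module_simps)
  have D_ker: "\<eta> \<triangleleft>\<^bsub>?D\<^esub> a = \<zero>\<^bsub>?D\<^esub> \<longleftrightarrow> (\<exists>b\<in>carrier ?O. a = \<theta> (- 2) \<otimes>\<^bsub>?O\<^esub> b)" if a: "a \<in> carrier ?O" for a
  proof -
    have "\<eta> \<triangleleft>\<^bsub>?D\<^esub> a = \<zero>\<^bsub>?D\<^esub> \<longleftrightarrow> a \<otimes>\<^bsub>A\<^esub> \<theta> (- 1) = \<zero>\<^bsub>A\<^esub>"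
    proof
      assume "\<eta> \<triangleleft>\<^bsub>?D\<^esub> a = \<zero>\<^bsub>?D\<^esub>"
      then have "(\<eta> \<triangleleft>\<^bsub>?D\<^esub> a) g = \<zero>\<^bsub>A\<^esub>" using D_zero by simp
      then show "a \<otimes>\<^bsub>A\<^esub> \<theta> (- 1) = \<zero>\<^bsub>A\<^esub>" using a \<eta> by (simp add: D_ract_g)
    next
      assume "a \<otimes>\<^bsub>A\<^esub> \<theta> (- 1) = \<zero>\<^bsub>A\<^esub>"
      then show "\<eta> \<triangleleft>\<^bsub>?D\<^esub> a = \<zero>\<^bsub>?D\<^esub>" using a \<eta> D_zero by (intro D_eqI) (auto simp: D_ract_g D.ract_closed)
    qed
    then show ?thesis using exl[of a "- 1"] a by simp
  qed
  let ?B = "biduality_map A N" and ?E = "dual_module ?O ?D"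
  interpret E: right_module "opposite ?O" ?E by (rule right_module_dual[OF D.right_module_axioms])
  have B: "?B x \<in> carrier ?E" if x: "x \<in> carrier N" for x
    unfolding dual_module_simps(1)[of ?O]
  proof (intro IntI right_homI)
    show "?B x \<in> extensional (carrier ?D)" by (simp add: biduality_map_def)
  qed (use x g in \<open>auto simp: biduality_map_def D D.M.a_closed D.ract_closed\<close>, auto simp: dual_module_simps dest: right_homD(1))
  have B_hom: "?B \<in> right_hom A N ?E"
    by (rule right_homI[OF B]) (auto simp: biduality_map_def dual_module_simps(3,4)[of ?O] D D_add intro!: restrict_ext)
  have B_\<eta>: "?B (g \<triangleleft>\<^bsub>N\<^esub> a) \<eta> = \<theta> (- 1) \<otimes>\<^bsub>A\<^esub> a" if "a \<in> carrier A" for a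
    using that \<eta> D(2)[OF \<eta>(1) g that g] by (simp add: biduality_map_def)
  have "bij_betw ?B (carrier N) (carrier ?E)"
  proof (rule bij_betwI')
    fix x y assume xy: "x \<in> carrier N" "y \<in> carrier N"
    show "?B x = ?B y \<longleftrightarrow> x = y"
    proof
      assume eq: "?B x = ?B y"
      obtain a b where ab: "a \<in> carrier A" "x = g \<triangleleft>\<^bsub>N\<^esub> a" "b \<in> carrier A" "y = g \<triangleleft>\<^bsub>N\<^esub> b" using xy gen by metis
      then have "\<theta> (- 1) \<otimes>\<^bsub>A\<^esub> a = \<theta> (- 1) \<otimes>\<^bsub>A\<^esub> b" using eq B_\<eta> by metis
      then have "\<theta> (- 1) \<otimes>\<^bsub>A\<^esub> (a \<ominus>\<^bsub>A\<^esub> b) = \<zero>\<^bsub>A\<^esub>"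
        using ab \<theta> by (simp add: a_minus_def N.R.r_distr N.R.r_minus N.R.r_neg)
      \<comment> \<open>Injectivity of biduality: what \<theta> (-1) kills is a multiple of \<theta>
        0, hence a relation of \<open>N\<close>.\<close>
      then have "g \<triangleleft>\<^bsub>N\<^esub> (a \<ominus>\<^bsub>A\<^esub> b) = \<zero>\<^bsub>N\<^esub>" using exr[of "a \<ominus>\<^bsub>A\<^esub> b" "- 1"] ker[of "a \<ominus>\<^bsub>A\<^esub> b"] ab by simp
      then have "x \<ominus>\<^bsub>N\<^esub> y = \<zero>\<^bsub>N\<^esub>" using ab g by (simp add: a_minus_def N.ract_add_right N.ract_minus_right)
      then show "x = y" using xy by (simp add: N.M.minus_eq_zero_iff)
    qed simp
  next
    show "?B x \<in> carrier ?E" if "x \<in> carrier N" for x using B that .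
  next
    fix k assume k: "k \<in> carrier ?E"
    then have kh: "k \<in> right_hom ?O ?D (regular_module ?O)" "k \<in> extensional (carrier ?D)" by (auto simp: dual_module_simps(1)[of ?O])
    have y: "k \<eta> \<in> carrier A" using right_homD(1)[OF kh(1) \<eta>(1)] by simp
    have "\<eta> \<triangleleft>\<^bsub>?D\<^esub> \<theta> (- 2) = \<zero>\<^bsub>?D\<^esub>" using D_ker[of "\<theta> (- 2)"] \<theta> by simp (metis N.R.l_one N.R.one_closed)
    then have "\<theta> (- 2) \<otimes>\<^bsub>A\<^esub> k \<eta> = \<zero>\<^bsub>A\<^esub>"
      using right_homD(3)[OF kh(1) \<eta>(1), of "\<theta> (- 2)"] \<theta>
        right_hom_zero[OF kh(1) D.M.abelian_group_axioms right_module.axioms(2)[OF right_module_regular[OF D.R.ring_axioms]]] by simp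
    then obtain a where a: "a \<in> carrier A" "k \<eta> = \<theta> (- 1) \<otimes>\<^bsub>A\<^esub> a" using exr[of "k \<eta>" "- 2"] y by auto
    have "k h = ?B (g \<triangleleft>\<^bsub>N\<^esub> a) h" if h: "h \<in> carrier ?D" for h
    proof -
      obtain b where b: "b \<in> carrier A" "h = \<eta> \<triangleleft>\<^bsub>?D\<^esub> b" using D_gen[OF h] by auto
      have "k h = b \<otimes>\<^bsub>A\<^esub> (\<theta> (- 1) \<otimes>\<^bsub>A\<^esub> a)" using right_homD(3)[OF kh(1) \<eta>(1), of b] b a by simp
      also have "\<dots> = h g \<otimes>\<^bsub>A\<^esub> a" using b a \<eta> \<theta> by (simp add: D_ract_g N.R.m_assoc)
      also have "\<dots> = ?B (g \<triangleleft>\<^bsub>N\<^esub> a) h" using h D(2)[OF h g a(1) g] by (simp add: biduality_map_def)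
      finally show ?thesis .
    qed
    then have "k = ?B (g \<triangleleft>\<^bsub>N\<^esub> a)"
      by (intro extensionalityI[OF kh(2), of "?B (g \<triangleleft>\<^bsub>N\<^esub> a)"]) (auto simp: biduality_map_def)
    then show "\<exists>x\<in>carrier N. k = ?B x" using g a by (intro bexI[of _ "g \<triangleleft>\<^bsub>N\<^esub> a"]) (auto simp: N.ract_closed)
  qed
  moreover have "Ext_vanishes A i N (regular_module A)" if "i \<ge> 1" for i
  proof (rule Ext_vanishes_chain[OF N g, where t = "\<lambda>i. \<theta> (int i)"])
    show "\<theta> (int i) \<otimes>\<^bsub>A\<^esub> a = \<zero>\<^bsub>A\<^esub> \<longleftrightarrow> (\<exists>b\<in>carrier A. a = \<theta> (int (Suc i)) \<otimes>\<^bsub>A\<^esub> b)" if "a \<in> carrier A" for i a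
      using exr[OF that, of "int i"] by (simp add: add.commute)
    show "\<exists>b\<in>carrier A. a = b \<otimes>\<^bsub>A\<^esub> \<theta> (int i)" if "a \<in> carrier A" "a \<otimes>\<^bsub>A\<^esub> \<theta> (int (Suc i)) = \<zero>\<^bsub>A\<^esub>" for i a
      using exl[OF that(1), of "int (Suc i)"] that by simp
  qed (use \<theta> gen ker that in simp_all)
  moreover have "Ext_vanishes ?O i ?D (regular_module ?O)" if "i \<ge> 1" for i
  \<comment> \<open>The relations of the dual come from \<theta> (-2), so its resolution over the
    opposite ring runs down the sequence from there.\<close>
  proof (rule Ext_vanishes_chain[OF D.right_module_axioms \<eta>(1), where t = "\<lambda>i. \<theta> (- 2 - int i)"])
    show "\<theta> (- 2 - int i) \<otimes>\<^bsub>?O\<^esub> a = \<zero>\<^bsub>?O\<^esub> \<longleftrightarrow> (\<exists>b\<in>carrier ?O. a = \<theta> (- 2 - int (Suc i)) \<otimes>\<^bsub>?O\<^esub> b)"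
      if "a \<in> carrier ?O" for i a
      using exl[of a "- 2 - int i"] that by (simp add: algebra_simps)
    show "\<exists>b\<in>carrier ?O. a = b \<otimes>\<^bsub>?O\<^esub> \<theta> (- 2 - int i)" if "a \<in> carrier ?O" "a \<otimes>\<^bsub>?O\<^esub> \<theta> (- 2 - int (Suc i)) = \<zero>\<^bsub>?O\<^esub>" for i a
    proof -
      have "- 2 - int (Suc i) + 1 = - 2 - int i" by simp
      then show ?thesis using exr[of a "- 2 - int (Suc i)"] that by simp
    qed
  qed (use \<theta> D_gen D_ker that in simp_all)
  ultimately show ?thesis unfolding totally_reflexive_def using B_hom by blast
qed

section \<open>Quotient modules and the action on cosets\<close>

subsection \<open>Quotient modules\<close>

lemma quot_module_simps:
  "carrier (quot_module M H) = a_rcosets\<^bsub>M\<^esub> H" "\<zero>\<^bsub>quot_module M H\<^esub> = H" "add (quot_module M H) = set_add M"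
  "U \<triangleleft>\<^bsub>quot_module M H\<^esub> a = (\<Union>x\<in>U. H +>\<^bsub>M\<^esub> (x \<triangleleft>\<^bsub>M\<^esub> a))"
  "mpart (quot_module M H) i = (\<lambda>x. H +>\<^bsub>M\<^esub> x) ` mpart M i"
  by (simp_all add: quot_module_def)

text \<open>The action on cosets is derived from the behaviour of one scalar \<open>a\<close> alone,
  without the module axioms, so that the result also covers \<open>pre_tensor\<close>, which is not
  a module.\<close>

lemma quot_module:
  fixes M :: "('a, 'm) gmod"
  assumes "abelian_group M" "additive_subgroup H M"
  shows quot_carrier: "carrier (quot_module M H) = (\<lambda>x. H +>\<^bsub>M\<^esub> x) ` carrier M"
    and quot_abelian_group: "abelian_group (quot_module M H)"
    and quot_add: "\<And>x y. x \<in> carrier M \<Longrightarrow> y \<in> carrier M \<Longrightarrow>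
      (H +>\<^bsub>M\<^esub> x) \<oplus>\<^bsub>quot_module M H\<^esub> (H +>\<^bsub>M\<^esub> y) = H +>\<^bsub>M\<^esub> (x \<oplus>\<^bsub>M\<^esub> y)"
    and quot_eq_iff: "\<And>x y. x \<in> carrier M \<Longrightarrow> y \<in> carrier M \<Longrightarrow> H +>\<^bsub>M\<^esub> x = H +>\<^bsub>M\<^esub> y \<longleftrightarrow> x \<ominus>\<^bsub>M\<^esub> y \<in> H"
    and quot_eq_zero_iff: "\<And>x. x \<in> carrier M \<Longrightarrow> H +>\<^bsub>M\<^esub> x = H \<longleftrightarrow> x \<in> H"
    and quot_ract: "\<And>x a. x \<in> carrier M \<Longrightarrow> (\<And>x. x \<in> carrier M \<Longrightarrow> x \<triangleleft>\<^bsub>M\<^esub> a \<in> carrier M) \<Longrightarrow>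
      (\<And>x y. x \<in> carrier M \<Longrightarrow> y \<in> carrier M \<Longrightarrow> (x \<oplus>\<^bsub>M\<^esub> y) \<triangleleft>\<^bsub>M\<^esub> a = x \<triangleleft>\<^bsub>M\<^esub> a \<oplus>\<^bsub>M\<^esub> y \<triangleleft>\<^bsub>M\<^esub> a) \<Longrightarrow>
      (\<And>x. x \<in> H \<Longrightarrow> x \<triangleleft>\<^bsub>M\<^esub> a \<in> H) \<Longrightarrow>
      (H +>\<^bsub>M\<^esub> x) \<triangleleft>\<^bsub>quot_module M H\<^esub> a = H +>\<^bsub>M\<^esub> (x \<triangleleft>\<^bsub>M\<^esub> a)"
proof -
  interpret M: abelian_group M by fact
  interpret H: abelian_subgroup H M by (rule abelian_subgroupI3[OF assms(2,1)])
  show "carrier (quot_module M H) = (\<lambda>x. H +>\<^bsub>M\<^esub> x) ` carrier M"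
    by (auto simp: quot_module_simps A_RCOSETS_def')
  have "abelian_group (ring.make (a_rcosets\<^bsub>M\<^esub> H) undefined undefined H (set_add M) :: 'm set ring)"
    by (rule comm_group_abelian_groupI)
       (simp add: ring.defs H.a_factorgroup_is_comm_group[unfolded A_FactGroup_def'])
  then show "abelian_group (quot_module M H)"
    by (rule abelian_group_change_record) (simp_all add: quot_module_simps ring.defs)
  show "(H +>\<^bsub>M\<^esub> x) \<oplus>\<^bsub>quot_module M H\<^esub> (H +>\<^bsub>M\<^esub> y) = H +>\<^bsub>M\<^esub> (x \<oplus>\<^bsub>M\<^esub> y)"
    if "x \<in> carrier M" "y \<in> carrier M" for x y
    using that by (simp add: quot_module_simps H.a_rcos_sum)
  show "H +>\<^bsub>M\<^esub> x = H +>\<^bsub>M\<^esub> y \<longleftrightarrow> x \<ominus>\<^bsub>M\<^esub> y \<in> H" if "x \<in> carrier M" "y \<in> carrier M" for x y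
  proof -
    have "x \<ominus>\<^bsub>M\<^esub> y \<in> H \<longleftrightarrow> x \<in> H +>\<^bsub>M\<^esub> y"
      using that by (simp add: H.a_rcos_module a_minus_def)
    also have "\<dots> \<longleftrightarrow> H +>\<^bsub>M\<^esub> x = H +>\<^bsub>M\<^esub> y"
      using that H.a_repr_independence'[of x y] H.a_rcos_self[of x] by auto
    finally show ?thesis by simp
  qed
  show "H +>\<^bsub>M\<^esub> x = H \<longleftrightarrow> x \<in> H" if "x \<in> carrier M" for x
    using that H.a_rcos_const[of x] H.a_rcos_self[of x] by auto
  show "(H +>\<^bsub>M\<^esub> x) \<triangleleft>\<^bsub>quot_module M H\<^esub> a = H +>\<^bsub>M\<^esub> (x \<triangleleft>\<^bsub>M\<^esub> a)"
    if x: "x \<in> carrier M" and cl: "\<And>x. x \<in> carrier M \<Longrightarrow> x \<triangleleft>\<^bsub>M\<^esub> a \<in> carrier M"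
      and add: "\<And>x y. x \<in> carrier M \<Longrightarrow> y \<in> carrier M \<Longrightarrow> (x \<oplus>\<^bsub>M\<^esub> y) \<triangleleft>\<^bsub>M\<^esub> a = x \<triangleleft>\<^bsub>M\<^esub> a \<oplus>\<^bsub>M\<^esub> y \<triangleleft>\<^bsub>M\<^esub> a"
      and Ha: "\<And>x. x \<in> H \<Longrightarrow> x \<triangleleft>\<^bsub>M\<^esub> a \<in> H" for x a
  proof -
    have "H +>\<^bsub>M\<^esub> (y \<triangleleft>\<^bsub>M\<^esub> a) = H +>\<^bsub>M\<^esub> (x \<triangleleft>\<^bsub>M\<^esub> a)" if "y \<in> H +>\<^bsub>M\<^esub> x" for y
    proof -
      have "y \<in> (\<Union>h\<in>H. {h \<oplus>\<^bsub>M\<^esub> x})" using that unfolding a_r_coset_def' .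
      then obtain h where h: "h \<in> H" "y = h \<oplus>\<^bsub>M\<^esub> x" by blast
      then have "y \<triangleleft>\<^bsub>M\<^esub> a = h \<triangleleft>\<^bsub>M\<^esub> a \<oplus>\<^bsub>M\<^esub> x \<triangleleft>\<^bsub>M\<^esub> a" using x add by simp
      then have "y \<triangleleft>\<^bsub>M\<^esub> a \<in> H +>\<^bsub>M\<^esub> (x \<triangleleft>\<^bsub>M\<^esub> a)" using Ha[OF h(1)] unfolding a_r_coset_def' by blast
      then show ?thesis using H.a_repr_independence' cl x by blast
    qed
    then show ?thesis unfolding quot_module_simps using H.a_rcos_self[OF x] by blast
  qed
qed

lemma cyclic_quot:
  fixes A :: "'a gring"
  assumes "ring A" and \<theta>: "\<theta> \<in> carrier A"
  defines "H \<equiv> {\<theta> \<otimes>\<^bsub>A\<^esub> b | b. b \<in> carrier A}"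
  defines "N \<equiv> quot_module (regular_module A) H"
  shows cyclic_quot_carrier: "carrier N = (\<lambda>a. H +>\<^bsub>regular_module A\<^esub> a) ` carrier A"
    and cyclic_quot_ract: "\<And>a b. a \<in> carrier A \<Longrightarrow> b \<in> carrier A \<Longrightarrow>
      (H +>\<^bsub>regular_module A\<^esub> a) \<triangleleft>\<^bsub>N\<^esub> b = H +>\<^bsub>regular_module A\<^esub> (a \<otimes>\<^bsub>A\<^esub> b)"
    and cyclic_quot_eq_zero_iff: "\<And>a. a \<in> carrier A \<Longrightarrow>
      H +>\<^bsub>regular_module A\<^esub> a = \<zero>\<^bsub>N\<^esub> \<longleftrightarrow> (\<exists>b\<in>carrier A. a = \<theta> \<otimes>\<^bsub>A\<^esub> b)"
    and cyclic_quot_mpart: "mpart N i = (\<lambda>a. H +>\<^bsub>regular_module A\<^esub> a) ` rpart A i"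
proof -
  interpret ring A by fact
  interpret M: right_module A "regular_module A" by (rule right_module_regular) fact
  have "additive_subgroup H (regular_module A)"
  proof (rule additive_subgroupI, rule M.M.add.subgroupI)
    show "H \<subseteq> carrier (regular_module A)" using \<theta> by (auto simp: H_def)
    show "H \<noteq> {}" by (auto simp: H_def)
    show "\<ominus>\<^bsub>regular_module A\<^esub> x \<in> H" if x: "x \<in> H" for x
    proof -
      obtain b where b: "b \<in> carrier A" "x = \<theta> \<otimes>\<^bsub>A\<^esub> b" using x by (auto simp: H_def)
      have "\<ominus>\<^bsub>regular_module A\<^esub> x = \<theta> \<otimes>\<^bsub>A\<^esub> (\<ominus>\<^bsub>A\<^esub> b)"
        by (rule M.M.minus_equality) (use b \<theta> in \<open>auto simp: l_neg simp flip: r_distr\<close>)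
      then show ?thesis using b by (auto simp: H_def)
    qed
    show "x \<oplus>\<^bsub>regular_module A\<^esub> y \<in> H" if xy: "x \<in> H" "y \<in> H" for x y
    proof -
      obtain b c where "b \<in> carrier A" "x = \<theta> \<otimes>\<^bsub>A\<^esub> b" "c \<in> carrier A" "y = \<theta> \<otimes>\<^bsub>A\<^esub> c" using xy by (auto simp: H_def)
      then have "b \<oplus>\<^bsub>A\<^esub> c \<in> carrier A" "x \<oplus>\<^bsub>A\<^esub> y = \<theta> \<otimes>\<^bsub>A\<^esub> (b \<oplus>\<^bsub>A\<^esub> c)" using \<theta> by (auto simp: r_distr)
      then show ?thesis by (auto simp: H_def)
    qed
  qed
  note Q = quot_module[OF M.M.abelian_group_axioms this]
  show "carrier N = (\<lambda>a. H +>\<^bsub>regular_module A\<^esub> a) ` carrier A" unfolding N_def by (simp add: Q(1))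
  show "(H +>\<^bsub>regular_module A\<^esub> a) \<triangleleft>\<^bsub>N\<^esub> b = H +>\<^bsub>regular_module A\<^esub> (a \<otimes>\<^bsub>A\<^esub> b)"
    if "a \<in> carrier A" "b \<in> carrier A" for a b
    using that \<theta> unfolding N_def by (subst Q(6)) (auto simp: H_def l_distr m_assoc)
  show "H +>\<^bsub>regular_module A\<^esub> a = \<zero>\<^bsub>N\<^esub> \<longleftrightarrow> (\<exists>b\<in>carrier A. a = \<theta> \<otimes>\<^bsub>A\<^esub> b)" if "a \<in> carrier A" for a
    using that unfolding N_def quot_module_simps by (subst Q(5)) (auto simp: H_def)
  show "mpart N i = (\<lambda>a. H +>\<^bsub>regular_module A\<^esub> a) ` rpart A i"
    unfolding N_def quot_module_simps by simp
qed

lemma restrict_scalars_simps [simp]: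
  "carrier (restrict_scalars \<pi> M) = carrier M" "\<zero>\<^bsub>restrict_scalars \<pi> M\<^esub> = \<zero>\<^bsub>M\<^esub>"
  "add (restrict_scalars \<pi> M) = add M" "x \<triangleleft>\<^bsub>restrict_scalars \<pi> M\<^esub> s = x \<triangleleft>\<^bsub>M\<^esub> \<pi> s"
  by (simp_all add: restrict_scalars_def)

lemma right_module_restrict_scalars:
  assumes "ring S" "\<pi> \<in> ring_hom S A" "right_module A M"
  shows "right_module S (restrict_scalars \<pi> M)"
proof -
  interpret right_module A M by fact
  show ?thesis
    using assms(1,2)
    by (intro right_module.intro right_module_axioms.intro abelian_group_change_record[OF M.abelian_group_axioms])
       (auto simp: ring_hom_closed ring_hom_add ring_hom_mult ring_hom_one ract_closed ract_add_left ract_add_right ract_assoc ract_one)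
qed

section \<open>Chains of linear factors of f over S and A = S/(f)\<close>

section \<open>Hypersurfaces\<close>

text \<open>What the module theory requires of \<open>S\<close>, free of monomials: f is regular,
  normal and homogeneous of degree 2, and \<open>A\<close> is S/(f). The powers \<tau> j of the
  normalizing automorphism are given for all integers j, so that f can be moved to either
  side.\<close>

locale hypersurface = S: ring S + A: ring A
  for S :: "'s gring" and A :: "'a gring" +
  fixes \<pi> :: "'s \<Rightarrow> 'a" and f :: 's and \<tau> :: "int \<Rightarrow> 's \<Rightarrow> 's" and cS :: "'s \<Rightarrow> int \<Rightarrow> 's"
  assumes pi_hom: "\<pi> \<in> ring_hom S A" and pi_surj: "\<pi> ` carrier S = carrier A"
    and pi_zero_iff: "s \<in> carrier S \<Longrightarrow> \<pi> s = \<zero>\<^bsub>A\<^esub> \<longleftrightarrow> (\<exists>t\<in>carrier S. s = f \<otimes>\<^bsub>S\<^esub> t)"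
    and rpart_A: "rpart A i = \<pi> ` rpart S i"
    and f_rpart: "f \<in> rpart S 2"
    and f_left: "s \<in> carrier S \<Longrightarrow> f \<otimes>\<^bsub>S\<^esub> s = \<zero>\<^bsub>S\<^esub> \<Longrightarrow> s = \<zero>\<^bsub>S\<^esub>"
    and f_right: "s \<in> carrier S \<Longrightarrow> s \<otimes>\<^bsub>S\<^esub> f = \<zero>\<^bsub>S\<^esub> \<Longrightarrow> s = \<zero>\<^bsub>S\<^esub>"
    and tau_hom: "\<tau> j \<in> ring_hom S S"
    and tau_0: "s \<in> carrier S \<Longrightarrow> \<tau> 0 s = s"
    and tau_add: "s \<in> carrier S \<Longrightarrow> \<tau> i (\<tau> j s) = \<tau> (i + j) s"
    and tau_f: "\<tau> j f = f"
    and tau_rpart: "s \<in> rpart S d \<Longrightarrow> \<tau> j s \<in> rpart S d"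
    and tau_normal: "s \<in> carrier S \<Longrightarrow> s \<otimes>\<^bsub>S\<^esub> f = f \<otimes>\<^bsub>S\<^esub> \<tau> 1 s"
    and comps: "components S (rpart S) cS"
    and one_rpart: "\<one>\<^bsub>S\<^esub> \<in> rpart S 0"
    and mult_rpart: "s \<in> rpart S i \<Longrightarrow> t \<in> rpart S j \<Longrightarrow> s \<otimes>\<^bsub>S\<^esub> t \<in> rpart S (i + j)"
begin

sublocale pi: ring_hom_ring S A \<pi>
  by (rule ring_hom_ringI2[OF S.ring_axioms A.ring_axioms pi_hom])

lemma rpart_subgroup: "additive_subgroup (rpart S i) S"
  using comps by (simp add: components_def)

lemma rpart_closed: "s \<in> rpart S i \<Longrightarrow> s \<in> carrier S"
  using additive_subgroup.a_subset[OF rpart_subgroup] by blast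

lemma f_closed [simp]: "f \<in> carrier S"
  using f_rpart by (rule rpart_closed)

lemma tau_closed [simp]: "s \<in> carrier S \<Longrightarrow> \<tau> j s \<in> carrier S"
  using tau_hom by (rule ring_hom_closed)

lemma pi_f: "\<pi> f = \<zero>\<^bsub>A\<^esub>"
  using pi_zero_iff[of f] by (metis S.one_closed S.r_one f_closed)

lemma pi_lift: "a \<in> carrier A \<Longrightarrow> \<exists>s\<in>carrier S. a = \<pi> s"
  using pi_surj by blast

lemma f_normal: "t \<in> carrier S \<Longrightarrow> f \<otimes>\<^bsub>S\<^esub> t = \<tau> (- 1) t \<otimes>\<^bsub>S\<^esub> f"
  using tau_normal[of "\<tau> (- 1) t"] by (simp add: tau_add tau_0)

text \<open>A rank-one factorization of f into linear forms, continued in both directions. As f is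
  regular and normal, \<Theta> (i + 2) is forced to be \<tau> 1 applied to \<Theta> i.\<close>

definition chain :: "(int \<Rightarrow> 's) \<Rightarrow> bool" where
  "chain \<Theta> \<longleftrightarrow> (\<forall>i. \<Theta> i \<in> rpart S 1 \<and> \<Theta> i \<otimes>\<^bsub>S\<^esub> \<Theta> (i + 1) = f)"

context
  fixes \<Theta> assumes chain: "chain \<Theta>"
begin

lemma chain_rpart: "\<Theta> i \<in> rpart S 1" and chain_mult: "\<Theta> i \<otimes>\<^bsub>S\<^esub> \<Theta> (i + 1) = f"
  using chain by (auto simp: chain_def)

lemma chain_closed [simp]: "\<Theta> i \<in> carrier S"
  using chain_rpart rpart_closed by blast

text \<open>Multiplying by \<Theta> (i - 1) from the left turns \<Theta> i into f, which is
  regular.\<close>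

lemma chain_inj:
  assumes "s \<in> carrier S" "\<Theta> i \<otimes>\<^bsub>S\<^esub> s = \<zero>\<^bsub>S\<^esub>"
  shows "s = \<zero>\<^bsub>S\<^esub>"
proof (rule f_left[OF assms(1)])
  have "f \<otimes>\<^bsub>S\<^esub> s = \<Theta> (i - 1) \<otimes>\<^bsub>S\<^esub> (\<Theta> i \<otimes>\<^bsub>S\<^esub> s)"
    using chain_mult[of "i - 1"] assms(1) by (simp flip: S.m_assoc)
  then show "f \<otimes>\<^bsub>S\<^esub> s = \<zero>\<^bsub>S\<^esub>" using assms by simp
qed

lemma chain_inj_right:
  assumes "s \<in> carrier S" "s \<otimes>\<^bsub>S\<^esub> \<Theta> i = \<zero>\<^bsub>S\<^esub>"
  shows "s = \<zero>\<^bsub>S\<^esub>"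
proof (rule f_right[OF assms(1)])
  have "s \<otimes>\<^bsub>S\<^esub> f = (s \<otimes>\<^bsub>S\<^esub> \<Theta> i) \<otimes>\<^bsub>S\<^esub> \<Theta> (i + 1)"
    using chain_mult[of i] assms(1) by (simp add: S.m_assoc)
  then show "s \<otimes>\<^bsub>S\<^esub> f = \<zero>\<^bsub>S\<^esub>" using assms by simp
qed

lemma chain_cancel: "s \<in> carrier S \<Longrightarrow> t \<in> carrier S \<Longrightarrow> \<Theta> i \<otimes>\<^bsub>S\<^esub> s = \<Theta> i \<otimes>\<^bsub>S\<^esub> t \<Longrightarrow> s = t"
  using chain_inj[of "s \<ominus>\<^bsub>S\<^esub> t" i]
  by (simp add: a_minus_def S.r_distr S.r_minus S.r_neg) (simp flip: a_minus_def add: S.minus_eq_zero_iff)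

lemma chain_cancel_right: "s \<in> carrier S \<Longrightarrow> t \<in> carrier S \<Longrightarrow> s \<otimes>\<^bsub>S\<^esub> \<Theta> i = t \<otimes>\<^bsub>S\<^esub> \<Theta> i \<Longrightarrow> s = t"
  using chain_inj_right[of "s \<ominus>\<^bsub>S\<^esub> t" i]
  by (simp add: a_minus_def S.l_distr S.l_minus S.r_neg) (simp flip: a_minus_def add: S.minus_eq_zero_iff)

text \<open>Lifted to \<open>S\<close>, vanishing of the product reads \<Theta> i s = f t = \<Theta>
  i \<Theta> (i + 1) t, and \<Theta> i cancels.\<close>

lemma chain_exact_right:
  assumes "a \<in> carrier A"
  shows "\<pi> (\<Theta> i) \<otimes>\<^bsub>A\<^esub> a = \<zero>\<^bsub>A\<^esub> \<longleftrightarrow> (\<exists>b\<in>carrier A. a = \<pi> (\<Theta> (i + 1)) \<otimes>\<^bsub>A\<^esub> b)"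
proof
  obtain s where s: "s \<in> carrier S" "a = \<pi> s" using assms pi_lift by blast
  assume "\<pi> (\<Theta> i) \<otimes>\<^bsub>A\<^esub> a = \<zero>\<^bsub>A\<^esub>"
  then have "\<pi> (\<Theta> i \<otimes>\<^bsub>S\<^esub> s) = \<zero>\<^bsub>A\<^esub>" using s by simp
  then obtain t where t: "t \<in> carrier S" "\<Theta> i \<otimes>\<^bsub>S\<^esub> s = f \<otimes>\<^bsub>S\<^esub> t"
    using pi_zero_iff[of "\<Theta> i \<otimes>\<^bsub>S\<^esub> s"] s(1) by (auto simp del: pi.hom_mult)
  then have "\<Theta> i \<otimes>\<^bsub>S\<^esub> s = \<Theta> i \<otimes>\<^bsub>S\<^esub> (\<Theta> (i + 1) \<otimes>\<^bsub>S\<^esub> t)" by (simp add: chain_mult flip: S.m_assoc)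
  then have "s = \<Theta> (i + 1) \<otimes>\<^bsub>S\<^esub> t" using s t by (intro chain_cancel[of s _ i]) auto
  then show "\<exists>b\<in>carrier A. a = \<pi> (\<Theta> (i + 1)) \<otimes>\<^bsub>A\<^esub> b" using s t by (intro bexI[of _ "\<pi> t"]) auto
next
  assume "\<exists>b\<in>carrier A. a = \<pi> (\<Theta> (i + 1)) \<otimes>\<^bsub>A\<^esub> b"
  then obtain b where b: "b \<in> carrier A" "a = \<pi> (\<Theta> (i + 1)) \<otimes>\<^bsub>A\<^esub> b" by blast
  then have "\<pi> (\<Theta> i) \<otimes>\<^bsub>A\<^esub> a = \<pi> (\<Theta> i \<otimes>\<^bsub>S\<^esub> \<Theta> (i + 1)) \<otimes>\<^bsub>A\<^esub> b" by (simp add: A.m_assoc)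
  then show "\<pi> (\<Theta> i) \<otimes>\<^bsub>A\<^esub> a = \<zero>\<^bsub>A\<^esub>" using b by (simp add: chain_mult pi_f del: pi.hom_mult)
qed

text \<open>Here the multiple f t has to be rewritten with f on the right, as \<tau> (-1) t times f,
  before \<Theta> i can be cancelled on the right; this is where normality enters.\<close>

lemma chain_exact_left:
  assumes "a \<in> carrier A"
  shows "a \<otimes>\<^bsub>A\<^esub> \<pi> (\<Theta> i) = \<zero>\<^bsub>A\<^esub> \<longleftrightarrow> (\<exists>b\<in>carrier A. a = b \<otimes>\<^bsub>A\<^esub> \<pi> (\<Theta> (i - 1)))"
proof
  have m: "\<Theta> (i - 1) \<otimes>\<^bsub>S\<^esub> \<Theta> i = f" using chain_mult[of "i - 1"] by simp
  {
    obtain s where s: "s \<in> carrier S" "a = \<pi> s" using assms pi_lift by blast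
    assume "a \<otimes>\<^bsub>A\<^esub> \<pi> (\<Theta> i) = \<zero>\<^bsub>A\<^esub>"
    then have "\<pi> (s \<otimes>\<^bsub>S\<^esub> \<Theta> i) = \<zero>\<^bsub>A\<^esub>" using s by simp
    then obtain t where t: "t \<in> carrier S" "s \<otimes>\<^bsub>S\<^esub> \<Theta> i = f \<otimes>\<^bsub>S\<^esub> t"
      using pi_zero_iff[of "s \<otimes>\<^bsub>S\<^esub> \<Theta> i"] s(1) by (auto simp del: pi.hom_mult)
    then have "s \<otimes>\<^bsub>S\<^esub> \<Theta> i = (\<tau> (- 1) t \<otimes>\<^bsub>S\<^esub> \<Theta> (i - 1)) \<otimes>\<^bsub>S\<^esub> \<Theta> i" by (simp add: m f_normal S.m_assoc)
    then have "s = \<tau> (- 1) t \<otimes>\<^bsub>S\<^esub> \<Theta> (i - 1)" using s t by (intro chain_cancel_right[of s _ i]) auto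
    then show "\<exists>b\<in>carrier A. a = b \<otimes>\<^bsub>A\<^esub> \<pi> (\<Theta> (i - 1))" using s t by (intro bexI[of _ "\<pi> (\<tau> (- 1) t)"]) auto
  next
    assume "\<exists>b\<in>carrier A. a = b \<otimes>\<^bsub>A\<^esub> \<pi> (\<Theta> (i - 1))"
    then obtain b where b: "b \<in> carrier A" "a = b \<otimes>\<^bsub>A\<^esub> \<pi> (\<Theta> (i - 1))" by blast
    then have "a \<otimes>\<^bsub>A\<^esub> \<pi> (\<Theta> i) = b \<otimes>\<^bsub>A\<^esub> \<pi> (\<Theta> (i - 1) \<otimes>\<^bsub>S\<^esub> \<Theta> i)" by (simp add: A.m_assoc)
    then show "a \<otimes>\<^bsub>A\<^esub> \<pi> (\<Theta> i) = \<zero>\<^bsub>A\<^esub>" using b by (simp add: m pi_f del: pi.hom_mult)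
  }
qed

text \<open>The right ideal generated by \<Theta> i contains f S, so membership modulo f can be
  tested in \<open>S\<close>. Over \<open>S\<close> the cyclic module defined by \<Theta> 0 is
  therefore S/(\<Theta> 0)S.\<close>

lemma chain_ideal_lift:
  assumes "s \<in> carrier S"
  shows "(\<exists>b\<in>carrier A. \<pi> s = \<pi> (\<Theta> i) \<otimes>\<^bsub>A\<^esub> b) \<longleftrightarrow> (\<exists>t\<in>carrier S. s = \<Theta> i \<otimes>\<^bsub>S\<^esub> t)"
proof
  assume "\<exists>b\<in>carrier A. \<pi> s = \<pi> (\<Theta> i) \<otimes>\<^bsub>A\<^esub> b"
  then obtain b where b: "b \<in> carrier S" "\<pi> s = \<pi> (\<Theta> i) \<otimes>\<^bsub>A\<^esub> \<pi> b" using pi_lift by blast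
  then have "\<pi> (s \<ominus>\<^bsub>S\<^esub> \<Theta> i \<otimes>\<^bsub>S\<^esub> b) = \<zero>\<^bsub>A\<^esub>" using assms by (simp add: a_minus_def A.r_neg)
  then obtain t where t: "t \<in> carrier S" "s \<ominus>\<^bsub>S\<^esub> \<Theta> i \<otimes>\<^bsub>S\<^esub> b = f \<otimes>\<^bsub>S\<^esub> t"
    using pi_zero_iff[of "s \<ominus>\<^bsub>S\<^esub> \<Theta> i \<otimes>\<^bsub>S\<^esub> b"] assms b by auto
  have "s = (s \<ominus>\<^bsub>S\<^esub> \<Theta> i \<otimes>\<^bsub>S\<^esub> b) \<oplus>\<^bsub>S\<^esub> \<Theta> i \<otimes>\<^bsub>S\<^esub> b"
    using assms b by (simp add: S.minus_eq S.a_assoc S.l_neg)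
  also have "\<dots> = \<Theta> i \<otimes>\<^bsub>S\<^esub> (\<Theta> (i + 1) \<otimes>\<^bsub>S\<^esub> t \<oplus>\<^bsub>S\<^esub> b)"
    using t b by (simp add: S.r_distr chain_mult flip: S.m_assoc)
  finally show "\<exists>t\<in>carrier S. s = \<Theta> i \<otimes>\<^bsub>S\<^esub> t"
    using t b by (intro bexI[of _ "\<Theta> (i + 1) \<otimes>\<^bsub>S\<^esub> t \<oplus>\<^bsub>S\<^esub> b"]) simp_all
next
  assume "\<exists>t\<in>carrier S. s = \<Theta> i \<otimes>\<^bsub>S\<^esub> t"
  then obtain t where "t \<in> carrier S" "s = \<Theta> i \<otimes>\<^bsub>S\<^esub> t" by blast
  then show "\<exists>b\<in>carrier A. \<pi> s = \<pi> (\<Theta> i) \<otimes>\<^bsub>A\<^esub> b" by (intro bexI[of _ "\<pi> t"]) simp_all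
qed

lemma chain_TR:
  fixes N :: "('a, 'm, 'z) gmod_scheme"
  assumes N: "right_module A N" and g: "g \<in> carrier N"
    and gen: "\<And>x. x \<in> carrier N \<Longrightarrow> \<exists>a\<in>carrier A. x = g \<triangleleft>\<^bsub>N\<^esub> a"
    and ker: "\<And>a. a \<in> carrier A \<Longrightarrow> g \<triangleleft>\<^bsub>N\<^esub> a = \<zero>\<^bsub>N\<^esub> \<longleftrightarrow> (\<exists>b\<in>carrier A. a = \<pi> (\<Theta> 0) \<otimes>\<^bsub>A\<^esub> b)"
  shows "totally_reflexive A N" "finite_projdim S (restrict_scalars \<pi> N)"
proof -
  show "totally_reflexive A N"
    by (rule totally_reflexive_cyclic[OF N g, where \<theta> = "\<lambda>i. \<pi> (\<Theta> i)"])
       (simp_all add: gen ker chain_exact_right chain_exact_left)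
  show "finite_projdim S (restrict_scalars \<pi> N)"
  proof (rule finite_projdim_cyclic[where g = g and t = "\<Theta> 0"])
    show "right_module S (restrict_scalars \<pi> N)"
      by (rule right_module_restrict_scalars[OF S.ring_axioms pi_hom N])
    show "\<exists>s\<in>carrier S. x = g \<triangleleft>\<^bsub>restrict_scalars \<pi> N\<^esub> s" if "x \<in> carrier (restrict_scalars \<pi> N)" for x
      using gen[of x] pi_lift that by fastforce
    show "g \<triangleleft>\<^bsub>restrict_scalars \<pi> N\<^esub> s = \<zero>\<^bsub>restrict_scalars \<pi> N\<^esub> \<longleftrightarrow> (\<exists>t\<in>carrier S. s = \<Theta> 0 \<otimes>\<^bsub>S\<^esub> t)"
      if "s \<in> carrier S" for s
      using that by (simp add: ker chain_ideal_lift)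
  qed (use g chain_inj in auto)
qed

end

end

section \<open>Graded free modules and their homogeneous maps\<close>

section \<open>Graded free modules\<close>

lemma components_natural:
  assumes M: "abelian_group M" "components M P c" and N: "abelian_group N" "components N Q c'"
    and h: "h \<in> carrier M \<rightarrow> carrier N" "\<And>x y. x \<in> carrier M \<Longrightarrow> y \<in> carrier M \<Longrightarrow> h (x \<oplus>\<^bsub>M\<^esub> y) = h x \<oplus>\<^bsub>N\<^esub> h y"
    and hP: "\<And>i. h ` P i \<subseteq> Q i" and x: "x \<in> carrier M"
  shows "c' (h x) j = h (c x j)"
proof -
  interpret M: abelian_group M by fact
  interpret N: abelian_group N by fact
  have PM: "P i \<subseteq> carrier M" for i using M(2) additive_subgroup.a_subset unfolding components_def by blast
  have QN: "Q i \<subseteq> carrier N" for i using N(2) additive_subgroup.a_subset unfolding components_def by blast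
  have cP: "c x i \<in> P i" for i using M(2) x by (simp add: components_def)
  then have cM: "c x i \<in> carrier M" for i using PM by blast
  have hc: "h (c x i) \<in> Q i" for i using cP hP by blast
  have c'Q: "c' y i \<in> carrier N" if "y \<in> carrier N" for y i
    using N(2) QN[of i] that unfolding components_def by blast
  let ?I = "{i. c x i \<noteq> \<zero>\<^bsub>M\<^esub>}"
  have fin: "finite ?I" and sum: "x = (\<Oplus>\<^bsub>M\<^esub>i\<in>?I. c x i)"
    using M(2) x unfolding components_def by blast+
  have h0: "h \<zero>\<^bsub>M\<^esub> = \<zero>\<^bsub>N\<^esub>"
    using M.additive_map_finsum[OF N(1) h, of "\<lambda>i. \<zero>\<^bsub>M\<^esub>" "{}"] by simp
  have "h x = (\<Oplus>\<^bsub>N\<^esub>i\<in>?I. h (c x i))"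
    using M.additive_map_finsum[OF N(1) h, of "c x" ?I] cM fin sum by simp
  then have "c' (h x) j = c' (\<Oplus>\<^bsub>N\<^esub>i\<in>?I. h (c x i)) j" by simp
  also have "\<dots> = (\<Oplus>\<^bsub>N\<^esub>i\<in>?I. c' (h (c x i)) j)"
    using N(2) c'Q h(1) cM fin
    by (intro N.additive_map_finsum[OF N(1)]) (auto simp: components_def)
  also have "\<dots> = (\<Oplus>\<^bsub>N\<^esub>i\<in>?I. if j = i then h (c x i) else \<zero>\<^bsub>N\<^esub>)"
    using N(2) hc QN h(1) cM by (intro N.finsum_cong') (auto simp: components_def)
  also have "\<dots> = h (c x j)"
  proof (cases "c x j = \<zero>\<^bsub>M\<^esub>")
    case True
    then have "(\<Oplus>\<^bsub>N\<^esub>i\<in>?I. if j = i then h (c x i) else \<zero>\<^bsub>N\<^esub>) = (\<Oplus>\<^bsub>N\<^esub>i\<in>?I. \<zero>\<^bsub>N\<^esub>)"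
      by (intro N.finsum_cong') auto
    then show ?thesis using True h0 by simp
  next
    case False
    then show ?thesis using fin cM h(1) by (intro N.finsum_singleton) auto
  qed
  finally show ?thesis .
qed

text \<open>Graded maps commute with the projections, so the component of \<open>x\<close> in degree
  \<open>d\<close> has the same image as \<open>x\<close>. This recovers degrees of elements that
  are known only through an injective graded map.\<close>

lemma components_reflect:
  assumes M: "abelian_group M" "components M P c" and N: "abelian_group N" "components N Q c'"
    and h: "h \<in> carrier M \<rightarrow> carrier N" "\<And>x y. x \<in> carrier M \<Longrightarrow> y \<in> carrier M \<Longrightarrow> h (x \<oplus>\<^bsub>M\<^esub> y) = h x \<oplus>\<^bsub>N\<^esub> h y"
    and hP: "\<And>i. h ` P i \<subseteq> Q i" and inj: "inj_on h (carrier M)"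
    and x: "x \<in> carrier M" "h x \<in> Q d"
  shows "x \<in> P d"
proof -
  have cP: "c x d \<in> P d" using M(2) x by (simp add: components_def)
  then have cM: "c x d \<in> carrier M" using M(2) additive_subgroup.a_subset unfolding components_def by blast
  have "h (c x d) = c' (h x) d" by (rule components_natural[OF M N h hP x(1), symmetric])
  also have "\<dots> = h x" using N(2) x(2) by (simp add: components_def)
  finally have "c x d = x" using inj cM x(1) by (simp add: inj_on_eq_iff)
  then show ?thesis using cP by simp
qed

lemma graded_free_simps:
  "carrier (graded_free R r m) = ({..<r} \<rightarrow>\<^sub>E carrier R)"
  "\<zero>\<^bsub>graded_free R r m\<^esub> = (\<lambda>s\<in>{..<r}. \<zero>\<^bsub>R\<^esub>)"
  "u \<oplus>\<^bsub>graded_free R r m\<^esub> v = (\<lambda>s\<in>{..<r}. u s \<oplus>\<^bsub>R\<^esub> v s)"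
  "u \<triangleleft>\<^bsub>graded_free R r m\<^esub> a = (\<lambda>s\<in>{..<r}. u s \<otimes>\<^bsub>R\<^esub> a)"
  "mpart (graded_free R r m) i = (\<Pi>\<^sub>E s\<in>{..<r}. rpart R (i - m s))"
  by (simp_all add: graded_free_def twist_def)

lemma graded_free_apply:
  "s < r \<Longrightarrow> \<zero>\<^bsub>graded_free R r m\<^esub> s = \<zero>\<^bsub>R\<^esub>"
  "s < r \<Longrightarrow> (u \<oplus>\<^bsub>graded_free R r m\<^esub> v) s = u s \<oplus>\<^bsub>R\<^esub> v s"
  "s < r \<Longrightarrow> (u \<triangleleft>\<^bsub>graded_free R r m\<^esub> a) s = u s \<otimes>\<^bsub>R\<^esub> a"
  by (simp_all add: graded_free_simps)

lemma graded_free_ext: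
  "u \<in> carrier (graded_free R r m) \<Longrightarrow> v \<in> carrier (graded_free R r m) \<Longrightarrow> (\<And>s. s < r \<Longrightarrow> u s = v s) \<Longrightarrow> u = v"
  unfolding graded_free_simps by (rule PiE_ext) auto

lemma right_module_graded_free:
  assumes "ring R"
  shows "right_module R (graded_free R r m)"
proof -
  interpret ring R by fact
  let ?F = "graded_free R r m"
  have "abelian_group ?F"
  proof (rule abelian_groupI)
    fix u assume u: "u \<in> carrier ?F"
    show "\<exists>v\<in>carrier ?F. v \<oplus>\<^bsub>?F\<^esub> u = \<zero>\<^bsub>?F\<^esub>"
      using u by (intro bexI[of _ "\<lambda>s\<in>{..<r}. \<ominus>\<^bsub>R\<^esub> u s"]) (auto simp: graded_free_simps l_neg PiE_iff intro!: restrict_ext)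
    show "\<zero>\<^bsub>?F\<^esub> \<oplus>\<^bsub>?F\<^esub> u = u"
      using u by (auto simp: graded_free_simps PiE_iff extensional_def)
  qed (auto simp: graded_free_simps PiE_iff a_ac intro!: restrict_ext)
  then show ?thesis
  proof (intro right_module.intro right_module_axioms.intro assms)
    show "u \<triangleleft>\<^bsub>?F\<^esub> \<one>\<^bsub>R\<^esub> = u" if "u \<in> carrier ?F" for u
      using that by (auto simp: graded_free_simps PiE_iff extensional_def)
  qed (auto simp: graded_free_simps PiE_iff l_distr r_distr m_assoc intro!: restrict_ext)
qed

lemma graded_free_minus_apply:
  assumes "ring R" "u \<in> carrier (graded_free R r m)" "s < r"
  shows "(\<ominus>\<^bsub>graded_free R r m\<^esub> u) s = \<ominus>\<^bsub>R\<^esub> u s"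
proof -
  interpret ring R by fact
  interpret F: right_module R "graded_free R r m" by (rule right_module_graded_free[OF assms(1)])
  have "\<ominus>\<^bsub>graded_free R r m\<^esub> u = (\<lambda>s\<in>{..<r}. \<ominus>\<^bsub>R\<^esub> u s)"
    using assms(2) by (intro F.M.minus_equality) (auto simp: graded_free_simps l_neg PiE_iff intro!: restrict_ext)
  then show ?thesis using assms(3) by simp
qed

lemma graded_free_finsum_apply:
  assumes "ring R" "finite I" "\<And>i. i \<in> I \<Longrightarrow> f i \<in> carrier (graded_free R r m)" "s < r"
  shows "(\<Oplus>\<^bsub>graded_free R r m\<^esub>i\<in>I. f i) s = (\<Oplus>\<^bsub>R\<^esub>i\<in>I. f i s)"
proof -
  interpret ring R by fact
  interpret F: right_module R "graded_free R r m" by (rule right_module_graded_free[OF assms(1)])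
  have "(\<lambda>u. u s) (\<Oplus>\<^bsub>graded_free R r m\<^esub>i\<in>I. f i) = (\<Oplus>\<^bsub>R\<^esub>i\<in>I. (\<lambda>u. u s) (f i))"
    using assms(2-4) by (intro F.M.additive_map_finsum abelian_group_axioms) (auto simp: graded_free_simps)
  then show ?thesis .
qed

lemma components_graded_free:
  assumes "ring R" and c: "components R (rpart R) c"
  shows "components (graded_free R r m) (mpart (graded_free R r m)) (\<lambda>v i. \<lambda>s\<in>{..<r}. c (v s) (i - m s))"
proof -
  interpret ring R by fact
  let ?F = "graded_free R r m" and ?c = "\<lambda>v i. \<lambda>s\<in>{..<r}. c (v s) (i - m s)"
  interpret F: right_module R ?F by (rule right_module_graded_free[OF assms(1)])
  have sub: "additive_subgroup (rpart R i) R" for i using c by (simp add: components_def)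
  have closed: "x \<in> carrier R" if "x \<in> rpart R i" for x i using additive_subgroup.a_subset[OF sub] that by blast
  have cr: "c x i \<in> rpart R i" if "x \<in> carrier R" for x i using c that by (simp add: components_def)
  have c0: "c \<zero>\<^bsub>R\<^esub> i = \<zero>\<^bsub>R\<^esub>" for i
    using c additive_subgroup.zero_closed[OF sub[of i]] by (simp add: components_def)
  have ccl: "?c v i \<in> carrier ?F" if "v \<in> carrier ?F" for v i
    using that closed[OF cr] by (auto simp: graded_free_simps)
  have mp: "u \<in> carrier ?F" if "u \<in> mpart ?F i" for u i
    using that closed by (auto simp: graded_free_simps PiE_iff)
  show ?thesis
    unfolding components_def
  proof (intro conjI allI ballI)
    show "additive_subgroup (mpart ?F i) ?F" for i
    proof (rule additive_subgroupI, rule F.M.add.subgroupI)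
      show "mpart ?F i \<subseteq> carrier ?F" using mp by blast
      have "\<zero>\<^bsub>?F\<^esub> \<in> mpart ?F i" using additive_subgroup.zero_closed[OF sub] by (auto simp: graded_free_simps)
      then show "mpart ?F i \<noteq> {}" by blast
      show "u \<oplus>\<^bsub>?F\<^esub> v \<in> mpart ?F i" if "u \<in> mpart ?F i" "v \<in> mpart ?F i" for u v
        using that additive_subgroup.a_closed[OF sub] by (auto simp: graded_free_simps PiE_iff)
      show "\<ominus>\<^bsub>?F\<^esub> u \<in> mpart ?F i" if u: "u \<in> mpart ?F i" for u
      proof -
        have uc: "u \<in> carrier ?F" using u by (rule mp)
        have "\<ominus>\<^bsub>R\<^esub> u s \<in> rpart R (i - m s)" if "s < r" for s
          using u that additive_subgroup.a_inv_closed[OF sub] 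
          by (auto simp: graded_free_simps PiE_iff)
        then show ?thesis
          using F.M.a_inv_closed[OF uc] graded_free_minus_apply[OF assms(1) uc]
          by (simp add: graded_free_simps PiE_iff)
      qed
    qed
    show "?c v i \<in> mpart ?F i" if "v \<in> carrier ?F" for v i
      using that cr by (auto simp: graded_free_simps)
    show "?c (u \<oplus>\<^bsub>?F\<^esub> v) i = ?c u i \<oplus>\<^bsub>?F\<^esub> ?c v i" if "u \<in> carrier ?F" "v \<in> carrier ?F" for u v i
      using that c by (auto simp: graded_free_simps components_def PiE_iff intro!: restrict_ext)
    show "?c u i = (if i = j then u else \<zero>\<^bsub>?F\<^esub>)" if u: "u \<in> mpart ?F j" for u i j
    proof (rule graded_free_ext[of _ R r m])
      have uc: "u \<in> carrier ?F" using u by (rule mp)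
      show "?c u i \<in> carrier ?F" by (rule ccl[OF uc])
      show "(if i = j then u else \<zero>\<^bsub>?F\<^esub>) \<in> carrier ?F" using uc by simp
      show "?c u i s = (if i = j then u else \<zero>\<^bsub>?F\<^esub>) s" if "s < r" for s
      proof -
        have "u s \<in> rpart R (j - m s)" using u that by (auto simp: graded_free_simps)
        then have "c (u s) (i - m s) = (if i - m s = j - m s then u s else \<zero>\<^bsub>R\<^esub>)"
          using c unfolding components_def by blast
        then show ?thesis using that by (simp add: graded_free_simps)
      qed
    qed
    fix v assume v: "v \<in> carrier ?F"
    have vs: "v s \<in> carrier R" if "s < r" for s using v that by (auto simp: graded_free_simps)
    have fs: "finite {i. c (v s) i \<noteq> \<zero>\<^bsub>R\<^esub>}" and ss: "v s = (\<Oplus>\<^bsub>R\<^esub>i\<in>{i. c (v s) i \<noteq> \<zero>\<^bsub>R\<^esub>}. c (v s) i)" if "s < r" for s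
      using c vs[OF that] unfolding components_def by blast+
    let ?I = "{i. ?c v i \<noteq> \<zero>\<^bsub>?F\<^esub>}"
    have nz: "?c v i \<noteq> \<zero>\<^bsub>?F\<^esub> \<longleftrightarrow> (\<exists>s<r. c (v s) (i - m s) \<noteq> \<zero>\<^bsub>R\<^esub>)" for i
      by (auto simp: graded_free_simps fun_eq_iff)
    have "?I \<subseteq> (\<Union>s<r. (\<lambda>i. i + m s) ` {i. c (v s) i \<noteq> \<zero>\<^bsub>R\<^esub>})"
    proof
      fix i assume "i \<in> ?I"
      then obtain s where "s < r" "c (v s) (i - m s) \<noteq> \<zero>\<^bsub>R\<^esub>" using nz by blast
      then show "i \<in> (\<Union>s<r. (\<lambda>i. i + m s) ` {i. c (v s) i \<noteq> \<zero>\<^bsub>R\<^esub>})"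
        by (intro UN_I[of s] image_eqI[of _ _ "i - m s"]) auto
    qed
    then show fin: "finite ?I" by (rule finite_subset) (simp add: fs)
    have cvc: "?c v i \<in> carrier ?F" for i by (rule ccl[OF v])
    show "v = (\<Oplus>\<^bsub>?F\<^esub>i\<in>?I. ?c v i)"
    proof (rule graded_free_ext[OF v])
      show "(\<Oplus>\<^bsub>?F\<^esub>i\<in>?I. ?c v i) \<in> carrier ?F" using cvc by (intro F.M.finsum_closed) auto
      fix s assume s: "s < r"
      have cc: "c (v s) i \<in> carrier R" for i using closed[OF cr[OF vs[OF s]]] .
      have "(\<Oplus>\<^bsub>?F\<^esub>i\<in>?I. ?c v i) s = (\<Oplus>\<^bsub>R\<^esub>i\<in>?I. ?c v i s)"
        by (rule graded_free_finsum_apply[OF assms(1) fin cvc s])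
      also have "\<dots> = (\<Oplus>\<^bsub>R\<^esub>i\<in>?I. c (v s) (i - m s))" using s by simp
      also have "\<dots> = (\<Oplus>\<^bsub>R\<^esub>j\<in>(\<lambda>i. i - m s) ` ?I. c (v s) j)"
        by (rule finsum_reindex[symmetric]) (use cc in \<open>auto simp: inj_on_def\<close>)
      \<comment> \<open>The degrees occurring in the whole vector, shifted by \<open>m s\<close>,
        include those of its coordinate \<open>s\<close>; the additional summands are zero.\<close>
      also have "\<dots> = (\<Oplus>\<^bsub>R\<^esub>j\<in>{i. c (v s) i \<noteq> \<zero>\<^bsub>R\<^esub>}. c (v s) j)"
      proof (rule add.finprod_mono_neutral_cong_left[symmetric])
        show "{i. c (v s) i \<noteq> \<zero>\<^bsub>R\<^esub>} \<subseteq> (\<lambda>i. i - m s) ` ?I"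
        proof
          fix i assume i: "i \<in> {i. c (v s) i \<noteq> \<zero>\<^bsub>R\<^esub>}"
          then have "?c v (i + m s) \<noteq> \<zero>\<^bsub>?F\<^esub>" using s nz[of "i + m s"] by auto
          then show "i \<in> (\<lambda>i. i - m s) ` ?I" by (intro image_eqI[of _ _ "i + m s"]) auto
        qed
      qed (use fin cc in auto)
      finally show "v s = (\<Oplus>\<^bsub>?F\<^esub>i\<in>?I. ?c v i) s" using ss[OF s] by simp
    qed
  qed
qed

lemma graded_right_module_graded_free:
  assumes "ring R" and c: "components R (rpart R) c"
    and mult: "\<And>s t i j. s \<in> rpart R i \<Longrightarrow> t \<in> rpart R j \<Longrightarrow> s \<otimes>\<^bsub>R\<^esub> t \<in> rpart R (i + j)"
  shows "graded_right_module R (graded_free R r m)"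
proof (intro graded_right_module.intro graded_right_module_axioms.intro)
  let ?F = "graded_free R r m"
  show F: "right_module R ?F" by (rule right_module_graded_free[OF assms(1)])
  note cF = components_graded_free[OF assms(1) c, of r m]
  show "additive_subgroup (mpart ?F i) ?F" for i using cF by (simp add: components_def)
  show "\<exists>!c. (\<forall>i. c i \<in> mpart ?F i) \<and> finite {i. c i \<noteq> \<zero>\<^bsub>?F\<^esub>} \<and> x = (\<Oplus>\<^bsub>?F\<^esub>i\<in>{i. c i \<noteq> \<zero>\<^bsub>?F\<^esub>}. c i)"
    if "x \<in> carrier ?F" for x
    by (rule components_unique[OF right_module.axioms(2)[OF F] cF that])
  show "x \<triangleleft>\<^bsub>?F\<^esub> a \<in> mpart ?F (i + j)" if "x \<in> mpart ?F i" "a \<in> rpart R j" for x a i j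
  proof -
    have "x s \<otimes>\<^bsub>R\<^esub> a \<in> rpart R (i + j - m s)" if "s < r" for s
      using mult[of "x s" "i - m s" a j] \<open>x \<in> _\<close> \<open>a \<in> _\<close> that by (auto simp: graded_free_simps PiE_iff algebra_simps)
    then show ?thesis by (simp add: graded_free_simps)
  qed
qed

definition lincomb :: "nat \<Rightarrow> ('a, 'm, 'z) rmod_scheme \<Rightarrow> (nat \<Rightarrow> 'm) \<Rightarrow> (nat \<Rightarrow> 'a) \<Rightarrow> 'm" where
  "lincomb r X e v = (\<Oplus>\<^bsub>X\<^esub>j\<in>{..<r}. e j \<triangleleft>\<^bsub>X\<^esub> v j)"

definition unit_vec :: "('a, 'x) ring_scheme \<Rightarrow> nat \<Rightarrow> nat \<Rightarrow> 'a \<Rightarrow> nat \<Rightarrow> 'a" where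
  "unit_vec R r i s = (\<lambda>j\<in>{..<r}. if j = i then s else \<zero>\<^bsub>R\<^esub>)"

context right_module
begin

lemma ract_finsum:
  assumes "finite I" "f \<in> I \<rightarrow> carrier M" "a \<in> carrier R"
  shows "(\<Oplus>\<^bsub>M\<^esub>i\<in>I. f i) \<triangleleft>\<^bsub>M\<^esub> a = (\<Oplus>\<^bsub>M\<^esub>i\<in>I. f i \<triangleleft>\<^bsub>M\<^esub> a)"
  using assms by (intro M.additive_map_finsum M.abelian_group_axioms) (auto simp: ract_closed ract_add_left)

lemma lincomb_unit_vec:
  assumes "\<And>j. j < r \<Longrightarrow> e j \<in> carrier M" "i < r" "s \<in> carrier R"
  shows "lincomb r M e (unit_vec R r i s) = e i \<triangleleft>\<^bsub>M\<^esub> s"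
proof -
  have "lincomb r M e (unit_vec R r i s) = (\<Oplus>\<^bsub>M\<^esub>j\<in>{..<r}. if i = j then e j \<triangleleft>\<^bsub>M\<^esub> s else \<zero>\<^bsub>M\<^esub>)"
    unfolding lincomb_def using assms by (intro M.finsum_cong') (auto simp: unit_vec_def ract_closed)
  also have "\<dots> = e i \<triangleleft>\<^bsub>M\<^esub> s" using assms by (intro M.finsum_singleton) (auto simp: ract_closed)
  finally show ?thesis .
qed

end

lemma lincomb_right_hom:
  fixes R :: "('a, 'x) gring_scheme" and M :: "('a, 'm, 'z) rmod_scheme"
  assumes M: "right_module R M" and e: "\<And>j. j < r \<Longrightarrow> e j \<in> carrier M"
  shows "lincomb r M e \<in> right_hom R (graded_free R r m) M"
proof (rule right_homI)
  interpret right_module R M by (rule M)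
  fix u assume u: "u \<in> carrier (graded_free R r m)"
  then have uc: "u j \<in> carrier R" if "j < r" for j using that by (auto simp: graded_free_simps)
  then show "lincomb r M e u \<in> carrier M" using e by (auto simp: lincomb_def intro!: M.finsum_closed ract_closed)
  { fix v assume v: "v \<in> carrier (graded_free R r m)"
    then have vc: "v j \<in> carrier R" if "j < r" for j using that by (auto simp: graded_free_simps)
    have "lincomb r M e (u \<oplus>\<^bsub>graded_free R r m\<^esub> v) = (\<Oplus>\<^bsub>M\<^esub>j\<in>{..<r}. e j \<triangleleft>\<^bsub>M\<^esub> u j \<oplus>\<^bsub>M\<^esub> e j \<triangleleft>\<^bsub>M\<^esub> v j)"
      unfolding lincomb_def using e uc vc by (intro M.finsum_cong') (auto simp: graded_free_simps ract_add_right ract_closed)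
    then show "lincomb r M e (u \<oplus>\<^bsub>graded_free R r m\<^esub> v) = lincomb r M e u \<oplus>\<^bsub>M\<^esub> lincomb r M e v"
      unfolding lincomb_def using e uc vc by (simp add: M.finsum_addf Pi_iff ract_closed) }
  { fix a assume a: "a \<in> carrier R"
    have "lincomb r M e u \<triangleleft>\<^bsub>M\<^esub> a = (\<Oplus>\<^bsub>M\<^esub>j\<in>{..<r}. (e j \<triangleleft>\<^bsub>M\<^esub> u j) \<triangleleft>\<^bsub>M\<^esub> a)"
      unfolding lincomb_def using e uc a by (intro ract_finsum) (auto simp: ract_closed)
    also have "\<dots> = lincomb r M e (u \<triangleleft>\<^bsub>graded_free R r m\<^esub> a)"
      unfolding lincomb_def using e uc a by (intro M.finsum_cong') (auto simp: graded_free_simps ract_assoc ract_closed)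
    finally show "lincomb r M e (u \<triangleleft>\<^bsub>graded_free R r m\<^esub> a) = lincomb r M e u \<triangleleft>\<^bsub>M\<^esub> a" by simp }
qed

lemma unit_vec_closed:
  assumes "ring R" "s \<in> carrier R"
  shows "unit_vec R r i s \<in> carrier (graded_free R r m)"
proof -
  interpret ring R by fact
  show ?thesis using assms(2) by (auto simp: unit_vec_def graded_free_simps)
qed

lemma right_hom_lincomb:
  assumes M: "right_module R M" and N: "right_module R N" and h: "h \<in> right_hom R M N"
    and e: "\<And>j. j < r \<Longrightarrow> e j \<in> carrier M" and v: "\<And>j. j < r \<Longrightarrow> v j \<in> carrier R"
  shows "h (lincomb r M e v) = lincomb r N (\<lambda>j. h (e j)) v"
proof -
  interpret M: right_module R M by fact
  interpret N: right_module R N by fact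
  have "h (lincomb r M e v) = (\<Oplus>\<^bsub>N\<^esub>j\<in>{..<r}. h (e j \<triangleleft>\<^bsub>M\<^esub> v j))"
    unfolding lincomb_def using e v right_homD[OF h]
    by (intro M.M.additive_map_finsum N.M.abelian_group_axioms) (auto simp: M.ract_closed)
  also have "\<dots> = lincomb r N (\<lambda>j. h (e j)) v"
    unfolding lincomb_def using e v right_homD[OF h]
    by (intro N.M.finsum_cong') (auto simp: N.ract_closed)
  finally show ?thesis .
qed

section \<open>The free presentation of a filtered module over S\<close>

section \<open>The matrix factorization of a filtered module\<close>

text \<open>The shifts enter only \<open>mpart\<close>, so ungraded homomorphisms do not see them;
  linearity and degrees can be treated separately.\<close>

lemma right_hom_graded_free_twist:
  "right_hom S (graded_free S r m) (graded_free S r' m') = right_hom S (graded_free S r k) (graded_free S r' k')"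
  by (simp add: right_hom_def graded_free_simps)

text \<open>The form in which an extension is used: \<open>e i\<close> is a degree-zero lift of the
  generator of the layer between \<open>L i\<close> and \<open>L (Suc i)\<close>, and
  \<open>ann\<close> identifies this layer with \<open>A\<close> modulo the right ideal generated by
  the image of \<Theta> i 0. Of the two generation conditions, \<open>gen\<close> makes the free
  cover surjective, and \<open>gen_mpart\<close> controls degrees.\<close>

locale filtered_module = hypersurface S A \<pi> f \<tau> cS + M: right_module A M
  for S :: "'s gring" and A :: "'a gring" and \<pi> f \<tau> cS and M :: "('a, 'm) gmod" +
  fixes L :: "nat \<Rightarrow> 'm set" and r :: nat and e :: "nat \<Rightarrow> 'm" and \<Theta> :: "nat \<Rightarrow> int \<Rightarrow> 's"
  assumes mpart_subgroup: "additive_subgroup (mpart M d) M"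
    and mpart_ract: "x \<in> mpart M d \<Longrightarrow> a \<in> rpart A d' \<Longrightarrow> x \<triangleleft>\<^bsub>M\<^esub> a \<in> mpart M (d + d')"
    and L_0: "L 0 = carrier M" and L_r: "L r = {\<zero>\<^bsub>M\<^esub>}"
    and L_sub: "i \<le> r \<Longrightarrow> rsubmodule A M (L i)" and L_Suc: "i < r \<Longrightarrow> L (Suc i) \<subseteq> L i"
    and e_L: "i < r \<Longrightarrow> e i \<in> L i" and e_mpart: "i < r \<Longrightarrow> e i \<in> mpart M 0"
    and gen: "i < r \<Longrightarrow> x \<in> L i \<Longrightarrow> \<exists>a\<in>carrier A. x \<ominus>\<^bsub>M\<^esub> e i \<triangleleft>\<^bsub>M\<^esub> a \<in> L (Suc i)"
    and gen_mpart: "i < r \<Longrightarrow> x \<in> L i \<Longrightarrow> x \<in> mpart M d \<Longrightarrow> \<exists>a\<in>rpart A d. x \<ominus>\<^bsub>M\<^esub> e i \<triangleleft>\<^bsub>M\<^esub> a \<in> L (Suc i)"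
    and ann: "i < r \<Longrightarrow> a \<in> carrier A \<Longrightarrow> e i \<triangleleft>\<^bsub>M\<^esub> a \<in> L (Suc i) \<longleftrightarrow> (\<exists>b\<in>carrier A. a = \<pi> (\<Theta> i 0) \<otimes>\<^bsub>A\<^esub> b)"
    and chains: "i < r \<Longrightarrow> chain (\<Theta> i)"
begin

abbreviation F :: "int \<Rightarrow> ('s, nat \<Rightarrow> 's) gmod" where
  "F d \<equiv> graded_free S r (\<lambda>_. d)"

abbreviation X where "X \<equiv> restrict_scalars \<pi> M"

sublocale X: right_module S X
  by (rule right_module_restrict_scalars[OF S.ring_axioms pi_hom M.right_module_axioms])

sublocale F: right_module S "F d" for d
  by (rule right_module_graded_free[OF S.ring_axioms])

lemma F_carrier: "v \<in> carrier (F d) \<longleftrightarrow> v \<in> {..<r} \<rightarrow>\<^sub>E carrier S"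
  by (simp add: graded_free_simps)

lemma F_apply: "v \<in> carrier (F d) \<Longrightarrow> j < r \<Longrightarrow> v j \<in> carrier S"
  by (auto simp: graded_free_simps)

lemma e_closed: "i < r \<Longrightarrow> e i \<in> carrier M"
  using e_mpart additive_subgroup.a_subset[OF mpart_subgroup] by blast

lemma L_subgroup: "i \<le> r \<Longrightarrow> additive_subgroup (L i) M"
  and L_ract: "i \<le> r \<Longrightarrow> x \<in> L i \<Longrightarrow> a \<in> carrier A \<Longrightarrow> x \<triangleleft>\<^bsub>M\<^esub> a \<in> L i"
  using L_sub by (auto simp: rsubmodule_def)

lemma L_closed: "i \<le> r \<Longrightarrow> x \<in> L i \<Longrightarrow> x \<in> carrier M"
  using L_subgroup additive_subgroup.a_subset by blast

lemma L_antimono: "i \<le> j \<Longrightarrow> j \<le> r \<Longrightarrow> L j \<subseteq> L i"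
proof (induction j rule: dec_induct)
  case (step j)
  then show ?case using L_Suc[of j] by auto
qed simp

lemma mpart_closed: "x \<in> mpart M d \<Longrightarrow> x \<in> carrier M"
  using additive_subgroup.a_subset[OF mpart_subgroup] by blast

text \<open>The free cover of \<open>M\<close> over \<open>S\<close> by the lifted
  generators.\<close>

definition rho :: "(nat \<Rightarrow> 's) \<Rightarrow> 'm" where
  "rho = lincomb r X e"

lemma rho_hom: "rho \<in> right_hom S (F d) X"
  unfolding rho_def by (rule lincomb_right_hom[OF X.right_module_axioms]) (simp add: e_closed)

lemma rho_closed: "v \<in> carrier (F d) \<Longrightarrow> rho v \<in> carrier M"
  using right_homD(1)[OF rho_hom] by simp

lemma rho_add: "u \<in> carrier (F d) \<Longrightarrow> v \<in> carrier (F d) \<Longrightarrow> rho (u \<oplus>\<^bsub>F d\<^esub> v) = rho u \<oplus>\<^bsub>M\<^esub> rho v"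
  using right_homD(2)[OF rho_hom] by simp

lemma rho_ract: "v \<in> carrier (F d) \<Longrightarrow> s \<in> carrier S \<Longrightarrow> rho (v \<triangleleft>\<^bsub>F d\<^esub> s) = rho v \<triangleleft>\<^bsub>M\<^esub> \<pi> s"
  using right_homD(3)[OF rho_hom] by simp

lemma rho_zero: "rho \<zero>\<^bsub>F d\<^esub> = \<zero>\<^bsub>M\<^esub>"
  using right_hom_zero[OF rho_hom F.M.abelian_group_axioms X.M.abelian_group_axioms] by simp

abbreviation U where "U i s \<equiv> unit_vec S r i s"

lemma U_closed: "s \<in> carrier S \<Longrightarrow> U i s \<in> carrier (F d)"
  by (rule unit_vec_closed[OF S.ring_axioms])

lemma U_apply: "j < r \<Longrightarrow> U i s j = (if j = i then s else \<zero>\<^bsub>S\<^esub>)"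
  by (simp add: unit_vec_def)

lemma rho_U: "i < r \<Longrightarrow> s \<in> carrier S \<Longrightarrow> rho (U i s) = e i \<triangleleft>\<^bsub>M\<^esub> \<pi> s"
  unfolding rho_def using X.lincomb_unit_vec[of r e i s] by (simp add: e_closed)

lemma split_U:
  assumes v: "v \<in> carrier (F d)" and i: "i < r"
  shows "v = U i (v i) \<oplus>\<^bsub>F d\<^esub> v(i := \<zero>\<^bsub>S\<^esub>)" "v(i := \<zero>\<^bsub>S\<^esub>) \<in> carrier (F d)"
proof -
  show c: "v(i := \<zero>\<^bsub>S\<^esub>) \<in> carrier (F d)" using v i by (auto simp: graded_free_simps PiE_iff extensional_def)
  show "v = U i (v i) \<oplus>\<^bsub>F d\<^esub> v(i := \<zero>\<^bsub>S\<^esub>)"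
  proof (rule graded_free_ext[OF v])
    show "U i (v i) \<oplus>\<^bsub>F d\<^esub> v(i := \<zero>\<^bsub>S\<^esub>) \<in> carrier (F d)"
      using c U_closed[OF F_apply[OF v i]] by simp
  qed (use v i F_apply in \<open>auto simp: graded_free_apply U_apply\<close>)
qed

text \<open>Descent along the filtration: subtracting a multiple of \<open>e i\<close> moves an
  element of \<open>L i\<close> into the next layer, until \<open>L r\<close> = 0 is reached. The
  parameters serve arbitrary elements with arbitrary coefficients as well as homogeneous elements
  with homogeneous coefficients of the same degree. The zeros before \<open>i\<close> will make the
  presentation matrix triangular.\<close>

lemma lift_set:
  assumes P: "\<And>i x. i < r \<Longrightarrow> x \<in> L i \<Longrightarrow> x \<in> P \<Longrightarrow> \<exists>s\<in>Q. x \<ominus>\<^bsub>M\<^esub> e i \<triangleleft>\<^bsub>M\<^esub> \<pi> s \<in> L (Suc i) \<and> x \<ominus>\<^bsub>M\<^esub> e i \<triangleleft>\<^bsub>M\<^esub> \<pi> s \<in> P"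
    and Q: "\<zero>\<^bsub>S\<^esub> \<in> Q" "Q \<subseteq> carrier S"
    and x: "i \<le> r" "x \<in> L i" "x \<in> P"
  shows "\<exists>v\<in>{..<r} \<rightarrow>\<^sub>E Q. (\<forall>j<r. j < i \<longrightarrow> v j = \<zero>\<^bsub>S\<^esub>) \<and> rho v = x"
  using x
proof (induction "r - i" arbitrary: i x)
  case 0
  then have "x = \<zero>\<^bsub>M\<^esub>" using L_r by simp
  moreover have "\<zero>\<^bsub>F 0\<^esub> \<in> {..<r} \<rightarrow>\<^sub>E Q" using Q(1) by (simp add: graded_free_simps)
  ultimately show ?case by (intro bexI[of _ "\<zero>\<^bsub>F 0\<^esub>"]) (simp_all add: rho_zero graded_free_apply)
next
  case (Suc k)
  then have i: "i < r" by simp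
  obtain s where s: "s \<in> Q" "x \<ominus>\<^bsub>M\<^esub> e i \<triangleleft>\<^bsub>M\<^esub> \<pi> s \<in> L (Suc i)" "x \<ominus>\<^bsub>M\<^esub> e i \<triangleleft>\<^bsub>M\<^esub> \<pi> s \<in> P"
    using P[OF i Suc.prems(2,3)] by blast
  have k: "k = r - Suc i" using Suc.hyps(2) by simp
  obtain v where v: "v \<in> {..<r} \<rightarrow>\<^sub>E Q" "\<forall>j<r. j < Suc i \<longrightarrow> v j = \<zero>\<^bsub>S\<^esub>" "rho v = x \<ominus>\<^bsub>M\<^esub> e i \<triangleleft>\<^bsub>M\<^esub> \<pi> s"
    using Suc.hyps(1)[OF k _ s(2,3)] i by auto
  have vF: "v \<in> carrier (F 0)" using v(1) Q(2) by (auto simp: graded_free_simps)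
  have sS: "s \<in> carrier S" using s(1) Q(2) by blast
  let ?w = "v(i := s)"
  have wF: "?w \<in> carrier (F 0)" using vF sS i by (auto simp: graded_free_simps PiE_iff extensional_def)
  have "?w = U i s \<oplus>\<^bsub>F 0\<^esub> v"
    using v(2) vF sS i U_closed[OF sS, of i 0] F_apply[OF vF]
    by (intro graded_free_ext[OF wF]) (auto simp: graded_free_apply U_apply)
  then have "rho ?w = e i \<triangleleft>\<^bsub>M\<^esub> \<pi> s \<oplus>\<^bsub>M\<^esub> (x \<ominus>\<^bsub>M\<^esub> e i \<triangleleft>\<^bsub>M\<^esub> \<pi> s)"
    using vF sS i U_closed[OF sS, of i 0] by (simp only: rho_add rho_U v(3))
  also have "\<dots> = x"
    using L_closed[OF Suc.prems(1,2)] e_closed[OF i] sS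
    by (simp add: a_minus_def M.ract_closed M.M.a_lcomm M.M.r_neg)
  finally have "rho ?w = x" .
  moreover have "?w \<in> {..<r} \<rightarrow>\<^sub>E Q" using v(1) s(1) i by (auto simp: PiE_iff extensional_def)
  ultimately show ?case using v(2) by (intro bexI[of _ ?w]) auto
qed

lemma rho_surj:
  assumes "x \<in> carrier M" shows "\<exists>v\<in>carrier (F d). rho v = x"
proof -
  have "\<exists>v\<in>{..<r} \<rightarrow>\<^sub>E carrier S. (\<forall>j<r. j < 0 \<longrightarrow> v j = \<zero>\<^bsub>S\<^esub>) \<and> rho v = x"
  proof (rule lift_set[where P = UNIV])
    show "\<exists>s\<in>carrier S. x \<ominus>\<^bsub>M\<^esub> e i \<triangleleft>\<^bsub>M\<^esub> \<pi> s \<in> L (Suc i) \<and> x \<ominus>\<^bsub>M\<^esub> e i \<triangleleft>\<^bsub>M\<^esub> \<pi> s \<in> UNIV"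
      if "i < r" "x \<in> L i" for i x
      using gen[OF that] pi_lift by blast
  qed (use assms L_0 in auto)
  then show ?thesis by (auto simp: graded_free_simps)
qed

lemma rho_mpart_lift:
  assumes "i \<le> r" "x \<in> L i" "x \<in> mpart M d"
  shows "\<exists>v\<in>{..<r} \<rightarrow>\<^sub>E rpart S d. (\<forall>j<r. j < i \<longrightarrow> v j = \<zero>\<^bsub>S\<^esub>) \<and> rho v = x"
proof (rule lift_set[where P = "mpart M d"])
  fix i x assume i: "i < r" and x: "x \<in> L i" "x \<in> mpart M d"
  obtain a where a: "a \<in> rpart A d" "x \<ominus>\<^bsub>M\<^esub> e i \<triangleleft>\<^bsub>M\<^esub> a \<in> L (Suc i)" using gen_mpart[OF i x] by blast
  then obtain s where s: "s \<in> rpart S d" "a = \<pi> s" unfolding rpart_A by blast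
  have "e i \<triangleleft>\<^bsub>M\<^esub> a \<in> mpart M d" using mpart_ract[OF e_mpart[OF i] a(1)] by simp
  then have "x \<ominus>\<^bsub>M\<^esub> e i \<triangleleft>\<^bsub>M\<^esub> a \<in> mpart M d"
    unfolding a_minus_def using x(2) additive_subgroup.a_closed[OF mpart_subgroup]
      additive_subgroup.a_inv_closed[OF mpart_subgroup] by blast
  then show "\<exists>s\<in>rpart S d. x \<ominus>\<^bsub>M\<^esub> e i \<triangleleft>\<^bsub>M\<^esub> \<pi> s \<in> L (Suc i) \<and> x \<ominus>\<^bsub>M\<^esub> e i \<triangleleft>\<^bsub>M\<^esub> \<pi> s \<in> mpart M d"
    using a s by blast
qed (use assms additive_subgroup.zero_closed[OF rpart_subgroup] rpart_closed in auto)

text \<open>\<Theta> i 0 kills the generator of its layer, so e i \<Theta> i 0 lies in the next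
  layer and, being homogeneous of degree 1, is a combination of later generators with linear
  coefficients. Moving these to the other side gives a relation with \<Theta> i 0 on the
  diagonal.\<close>

lemma columns_exist:
  assumes i: "i < r"
  shows "\<exists>v. v \<in> {..<r} \<rightarrow>\<^sub>E rpart S 1 \<and> (\<forall>j<i. v j = \<zero>\<^bsub>S\<^esub>) \<and> v i = \<Theta> i 0 \<and> rho v = \<zero>\<^bsub>M\<^esub>"
proof -
  let ?t = "\<Theta> i 0" and ?x = "\<ominus>\<^bsub>M\<^esub> (e i \<triangleleft>\<^bsub>M\<^esub> \<pi> (\<Theta> i 0))"
  have t: "?t \<in> rpart S 1" "?t \<in> carrier S" using chain_rpart[OF chains[OF i]] rpart_closed by blast+
  have "e i \<triangleleft>\<^bsub>M\<^esub> \<pi> ?t \<in> L (Suc i)"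
    using ann[OF i, of "\<pi> ?t"] t by (metis A.one_closed A.r_one pi.hom_closed)
  then have L: "?x \<in> L (Suc i)" using i L_subgroup[of "Suc i"] additive_subgroup.a_inv_closed by fastforce
  have "e i \<triangleleft>\<^bsub>M\<^esub> \<pi> ?t \<in> mpart M (0 + 1)" using mpart_ract[OF e_mpart[OF i]] t(1) by (auto simp: rpart_A)
  then have m: "?x \<in> mpart M 1" using additive_subgroup.a_inv_closed[OF mpart_subgroup] by simp
  obtain v where v: "v \<in> {..<r} \<rightarrow>\<^sub>E rpart S 1" "\<forall>j<r. j < Suc i \<longrightarrow> v j = \<zero>\<^bsub>S\<^esub>" "rho v = ?x"
    using rho_mpart_lift[OF _ L m] i by auto
  have vF: "v \<in> carrier (F 0)" using v(1) rpart_closed by (auto simp: graded_free_simps PiE_iff)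
  let ?w = "v(i := ?t)"
  have wF: "?w \<in> carrier (F 0)" using vF t i by (auto simp: graded_free_simps PiE_iff extensional_def)
  have "?w = U i ?t \<oplus>\<^bsub>F 0\<^esub> v"
    using v(2) vF t i U_closed[OF t(2), of i 0] F_apply[OF vF]
    by (intro graded_free_ext[OF wF]) (auto simp: graded_free_apply U_apply)
  then have "rho ?w = e i \<triangleleft>\<^bsub>M\<^esub> \<pi> ?t \<oplus>\<^bsub>M\<^esub> ?x"
    using vF t i U_closed[OF t(2), of i 0] by (simp only: rho_add rho_U v(3))
  then have "rho ?w = \<zero>\<^bsub>M\<^esub>" using e_closed[OF i] t by (simp add: M.ract_closed M.M.r_neg)
  moreover have "?w \<in> {..<r} \<rightarrow>\<^sub>E rpart S 1" using v(1) t(1) i by (auto simp: PiE_iff extensional_def)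
  ultimately show ?thesis using v(2) i by (intro exI[of _ ?w]) auto
qed

definition C :: "nat \<Rightarrow> nat \<Rightarrow> 's" where
  "C i = (SOME v. v \<in> {..<r} \<rightarrow>\<^sub>E rpart S 1 \<and> (\<forall>j<i. v j = \<zero>\<^bsub>S\<^esub>) \<and> v i = \<Theta> i 0 \<and> rho v = \<zero>\<^bsub>M\<^esub>)"

lemma C:
  assumes "i < r"
  shows "C i \<in> {..<r} \<rightarrow>\<^sub>E rpart S 1" "j < i \<Longrightarrow> C i j = \<zero>\<^bsub>S\<^esub>" "C i i = \<Theta> i 0" "rho (C i) = \<zero>\<^bsub>M\<^esub>" "C i \<in> carrier (F d)"
proof -
  note c = someI_ex[OF columns_exist[OF assms], folded C_def]
  from c show "C i \<in> {..<r} \<rightarrow>\<^sub>E rpart S 1" "j < i \<Longrightarrow> C i j = \<zero>\<^bsub>S\<^esub>" "C i i = \<Theta> i 0" "rho (C i) = \<zero>\<^bsub>M\<^esub>" by auto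
  then show "C i \<in> carrier (F d)" using rpart_closed by (auto simp: graded_free_simps PiE_iff)
qed

lemma C_rpart: "i < r \<Longrightarrow> j < r \<Longrightarrow> C i j \<in> rpart S 1"
  using C(1) by (auto simp: PiE_iff)

definition phi0 :: "(nat \<Rightarrow> 's) \<Rightarrow> nat \<Rightarrow> 's" where
  "phi0 = lincomb r (F 0) C"

lemma phi0_hom: "phi0 \<in> right_hom S (F c) (F d)"
proof -
  have "phi0 \<in> right_hom S (F 0) (F 0)"
    unfolding phi0_def by (rule lincomb_right_hom[OF F.right_module_axioms]) (rule C)
  then show ?thesis by (metis right_hom_graded_free_twist)
qed

lemma phi0_closed: "v \<in> carrier (F c) \<Longrightarrow> phi0 v \<in> carrier (F d)"
  using right_homD(1)[OF phi0_hom] .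

lemma phi0_apply:
  assumes v: "v \<in> carrier (F d)" and j: "j < r"
  shows "phi0 v j = (\<Oplus>\<^bsub>S\<^esub>i\<in>{..<r}. C i j \<otimes>\<^bsub>S\<^esub> v i)"
proof -
  have "phi0 v j = (\<Oplus>\<^bsub>S\<^esub>i\<in>{..<r}. (C i \<triangleleft>\<^bsub>F 0\<^esub> v i) j)"
    unfolding phi0_def lincomb_def using C(5) F_apply[OF v]
    by (intro graded_free_finsum_apply[OF S.ring_axioms _ _ j]) (auto intro!: F.ract_closed)
  also have "\<dots> = (\<Oplus>\<^bsub>S\<^esub>i\<in>{..<r}. C i j \<otimes>\<^bsub>S\<^esub> v i)" using j by (simp add: graded_free_apply)
  finally show ?thesis .
qed

lemma rho_phi0:
  assumes v: "v \<in> carrier (F d)"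
  shows "rho (phi0 v) = \<zero>\<^bsub>M\<^esub>"
proof -
  have "rho (phi0 v) = lincomb r X (\<lambda>j. rho (C j)) v"
    unfolding phi0_def
    by (rule right_hom_lincomb[OF F.right_module_axioms X.right_module_axioms rho_hom]) (use C(5) F_apply[OF v] in auto)
  also have "\<dots> = (\<Oplus>\<^bsub>X\<^esub>j\<in>{..<r}. \<zero>\<^bsub>M\<^esub>)"
    unfolding lincomb_def using C(4) F_apply[OF v] by (intro X.M.finsum_cong') auto
  also have "\<dots> = \<zero>\<^bsub>M\<^esub>" using X.M.finsum_zero by simp
  finally show ?thesis .
qed

text \<open>Forward substitution in a triangular system: once the coordinates before
  \<open>k\<close> vanish, coordinate \<open>k\<close> of the image is \<Theta> k 0 times
  \<open>v k\<close>, and left multiplication by \<Theta> k 0 is injective on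
  \<open>S\<close>.\<close>

lemma phi0_inj_zero:
  assumes v: "v \<in> carrier (F d)" and z: "phi0 v = \<zero>\<^bsub>F d\<^esub>"
  shows "v = \<zero>\<^bsub>F d\<^esub>"
proof (rule graded_free_ext[OF v])
  fix k assume "k < r"
  then show "v k = \<zero>\<^bsub>F d\<^esub> k"
  proof (induction k rule: less_induct)
    case (less k)
    have lt: "v i = \<zero>\<^bsub>S\<^esub>" if "i < k" for i
      using less.IH[OF that] that less.prems by (simp add: graded_free_apply)
    have cl: "C i k \<in> carrier S" if "i < r" for i using C_rpart[OF that less.prems] rpart_closed by blast
    have "\<zero>\<^bsub>S\<^esub> = phi0 v k" using z less.prems by (simp add: graded_free_apply)
    also have "\<dots> = (\<Oplus>\<^bsub>S\<^esub>i\<in>{..<r}. if k = i then C k k \<otimes>\<^bsub>S\<^esub> v k else \<zero>\<^bsub>S\<^esub>)"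
      unfolding phi0_apply[OF v less.prems]
    proof (rule S.finsum_cong')
      fix i assume "i \<in> {..<r}"
      then have i: "i < r" by simp
      then show "C i k \<otimes>\<^bsub>S\<^esub> v i = (if k = i then C k k \<otimes>\<^bsub>S\<^esub> v k else \<zero>\<^bsub>S\<^esub>)"
        using lt[of i] C(2)[OF i, of k] cl F_apply[OF v i] by (cases i k rule: linorder_cases) auto
    qed (use cl F_apply[OF v less.prems] less.prems in auto)
    also have "\<dots> = \<Theta> k 0 \<otimes>\<^bsub>S\<^esub> v k"
      using less.prems F_apply[OF v less.prems] cl[OF less.prems] C(3)[OF less.prems]
      by (subst S.finsum_singleton) auto
    finally have "v k = \<zero>\<^bsub>S\<^esub>" using chain_inj[OF chains[OF less.prems] F_apply[OF v less.prems]] by simp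
    then show ?case using less.prems by (simp add: graded_free_apply)
  qed
qed simp

lemma phi0_inj: "inj_on phi0 (carrier (F d))"
proof (rule inj_onI)
  fix u v assume uv: "u \<in> carrier (F d)" "v \<in> carrier (F d)" "phi0 u = phi0 v"
  have "phi0 (u \<ominus>\<^bsub>F d\<^esub> v) = phi0 u \<ominus>\<^bsub>F d\<^esub> phi0 v"
    by (rule right_hom_diff[OF phi0_hom F.M.abelian_group_axioms F.M.abelian_group_axioms uv(1,2)])
  also have "\<dots> = \<zero>\<^bsub>F d\<^esub>" unfolding uv(3)
    by (subst F.M.minus_eq_zero_iff) (simp_all add: phi0_closed[OF uv(2), of d])
  finally have "u \<ominus>\<^bsub>F d\<^esub> v = \<zero>\<^bsub>F d\<^esub>" by (rule phi0_inj_zero[OF F.M.minus_closed[OF uv(1,2)]])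
  then show "u = v" using F.M.minus_eq_zero_iff[OF uv(1,2)] by simp
qed

lemma rho_in_L:
  assumes v: "v \<in> carrier (F d)" and k: "k \<le> r" and z: "\<And>j. j < k \<Longrightarrow> v j = \<zero>\<^bsub>S\<^esub>"
  shows "rho v \<in> L k"
proof -
  have "finsum X (\<lambda>j. e j \<triangleleft>\<^bsub>X\<^esub> v j) {..<r} \<in> L k"
  proof (rule X.M.additive_subgroup_finsum)
    interpret Lk: additive_subgroup "L k" M by (rule L_subgroup[OF k])
    show "additive_subgroup (L k) X"
    proof (rule additive_subgroupI, rule X.M.add.subgroupI)
      show "\<ominus>\<^bsub>X\<^esub> x \<in> L k" if "x \<in> L k" for x
      proof -
        have "\<ominus>\<^bsub>X\<^esub> x = \<ominus>\<^bsub>M\<^esub> x"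
          by (rule X.M.minus_equality) (use that in \<open>auto simp: M.M.l_neg\<close>)
        then show ?thesis using that by simp
      qed
      show "L k \<noteq> {}" using Lk.zero_closed by blast
    qed (use Lk.a_subset in auto)
    fix j assume "j \<in> {..<r}"
    then have j: "j < r" by simp
    show "e j \<triangleleft>\<^bsub>X\<^esub> v j \<in> L k"
    proof (cases "j < k")
      case True
      then show ?thesis using z e_closed[OF j] additive_subgroup.zero_closed[OF L_subgroup[OF k]] by simp
    next
      case False
      then have "e j \<in> L k" using e_L[OF j] L_antimono[of k j] j by auto
      then show ?thesis using L_ract[OF k, of "e j" "\<pi> (v j)"] F_apply[OF v j] by simp
    qed
  qed simp
  then show ?thesis by (simp add: rho_def lincomb_def)
qed

text \<open>Elimination: if the coordinates before \<open>k\<close> vanish, a relation forces e k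
  times \<open>v k\<close> into the next layer, so \<open>v k\<close> is a multiple of \<Theta> k 0
  and a multiple of the column \<open>C k\<close> clears it. The induction runs over the number of
  coordinates left.\<close>

lemma rho_kernel_aux:
  assumes "k \<le> r" "v \<in> carrier (F 0)" "\<And>j. j < k \<Longrightarrow> v j = \<zero>\<^bsub>S\<^esub>" "rho v = \<zero>\<^bsub>M\<^esub>"
  shows "\<exists>t\<in>carrier (F 0). v = phi0 t"
  using assms
proof (induction "r - k" arbitrary: k v)
  case 0
  then have z: "v j = \<zero>\<^bsub>S\<^esub>" if "j < r" for j using that by simp
  have "v = \<zero>\<^bsub>F 0\<^esub>"
    by (rule graded_free_ext[OF 0(3) F.M.zero_closed]) (simp add: z graded_free_apply)
  then show ?case
    using right_hom_zero[OF phi0_hom F.M.abelian_group_axioms F.M.abelian_group_axioms, of 0 0]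
    by (intro bexI[of _ "\<zero>\<^bsub>F 0\<^esub>"]) simp_all
next
  case (Suc n)
  then have k: "k < r" by simp
  note v = Suc.prems(2)
  have vk: "v k \<in> carrier S" by (rule F_apply[OF v k])
  let ?v = "v(k := \<zero>\<^bsub>S\<^esub>)"
  note sp = split_U[OF v k]
  have "rho ?v \<in> L (Suc k)"
    using sp(2) k Suc.prems(3) by (intro rho_in_L) (auto simp: less_Suc_eq)
  moreover have "\<zero>\<^bsub>M\<^esub> = rho (U k (v k)) \<oplus>\<^bsub>M\<^esub> rho ?v"
    using Suc.prems(4) sp U_closed[OF vk, of k 0] rho_add[of "U k (v k)" 0 ?v] by simp
  then have "rho (U k (v k)) = \<ominus>\<^bsub>M\<^esub> rho ?v"
    using rho_closed[OF sp(2)] rho_closed[OF U_closed[OF vk, of k 0]] by (simp add: M.M.minus_equality)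
  ultimately have "e k \<triangleleft>\<^bsub>M\<^esub> \<pi> (v k) \<in> L (Suc k)"
    using additive_subgroup.a_inv_closed[OF L_subgroup[of "Suc k"]] k by (simp add: rho_U vk)
  \<comment> \<open>\<open>ann\<close> gives divisibility in \<open>A\<close>; it lifts to
    \<open>S\<close> because f itself is a multiple of \<Theta> k 0.\<close>
  then obtain t where t: "t \<in> carrier S" "v k = \<Theta> k 0 \<otimes>\<^bsub>S\<^esub> t"
    using ann[OF k, of "\<pi> (v k)"] chain_ideal_lift[OF chains[OF k] vk] vk by auto
  let ?w = "v \<ominus>\<^bsub>F 0\<^esub> C k \<triangleleft>\<^bsub>F 0\<^esub> t"
  have Ck: "C k \<triangleleft>\<^bsub>F 0\<^esub> t \<in> carrier (F 0)" using C(5)[OF k] t by (simp add: F.ract_closed)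
  have w: "?w \<in> carrier (F 0)" using v Ck by simp
  have "\<exists>t\<in>carrier (F 0). ?w = phi0 t"
  proof (rule Suc.hyps(1))
    show "n = r - Suc k" "Suc k \<le> r" using Suc.hyps(2) by auto
    show "?w \<in> carrier (F 0)" by (rule w)
    show "?w j = \<zero>\<^bsub>S\<^esub>" if "j < Suc k" for j
    proof -
      have jr: "j < r" using that k by simp
      have "?w j = v j \<ominus>\<^bsub>S\<^esub> C k j \<otimes>\<^bsub>S\<^esub> t"
        using jr by (simp add: a_minus_def graded_free_apply graded_free_minus_apply[OF S.ring_axioms Ck])
      also have "\<dots> = \<zero>\<^bsub>S\<^esub>"
        using that t C(2,3)[OF k] Suc.prems(3) vk by (cases "j = k") (auto simp: a_minus_def S.r_neg)
      finally show ?thesis .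
    qed
    have "rho ?w = rho v \<ominus>\<^bsub>X\<^esub> rho (C k \<triangleleft>\<^bsub>F 0\<^esub> t)"
      by (rule right_hom_diff[OF rho_hom F.M.abelian_group_axioms X.M.abelian_group_axioms v Ck])
    also have "rho (C k \<triangleleft>\<^bsub>F 0\<^esub> t) = \<zero>\<^bsub>X\<^esub>" using C(4)[OF k] t by (simp add: rho_ract[OF C(5)[OF k]])
    finally show "rho ?w = \<zero>\<^bsub>M\<^esub>" using Suc.prems(4) X.M.minus_eq_zero_iff[of "\<zero>\<^bsub>X\<^esub>" "\<zero>\<^bsub>X\<^esub>"] by simp
  qed
  then obtain u where u: "u \<in> carrier (F 0)" "?w = phi0 u" by blast
  have "phi0 (U k t) = C k \<triangleleft>\<^bsub>F 0\<^esub> t"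
    unfolding phi0_def by (rule F.lincomb_unit_vec[OF _ k t(1)]) (rule C(5))
  then have "phi0 (u \<oplus>\<^bsub>F 0\<^esub> U k t) = ?w \<oplus>\<^bsub>F 0\<^esub> C k \<triangleleft>\<^bsub>F 0\<^esub> t"
    using right_homD(2)[OF phi0_hom[of 0 0] u(1) U_closed[OF t(1), of k]] u(2) by simp
  also have "\<dots> = v" using v Ck by (simp add: a_minus_def F.M.a_assoc F.M.l_neg)
  finally show ?case using u U_closed[OF t(1), of k 0] by (intro bexI[of _ "u \<oplus>\<^bsub>F 0\<^esub> U k t"]) auto
qed

lemma rho_kernel:
  assumes "v \<in> carrier (F c)" "rho v = \<zero>\<^bsub>M\<^esub>"
  shows "\<exists>t\<in>carrier (F d). v = phi0 t"
  using rho_kernel_aux[of 0 v] assms by (auto simp: graded_free_simps)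

end

section \<open>Tensoring with A over S returns a module on which S already acts through A\<close>

section \<open>Extension of scalars\<close>

lemma pre_tensor_simps:
  "carrier (pre_tensor W A) = {c. finite {p. c p \<noteq> 0} \<and> {p. c p \<noteq> 0} \<subseteq> carrier W \<times> carrier A}"
  "\<zero>\<^bsub>pre_tensor W A\<^esub> = (\<lambda>p. 0)"
  "c \<oplus>\<^bsub>pre_tensor W A\<^esub> c' = (\<lambda>p. c p + c' p)"
  "(c \<triangleleft>\<^bsub>pre_tensor W A\<^esub> a) (m, b') = (\<Sum>b\<in>{b. c (m, b) \<noteq> 0 \<and> b \<otimes>\<^bsub>A\<^esub> a = b'}. c (m, b))"
  "mpart (pre_tensor W A) i = {c. finite {p. c p \<noteq> 0} \<and> {p. c p \<noteq> 0} \<subseteq> (\<Union>j. mpart W j \<times> rpart A (i - j))}"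
  by (simp_all add: pre_tensor_def)

lemma (in abelian_group) add_minus_minus:
  assumes "x \<in> carrier G" "y \<in> carrier G"
  shows "x \<oplus> y \<ominus> x \<ominus> y = \<zero>"
proof -
  have "x \<oplus> y \<ominus> x = y" using assms by (simp add: a_comm[of x y] a_minus_def a_assoc r_neg)
  then show ?thesis using assms by (simp add: a_minus_def r_neg)
qed

text \<open>\<open>W\<close> is \<open>M\<close> with scalars restricted along \<pi>, up to the
  bijection \<beta>. Surjectivity of \<pi> makes the extension of scalars give \<open>M\<close>
  back: x is sent to the class of \<beta> x \<otimes> 1, and evaluation of tensors in
  \<open>M\<close> shows that nothing is lost.\<close>

locale scalar_extension = A: ring A + M: right_module A M + W: abelian_group W
  for S :: "'s gring" and A :: "'a gring" and M :: "('a, 'm) gmod" and W :: "('s, 'w) gmod" +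
  fixes \<pi> :: "'s \<Rightarrow> 'a" and \<beta> :: "'m \<Rightarrow> 'w"
  assumes pi_surj: "\<pi> ` carrier S = carrier A"
    and W_ract: "w \<in> carrier W \<Longrightarrow> s \<in> carrier S \<Longrightarrow> w \<triangleleft>\<^bsub>W\<^esub> s \<in> carrier W"
    and beta_bij: "bij_betw \<beta> (carrier M) (carrier W)"
    and beta_add: "x \<in> carrier M \<Longrightarrow> y \<in> carrier M \<Longrightarrow> \<beta> (x \<oplus>\<^bsub>M\<^esub> y) = \<beta> x \<oplus>\<^bsub>W\<^esub> \<beta> y"
    and beta_ract: "x \<in> carrier M \<Longrightarrow> s \<in> carrier S \<Longrightarrow> \<beta> (x \<triangleleft>\<^bsub>M\<^esub> \<pi> s) = \<beta> x \<triangleleft>\<^bsub>W\<^esub> s"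
    and beta_mpart: "x \<in> mpart M i \<Longrightarrow> \<beta> x \<in> mpart W i"
    and one_rpart: "\<one>\<^bsub>A\<^esub> \<in> rpart A 0"
    and mpart_closed: "x \<in> mpart M i \<Longrightarrow> x \<in> carrier M"
begin

abbreviation "P \<equiv> pre_tensor W A"
abbreviation "Rel \<equiv> tensor_relations S A \<pi> W"
definition "H = generate (add_monoid P) Rel"

lemma pi_closed: "s \<in> carrier S \<Longrightarrow> \<pi> s \<in> carrier A"
  using pi_surj by blast

lemma beta_closed: "x \<in> carrier M \<Longrightarrow> \<beta> x \<in> carrier W"
  using beta_bij by (auto simp: bij_betw_def)

lemma beta_surj: "w \<in> carrier W \<Longrightarrow> \<exists>x\<in>carrier M. w = \<beta> x"
  using beta_bij by (auto simp: bij_betw_def)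

lemma pt_closed: "m \<in> carrier W \<Longrightarrow> b \<in> carrier A \<Longrightarrow> pure_tensor m b \<in> carrier P"
  by (auto simp: pre_tensor_simps pure_tensor_def)

lemma P_diff_closed:
  assumes "c \<in> carrier P" "c' \<in> carrier P" 
  shows "(\<lambda>p. c p - c' p) \<in> carrier P" "(\<lambda>p. c p + c' p) \<in> carrier P"
proof -
  have "{p. c p - c' p \<noteq> 0} \<subseteq> {p. c p \<noteq> 0} \<union> {p. c' p \<noteq> 0}" "{p. c p + c' p \<noteq> 0} \<subseteq> {p. c p \<noteq> 0} \<union> {p. c' p \<noteq> 0}"
    by auto
  then show "(\<lambda>p. c p - c' p) \<in> carrier P" "(\<lambda>p. c p + c' p) \<in> carrier P"
    using assms unfolding pre_tensor_simps by (blast intro: finite_subset)+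
qed

sublocale P: abelian_group P
proof (rule abelian_groupI)
  show "\<zero>\<^bsub>P\<^esub> \<in> carrier P" by (simp add: pre_tensor_simps)
  show "\<exists>y\<in>carrier P. y \<oplus>\<^bsub>P\<^esub> x = \<zero>\<^bsub>P\<^esub>" if "x \<in> carrier P" for x
    using that by (intro bexI[of _ "\<lambda>p. - x p"]) (auto simp: pre_tensor_simps)
qed (use P_diff_closed in \<open>auto simp: pre_tensor_simps(2,3) algebra_simps\<close>)

lemma P_minus: "c \<in> carrier P \<Longrightarrow> \<ominus>\<^bsub>P\<^esub> c = (\<lambda>p. - c p)"
  by (rule P.minus_equality) (auto simp: pre_tensor_simps)

lemma P_diff: "c \<in> carrier P \<Longrightarrow> c' \<in> carrier P \<Longrightarrow> c \<ominus>\<^bsub>P\<^esub> c' = (\<lambda>p. c p - c' p)"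
  by (simp add: a_minus_def P_minus pre_tensor_simps(3))

lemma Rel_cases:
  assumes "g \<in> Rel"
  obtains (add_left) x y b where "x \<in> carrier W" "y \<in> carrier W" "b \<in> carrier A"
      "g = (\<lambda>p. pure_tensor (x \<oplus>\<^bsub>W\<^esub> y) b p - pure_tensor x b p - pure_tensor y b p)"
  | (add_right) x b b' where "x \<in> carrier W" "b \<in> carrier A" "b' \<in> carrier A"
      "g = (\<lambda>p. pure_tensor x (b \<oplus>\<^bsub>A\<^esub> b') p - pure_tensor x b p - pure_tensor x b' p)"
  | (balanced) x s b where "x \<in> carrier W" "s \<in> carrier S" "b \<in> carrier A"
      "g = (\<lambda>p. pure_tensor (x \<triangleleft>\<^bsub>W\<^esub> s) b p - pure_tensor x (\<pi> s \<otimes>\<^bsub>A\<^esub> b) p)"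
  using assms(1) unfolding tensor_relations_def
  by (elim UnE CollectE exE conjE) (erule (3) add_left add_right balanced)+

lemma Rel_closed: "Rel \<subseteq> carrier P"
proof
  fix g assume "g \<in> Rel"
  then show "g \<in> carrier P"
    by (cases rule: Rel_cases) (auto intro!: P_diff_closed pt_closed W_ract pi_closed)
qed

lemma H_subgroup: "additive_subgroup H P"
  unfolding H_def using Rel_closed
  by (intro additive_subgroupI group.generate_is_subgroup) (auto simp: P.add.is_group)

lemma H_Rel: "g \<in> Rel \<Longrightarrow> g \<in> H"
  unfolding H_def by (rule generate.incl)

lemma H_induct [consumes 1, case_names zero rel neg add]:
  assumes "h \<in> H" "Pr (\<lambda>p. 0)" "\<And>g. g \<in> Rel \<Longrightarrow> Pr g" "\<And>g. g \<in> Rel \<Longrightarrow> Pr (\<lambda>p. - g p)"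
    and "\<And>g h. g \<in> H \<Longrightarrow> h \<in> H \<Longrightarrow> Pr g \<Longrightarrow> Pr h \<Longrightarrow> Pr (\<lambda>p. g p + h p)"
  shows "Pr h"
  using assms(1) unfolding H_def
proof (induction rule: generate.induct)
  case one
  then show ?case using assms(2) by (simp add: pre_tensor_simps)
next
  case (incl g)
  then show ?case by (rule assms(3))
next
  case (inv g)
  have "inv\<^bsub>add_monoid P\<^esub> g = (\<lambda>p. - g p)"
    using P_minus[of g] Rel_closed inv by (auto simp: a_inv_def)
  then show ?case using assms(4)[OF inv] by simp
next
  case (eng g h)
  then show ?case using assms(5)[of g h] by (simp add: H_def pre_tensor_simps)
qed

lemma quot_eqI:
  assumes "c \<in> carrier P" "c' \<in> carrier P" "(\<lambda>p. c p - c' p) \<in> H"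
  shows "H +>\<^bsub>P\<^esub> c = H +>\<^bsub>P\<^esub> c'"
  using quot_eq_iff[OF P.abelian_group_axioms H_subgroup assms(1,2)] P_diff[OF assms(1,2)] assms(3) by simp

subsection \<open>The action on tensors\<close>

text \<open>The sum defining the action ranges over the support of \<open>c\<close>, which changes
  under addition; over a common finite superset it becomes linear in \<open>c\<close>.\<close>

lemma P_ract_superset:
  assumes "finite B" "\<And>b. c (m, b) \<noteq> 0 \<Longrightarrow> b \<in> B"
  shows "(c \<triangleleft>\<^bsub>P\<^esub> a) (m, b') = (\<Sum>b\<in>{b\<in>B. b \<otimes>\<^bsub>A\<^esub> a = b'}. c (m, b))"
  unfolding pre_tensor_simps by (rule sum.mono_neutral_left) (use assms in auto)

lemma P_support_snd: "c \<in> carrier P \<Longrightarrow> finite (snd ` {p. c p \<noteq> 0})" "c (m, b) \<noteq> 0 \<Longrightarrow> b \<in> snd ` {p. c p \<noteq> 0}"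
  by (auto simp: pre_tensor_simps intro!: image_eqI[of _ _ "(m, b)"])

lemma P_ract_lin:
  assumes c: "c \<in> carrier P" "c' \<in> carrier P"
  shows "(\<lambda>p. c p + c' p) \<triangleleft>\<^bsub>P\<^esub> a = (\<lambda>p. (c \<triangleleft>\<^bsub>P\<^esub> a) p + (c' \<triangleleft>\<^bsub>P\<^esub> a) p)"
    "(\<lambda>p. c p - c' p) \<triangleleft>\<^bsub>P\<^esub> a = (\<lambda>p. (c \<triangleleft>\<^bsub>P\<^esub> a) p - (c' \<triangleleft>\<^bsub>P\<^esub> a) p)"
proof -
  let ?B = "snd ` {p. c p \<noteq> 0} \<union> snd ` {p. c' p \<noteq> 0}"
  have fin: "finite ?B" using P_support_snd c by blast
  have B: "c (m, b) \<noteq> 0 \<Longrightarrow> b \<in> ?B" "c' (m, b) \<noteq> 0 \<Longrightarrow> b \<in> ?B" "c (m, b) + c' (m, b) \<noteq> 0 \<Longrightarrow> b \<in> ?B"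
    "c (m, b) - c' (m, b) \<noteq> 0 \<Longrightarrow> b \<in> ?B" for m b
  proof -
    have *: "b \<in> ?B" if "c (m, b) \<noteq> 0 \<or> c' (m, b) \<noteq> 0"
      using that P_support_snd(2)[of c m b] P_support_snd(2)[of c' m b] by blast
    show "c (m, b) \<noteq> 0 \<Longrightarrow> b \<in> ?B" "c' (m, b) \<noteq> 0 \<Longrightarrow> b \<in> ?B" using * by blast+
    show "c (m, b) + c' (m, b) \<noteq> 0 \<Longrightarrow> b \<in> ?B" "c (m, b) - c' (m, b) \<noteq> 0 \<Longrightarrow> b \<in> ?B"
      using * by (cases "c (m, b) = 0"; simp)+
  qed
  note sup = P_ract_superset[OF fin]
  show "(\<lambda>p. c p + c' p) \<triangleleft>\<^bsub>P\<^esub> a = (\<lambda>p. (c \<triangleleft>\<^bsub>P\<^esub> a) p + (c' \<triangleleft>\<^bsub>P\<^esub> a) p)"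
  proof
    fix p :: "'w \<times> 'a" obtain m b where "p = (m, b)" by (cases p)
    then show "((\<lambda>p. c p + c' p) \<triangleleft>\<^bsub>P\<^esub> a) p = (c \<triangleleft>\<^bsub>P\<^esub> a) p + (c' \<triangleleft>\<^bsub>P\<^esub> a) p"
      using sup[of c m a b, OF B(1)] sup[of c' m a b, OF B(2)] sup[of "\<lambda>p. c p + c' p" m a b, OF B(3)]
      by (simp add: sum.distrib)
  qed
  show "(\<lambda>p. c p - c' p) \<triangleleft>\<^bsub>P\<^esub> a = (\<lambda>p. (c \<triangleleft>\<^bsub>P\<^esub> a) p - (c' \<triangleleft>\<^bsub>P\<^esub> a) p)"
  proof
    fix p :: "'w \<times> 'a" obtain m b where "p = (m, b)" by (cases p)
    then show "((\<lambda>p. c p - c' p) \<triangleleft>\<^bsub>P\<^esub> a) p = (c \<triangleleft>\<^bsub>P\<^esub> a) p - (c' \<triangleleft>\<^bsub>P\<^esub> a) p"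
      using sup[of c m a b, OF B(1)] sup[of c' m a b, OF B(2)] sup[of "\<lambda>p. c p - c' p" m a b, OF B(4)]
      by (simp add: sum_subtractf)
  qed
qed

lemma pt_ract: "pure_tensor m b \<triangleleft>\<^bsub>P\<^esub> a = pure_tensor m (b \<otimes>\<^bsub>A\<^esub> a)"
proof
  fix p :: "'w \<times> 'a" obtain m' b' where p: "p = (m', b')" by (cases p)
  have "(pure_tensor m b \<triangleleft>\<^bsub>P\<^esub> a) (m', b') = (\<Sum>x\<in>{x\<in>{b}. x \<otimes>\<^bsub>A\<^esub> a = b'}. pure_tensor m b (m', x))"
    by (rule P_ract_superset) (auto simp: pure_tensor_def split: if_splits)
  also have "{x\<in>{b}. x \<otimes>\<^bsub>A\<^esub> a = b'} = (if b \<otimes>\<^bsub>A\<^esub> a = b' then {b} else {})" by auto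
  finally show "(pure_tensor m b \<triangleleft>\<^bsub>P\<^esub> a) p = pure_tensor m (b \<otimes>\<^bsub>A\<^esub> a) p"
    by (auto simp: p pure_tensor_def)
qed

lemma P_ract_closed:
  assumes c: "c \<in> carrier P" and a: "a \<in> carrier A"
  shows "c \<triangleleft>\<^bsub>P\<^esub> a \<in> carrier P"
proof -
  have "{p. (c \<triangleleft>\<^bsub>P\<^esub> a) p \<noteq> 0} \<subseteq> (\<lambda>(m, b). (m, b \<otimes>\<^bsub>A\<^esub> a)) ` {p. c p \<noteq> 0}"
  proof
    fix p assume "p \<in> {p. (c \<triangleleft>\<^bsub>P\<^esub> a) p \<noteq> 0}"
    moreover obtain m b' where p: "p = (m, b')" by (cases p)
    ultimately have "(\<Sum>b\<in>{b. c (m, b) \<noteq> 0 \<and> b \<otimes>\<^bsub>A\<^esub> a = b'}. c (m, b)) \<noteq> 0" by (simp add: pre_tensor_simps)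
    then obtain b where "c (m, b) \<noteq> 0" "b \<otimes>\<^bsub>A\<^esub> a = b'"
      by (rule sum.not_neutral_contains_not_neutral) blast
    then show "p \<in> (\<lambda>(m, b). (m, b \<otimes>\<^bsub>A\<^esub> a)) ` {p. c p \<noteq> 0}"
      by (intro image_eqI[of _ _ "(m, b)"]) (auto simp: p)
  qed
  moreover have "finite ((\<lambda>(m, b). (m, b \<otimes>\<^bsub>A\<^esub> a)) ` {p. c p \<noteq> 0})"
    "(\<lambda>(m, b). (m, b \<otimes>\<^bsub>A\<^esub> a)) ` {p. c p \<noteq> 0} \<subseteq> carrier W \<times> carrier A"
    using c a by (auto simp: pre_tensor_simps)
  ultimately show ?thesis unfolding pre_tensor_simps mem_Collect_eq by (meson finite_subset order_trans)
qed

text \<open>Acting on the second tensor factor maps each of the three families of relations to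
  itself; hence the action descends to the quotient.\<close>

lemma Rel_ract: "g \<in> Rel \<Longrightarrow> a \<in> carrier A \<Longrightarrow> g \<triangleleft>\<^bsub>P\<^esub> a \<in> Rel"
proof -
  assume g: "g \<in> Rel" and a: "a \<in> carrier A"
  from g show ?thesis
  proof (cases rule: Rel_cases)
    case (add_left x y b)
    then have "g \<triangleleft>\<^bsub>P\<^esub> a = (\<lambda>p. pure_tensor (x \<oplus>\<^bsub>W\<^esub> y) (b \<otimes>\<^bsub>A\<^esub> a) p - pure_tensor x (b \<otimes>\<^bsub>A\<^esub> a) p - pure_tensor y (b \<otimes>\<^bsub>A\<^esub> a) p)"
      by (simp add: P_ract_lin pt_closed P_diff_closed pt_ract)
    moreover have "b \<otimes>\<^bsub>A\<^esub> a \<in> carrier A" using a add_left by simp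
    ultimately show ?thesis using add_left(1,2) unfolding tensor_relations_def by blast
  next
    case (add_right x b b')
    then have "g \<triangleleft>\<^bsub>P\<^esub> a = (\<lambda>p. pure_tensor x (b \<otimes>\<^bsub>A\<^esub> a \<oplus>\<^bsub>A\<^esub> b' \<otimes>\<^bsub>A\<^esub> a) p - pure_tensor x (b \<otimes>\<^bsub>A\<^esub> a) p - pure_tensor x (b' \<otimes>\<^bsub>A\<^esub> a) p)"
      using a by (simp add: P_ract_lin pt_closed P_diff_closed pt_ract A.l_distr)
    moreover have "b \<otimes>\<^bsub>A\<^esub> a \<in> carrier A" "b' \<otimes>\<^bsub>A\<^esub> a \<in> carrier A" using a add_right by simp_all
    ultimately show ?thesis using add_right(1) unfolding tensor_relations_def by blast
  next
    case (balanced x s b)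
    then have "g \<triangleleft>\<^bsub>P\<^esub> a = (\<lambda>p. pure_tensor (x \<triangleleft>\<^bsub>W\<^esub> s) (b \<otimes>\<^bsub>A\<^esub> a) p - pure_tensor x (\<pi> s \<otimes>\<^bsub>A\<^esub> (b \<otimes>\<^bsub>A\<^esub> a)) p)"
      using a by (simp add: P_ract_lin pt_closed P_diff_closed pt_ract A.m_assoc pi_closed W_ract)
    moreover have "b \<otimes>\<^bsub>A\<^esub> a \<in> carrier A" using a balanced by simp
    ultimately show ?thesis using balanced(1,2) unfolding tensor_relations_def by blast
  qed
qed

lemma zero_ract: "(\<lambda>p. 0) \<triangleleft>\<^bsub>P\<^esub> a = (\<lambda>p. 0)"
  using P_ract_lin(2)[of "\<lambda>p. 0" "\<lambda>p. 0" a] P.zero_closed by (simp add: pre_tensor_simps(2))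

lemma H_closed: "h \<in> H \<Longrightarrow> h \<in> carrier P"
  using additive_subgroup.a_subset[OF H_subgroup] by blast

lemma H_add: "g \<in> H \<Longrightarrow> h \<in> H \<Longrightarrow> (\<lambda>p. g p + h p) \<in> H"
  using additive_subgroup.a_closed[OF H_subgroup] by (simp add: pre_tensor_simps)

lemma H_neg: "g \<in> H \<Longrightarrow> (\<lambda>p. - g p) \<in> H"
  using additive_subgroup.a_inv_closed[OF H_subgroup] P_minus H_closed by metis

lemma H_ract:
  assumes h: "h \<in> H" and a: "a \<in> carrier A"
  shows "h \<triangleleft>\<^bsub>P\<^esub> a \<in> H"
  using h
proof (induction rule: H_induct)
  case zero
  then show ?case using additive_subgroup.zero_closed[OF H_subgroup] by (simp add: zero_ract pre_tensor_simps(2))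
next
  case (rel g)
  then show ?case using Rel_ract a H_Rel by blast
next
  case (neg g)
  have "(\<lambda>p. - g p) \<triangleleft>\<^bsub>P\<^esub> a = (\<lambda>p. - (g \<triangleleft>\<^bsub>P\<^esub> a) p)"
    using P_ract_lin(2)[of "\<lambda>p. 0" g a] P.zero_closed Rel_closed neg by (auto simp: pre_tensor_simps(2) zero_ract)
  then show ?case using H_neg[OF H_Rel[OF Rel_ract[OF neg a]]] by simp
next
  case (add g h)
  then show ?case using H_add by (simp add: P_ract_lin H_closed)
qed

lemma coset_ract:
  assumes "c \<in> carrier P" "a \<in> carrier A"
  shows "(H +>\<^bsub>P\<^esub> c) \<triangleleft>\<^bsub>quot_module P H\<^esub> a = H +>\<^bsub>P\<^esub> (c \<triangleleft>\<^bsub>P\<^esub> a)"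
  using assms by (intro quot_ract[OF P.abelian_group_axioms H_subgroup])
    (auto simp: P_ract_closed H_ract pre_tensor_simps(3) P_ract_lin)

subsection \<open>The comparison map\<close>

text \<open>The evaluation that sends w \<otimes> b to the \<beta>-preimage of w acted on by b,
  extended to formal integer combinations of pairs.\<close>

definition mu :: "('w \<times> 'a \<Rightarrow> int) \<Rightarrow> 'm" where
  "mu c = (\<Oplus>\<^bsub>M\<^esub>p\<in>{p. c p \<noteq> 0}. [c p] \<cdot>\<^bsub>M\<^esub> (inv_into (carrier M) \<beta> (fst p) \<triangleleft>\<^bsub>M\<^esub> snd p))"

lemma inv_beta: "x \<in> carrier M \<Longrightarrow> inv_into (carrier M) \<beta> (\<beta> x) = x"
  using beta_bij by (simp add: bij_betw_def)

lemma inv_beta_closed: "w \<in> carrier W \<Longrightarrow> inv_into (carrier M) \<beta> w \<in> carrier M"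
  using beta_surj inv_beta by force

lemma mu_superset:
  assumes c: "c \<in> carrier P" and B: "finite B" "{p. c p \<noteq> 0} \<subseteq> B" "B \<subseteq> carrier W \<times> carrier A"
  shows "mu c = (\<Oplus>\<^bsub>M\<^esub>p\<in>B. [c p] \<cdot>\<^bsub>M\<^esub> (inv_into (carrier M) \<beta> (fst p) \<triangleleft>\<^bsub>M\<^esub> snd p))"
  unfolding mu_def
proof (rule M.M.add.finprod_mono_neutral_cong_left)
  have "inv_into (carrier M) \<beta> (fst p) \<triangleleft>\<^bsub>M\<^esub> snd p \<in> carrier M" if "p \<in> B" for p
    using B that by (intro M.ract_closed inv_beta_closed) auto
  then show "(\<lambda>p. [c p] \<cdot>\<^bsub>M\<^esub> (inv_into (carrier M) \<beta> (fst p) \<triangleleft>\<^bsub>M\<^esub> snd p)) \<in> B \<rightarrow> carrier M"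
    by (auto intro: M.M.add.int_pow_closed)
qed (use B in \<open>auto simp: add_pow_def\<close>)

lemma mu_closed: "c \<in> carrier P \<Longrightarrow> mu c \<in> carrier M"
  unfolding mu_def by (intro M.M.finsum_closed)
    (auto simp: pre_tensor_simps intro!: M.M.add.int_pow_closed M.ract_closed inv_beta_closed)

lemma mu_add:
  assumes c: "c \<in> carrier P" "c' \<in> carrier P"
  shows "mu (\<lambda>p. c p + c' p) = mu c \<oplus>\<^bsub>M\<^esub> mu c'"
proof -
  let ?B = "{p. c p \<noteq> 0} \<union> {p. c' p \<noteq> 0}" and ?g = "\<lambda>p. inv_into (carrier M) \<beta> (fst p) \<triangleleft>\<^bsub>M\<^esub> snd p"
  have B: "finite ?B" "?B \<subseteq> carrier W \<times> carrier A" using c by (auto simp: pre_tensor_simps)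
  have g: "?g p \<in> carrier M" if "p \<in> ?B" for p
    using subsetD[OF B(2) that] by (intro M.ract_closed inv_beta_closed) auto
  have "mu (\<lambda>p. c p + c' p) = (\<Oplus>\<^bsub>M\<^esub>p\<in>?B. [(c p + c' p)] \<cdot>\<^bsub>M\<^esub> ?g p)"
    by (rule mu_superset[OF P_diff_closed(2)[OF c] B(1) _ B(2)]) auto
  also have "\<dots> = (\<Oplus>\<^bsub>M\<^esub>p\<in>?B. [c p] \<cdot>\<^bsub>M\<^esub> ?g p \<oplus>\<^bsub>M\<^esub> [c' p] \<cdot>\<^bsub>M\<^esub> ?g p)"
    using g by (intro M.M.finsum_cong') (auto simp: M.M.add.int_pow_mult intro!: M.M.a_closed M.M.add.int_pow_closed)
  also have "\<dots> = mu c \<oplus>\<^bsub>M\<^esub> mu c'"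
    using g mu_superset[OF c(1) B(1) _ B(2)] mu_superset[OF c(2) B(1) _ B(2)]
    by (subst M.M.finsum_addf) (auto intro!: M.M.add.int_pow_closed)
  finally show ?thesis .
qed

lemma mu_pt:
  assumes "x \<in> carrier M" "b \<in> carrier A"
  shows "mu (pure_tensor (\<beta> x) b) = x \<triangleleft>\<^bsub>M\<^esub> b"
proof -
  have "mu (pure_tensor (\<beta> x) b) = (\<Oplus>\<^bsub>M\<^esub>p\<in>{(\<beta> x, b)}. [pure_tensor (\<beta> x) b p] \<cdot>\<^bsub>M\<^esub> (inv_into (carrier M) \<beta> (fst p) \<triangleleft>\<^bsub>M\<^esub> snd p))"
    using assms by (intro mu_superset pt_closed beta_closed) (auto simp: pure_tensor_def beta_closed split: if_splits)
  also have "\<dots> = x \<triangleleft>\<^bsub>M\<^esub> b"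
    using assms by (simp add: pure_tensor_def inv_beta M.ract_closed)
  finally show ?thesis .
qed

lemma mu_zero: "mu (\<lambda>p. 0) = \<zero>\<^bsub>M\<^esub>"
  by (simp add: mu_def)

lemma mu_diff:
  assumes "c \<in> carrier P" "c' \<in> carrier P"
  shows "mu (\<lambda>p. c p - c' p) = mu c \<ominus>\<^bsub>M\<^esub> mu c'"
proof -
  have "mu c = mu (\<lambda>p. c p - c' p) \<oplus>\<^bsub>M\<^esub> mu c'"
    using mu_add[OF P_diff_closed(1)[OF assms] assms(2)] by simp
  then show ?thesis using mu_closed[OF assms(2)] mu_closed[OF P_diff_closed(1)[OF assms]]
    by (simp add: a_minus_def M.M.a_assoc M.M.r_neg)
qed

lemma mu_Rel: "g \<in> Rel \<Longrightarrow> mu g = \<zero>\<^bsub>M\<^esub>"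
proof -
  assume "g \<in> Rel"
  then show ?thesis
  proof (cases rule: Rel_cases)
    case (add_left u v b)
    then obtain x y where xy: "x \<in> carrier M" "u = \<beta> x" "y \<in> carrier M" "v = \<beta> y" using beta_surj by metis
    then have uv: "u \<oplus>\<^bsub>W\<^esub> v = \<beta> (x \<oplus>\<^bsub>M\<^esub> y)" by (simp add: beta_add)
    have "mu g = (x \<oplus>\<^bsub>M\<^esub> y) \<triangleleft>\<^bsub>M\<^esub> b \<ominus>\<^bsub>M\<^esub> x \<triangleleft>\<^bsub>M\<^esub> b \<ominus>\<^bsub>M\<^esub> y \<triangleleft>\<^bsub>M\<^esub> b"
      unfolding add_left(4) uv using xy add_left(3)
      by (simp add: mu_diff P_diff_closed pt_closed mu_pt beta_closed)
    then show ?thesis using xy add_left(3)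
      by (simp add: M.ract_add_left M.ract_closed M.M.add_minus_minus)
  next
    case (add_right u b b')
    then obtain x where x: "x \<in> carrier M" "u = \<beta> x" using beta_surj by metis
    have "mu g = x \<triangleleft>\<^bsub>M\<^esub> (b \<oplus>\<^bsub>A\<^esub> b') \<ominus>\<^bsub>M\<^esub> x \<triangleleft>\<^bsub>M\<^esub> b \<ominus>\<^bsub>M\<^esub> x \<triangleleft>\<^bsub>M\<^esub> b'"
      unfolding add_right(4) x(2) using x add_right(2,3)
      by (simp add: mu_diff P_diff_closed pt_closed mu_pt beta_closed)
    then show ?thesis using x add_right(2,3)
      by (simp add: M.ract_add_right M.ract_closed M.M.add_minus_minus)
  next
    case (balanced u s b)
    then obtain x where x: "x \<in> carrier M" "u = \<beta> x" using beta_surj by metis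
    have us: "u \<triangleleft>\<^bsub>W\<^esub> s = \<beta> (x \<triangleleft>\<^bsub>M\<^esub> \<pi> s)" using x balanced(2) by (simp add: beta_ract)
    have "mu g = (x \<triangleleft>\<^bsub>M\<^esub> \<pi> s) \<triangleleft>\<^bsub>M\<^esub> b \<ominus>\<^bsub>M\<^esub> x \<triangleleft>\<^bsub>M\<^esub> (\<pi> s \<otimes>\<^bsub>A\<^esub> b)"
      unfolding balanced(4) us unfolding x(2) using x balanced(2,3) pi_closed[OF balanced(2)]
      by (simp add: mu_diff P_diff_closed pt_closed mu_pt beta_closed M.ract_closed)
    then show ?thesis using x balanced(2,3) pi_closed[OF balanced(2)]
      by (simp add: a_minus_def M.ract_closed M.M.r_neg M.ract_assoc)
  qed
qed

lemma mu_H: "h \<in> H \<Longrightarrow> mu h = \<zero>\<^bsub>M\<^esub>"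
proof (induction rule: H_induct)
  case (neg g)
  have "mu (\<lambda>p. 0 - g p) = mu (\<lambda>p. 0) \<ominus>\<^bsub>M\<^esub> mu g"
    using P.zero_closed Rel_closed neg by (intro mu_diff) (auto simp: pre_tensor_simps(2))
  then show ?case using neg by (simp add: mu_Rel mu_zero a_minus_def)
qed (auto simp: mu_zero mu_Rel mu_add H_closed)

definition eta :: "'m \<Rightarrow> ('w \<times> 'a \<Rightarrow> int) set" where
  "eta x = H +>\<^bsub>P\<^esub> pure_tensor (\<beta> x) \<one>\<^bsub>A\<^esub>"

abbreviation "E \<equiv> extend_scalars S A \<pi> W"

lemma E_eq: "E = quot_module P H"
  by (simp add: extend_scalars_def H_def)

lemma pt1: "x \<in> carrier M \<Longrightarrow> pure_tensor (\<beta> x) \<one>\<^bsub>A\<^esub> \<in> carrier P"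
  by (simp add: pt_closed beta_closed)

lemma eta_closed: "x \<in> carrier M \<Longrightarrow> eta x \<in> carrier E"
  unfolding E_eq quot_carrier[OF P.abelian_group_axioms H_subgroup] eta_def using pt1 by blast

lemma eta_add: "x \<in> carrier M \<Longrightarrow> y \<in> carrier M \<Longrightarrow> eta (x \<oplus>\<^bsub>M\<^esub> y) = eta x \<oplus>\<^bsub>E\<^esub> eta y"
proof -
  assume xy: "x \<in> carrier M" "y \<in> carrier M"
  let ?t = "\<lambda>x. pure_tensor (\<beta> x) \<one>\<^bsub>A\<^esub>"
  have "(\<lambda>p. pure_tensor (\<beta> x \<oplus>\<^bsub>W\<^esub> \<beta> y) \<one>\<^bsub>A\<^esub> p - ?t x p - ?t y p) \<in> Rel"
    using xy beta_closed[of x] beta_closed[of y] A.one_closed unfolding tensor_relations_def by blast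
  then have "(\<lambda>p. ?t (x \<oplus>\<^bsub>M\<^esub> y) p - (?t x p + ?t y p)) \<in> H"
    using H_Rel xy by (simp add: beta_add diff_diff_eq)
  then have "H +>\<^bsub>P\<^esub> ?t (x \<oplus>\<^bsub>M\<^esub> y) = H +>\<^bsub>P\<^esub> (\<lambda>p. ?t x p + ?t y p)"
    using xy by (intro quot_eqI P_diff_closed pt1) auto
  also have "\<dots> = eta x \<oplus>\<^bsub>E\<^esub> eta y"
    unfolding E_eq eta_def using quot_add[OF P.abelian_group_axioms H_subgroup pt1[OF xy(1)] pt1[OF xy(2)]]
    by (simp add: pre_tensor_simps(3))
  finally show ?thesis by (simp add: eta_def)
qed

text \<open>Balancing moves the second factor to the left; since \<pi> is surjective, every pure
  tensor becomes one with second factor 1.\<close>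

lemma coset_pt:
  assumes x: "x \<in> carrier M" and s: "s \<in> carrier S"
  shows "H +>\<^bsub>P\<^esub> pure_tensor (\<beta> x) (\<pi> s) = eta (x \<triangleleft>\<^bsub>M\<^esub> \<pi> s)"
proof -
  have "(\<lambda>p. pure_tensor (\<beta> x \<triangleleft>\<^bsub>W\<^esub> s) \<one>\<^bsub>A\<^esub> p - pure_tensor (\<beta> x) (\<pi> s \<otimes>\<^bsub>A\<^esub> \<one>\<^bsub>A\<^esub>) p) \<in> Rel"
    using assms beta_closed A.one_closed unfolding tensor_relations_def by blast
  then have "(\<lambda>p. pure_tensor (\<beta> (x \<triangleleft>\<^bsub>M\<^esub> \<pi> s)) \<one>\<^bsub>A\<^esub> p - pure_tensor (\<beta> x) (\<pi> s) p) \<in> H"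
    using H_Rel assms pi_closed[OF s] by (simp add: beta_ract)
  then have "H +>\<^bsub>P\<^esub> pure_tensor (\<beta> (x \<triangleleft>\<^bsub>M\<^esub> \<pi> s)) \<one>\<^bsub>A\<^esub> = H +>\<^bsub>P\<^esub> pure_tensor (\<beta> x) (\<pi> s)"
    using assms pi_closed[OF s] by (intro quot_eqI pt1 pt_closed beta_closed M.ract_closed)
  then show ?thesis by (simp add: eta_def)
qed

lemma eta_ract:
  assumes x: "x \<in> carrier M" and a: "a \<in> carrier A"
  shows "eta (x \<triangleleft>\<^bsub>M\<^esub> a) = eta x \<triangleleft>\<^bsub>E\<^esub> a"
proof -
  obtain s where s: "s \<in> carrier S" "a = \<pi> s" using a pi_surj by blast
  have "eta x \<triangleleft>\<^bsub>E\<^esub> a = H +>\<^bsub>P\<^esub> pure_tensor (\<beta> x) a"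
    unfolding E_eq eta_def using coset_ract[OF pt1[OF x] a] a by (simp add: pt_ract)
  then show ?thesis using coset_pt[OF x s(1)] s by simp
qed

text \<open>The evaluation \<open>mu\<close> kills the relations and recovers x from \<beta> x
  \<otimes> 1.\<close>

lemma eta_inj: "inj_on eta (carrier M)"
proof (rule inj_onI)
  fix x y assume xy: "x \<in> carrier M" "y \<in> carrier M" "eta x = eta y"
  then have "pure_tensor (\<beta> x) \<one>\<^bsub>A\<^esub> \<ominus>\<^bsub>P\<^esub> pure_tensor (\<beta> y) \<one>\<^bsub>A\<^esub> \<in> H"
    using quot_eq_iff[OF P.abelian_group_axioms H_subgroup pt1[OF xy(1)] pt1[OF xy(2)]] by (simp add: eta_def)
  then have "mu (\<lambda>p. pure_tensor (\<beta> x) \<one>\<^bsub>A\<^esub> p - pure_tensor (\<beta> y) \<one>\<^bsub>A\<^esub> p) = \<zero>\<^bsub>M\<^esub>"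
    using mu_H xy by (simp add: P_diff pt1)
  then have "x \<ominus>\<^bsub>M\<^esub> y = \<zero>\<^bsub>M\<^esub>" using xy by (simp add: mu_diff pt1 mu_pt M.ract_one)
  then show "x = y" using xy by (simp add: M.M.minus_eq_zero_iff)
qed

lemma eta_zero: "eta \<zero>\<^bsub>M\<^esub> = \<zero>\<^bsub>E\<^esub>"
proof -
  interpret E: abelian_group E unfolding E_eq by (rule quot_abelian_group[OF P.abelian_group_axioms H_subgroup])
  have "eta \<zero>\<^bsub>M\<^esub> \<oplus>\<^bsub>E\<^esub> eta \<zero>\<^bsub>M\<^esub> = eta \<zero>\<^bsub>M\<^esub>" using eta_add[of "\<zero>\<^bsub>M\<^esub>" "\<zero>\<^bsub>M\<^esub>"] by simp
  then show ?thesis using E.add.l_cancel_one eta_closed[of "\<zero>\<^bsub>M\<^esub>"] by simp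
qed

text \<open>The classes of the form \<open>eta x\<close> are closed under addition and negation and
  include the pure tensors, and formal combinations are finite integer sums of these.\<close>

lemma eta_surj: "c \<in> carrier P \<Longrightarrow> \<exists>x\<in>carrier M. H +>\<^bsub>P\<^esub> c = eta x"
proof -
  define Good where "Good c \<longleftrightarrow> c \<in> carrier P \<and> (\<exists>x\<in>carrier M. H +>\<^bsub>P\<^esub> c = eta x)" for c
  interpret E: abelian_group E unfolding E_eq by (rule quot_abelian_group[OF P.abelian_group_axioms H_subgroup])
  note Hq = quot_add[OF P.abelian_group_axioms H_subgroup, folded E_eq]
  have zero: "Good (\<lambda>p. 0)"
  proof -
    have "H +>\<^bsub>P\<^esub> \<zero>\<^bsub>P\<^esub> = eta \<zero>\<^bsub>M\<^esub>"
      using quot_eq_zero_iff[OF P.abelian_group_axioms H_subgroup P.zero_closed] additive_subgroup.zero_closed[OF H_subgroup]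
      by (simp add: eta_zero E_eq quot_module_simps)
    then show ?thesis unfolding Good_def using P.zero_closed by (auto simp: pre_tensor_simps(2))
  qed
  have add: "Good (\<lambda>p. c p + c' p)" if g: "Good c" "Good c'" for c c'
  proof -
    obtain x y where xy: "x \<in> carrier M" "H +>\<^bsub>P\<^esub> c = eta x" "y \<in> carrier M" "H +>\<^bsub>P\<^esub> c' = eta y"
      using g unfolding Good_def by blast
    then have "H +>\<^bsub>P\<^esub> (\<lambda>p. c p + c' p) = eta (x \<oplus>\<^bsub>M\<^esub> y)"
      using g Hq[of c c'] by (simp add: Good_def eta_add pre_tensor_simps(3))
    then show ?thesis using xy g P_diff_closed(2) unfolding Good_def by blast
  qed
  have neg: "Good (\<lambda>p. - c p)" if g: "Good c" for c
  proof -
    obtain x where x: "x \<in> carrier M" "H +>\<^bsub>P\<^esub> c = eta x" using g unfolding Good_def by blast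
    have c: "c \<in> carrier P" "\<ominus>\<^bsub>P\<^esub> c \<in> carrier P" using g by (auto simp: Good_def)
    have "(H +>\<^bsub>P\<^esub> \<ominus>\<^bsub>P\<^esub> c) \<oplus>\<^bsub>E\<^esub> eta x = \<zero>\<^bsub>E\<^esub>"
      using Hq[OF c(2,1)] x c additive_subgroup.zero_closed[OF H_subgroup]
        quot_eq_zero_iff[OF P.abelian_group_axioms H_subgroup P.zero_closed]
      by (simp add: P.l_neg E_eq quot_module_simps)
    moreover have "eta (\<ominus>\<^bsub>M\<^esub> x) \<oplus>\<^bsub>E\<^esub> eta x = \<zero>\<^bsub>E\<^esub>" using x by (simp add: M.M.l_neg eta_zero flip: eta_add)
    moreover have "H +>\<^bsub>P\<^esub> \<ominus>\<^bsub>P\<^esub> c \<in> carrier E"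
      unfolding E_eq quot_carrier[OF P.abelian_group_axioms H_subgroup] using c by blast
    ultimately have "H +>\<^bsub>P\<^esub> \<ominus>\<^bsub>P\<^esub> c = eta (\<ominus>\<^bsub>M\<^esub> x)"
      using E.minus_equality[of _ "eta x"] x eta_closed by (metis M.M.a_inv_closed)
    then show ?thesis unfolding Good_def using c x P_minus[OF c(1)] by (intro conjI bexI[of _ "\<ominus>\<^bsub>M\<^esub> x"]) auto
  qed
  have pt: "Good (pure_tensor m b)" if mb: "m \<in> carrier W" "b \<in> carrier A" for m b
  proof -
    obtain x s where xs: "x \<in> carrier M" "m = \<beta> x" "s \<in> carrier S" "b = \<pi> s" using mb beta_surj pi_surj by blast
    then show ?thesis unfolding Good_def using coset_pt[OF xs(1,3)] pt_closed[OF mb] M.ract_closed pi_closed by blast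
  qed
  \<comment> \<open>Integer multiples of one pure tensor, by induction on \<open>k\<close> in both
    directions from 0.\<close>
  have sg: "Good (\<lambda>q. if q = (m, b) then k else 0)" if mb: "m \<in> carrier W" "b \<in> carrier A" for m b k
  proof (induction k rule: int_induct[where k = 0])
    case base
    then show ?case using zero by simp
  next
    case (step1 i)
    have "(\<lambda>q. if q = (m, b) then i + 1 else 0) = (\<lambda>q. (if q = (m, b) then i else 0) + pure_tensor m b q)"
      by (auto simp: pure_tensor_def)
    then show ?case using add[OF step1(2) pt[OF mb]] by simp
  next
    case (step2 i)
    have "(\<lambda>q. if q = (m, b) then i - 1 else 0) = (\<lambda>q. (if q = (m, b) then i else 0) + - pure_tensor m b q)"
      by (auto simp: pure_tensor_def)
    then show ?case using add[OF step2(2) neg[OF pt[OF mb]]] by simp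
  qed
  have "Good c" if "finite B" "{p. c p \<noteq> 0} = B" "B \<subseteq> carrier W \<times> carrier A" for B c
    using that
  proof (induction B arbitrary: c rule: finite_induct)
    case empty
    then have "c = (\<lambda>p. 0)" by auto
    then show ?case using zero by simp
  next
    case (insert p B)
    obtain m b where p: "p = (m, b)" by (cases p)
    have "{q. (c(p := 0)) q \<noteq> 0} = B" using insert by (auto split: if_splits)
    then have "Good (c(p := 0))" using insert by blast
    moreover have "Good (\<lambda>q. if q = (m, b) then c p else 0)" using insert p by (intro sg) auto
    ultimately have "Good (\<lambda>q. (c(p := 0)) q + (if q = (m, b) then c p else 0))" by (rule add)
    moreover have "(\<lambda>q. (c(p := 0)) q + (if q = (m, b) then c p else 0)) = c" by (auto simp: p)
    ultimately show ?case by simp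
  qed
  then show "c \<in> carrier P \<Longrightarrow> \<exists>x\<in>carrier M. H +>\<^bsub>P\<^esub> c = eta x"
    by (auto simp: Good_def pre_tensor_simps(1))
qed

theorem extend_scalars_iso: "graded_isomorphic A M E"
proof -
  have "eta \<in> right_hom A M E"
    by (intro right_homI eta_closed eta_add eta_ract)
  moreover have "eta ` mpart M i \<subseteq> mpart E i" for i
  proof
    fix z assume "z \<in> eta ` mpart M i"
    then obtain x where x: "x \<in> mpart M i" "z = eta x" by blast
    have "pure_tensor (\<beta> x) \<one>\<^bsub>A\<^esub> \<in> mpart P i"
      using beta_mpart[OF x(1)] one_rpart by (auto simp: pre_tensor_simps pure_tensor_def split: if_splits intro!: exI[of _ i])
    then show "z \<in> mpart E i" unfolding x(2) E_eq quot_module_simps eta_def by blast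
  qed
  moreover have "eta ` carrier M = carrier E"
    using eta_closed eta_surj unfolding E_eq quot_carrier[OF P.abelian_group_axioms H_subgroup] by force
  ultimately have "eta \<in> graded_iso A M E"
    using eta_inj by (auto simp: graded_iso_def graded_hom_def bij_betw_def)
  then show ?thesis by (auto simp: graded_isomorphic_def)
qed

end

section \<open>The matrix factorization built from the presentation matrix, and its cokernel\<close>

context filtered_module
begin

definition fmul :: "(nat \<Rightarrow> 's) \<Rightarrow> nat \<Rightarrow> 's" where
  "fmul v = (\<lambda>s\<in>{..<r}. f \<otimes>\<^bsub>S\<^esub> v s)"

text \<open>Semilinear over \<tau> j rather than linear, so it enters the factorization only through
  conjugation.\<close>

definition T :: "int \<Rightarrow> (nat \<Rightarrow> 's) \<Rightarrow> nat \<Rightarrow> 's" where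
  "T j v = (\<lambda>s\<in>{..<r}. \<tau> j (v s))"

lemma F_closed_change: "v \<in> carrier (F c) \<Longrightarrow> v \<in> carrier (F d)"
  by (simp add: graded_free_simps)

lemma fmul_closed: "v \<in> carrier (F c) \<Longrightarrow> fmul v \<in> carrier (F d)"
  unfolding F_carrier fmul_def restrict_PiE_iff using F_apply[of v c] by (simp add: F_carrier)

lemma T_closed: "v \<in> carrier (F c) \<Longrightarrow> T j v \<in> carrier (F d)"
  unfolding F_carrier T_def restrict_PiE_iff using F_apply[of v c] by (simp add: F_carrier)

lemma fmul_apply: "s < r \<Longrightarrow> fmul v s = f \<otimes>\<^bsub>S\<^esub> v s"
  by (simp add: fmul_def)

lemma T_apply: "s < r \<Longrightarrow> T j v s = \<tau> j (v s)"
  by (simp add: T_def)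

lemma fmul_hom: "fmul \<in> right_hom S (F c) (F d)"
proof (rule right_homI[OF fmul_closed])
  fix u v assume uv: "u \<in> carrier (F c)" "v \<in> carrier (F c)"
  show "fmul (u \<oplus>\<^bsub>F c\<^esub> v) = fmul u \<oplus>\<^bsub>F d\<^esub> fmul v"
  proof (rule graded_free_ext[OF fmul_closed[OF F.M.a_closed[OF uv], of d]])
    show "fmul u \<oplus>\<^bsub>F d\<^esub> fmul v \<in> carrier (F d)" by (intro F.M.a_closed fmul_closed[OF uv(1)] fmul_closed[OF uv(2)])
    fix s assume s: "s < r"
    then show "fmul (u \<oplus>\<^bsub>F c\<^esub> v) s = (fmul u \<oplus>\<^bsub>F d\<^esub> fmul v) s"
      using F_apply[OF uv(1) s] F_apply[OF uv(2) s] by (simp add: fmul_apply graded_free_apply S.r_distr)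
  qed
next
  fix u a assume u: "u \<in> carrier (F c)" and a: "a \<in> carrier S"
  show "fmul (u \<triangleleft>\<^bsub>F c\<^esub> a) = fmul u \<triangleleft>\<^bsub>F d\<^esub> a"
  proof (rule graded_free_ext[OF fmul_closed[OF F.ract_closed[OF u a], of d] F.ract_closed[OF fmul_closed[OF u] a]])
    fix s assume s: "s < r"
    then show "fmul (u \<triangleleft>\<^bsub>F c\<^esub> a) s = (fmul u \<triangleleft>\<^bsub>F d\<^esub> a) s"
      using F_apply[OF u s] a by (simp add: fmul_apply graded_free_apply S.m_assoc)
  qed
qed

lemma T_add:
  assumes uv: "u \<in> carrier (F c)" "v \<in> carrier (F c)"
  shows "T j (u \<oplus>\<^bsub>F c\<^esub> v) = T j u \<oplus>\<^bsub>F d\<^esub> T j v"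
proof (rule graded_free_ext[OF T_closed[OF F.M.a_closed[OF uv], of j d]])
  show "T j u \<oplus>\<^bsub>F d\<^esub> T j v \<in> carrier (F d)" by (intro F.M.a_closed T_closed[OF uv(1)] T_closed[OF uv(2)])
  fix s assume s: "s < r"
  then show "T j (u \<oplus>\<^bsub>F c\<^esub> v) s = (T j u \<oplus>\<^bsub>F d\<^esub> T j v) s"
    using F_apply[OF uv(1) s] F_apply[OF uv(2) s] by (simp add: T_apply graded_free_apply ring_hom_add[OF tau_hom])
qed

lemma T_ract:
  assumes u: "v \<in> carrier (F c)" and a: "a \<in> carrier S"
  shows "T j (v \<triangleleft>\<^bsub>F c\<^esub> a) = T j v \<triangleleft>\<^bsub>F d\<^esub> \<tau> j a"
proof (rule graded_free_ext[OF T_closed[OF F.ract_closed[OF u a], of j d] F.ract_closed[OF T_closed[OF u] tau_closed[OF a]]])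
  fix s assume s: "s < r"
  then show "T j (v \<triangleleft>\<^bsub>F c\<^esub> a) s = (T j v \<triangleleft>\<^bsub>F d\<^esub> \<tau> j a) s"
    using F_apply[OF u s] a by (simp add: T_apply graded_free_apply ring_hom_mult[OF tau_hom])
qed

lemma T_0:
  assumes v: "v \<in> carrier (F c)"
  shows "T 0 v = v"
  by (rule graded_free_ext[OF T_closed[OF v] v]) (simp add: T_apply tau_0 F_apply[OF v])

lemma T_T:
  assumes v: "v \<in> carrier (F c)"
  shows "T i (T j v) = T (i + j) v"
  by (rule graded_free_ext[OF T_closed[OF T_closed[OF v]] T_closed[OF v]])
     (simp add: T_apply tau_add F_apply[OF v])

lemma T_fmul:
  assumes v: "v \<in> carrier (F c)"
  shows "T j (fmul v) = fmul (T j v)"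
  by (rule graded_free_ext[OF T_closed[OF fmul_closed[OF v]] fmul_closed[OF T_closed[OF v]]])
     (simp add: T_apply fmul_apply ring_hom_mult[OF tau_hom] tau_f F_apply[OF v])

text \<open>Normality of f in coordinates. Left multiplication by f is what a factorization has to
  produce, while the right action of f is what commutes with linear maps; the two differ by
  \<open>T 1\<close>.\<close>

lemma fmul_T_1:
  assumes v: "v \<in> carrier (F c)"
  shows "fmul (T 1 v) = v \<triangleleft>\<^bsub>F d\<^esub> f"
  by (rule graded_free_ext[OF fmul_closed[OF T_closed[OF v]] F.ract_closed[OF F_closed_change[OF v] f_closed]])
     (simp add: T_apply fmul_apply graded_free_apply tau_normal F_apply[OF v])

lemma T_mpart: "v \<in> mpart (F d) i \<Longrightarrow> T j v \<in> mpart (F d) i"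
  by (auto simp: T_def graded_free_simps PiE_iff tau_rpart)

lemma fmul_mpart:
  assumes "v \<in> mpart (F d) i"
  shows "fmul v \<in> mpart (F (d - 2)) i"
proof -
  have "f \<otimes>\<^bsub>S\<^esub> v s \<in> rpart S (i - (d - 2))" if "s < r" for s
    using mult_rpart[OF f_rpart, of "v s" "i - d"] assms that by (simp add: graded_free_simps PiE_iff algebra_simps)
  then show ?thesis by (simp add: fmul_def graded_free_simps)
qed

lemma F_mpart_closed: "v \<in> mpart (F d) i \<Longrightarrow> v \<in> carrier (F d)"
  using rpart_closed by (auto simp: graded_free_simps PiE_iff)

lemma phi0_mpart:
  assumes "v \<in> mpart (F (d + 1)) i"
  shows "phi0 v \<in> mpart (F d) i"
proof -
  note v = F_mpart_closed[OF assms]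
  have "phi0 v s \<in> rpart S (i - d)" if s: "s < r" for s
    unfolding phi0_apply[OF v s]
  proof (rule S.additive_subgroup_finsum[OF rpart_subgroup])
    fix j assume "j \<in> {..<r}"
    then have "v j \<in> rpart S (i - (d + 1))" "C j s \<in> rpart S 1"
      using assms C_rpart s by (auto simp: graded_free_simps PiE_iff)
    then show "C j s \<otimes>\<^bsub>S\<^esub> v j \<in> rpart S (i - d)" using mult_rpart[of "C j s" 1 "v j" "i - (d + 1)"] by simp
  qed simp
  then show ?thesis using phi0_closed[OF v, of d] by (simp add: graded_free_simps PiE_iff)
qed

text \<open>Degrees can be read off after applying the injective graded map
  \<open>phi0\<close>.\<close>

lemma phi0_reflect:
  assumes v: "v \<in> carrier (F (d + 1))" and i: "phi0 v \<in> mpart (F d) i"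
  shows "v \<in> mpart (F (d + 1)) i"
proof (rule components_reflect[OF F.M.abelian_group_axioms components_graded_free[OF S.ring_axioms comps]
      F.M.abelian_group_axioms components_graded_free[OF S.ring_axioms comps], where h = phi0])
  show "phi0 \<in> carrier (F (d + 1)) \<rightarrow> carrier (F d)" using phi0_closed by blast
  show "phi0 (x \<oplus>\<^bsub>F (d + 1)\<^esub> y) = phi0 x \<oplus>\<^bsub>F d\<^esub> phi0 y"
    if "x \<in> carrier (F (d + 1))" "y \<in> carrier (F (d + 1))" for x y
    using right_homD(2)[OF phi0_hom that] .
  show "phi0 ` mpart (F (d + 1)) i \<subseteq> mpart (F d) i" for i using phi0_mpart by blast
qed (use v i phi0_inj in auto)

lemma rho_fmul:
  assumes v: "v \<in> carrier (F d)"
  shows "rho (fmul v) = \<zero>\<^bsub>M\<^esub>"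
proof -
  have "rho (fmul v) = (\<Oplus>\<^bsub>X\<^esub>j\<in>{..<r}. \<zero>\<^bsub>M\<^esub>)"
    unfolding rho_def lincomb_def using F_apply[OF v] e_closed
    by (intro X.M.finsum_cong') (auto simp: fmul_def pi_f)
  also have "\<dots> = \<zero>\<^bsub>M\<^esub>" using X.M.finsum_zero by simp
  finally show ?thesis .
qed

text \<open>The quotient of f by \<open>phi0\<close>: f annihilates \<open>M\<close>, so multiples
  of f lie in the kernel of \<open>rho\<close>, which is the image of the injective map
  \<open>phi0\<close>. Linearity and degrees of \<open>phi1\<close> are obtained by cancelling
  \<open>phi0\<close>.\<close>

definition phi1 :: "(nat \<Rightarrow> 's) \<Rightarrow> nat \<Rightarrow> 's" where
  "phi1 v = (SOME t. t \<in> carrier (F 0) \<and> fmul v = phi0 t)"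

lemma phi1:
  assumes v: "v \<in> carrier (F c)"
  shows phi1_closed: "phi1 v \<in> carrier (F d)" and phi0_phi1: "phi0 (phi1 v) = fmul v"
proof -
  have "\<exists>t. t \<in> carrier (F 0) \<and> fmul v = phi0 t"
    using rho_kernel[OF fmul_closed[OF v] rho_fmul[OF v]] by blast
  from someI_ex[OF this, folded phi1_def] show "phi1 v \<in> carrier (F d)" "phi0 (phi1 v) = fmul v"
    by (auto intro: F_closed_change)
qed

lemma phi0_eqD: "u \<in> carrier (F c) \<Longrightarrow> v \<in> carrier (F c) \<Longrightarrow> phi0 u = phi0 v \<Longrightarrow> u = v"
  using phi0_inj by (rule inj_onD)

lemma phi1_hom: "phi1 \<in> right_hom S (F c) (F d)"
proof (rule right_homI[OF phi1_closed])
  fix u v assume uv: "u \<in> carrier (F c)" "v \<in> carrier (F c)"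
  note uv1 = phi1_closed[OF uv(1), of d] phi1_closed[OF uv(2), of d]
  show "phi1 (u \<oplus>\<^bsub>F c\<^esub> v) = phi1 u \<oplus>\<^bsub>F d\<^esub> phi1 v"
  proof (rule phi0_eqD[of _ d])
    show "phi1 (u \<oplus>\<^bsub>F c\<^esub> v) \<in> carrier (F d)" "phi1 u \<oplus>\<^bsub>F d\<^esub> phi1 v \<in> carrier (F d)"
      using phi1_closed[OF F.M.a_closed[OF uv]] uv1 by auto
    show "phi0 (phi1 (u \<oplus>\<^bsub>F c\<^esub> v)) = phi0 (phi1 u \<oplus>\<^bsub>F d\<^esub> phi1 v)"
      unfolding phi0_phi1[OF F.M.a_closed[OF uv]] right_homD(2)[OF phi0_hom uv1, of d]
        phi0_phi1[OF uv(1)] phi0_phi1[OF uv(2)] by (rule right_homD(2)[OF fmul_hom uv])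
  qed
next
  fix u a assume u: "u \<in> carrier (F c)" and a: "a \<in> carrier S"
  note u1 = phi1_closed[OF u, of d]
  show "phi1 (u \<triangleleft>\<^bsub>F c\<^esub> a) = phi1 u \<triangleleft>\<^bsub>F d\<^esub> a"
  proof (rule phi0_eqD[of _ d])
    show "phi1 (u \<triangleleft>\<^bsub>F c\<^esub> a) \<in> carrier (F d)" "phi1 u \<triangleleft>\<^bsub>F d\<^esub> a \<in> carrier (F d)"
      using phi1_closed[OF F.ract_closed[OF u a]] F.ract_closed[OF u1 a] by auto
    show "phi0 (phi1 (u \<triangleleft>\<^bsub>F c\<^esub> a)) = phi0 (phi1 u \<triangleleft>\<^bsub>F d\<^esub> a)"
      unfolding phi0_phi1[OF F.ract_closed[OF u a]] right_homD(3)[OF phi0_hom u1 a, of d]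
        phi0_phi1[OF u] by (rule right_homD(3)[OF fmul_hom u a])
  qed
qed

lemma phi1_mpart:
  assumes "v \<in> mpart (F (d + 1)) i"
  shows "phi1 v \<in> mpart (F d) i"
proof -
  note v = F_mpart_closed[OF assms]
  \<comment> \<open>\<open>phi0\<close> lowers the twist by one and multiplication by f lowers it by
    two, so \<open>phi1 v\<close> is read in twist d = (d - 1) + 1 to compare degrees in twist d -
    1.\<close>
  have "phi1 v \<in> carrier (F (d - 1 + 1))" by (rule phi1_closed[OF v])
  moreover have "phi0 (phi1 v) \<in> mpart (F (d - 1)) i"
    unfolding phi0_phi1[OF v] using fmul_mpart[OF assms] by simp
  ultimately show ?thesis using phi0_reflect[of "phi1 v" "d - 1" i] by simp
qed

text \<open>Even positions carry \<open>phi0\<close> and odd ones \<open>phi1\<close>, conjugated by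
  the power of \<open>T\<close> that counts the periods. Unconjugated, the composite of
  \<open>phi1\<close> followed by \<open>phi0\<close> would be f, but in general not the one in the
  other order; the increase of the power by one between positions 2j + 1 and 2j + 2 compensates for
  this. As \<open>div\<close> rounds down, one formula serves all integers.\<close>

definition phi :: "int \<Rightarrow> (nat \<Rightarrow> 's) \<Rightarrow> nat \<Rightarrow> 's" where
  "phi i v = T (i div 2) ((if even i then phi0 else phi1) (T (- (i div 2)) v))"

text \<open>The two semilinear factors have inverse twists, so scalars pass through
  unchanged.\<close>

lemma conj_T_hom:
  assumes h: "h \<in> right_hom S (F c) (F d)"
  shows "(\<lambda>v. T j (h (T (- j) v))) \<in> right_hom S (F c) (F d)"
proof (rule right_homI)
  fix u assume u: "u \<in> carrier (F c)"
  note Tu = T_closed[OF u, of "- j" c]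
  show "T j (h (T (- j) u)) \<in> carrier (F d)" by (rule T_closed[OF right_homD(1)[OF h Tu]])
  { fix v assume v: "v \<in> carrier (F c)"
    note Tv = T_closed[OF v, of "- j" c]
    show "T j (h (T (- j) (u \<oplus>\<^bsub>F c\<^esub> v))) = T j (h (T (- j) u)) \<oplus>\<^bsub>F d\<^esub> T j (h (T (- j) v))"
      unfolding T_add[OF u v, of "- j" c] right_homD(2)[OF h Tu Tv]
      by (rule T_add[OF right_homD(1)[OF h Tu] right_homD(1)[OF h Tv]]) }
  { fix a assume a: "a \<in> carrier S"
    have "T j (h (T (- j) u) \<triangleleft>\<^bsub>F d\<^esub> \<tau> (- j) a) = T j (h (T (- j) u)) \<triangleleft>\<^bsub>F d\<^esub> \<tau> j (\<tau> (- j) a)"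
      by (rule T_ract[OF right_homD(1)[OF h Tu] tau_closed[OF a]])
    then show "T j (h (T (- j) (u \<triangleleft>\<^bsub>F c\<^esub> a))) = T j (h (T (- j) u)) \<triangleleft>\<^bsub>F d\<^esub> a"
      unfolding T_ract[OF u a, of "- j" c] right_homD(3)[OF h Tu tau_closed[OF a]]
      using a by (simp add: tau_add tau_0) }
qed

lemma phi_hom: "phi i \<in> graded_hom S (F (i + 1)) (F i)"
proof -
  have "phi i \<in> right_hom S (F (i + 1)) (F i)"
    unfolding phi_def by (rule conj_T_hom) (simp add: phi0_hom phi1_hom)
  moreover have "phi i v \<in> mpart (F i) j" if "v \<in> mpart (F (i + 1)) j" for v j
    unfolding phi_def using T_mpart[OF that] phi0_mpart phi1_mpart by (auto intro!: T_mpart)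
  ultimately show ?thesis by (auto simp: graded_hom_def)
qed

text \<open>It suffices to compare after applying \<open>phi0\<close>. By the choice of
  \<open>phi1\<close> the left-hand side then starts with f times a \<open>T 1\<close>, which is the
  right action of f; this passes through the linear map \<open>phi0\<close> and turns back into left
  multiplication by f.\<close>

lemma phi1_T_phi0:
  assumes w: "w \<in> carrier (F c)"
  shows "phi1 (T 1 (phi0 (T (- 1) w))) = fmul w"
proof (rule phi0_eqD[of _ 0])
  note Tw = T_closed[OF w, of "- 1" 0]
  note pw = phi0_closed[OF Tw, of 0]
  note z = T_closed[OF pw, of 1 0]
  show "phi1 (T 1 (phi0 (T (- 1) w))) \<in> carrier (F 0)" "fmul w \<in> carrier (F 0)"
    using phi1_closed[OF z] fmul_closed[OF w] by auto
  have "phi0 (phi1 (T 1 (phi0 (T (- 1) w)))) = phi0 (T (- 1) w) \<triangleleft>\<^bsub>F 0\<^esub> f"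
    unfolding phi0_phi1[OF z] by (rule fmul_T_1[OF pw])
  also have "\<dots> = phi0 (T (- 1) w \<triangleleft>\<^bsub>F 0\<^esub> f)" by (rule right_homD(3)[OF phi0_hom Tw f_closed, symmetric])
  also have "T (- 1) w \<triangleleft>\<^bsub>F 0\<^esub> f = fmul (T 1 (T (- 1) w))" by (rule fmul_T_1[OF Tw, symmetric])
  also have "T 1 (T (- 1) w) = w" using T_T[OF w] T_0[OF w] by simp
  finally show "phi0 (phi1 (T 1 (phi0 (T (- 1) w)))) = phi0 (fmul w)" .
qed

text \<open>At even positions the inner twists cancel. At odd positions one \<open>T 1\<close> is
  left over, and \<open>phi1_T_phi0\<close> absorbs it. The outer conjugation does no harm because
  the automorphism fixes f.\<close>

lemma phi_phi:
  assumes v: "v \<in> carrier (F c)"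
  shows "phi i (phi (i + 1) v) = fmul v"
proof (cases "even i")
  case True
  then obtain j where i: "i = 2 * j" by (elim evenE)
  have j: "i div 2 = j" "(i + 1) div 2 = j" "odd (i + 1)" using i by auto
  note Tv = T_closed[OF v, of "- j" 0]
  note pv = phi1_closed[OF Tv, of 0]
  have "phi i (phi (i + 1) v) = T j (phi0 (T (- j) (T j (phi1 (T (- j) v)))))"
    unfolding phi_def j using True j(3) by simp
  also have "T (- j) (T j (phi1 (T (- j) v))) = phi1 (T (- j) v)" using T_T[OF pv] T_0[OF pv] by simp
  also have "T j (phi0 (phi1 (T (- j) v))) = fmul (T j (T (- j) v))"
    unfolding phi0_phi1[OF Tv] by (rule T_fmul[OF Tv])
  also have "T j (T (- j) v) = v" using T_T[OF v] T_0[OF v] by simp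
  finally show ?thesis .
next
  case False
  then obtain j where i: "i = 2 * j + 1" by (elim oddE)
  have j: "i div 2 = j" "(i + 1) div 2 = j + 1" "even (i + 1)" using i by auto
  note Tv = T_closed[OF v, of "- j" 0]
  note Tv' = T_closed[OF v, of "- (j + 1)" 0]
  note pv = phi0_closed[OF Tv', of 0]
  have "phi i (phi (i + 1) v) = T j (phi1 (T (- j) (T (j + 1) (phi0 (T (- (j + 1)) v)))))"
    unfolding phi_def j using False j(3) by simp
  also have "T (- j) (T (j + 1) (phi0 (T (- (j + 1)) v))) = T 1 (phi0 (T (- (j + 1)) v))"
    using T_T[OF pv, of "- j" "j + 1"] by simp
  also have "T (- (j + 1)) v = T (- 1 + - j) v" by (rule arg_cong[of _ _ "\<lambda>k. T k v"]) simp
  also have "\<dots> = T (- 1) (T (- j) v)" using T_T[OF v] by simp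
  also have "T j (phi1 (T 1 (phi0 (T (- 1) (T (- j) v))))) = fmul (T j (T (- j) v))"
    unfolding phi1_T_phi0[OF Tv] by (rule T_fmul[OF Tv])
  also have "T j (T (- j) v) = v" using T_T[OF v] T_0[OF v] by simp
  finally show ?thesis .
qed

lemma id_graded_iso: "(\<lambda>v. v) \<in> graded_iso S (F d) (F d)"
  by (auto simp: graded_iso_def graded_hom_def right_hom_def bij_betw_def)

lemma phi_NMF0: "(F, phi) \<in> NMF0 S 2 f r"
proof -
  have "(F, phi) \<in> NMF S 2 f r"
    unfolding NMF_def
  proof (intro CollectI case_prodI conjI allI)
    show "graded_right_module S (F i)" for i
      by (rule graded_right_module_graded_free[OF S.ring_axioms comps mult_rpart])
    show "phi i \<in> graded_hom S (F (i + 1)) (F i)" for i by (rule phi_hom)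
    have "\<forall>v\<in>carrier (F (i + 2)). phi i (phi (i + 1) v) = (\<lambda>s\<in>{..<r}. f \<otimes>\<^bsub>S\<^esub> v s)" for i
      using phi_phi by (auto simp: fmul_def)
    \<comment> \<open>\<open>F i\<close> is generated in degree i, so all twists at position i are
      i, and two steps raise them by the degree of f.\<close>
    then show "\<exists>m. \<forall>i. (\<forall>s<r. m (i + 2) s = m i s + 2) \<and>
        (\<exists>g\<in>graded_iso S (F (i + 2)) (graded_free S r (m (i + 2))).
         \<exists>h\<in>graded_iso S (F i) (graded_free S r (m i)).
           \<forall>v\<in>carrier (F (i + 2)). h (phi i (phi (i + 1) v)) = (\<lambda>s\<in>{..<r}. f \<otimes>\<^bsub>S\<^esub> g v s))"
      by (intro exI[of _ "\<lambda>i s. i"] allI conjI bexI[OF _ id_graded_iso]) auto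
  qed
  moreover have "graded_isomorphic S (F 0) (graded_free S r (\<lambda>s. 0))"
    using id_graded_iso unfolding graded_isomorphic_def by blast
  ultimately show ?thesis by (simp add: NMF0_def)
qed

lemma phi_0: "v \<in> carrier (F c) \<Longrightarrow> phi 0 v = phi0 v"
  using T_0 T_0[OF phi0_closed] by (simp add: phi_def)

definition K where "K = phi 0 ` carrier (F 1)"

lemma K: "K = {v \<in> carrier (F 0). rho v = \<zero>\<^bsub>M\<^esub>}"
proof
  show "K \<subseteq> {v \<in> carrier (F 0). rho v = \<zero>\<^bsub>M\<^esub>}"
    using phi_0 phi0_closed rho_phi0 by (auto simp: K_def)
  show "{v \<in> carrier (F 0). rho v = \<zero>\<^bsub>M\<^esub>} \<subseteq> K"
  proof
    fix v assume v: "v \<in> {v \<in> carrier (F 0). rho v = \<zero>\<^bsub>M\<^esub>}"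
    then obtain t where "t \<in> carrier (F 1)" "v = phi0 t" using rho_kernel[of v 0 1] by blast
    then show "v \<in> K" unfolding K_def using phi_0 by (metis image_eqI)
  qed
qed

lemma K_subgroup: "additive_subgroup K (F 0)"
proof (rule additive_subgroupI, rule F.M.add.subgroupI)
  show "K \<subseteq> carrier (F 0)" by (auto simp: K)
  show "K \<noteq> {}" using rho_zero[of 0] unfolding K by blast
  show "\<ominus>\<^bsub>F 0\<^esub> v \<in> K" if "v \<in> K" for v
  proof -
    have v: "v \<in> carrier (F 0)" "rho v = \<zero>\<^bsub>X\<^esub>" using that by (simp_all add: K)
    have "rho (\<ominus>\<^bsub>F 0\<^esub> v) = \<ominus>\<^bsub>X\<^esub> rho v"
      by (rule right_hom_minus[OF rho_hom F.M.abelian_group_axioms X.M.abelian_group_axioms v(1)])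
    also have "\<dots> = \<zero>\<^bsub>X\<^esub>" unfolding v(2) by (rule X.M.minus_equality) simp_all
    finally show ?thesis using v by (simp add: K)
  qed
  show "u \<oplus>\<^bsub>F 0\<^esub> v \<in> K" if "u \<in> K" "v \<in> K" for u v
    using that by (simp add: K rho_add)
qed

abbreviation "W \<equiv> quot_module (F 0) K"

text \<open>The inverse of the isomorphism from the cokernel to \<open>M\<close> induced by
  \<open>rho\<close>; well defined since \<open>K\<close> is the kernel of
  \<open>rho\<close>.\<close>

definition beta :: "'m \<Rightarrow> (nat \<Rightarrow> 's) set" where
  "beta x = K +>\<^bsub>F 0\<^esub> (SOME v. v \<in> carrier (F 0) \<and> rho v = x)"

lemma rho_diff: "u \<in> carrier (F d) \<Longrightarrow> v \<in> carrier (F d) \<Longrightarrow> rho (u \<ominus>\<^bsub>F d\<^esub> v) = \<zero>\<^bsub>M\<^esub> \<longleftrightarrow> rho u = rho v"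
  using right_hom_diff[OF rho_hom F.M.abelian_group_axioms X.M.abelian_group_axioms, of u d v]
    X.M.minus_eq_zero_iff[of "rho u" "rho v"] rho_closed[of u d] rho_closed[of v d] by simp

lemma coset_eq_iff: "u \<in> carrier (F 0) \<Longrightarrow> v \<in> carrier (F 0) \<Longrightarrow> K +>\<^bsub>F 0\<^esub> u = K +>\<^bsub>F 0\<^esub> v \<longleftrightarrow> rho u = rho v"
  using quot_eq_iff[OF F.M.abelian_group_axioms K_subgroup, of u v] by (simp add: K rho_diff)

lemma beta_rho: "v \<in> carrier (F 0) \<Longrightarrow> beta (rho v) = K +>\<^bsub>F 0\<^esub> v"
proof -
  assume v: "v \<in> carrier (F 0)"
  have "(SOME u. u \<in> carrier (F 0) \<and> rho u = rho v) \<in> carrier (F 0) \<and> rho (SOME u. u \<in> carrier (F 0) \<and> rho u = rho v) = rho v"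
    by (rule someI[of _ v]) (simp add: v)
  then show ?thesis unfolding beta_def using v coset_eq_iff by blast
qed

lemma K_ract: "v \<in> K \<Longrightarrow> s \<in> carrier S \<Longrightarrow> v \<triangleleft>\<^bsub>F 0\<^esub> s \<in> K"
  by (simp add: K rho_ract F.ract_closed)

lemma W_ract: "v \<in> carrier (F 0) \<Longrightarrow> s \<in> carrier S \<Longrightarrow> (K +>\<^bsub>F 0\<^esub> v) \<triangleleft>\<^bsub>W\<^esub> s = K +>\<^bsub>F 0\<^esub> (v \<triangleleft>\<^bsub>F 0\<^esub> s)"
  by (rule quot_ract[OF F.M.abelian_group_axioms K_subgroup]) (simp_all add: F.ract_closed F.ract_add_left K_ract)

text \<open>The cokernel over \<open>S\<close> is \<open>M\<close> with restricted scalars, and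
  extending them back to \<open>A\<close> returns \<open>M\<close>. Homogeneous elements have
  homogeneous preimages under \<open>rho\<close>, which takes care of the degrees.\<close>

theorem NMF_coker_iso: "graded_isomorphic A M (NMF_coker S A \<pi> (F, phi))"
proof -
  note Q = quot_module[OF F.M.abelian_group_axioms K_subgroup]
  interpret W: abelian_group W by (rule Q(2))
  have lift: "\<exists>v\<in>carrier (F 0). rho v = x" if "x \<in> carrier M" for x using rho_surj[OF that] .
  interpret E: scalar_extension S A M W \<pi> beta
  proof (intro scalar_extension.intro scalar_extension_axioms.intro)
    show "ring A" "right_module A M" "abelian_group W"
      by (rule A.ring_axioms M.right_module_axioms W.abelian_group_axioms)+
    show "\<pi> ` carrier S = carrier A" by (rule pi_surj)
    show "w \<triangleleft>\<^bsub>W\<^esub> s \<in> carrier W" if w: "w \<in> carrier W" and s: "s \<in> carrier S" for w s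
    proof -
      obtain v where v: "v \<in> carrier (F 0)" "w = K +>\<^bsub>F 0\<^esub> v" using w unfolding Q(1) by blast
      then show ?thesis unfolding v(2) W_ract[OF v(1) s] Q(1) using F.ract_closed[OF v(1) s] by blast
    qed
    show "bij_betw beta (carrier M) (carrier W)"
    proof (rule bij_betwI')
      show "beta x = beta y \<longleftrightarrow> x = y" if "x \<in> carrier M" "y \<in> carrier M" for x y
        using lift[OF that(1)] lift[OF that(2)] beta_rho coset_eq_iff by metis
      show "beta x \<in> carrier W" if x: "x \<in> carrier M" for x
      proof -
        obtain v where "v \<in> carrier (F 0)" "rho v = x" using lift[OF x] by blast
        then show ?thesis unfolding Q(1) using beta_rho by blast
      qed
      show "\<exists>x\<in>carrier M. w = beta x" if w: "w \<in> carrier W" for w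
      proof -
        obtain v where v: "v \<in> carrier (F 0)" "w = K +>\<^bsub>F 0\<^esub> v" using w unfolding Q(1) by blast
        then show ?thesis using beta_rho rho_closed by (intro bexI[of _ "rho v"]) auto
      qed
    qed
    fix x assume x: "x \<in> carrier M"
    obtain u where u: "u \<in> carrier (F 0)" "rho u = x" using lift[OF x] by blast
    { fix y assume y: "y \<in> carrier M"
      obtain v where v: "v \<in> carrier (F 0)" "rho v = y" using lift[OF y] by blast
      show "beta (x \<oplus>\<^bsub>M\<^esub> y) = beta x \<oplus>\<^bsub>W\<^esub> beta y"
        using u v beta_rho[of "u \<oplus>\<^bsub>F 0\<^esub> v"] Q(3)[OF u(1) v(1)] beta_rho[OF u(1)] beta_rho[OF v(1)]
        by (simp add: rho_add) }
    { fix s assume s: "s \<in> carrier S"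
      show "beta (x \<triangleleft>\<^bsub>M\<^esub> \<pi> s) = beta x \<triangleleft>\<^bsub>W\<^esub> s"
        using u s beta_rho[OF F.ract_closed[OF u(1) s]] W_ract[OF u(1) s] beta_rho[OF u(1)]
        by (simp add: rho_ract) }
  next
    fix x i assume x: "x \<in> mpart M i"
    then show xM: "x \<in> carrier M" by (rule mpart_closed)
    obtain v where v: "v \<in> {..<r} \<rightarrow>\<^sub>E rpart S i" "rho v = x" using rho_mpart_lift[of 0 x i] x xM L_0 by auto
    then have vm: "v \<in> mpart (F 0) i" by (simp add: graded_free_simps)
    then have "beta x = K +>\<^bsub>F 0\<^esub> v" using beta_rho[OF F_mpart_closed[OF vm]] v(2) by simp
    then show "beta x \<in> mpart W i" unfolding quot_module_simps using vm by blast
  next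
    show "\<one>\<^bsub>A\<^esub> \<in> rpart A 0" unfolding rpart_A using one_rpart by (metis image_eqI pi.hom_one)
  qed
  have "NMF_coker S A \<pi> (F, phi) = extend_scalars S A \<pi> W" by (simp add: NMF_coker_def K_def)
  then show ?thesis using E.extend_scalars_iso by simp
qed

end

section \<open>The linear forms of points, and what the co-point condition says about them\<close>

section \<open>Points\<close>

context skew_algebra
begin

sublocale hypersurface Sa Aa pr ff tau S.comp
proof
  show "pr \<in> ring_hom Sa Aa" by (rule pr_hom)
  show "pr ` carrier Sa = carrier Aa" by (rule pr_surj)
  show "pr s = \<zero>\<^bsub>Aa\<^esub> \<longleftrightarrow> (\<exists>t\<in>carrier Sa. s = ff \<otimes>\<^bsub>Sa\<^esub> t)" if "s \<in> carrier Sa" for s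
    using that by (rule pr_zero_iff)
  show "rpart Aa i = pr ` rpart Sa i" for i by (rule rpart_A)
  show "ff \<in> rpart Sa 2" by (rule ff_rpart)
  show "s = \<zero>\<^bsub>Sa\<^esub>" if "s \<in> carrier Sa" "ff \<otimes>\<^bsub>Sa\<^esub> s = \<zero>\<^bsub>Sa\<^esub>" for s using ff_regular that by blast
  show "s = \<zero>\<^bsub>Sa\<^esub>" if "s \<in> carrier Sa" "s \<otimes>\<^bsub>Sa\<^esub> ff = \<zero>\<^bsub>Sa\<^esub>" for s using ff_regular that by blast
  show "tau j \<in> ring_hom Sa Sa" for j by (rule tau_hom)
  show "tau 0 s = s" if "s \<in> carrier Sa" for s using that by (rule tau_simps)
  show "tau i (tau j s) = tau (i + j) s" if "s \<in> carrier Sa" for s i j using that by (rule tau_simps)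
  show "tau j ff = ff" for j by (rule tau_ff)
  show "tau j s \<in> rpart Sa d" if "s \<in> rpart Sa d" for s j d using that tau_rpart S.rpart_iff by blast
  show "s \<otimes>\<^bsub>Sa\<^esub> ff = ff \<otimes>\<^bsub>Sa\<^esub> tau 1 s" if "s \<in> carrier Sa" for s using that by (rule tau_simps)
  show "components Sa (rpart Sa) S.comp" by (rule S.components_comp)
  show "\<one>\<^bsub>Sa\<^esub> \<in> rpart Sa 0" by (rule S.rpart_one)
  show "s \<otimes>\<^bsub>Sa\<^esub> t \<in> rpart Sa (i + j)" if "s \<in> rpart Sa i" "t \<in> rpart Sa j" for s t i j
    using that by (rule S.rpart_mult)
qed

text \<open>The relation for the pair (i0, i) gives b i = (b i0 / a i0) gam i0 i a i. So, up to a
  common scalar, the coordinates of the annihilating form arise from those of \<theta> by this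
  diagonal rescaling.\<close>

definition gam :: "nat \<Rightarrow> nat \<Rightarrow> 'k" where
  "gam i0 i = (if i = i0 then 1 else \<alpha> i0 i)"

definition th :: "nat \<Rightarrow> (nat \<Rightarrow> 'k) \<Rightarrow> int \<Rightarrow> nat \<Rightarrow> 'k" where
  "th i0 a m i = gam i0 i powi m * a i"

text \<open>\<open>th i0 a\<close> are the iterates of \<open>a\<close> under the map that takes the coordinates of \<open>\<theta>\<close> to
  those of a linear form generating the annihilator of \<open>\<theta>\<close>.\<close>

lemma th_relation:
  assumes i0: "i0 \<in> {1..n}" "a i0 \<noteq> 0" and b: "\<exists>i\<in>{1..n}. b i \<noteq> 0"
    and ab: "\<And>i j. i \<in> {1..n} \<Longrightarrow> j \<in> {1..n} \<Longrightarrow> i \<noteq> j \<Longrightarrow> a i * b j = \<alpha> i j * a j * b i"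
    and ij: "i \<in> {1..n}" "j \<in> {1..n}" "i \<noteq> j"
  shows "th i0 a m i * th i0 a (m + 1) j = \<alpha> i j * th i0 a m j * th i0 a (m + 1) i"
proof -
  have bj: "b j = b i0 / a i0 * (gam i0 j * a j)" if "j \<in> {1..n}" for j
    using ab[OF i0(1) that] i0 by (auto simp: gam_def field_simps)
  then have "b i0 \<noteq> 0" using b by force
  then have *: "a i * (gam i0 j * a j) = \<alpha> i j * a j * (gam i0 i * a i)"
    using ab[OF ij] bj[OF ij(1)] bj[OF ij(2)] i0 by (simp add: field_simps)
  have g: "gam i0 i \<noteq> 0" if "i \<in> {1..n}" for i
    using alpha_inv[OF i0(1) that] by (auto simp: gam_def)
  have "th i0 a m i * th i0 a (m + 1) j = (gam i0 i powi m * gam i0 j powi m) * (a i * (gam i0 j * a j))"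
    using g[OF ij(2)] by (simp add: th_def power_int_add mult_ac)
  also have "\<dots> = \<alpha> i j * th i0 a m j * th i0 a (m + 1) i"
    unfolding * using g[OF ij(1)] by (simp add: th_def power_int_add mult_ac)
  finally show ?thesis .
qed

text \<open>Mixed coefficients cancel by \<open>th_relation\<close>, and of the squares of letters
  only that of x_n is nonzero in \<open>S\<close>.\<close>

lemma th_product:
  assumes i0: "i0 \<in> {1..n}" "a i0 \<noteq> 0" and b: "\<exists>i\<in>{1..n}. b i \<noteq> 0"
    and ab: "\<And>i j. i \<in> {1..n} \<Longrightarrow> j \<in> {1..n} \<Longrightarrow> i \<noteq> j \<Longrightarrow> a i * b j = \<alpha> i j * a j * b i"
  shows "S.coord (S.lin (th i0 a m) \<otimes>\<^bsub>Sa\<^esub> S.lin (th i0 a (m + 1))) e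
    = (if e = {#n, n#} then th i0 a m n * th i0 a (m + 1) n else 0)"
proof -
  have "admissible QS {#i, i#} \<longleftrightarrow> i = n" for i
    using n_pos by (auto simp: admissible_def QS_iff dest!: bspec[of _ _ i])
  moreover have "th i0 a m i * th i0 a (m + 1) j = \<alpha> i j * th i0 a m j * th i0 a (m + 1) i"
    if "i \<in> {1..n}" "j \<in> {1..n}" "i < j" for i j
    using that th_relation[OF i0 b ab] by auto
  ultimately show ?thesis by (subst S.coord_lin_lin) auto
qed

text \<open>The same choice as in \<open>point_module\<close>, so the two refer to the same
  representative.\<close>

definition coords :: "(nat \<Rightarrow> 'k) set \<Rightarrow> nat \<Rightarrow> 'k" where
  "coords p = (SOME a. a \<in> p)"

lemma coords:
  assumes "p \<in> proj_space n"
  shows "\<exists>i\<in>{1..n}. coords p i \<noteq> 0" "p \<in> vanishing_locus n \<longleftrightarrow> coords p n = 0"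
proof -
  obtain x where x: "x \<in> homog_coords n" and p: "p = {b \<in> homog_coords n. \<exists>c. c \<noteq> 0 \<and> b = (\<lambda>i. c * x i)}"
    using assms unfolding proj_space_def quotient_def by auto
  have "x \<in> p" using x unfolding p by (auto intro!: exI[of _ 1])
  then have a: "coords p \<in> p" unfolding coords_def by (rule someI[of "\<lambda>a. a \<in> p"])
  then obtain c where c: "c \<noteq> 0" "coords p = (\<lambda>i. c * x i)" unfolding p by blast
  have "coords p \<in> homog_coords n" using a unfolding p by blast
  then show "\<exists>i\<in>{1..n}. coords p i \<noteq> 0" unfolding homog_coords_def by blast
  have "(\<forall>b\<in>p. b n = 0) \<longleftrightarrow> coords p n = 0"
  proof
    assume "coords p n = 0"
    then have "x n = 0" using c by simp
    then show "\<forall>b\<in>p. b n = 0" unfolding p by auto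
  qed (use a in blast)
  then show "p \<in> vanishing_locus n \<longleftrightarrow> coords p n = 0" using assms by (simp add: vanishing_locus_def)
qed

definition pt_ideal :: "(nat \<Rightarrow> 'k) set \<Rightarrow> (nat list \<Rightarrow> 'k) set set set set" where
  "pt_ideal p = {A.lin (coords p) \<otimes>\<^bsub>Aa\<^esub> b | b. b \<in> carrier Aa}"

definition pt_gen :: "(nat \<Rightarrow> 'k) set \<Rightarrow> (nat list \<Rightarrow> 'k) set set set set" where
  "pt_gen p = pt_ideal p +>\<^bsub>regular_module Aa\<^esub> \<one>\<^bsub>Aa\<^esub>"

lemma point_module:
  defines "N \<equiv> point_module n \<alpha>"
  shows pt_gen_closed: "pt_gen p \<in> carrier (N p)"
    and pt_gen_mpart: "pt_gen p \<in> mpart (N p) 0"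
    and pt_gen_gen: "x \<in> carrier (N p) \<Longrightarrow> \<exists>a\<in>carrier Aa. x = pt_gen p \<triangleleft>\<^bsub>N p\<^esub> a"
    and pt_gen_mpart_gen: "x \<in> mpart (N p) d \<Longrightarrow> \<exists>a\<in>rpart Aa d. x = pt_gen p \<triangleleft>\<^bsub>N p\<^esub> a"
    and pt_gen_ann: "a \<in> carrier Aa \<Longrightarrow> pt_gen p \<triangleleft>\<^bsub>N p\<^esub> a = \<zero>\<^bsub>N p\<^esub> \<longleftrightarrow>
      (\<exists>b\<in>carrier Aa. a = A.lin (coords p) \<otimes>\<^bsub>Aa\<^esub> b)"
proof -
  have N: "N p = quot_module (regular_module Aa) (pt_ideal p)"
    by (simp add: N_def point_module_def pt_ideal_def linear_form_eq coords_def)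
  note Q = cyclic_quot[OF A.ring_axioms A.lin_closed[of "coords p"], folded pt_ideal_def, folded N]
  have g: "pt_gen p \<triangleleft>\<^bsub>N p\<^esub> a = pt_ideal p +>\<^bsub>regular_module Aa\<^esub> a" if "a \<in> carrier Aa" for a
    using that by (simp add: pt_gen_def Q(2))
  have rA: "a \<in> carrier Aa" if "a \<in> rpart Aa d" for a d using that A.rpart_iff by blast
  show "pt_gen p \<in> carrier (N p)" unfolding Q(1) pt_gen_def by blast
  show "pt_gen p \<in> mpart (N p) 0" unfolding Q(4) pt_gen_def using A.rpart_one by blast
  show "\<exists>a\<in>carrier Aa. x = pt_gen p \<triangleleft>\<^bsub>N p\<^esub> a" if "x \<in> carrier (N p)"
    using that unfolding Q(1) using g by auto
  show "\<exists>a\<in>rpart Aa d. x = pt_gen p \<triangleleft>\<^bsub>N p\<^esub> a" if "x \<in> mpart (N p) d"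
    using that unfolding Q(4) using g rA by auto
  show "pt_gen p \<triangleleft>\<^bsub>N p\<^esub> a = \<zero>\<^bsub>N p\<^esub> \<longleftrightarrow> (\<exists>b\<in>carrier Aa. a = A.lin (coords p) \<otimes>\<^bsub>Aa\<^esub> b)" if "a \<in> carrier Aa"
    using that by (simp add: g Q(3))
qed

lemma A_lin_coord_zero: "a \<in> carrier Aa \<Longrightarrow> A.coord (A.lin c \<otimes>\<^bsub>Aa\<^esub> a) {#} = 0"
  "a \<in> carrier Aa \<Longrightarrow> A.coord (a \<otimes>\<^bsub>Aa\<^esub> A.lin c) {#} = 0"
  by (simp_all add: A.coord_lin_mult A.coord_mult_lin admissible_def)

lemma copoint:
  assumes "p \<in> copoint_locus n \<alpha>"
  shows copoint_proj: "p \<in> proj_space n" and copoint_grmod: "point_module n \<alpha> p \<in> grmod Aa"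
    and copoint_graded: "graded_right_module Aa (point_module n \<alpha> p)"
  using assms by (auto simp: copoint_locus_def copoint_module_def grmod_def)

text \<open>For degree reasons the first two differentials are left multiplications by linear forms.
  The augmentation is a nonzero scalar multiple of the projection onto N_p, so the form of the first
  differential is a nonzero multiple of that of \<open>p\<close>; \<open>b\<close> consists of the
  coefficients of the second. That their composite vanishes is the relation, and \<open>b\<close> is
  not zero because the form of \<open>p\<close> has a nonzero annihilator in
  \<open>A\<close>.\<close>

lemma copoint_relation:
  assumes p: "p \<in> copoint_locus n \<alpha>"
  defines "a \<equiv> coords p"
  obtains b where "\<exists>i\<in>{1..n}. b i \<noteq> 0"
    "\<And>i j. i \<in> {1..n} \<Longrightarrow> j \<in> {1..n} \<Longrightarrow> i \<noteq> j \<Longrightarrow> a i * b j = \<alpha> i j * a j * b i"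
proof -
  let ?N = "point_module n \<alpha> p" and ?g = "pt_gen p" and ?R = "regular_module Aa"
  interpret N: graded_right_module Aa ?N by (rule copoint_graded[OF p])
  obtain d \<epsilon> where d: "\<And>i. d i \<in> graded_hom Aa (twist ?R (- int (Suc i))) (twist ?R (- int i))"
    and \<epsilon>: "\<epsilon> \<in> graded_hom Aa ?R ?N" "\<epsilon> ` carrier Aa = carrier ?N"
    and d0: "d 0 ` carrier Aa = {x \<in> carrier Aa. \<epsilon> x = \<zero>\<^bsub>?N\<^esub>}"
    and d1: "d 1 ` carrier Aa = {x \<in> carrier Aa. d 0 x = \<zero>\<^bsub>Aa\<^esub>}"
  proof -
    have "copoint_module Aa ?N" using p by (simp add: copoint_locus_def)
    note c = this[unfolded copoint_module_def, THEN conjunct2]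
    show ?thesis
    proof (use c in \<open>elim exE conjE\<close>)
      fix d \<epsilon>
      assume *: "\<forall>i. d (Suc i) ` carrier Aa = {x \<in> carrier Aa. d i x = \<zero>\<^bsub>Aa\<^esub>}"
        "\<forall>i. d i \<in> graded_hom Aa (twist ?R (- int (Suc i))) (twist ?R (- int i))"
      assume **: "\<epsilon> \<in> graded_hom Aa ?R ?N" "\<epsilon> ` carrier Aa = carrier ?N"
        "d 0 ` carrier Aa = {x \<in> carrier Aa. \<epsilon> x = \<zero>\<^bsub>?N\<^esub>}"
      have "d 1 ` carrier Aa = {x \<in> carrier Aa. d 0 x = \<zero>\<^bsub>Aa\<^esub>}"
        using *(1)[THEN spec, of 0] by (simp only: One_nat_def)
      then show thesis by (rule that[OF *(2)[THEN spec] **])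
    qed
  qed
  have dmul: "d i x = d i \<one>\<^bsub>Aa\<^esub> \<otimes>\<^bsub>Aa\<^esub> x" if "x \<in> carrier Aa" for i x
    using d[of i] that right_homD(3)[of "d i" Aa "twist ?R (- int (Suc i))" "twist ?R (- int i)" "\<one>\<^bsub>Aa\<^esub>" x]
    by (simp add: graded_hom_def twist_def)
  have d_deg: "d i \<one>\<^bsub>Aa\<^esub> \<in> rpart Aa 1" for i
  proof -
    have "\<one>\<^bsub>Aa\<^esub> \<in> mpart (twist ?R (- int (Suc i))) (int (Suc i))" by (simp add: twist_def A.rpart_one)
    then have "d i \<one>\<^bsub>Aa\<^esub> \<in> mpart (twist ?R (- int i)) (int (Suc i))" using d[of i] by (auto simp: graded_hom_def)
    then show ?thesis by (simp add: twist_def)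
  qed
  define b where "b = (\<lambda>i. A.coord (d 1 \<one>\<^bsub>Aa\<^esub>) {#i#})"
  define t where "t = (\<lambda>i. A.coord (d 0 \<one>\<^bsub>Aa\<^esub>) {#i#})"
  have db: "d 1 \<one>\<^bsub>Aa\<^esub> = A.lin b" and dt: "d 0 \<one>\<^bsub>Aa\<^esub> = A.lin t"
    unfolding b_def t_def by (rule A.rpart_one_lin[OF d_deg])+
  have "\<epsilon> \<one>\<^bsub>Aa\<^esub> \<in> mpart ?N 0" using \<epsilon>(1) A.rpart_one by (auto simp: graded_hom_def)
  then obtain c0 where c0: "c0 \<in> rpart Aa 0" "\<epsilon> \<one>\<^bsub>Aa\<^esub> = ?g \<triangleleft>\<^bsub>?N\<^esub> c0" using pt_gen_mpart_gen by blast
  define c where "c = A.coord c0 {#}"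
  have cs: "c0 = A.sc c" unfolding c_def by (rule A.rpart_zero_sc[OF c0(1)])
  have eps: "\<epsilon> x = ?g \<triangleleft>\<^bsub>?N\<^esub> (A.sc c \<otimes>\<^bsub>Aa\<^esub> x)" if x: "x \<in> carrier Aa" for x
  proof -
    have "\<epsilon> x = \<epsilon> \<one>\<^bsub>Aa\<^esub> \<triangleleft>\<^bsub>?N\<^esub> x"
      using \<epsilon>(1) x right_homD(3)[of \<epsilon> Aa ?R ?N "\<one>\<^bsub>Aa\<^esub>" x] by (simp add: graded_hom_def)
    then show ?thesis using x c0 cs pt_gen_closed by (simp add: N.ract_assoc)
  qed
  \<comment> \<open>With c = 0 the module would vanish and 1 would lie in the ideal generated by a
    linear form, which has no component in degree 0.\<close>
  have c_nz: "c \<noteq> 0"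
  proof
    assume "c = 0"
    then have "A.sc c = \<zero>\<^bsub>Aa\<^esub>" by (simp add: A.eq_zero_iff A.coord_sc)
    then have "\<epsilon> x = \<zero>\<^bsub>?N\<^esub>" if "x \<in> carrier Aa" for x using eps[OF that] that pt_gen_closed by simp
    then have "?g = \<zero>\<^bsub>?N\<^esub>" using \<epsilon>(2) pt_gen_closed[of p] by (metis imageE)
    then have "?g \<triangleleft>\<^bsub>?N\<^esub> \<one>\<^bsub>Aa\<^esub> = \<zero>\<^bsub>?N\<^esub>" by simp
    then obtain y where "y \<in> carrier Aa" "\<one>\<^bsub>Aa\<^esub> = A.lin a \<otimes>\<^bsub>Aa\<^esub> y"
      using pt_gen_ann[OF A.one_closed] unfolding a_def by blast
    then show False using A_lin_coord_zero(1)[of y a] A.coord_one by simp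
  qed
  have inv: "A.sc (1 / c) \<otimes>\<^bsub>Aa\<^esub> (A.sc c \<otimes>\<^bsub>Aa\<^esub> x) = x" if "x \<in> carrier Aa" "c \<noteq> 0" for x and c :: 'k
    using that by (simp add: A.sc_mult A.sc_one flip: A.m_assoc)
  have sc_mid: "A.sc c \<otimes>\<^bsub>Aa\<^esub> (A.lin a \<otimes>\<^bsub>Aa\<^esub> y) = A.lin a \<otimes>\<^bsub>Aa\<^esub> (A.sc c \<otimes>\<^bsub>Aa\<^esub> y)"
    if "y \<in> carrier Aa" for y c
  proof -
    have "A.sc c \<otimes>\<^bsub>Aa\<^esub> (A.lin a \<otimes>\<^bsub>Aa\<^esub> y) = (A.sc c \<otimes>\<^bsub>Aa\<^esub> A.lin a) \<otimes>\<^bsub>Aa\<^esub> y"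
      using that by (intro A.m_assoc[symmetric]) simp_all
    also have "\<dots> = (A.lin a \<otimes>\<^bsub>Aa\<^esub> A.sc c) \<otimes>\<^bsub>Aa\<^esub> y"
      by (subst A.sc_comm[OF A.lin_closed]) (rule refl)
    also have "\<dots> = A.lin a \<otimes>\<^bsub>Aa\<^esub> (A.sc c \<otimes>\<^bsub>Aa\<^esub> y)"
      using that by (intro A.m_assoc) simp_all
    finally show ?thesis .
  qed
  have ker: "x \<in> d 0 ` carrier Aa \<longleftrightarrow> (\<exists>y\<in>carrier Aa. x = A.lin a \<otimes>\<^bsub>Aa\<^esub> y)" if x: "x \<in> carrier Aa" for x
  proof -
    have "x \<in> d 0 ` carrier Aa \<longleftrightarrow> (\<exists>y\<in>carrier Aa. A.sc c \<otimes>\<^bsub>Aa\<^esub> x = A.lin a \<otimes>\<^bsub>Aa\<^esub> y)"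
      using x by (simp add: d0 eps pt_gen_ann a_def)
    also have "\<dots> \<longleftrightarrow> (\<exists>y\<in>carrier Aa. x = A.lin a \<otimes>\<^bsub>Aa\<^esub> y)"
    proof
      assume "\<exists>y\<in>carrier Aa. A.sc c \<otimes>\<^bsub>Aa\<^esub> x = A.lin a \<otimes>\<^bsub>Aa\<^esub> y"
      then obtain y where y: "y \<in> carrier Aa" "A.sc c \<otimes>\<^bsub>Aa\<^esub> x = A.lin a \<otimes>\<^bsub>Aa\<^esub> y" by blast
      have "x = A.sc (1 / c) \<otimes>\<^bsub>Aa\<^esub> (A.lin a \<otimes>\<^bsub>Aa\<^esub> y)" using inv[OF x c_nz] y(2) by simp
      also have "\<dots> = A.lin a \<otimes>\<^bsub>Aa\<^esub> (A.sc (1 / c) \<otimes>\<^bsub>Aa\<^esub> y)"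
        using y(1) by (rule sc_mid)
      finally show "\<exists>y\<in>carrier Aa. x = A.lin a \<otimes>\<^bsub>Aa\<^esub> y"
        using y(1) by (intro bexI[of _ "A.sc (1 / c) \<otimes>\<^bsub>Aa\<^esub> y"]) simp_all
    next
      assume "\<exists>y\<in>carrier Aa. x = A.lin a \<otimes>\<^bsub>Aa\<^esub> y"
      then obtain y where y: "y \<in> carrier Aa" "x = A.lin a \<otimes>\<^bsub>Aa\<^esub> y" by blast
      show "\<exists>y\<in>carrier Aa. A.sc c \<otimes>\<^bsub>Aa\<^esub> x = A.lin a \<otimes>\<^bsub>Aa\<^esub> y"
        unfolding y(2) sc_mid[OF y(1)] using y(1) by (intro bexI[of _ "A.sc c \<otimes>\<^bsub>Aa\<^esub> y"]) simp_all
    qed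
    finally show ?thesis .
  qed
  have "A.lin t \<in> d 0 ` carrier Aa" using dt by (metis A.one_closed image_eqI)
  then obtain y where y: "y \<in> carrier Aa" "A.lin t = A.lin a \<otimes>\<^bsub>Aa\<^esub> y" using ker A.lin_closed by blast
  \<comment> \<open>Both forms have degree 1, so only the degree-zero part of \<open>y\<close>
    contributes.\<close>
  define k where "k = A.coord y {#}"
  have "t i = k * a i" if i: "i \<in> {1..n}" for i
  proof -
    have "t i = A.coord (A.lin t) {#i#}" using i by simp
    also have "\<dots> = k * a i"
      unfolding y(2) k_def using i y(1) by (subst A.coord_lin_mult) (auto simp: admissible_def mult_ac)
    finally show ?thesis .
  qed
  then have t: "A.lin t = A.sc k \<otimes>\<^bsub>Aa\<^esub> A.lin a" unfolding A.sc_lin by (rule A.lin_cong)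
  obtain i where i: "i \<in> {1..n}" "a i \<noteq> 0" using coords(1)[OF copoint_proj[OF p]] unfolding a_def by blast
  \<comment> \<open>With k = 0 the map \<open>d 0\<close> would vanish, although its image contains
    the nonzero form of \<open>p\<close>.\<close>
  have k_nz: "k \<noteq> 0"
  proof
    assume "k = 0"
    then have "A.sc k = \<zero>\<^bsub>Aa\<^esub>" by (simp add: A.eq_zero_iff A.coord_sc)
    then have tz: "A.lin t = \<zero>\<^bsub>Aa\<^esub>" using t by simp
    have "A.lin a \<in> d 0 ` carrier Aa" using ker[OF A.lin_closed] by (metis A.one_closed A.r_one A.lin_closed)
    then obtain z where "z \<in> carrier Aa" "A.lin a = d 0 z" by blast
    then have "A.lin a = \<zero>\<^bsub>Aa\<^esub>" using dmul[of z 0] dt tz by simp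
    then have "A.coord (A.lin a) {#i#} = 0" by simp
    then show False using i by simp
  qed
  have dz: "d 0 z = \<zero>\<^bsub>Aa\<^esub> \<longleftrightarrow> A.lin a \<otimes>\<^bsub>Aa\<^esub> z = \<zero>\<^bsub>Aa\<^esub>" if z: "z \<in> carrier Aa" for z
  proof -
    have "d 0 z = A.sc k \<otimes>\<^bsub>Aa\<^esub> (A.lin a \<otimes>\<^bsub>Aa\<^esub> z)" using z dmul[OF z, of 0] dt t by (simp add: A.m_assoc)
    then show ?thesis using inv[of "A.lin a \<otimes>\<^bsub>Aa\<^esub> z" k] z k_nz by (metis A.lin_closed A.m_closed A.r_null A.sc_closed)
  qed
  have "A.lin b \<in> d 1 ` carrier Aa" using db by (metis A.one_closed image_eqI)
  then have ab: "A.lin a \<otimes>\<^bsub>Aa\<^esub> A.lin b = \<zero>\<^bsub>Aa\<^esub>" unfolding d1 using dz[of "A.lin b"] by simp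
  have "\<exists>i\<in>{1..n}. b i \<noteq> 0"
  proof (rule ccontr)
    assume "\<not> ?thesis"
    then have "A.lin b = A.lin (\<lambda>i. 0)" by (intro A.lin_cong) auto
    then have bz: "A.lin b = \<zero>\<^bsub>Aa\<^esub>" by (simp add: A.lin_zero)
    \<comment> \<open>The socle element: were \<open>b\<close> zero, \<open>d 1\<close> would vanish
      and, by exactness, so would everything that the form of \<open>p\<close> annihilates.\<close>
    obtain z where z: "z \<in> carrier Aa" "z \<noteq> \<zero>\<^bsub>Aa\<^esub>" "A.lin a \<otimes>\<^bsub>Aa\<^esub> z = \<zero>\<^bsub>Aa\<^esub>"
      using A.lin_has_annihilator[OF QA_def, of a] by blast
    then have "z \<in> d 1 ` carrier Aa" unfolding d1 using dz by simp
    then obtain w where "w \<in> carrier Aa" "z = d 1 w" by blast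
    then have "z = \<zero>\<^bsub>Aa\<^esub>" using dmul[of w 1] db bz by simp
    then show False using z by simp
  qed
  moreover have "{1..n} \<inter> QA = QA" by (auto simp: QA_def)
  ultimately show ?thesis using that A.lin_lin_zero_imp[OF _ ab] by blast
qed

text \<open>Coordinates are normalized to a n = 1 and the sequence is based at i0 = n. Since
  \<open>gam n n\<close> = 1, the coordinate at n remains 1 throughout, so the consecutive products
  are exactly f and no scalars have to be corrected.\<close>

lemma copoint_chain:
  assumes p: "p \<in> copoint_locus n \<alpha> - vanishing_locus n"
  obtains \<Theta> where "chain \<Theta>"
    "\<And>x. x \<in> carrier Aa \<Longrightarrow> pt_gen p \<triangleleft>\<^bsub>point_module n \<alpha> p\<^esub> x = \<zero>\<^bsub>point_module n \<alpha> p\<^esub> \<longleftrightarrow>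
      (\<exists>y\<in>carrier Aa. x = pr (\<Theta> 0) \<otimes>\<^bsub>Aa\<^esub> y)"
proof -
  let ?a = "coords p"
  have pE: "p \<in> copoint_locus n \<alpha>" using p by simp
  have an: "?a n \<noteq> 0" using p coords(2)[OF copoint_proj[OF pE]] by simp
  obtain b where b: "\<exists>i\<in>{1..n}. b i \<noteq> 0"
    "\<And>i j. i \<in> {1..n} \<Longrightarrow> j \<in> {1..n} \<Longrightarrow> i \<noteq> j \<Longrightarrow> ?a i * b j = \<alpha> i j * ?a j * b i"
    using copoint_relation[OF pE] by blast
  define a where "a = (\<lambda>i. ?a i / ?a n)"
  have n: "n \<in> {1..n}" "a n \<noteq> 0" using n_pos an by (auto simp: a_def)
  have ab: "a i * b j = \<alpha> i j * a j * b i" if "i \<in> {1..n}" "j \<in> {1..n}" "i \<noteq> j" for i j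
    using b(2)[OF that] by (simp add: a_def field_simps)
  define \<Theta> where "\<Theta> m = S.lin (th n a m)" for m
  have "th n a m n = 1" for m using an by (simp add: th_def gam_def a_def)
  moreover have "S.coord (\<Theta> m \<otimes>\<^bsub>Sa\<^esub> \<Theta> (m + 1)) e = (if e = {#n, n#} then th n a m n * th n a (m + 1) n else 0)" for m e
    unfolding \<Theta>_def by (rule th_product[where a = a and b = b, OF n b(1)]) (rule ab)
  ultimately have "S.coord (\<Theta> m \<otimes>\<^bsub>Sa\<^esub> \<Theta> (m + 1)) e = S.coord ff e" for m e
    by (simp add: coord_ff)
  then have "S.coord (\<Theta> m \<otimes>\<^bsub>Sa\<^esub> \<Theta> (m + 1)) = S.coord ff" for m by (rule ext)
  then have "\<Theta> m \<otimes>\<^bsub>Sa\<^esub> \<Theta> (m + 1) = ff" for m using S.coord_inject[of "\<Theta> m \<otimes>\<^bsub>Sa\<^esub> \<Theta> (m + 1)" ff] by (simp add: \<Theta>_def)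
  then have ch: "chain \<Theta>" unfolding chain_def \<Theta>_def using S.lin_rpart by blast
  have T0: "pr (\<Theta> 0) = A.lin a" unfolding \<Theta>_def pr_lin by (rule A.lin_cong) (simp add: th_def)
  have la: "A.lin ?a = A.lin a \<otimes>\<^bsub>Aa\<^esub> A.sc (?a n)"
    using an by (simp add: a_def A.sc_lin flip: A.sc_comm)
  have la': "A.lin a = A.lin ?a \<otimes>\<^bsub>Aa\<^esub> A.sc (1 / ?a n)"
    by (simp add: a_def A.sc_lin flip: A.sc_comm)
  \<comment> \<open>The normalization changes the form by a unit, which leaves the right ideal
    unchanged.\<close>
  have "(\<exists>y\<in>carrier Aa. x = A.lin ?a \<otimes>\<^bsub>Aa\<^esub> y) \<longleftrightarrow> (\<exists>y\<in>carrier Aa. x = A.lin a \<otimes>\<^bsub>Aa\<^esub> y)" for x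
  proof
    assume "\<exists>y\<in>carrier Aa. x = A.lin ?a \<otimes>\<^bsub>Aa\<^esub> y"
    then obtain y where "y \<in> carrier Aa" "x = A.lin ?a \<otimes>\<^bsub>Aa\<^esub> y" by blast
    then show "\<exists>y\<in>carrier Aa. x = A.lin a \<otimes>\<^bsub>Aa\<^esub> y"
      unfolding la by (intro bexI[of _ "A.sc (?a n) \<otimes>\<^bsub>Aa\<^esub> y"]) (simp_all add: A.m_assoc)
  next
    assume "\<exists>y\<in>carrier Aa. x = A.lin a \<otimes>\<^bsub>Aa\<^esub> y"
    then obtain y where "y \<in> carrier Aa" "x = A.lin a \<otimes>\<^bsub>Aa\<^esub> y" by blast
    then show "\<exists>y\<in>carrier Aa. x = A.lin ?a \<otimes>\<^bsub>Aa\<^esub> y"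
      unfolding la' by (intro bexI[of _ "A.sc (1 / ?a n) \<otimes>\<^bsub>Aa\<^esub> y"]) (simp_all add: A.m_assoc)
  qed
  then show ?thesis using that[OF ch] pt_gen_ann T0 by simp
qed

lemma point_module_TR0:
  assumes p: "p \<in> copoint_locus n \<alpha> - vanishing_locus n"
  shows "point_module n \<alpha> p \<in> TR0 Sa Aa pr"
proof -
  let ?N = "point_module n \<alpha> p"
  have pE: "p \<in> copoint_locus n \<alpha>" using p by simp
  interpret N: graded_right_module Aa ?N by (rule copoint_graded[OF pE])
  obtain \<Theta> where \<Theta>: "chain \<Theta>" "\<And>x. x \<in> carrier Aa \<Longrightarrow> pt_gen p \<triangleleft>\<^bsub>?N\<^esub> x = \<zero>\<^bsub>?N\<^esub> \<longleftrightarrow>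
      (\<exists>y\<in>carrier Aa. x = pr (\<Theta> 0) \<otimes>\<^bsub>Aa\<^esub> y)" using copoint_chain[OF p] by blast
  have TR: "totally_reflexive Aa ?N" "finite_projdim Sa (restrict_scalars pr ?N)"
    by (rule chain_TR[OF \<Theta>(1) N.right_module_axioms pt_gen_closed pt_gen_gen \<Theta>(2)]; assumption)+
  have "mspan Aa ?N (mpart ?N 0) = carrier ?N"
  proof
    have "rsubmodule Aa ?N (carrier ?N)"
      unfolding rsubmodule_def using N.ract_closed
      by (auto intro!: additive_subgroupI N.M.add.subgroup_self)
    moreover have "mpart ?N 0 \<subseteq> carrier ?N" using additive_subgroup.a_subset[OF N.mpart_subgroup] .
    ultimately show "mspan Aa ?N (mpart ?N 0) \<subseteq> carrier ?N" unfolding mspan_def by blast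
    show "carrier ?N \<subseteq> mspan Aa ?N (mpart ?N 0)"
      unfolding mspan_def
    proof (intro subsetI InterI)
      fix x H assume x: "x \<in> carrier ?N" and H: "H \<in> {H. rsubmodule Aa ?N H \<and> mpart ?N 0 \<subseteq> H}"
      obtain y where "y \<in> carrier Aa" "x = pt_gen p \<triangleleft>\<^bsub>?N\<^esub> y" using pt_gen_gen[OF x] by blast
      then show "x \<in> H" using H pt_gen_mpart unfolding rsubmodule_def by blast
    qed
  qed
  then show ?thesis using TR copoint_grmod[OF pE] by (simp add: TR0_def)
qed

text \<open>As a n = 0, some i0 < n has a i0 \<noteq> 0, and x_i0 has square zero in
  \<open>S\<close>, as \<open>left_annihilator_lin\<close> demands; moreover all consecutive
  products vanish. The class fed into \<open>infinite_projdim\<close> is the generator of N_p: the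
  form of \<open>p\<close> kills it, and for degree reasons it is no multiple of a linear
  form.\<close>

lemma point_module_not_TR0:
  assumes p: "p \<in> copoint_locus n \<alpha>" "p \<in> vanishing_locus n"
  shows "point_module n \<alpha> p \<notin> TR0 Sa Aa pr"
proof -
  let ?N = "point_module n \<alpha> p" and ?a = "coords p"
  interpret N: graded_right_module Aa ?N by (rule copoint_graded[OF p(1)])
  have an: "?a n = 0" using p(2) coords(2)[OF copoint_proj[OF p(1)]] by simp
  obtain b where b: "\<exists>i\<in>{1..n}. b i \<noteq> 0"
    "\<And>i j. i \<in> {1..n} \<Longrightarrow> j \<in> {1..n} \<Longrightarrow> i \<noteq> j \<Longrightarrow> ?a i * b j = \<alpha> i j * ?a j * b i"
    using copoint_relation[OF p(1)] by blast
  obtain i0 where i0: "i0 \<in> {1..n}" "?a i0 \<noteq> 0" using coords(1)[OF copoint_proj[OF p(1)]] by blast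
  then have i0Q: "i0 \<in> QS" using an by (auto simp: QS_def) (metis le_neq_implies_less)
  \<comment> \<open>Shifted by one so that \<open>t 1\<close>, which has to kill the generator, is
    the form of \<open>p\<close>, and \<open>t 0\<close> its predecessor in the sequence.\<close>
  define t where "t i = S.lin (th i0 ?a (int i - 1))" for i
  have tt: "t i \<otimes>\<^bsub>Sa\<^esub> t (Suc i) = \<zero>\<^bsub>Sa\<^esub>" for i
  proof -
    have "S.coord (t i \<otimes>\<^bsub>Sa\<^esub> t (Suc i)) e = 0" for e
    proof -
      have "S.coord (S.lin (th i0 ?a (int i - 1)) \<otimes>\<^bsub>Sa\<^esub> S.lin (th i0 ?a (int i - 1 + 1))) e
        = (if e = {#n, n#} then th i0 ?a (int i - 1) n * th i0 ?a (int i - 1 + 1) n else 0)"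
        by (rule th_product[where a = ?a and b = b, OF i0 b(1)]) (rule b(2))
      then show ?thesis using an by (simp add: t_def th_def)
    qed
    then show ?thesis by (simp add: S.eq_zero_iff t_def)
  qed
  have nz: "th i0 ?a m i0 \<noteq> 0" for m using i0 by (simp add: th_def gam_def)
  have "\<not> finite_projdim Sa (restrict_scalars pr ?N)"
  proof (rule infinite_projdim[where t = t and m = "pt_gen p"])
    show "right_module Sa (restrict_scalars pr ?N)"
      by (rule right_module_restrict_scalars[OF S.ring_axioms pr_hom N.right_module_axioms])
    show "t i \<in> carrier Sa" for i by (simp add: t_def)
    show "t i \<otimes>\<^bsub>Sa\<^esub> t (Suc i) = \<zero>\<^bsub>Sa\<^esub>" for i by (rule tt)
    show "\<exists>u\<in>carrier Sa. s = u \<otimes>\<^bsub>Sa\<^esub> t i" if s: "s \<in> carrier Sa" "s \<otimes>\<^bsub>Sa\<^esub> t (Suc i) = \<zero>\<^bsub>Sa\<^esub>" for i s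
      using S.left_annihilator_lin[OF i0Q i0(1) nz nz tt[of i, unfolded t_def] s(1) s(2)[unfolded t_def]] unfolding t_def by blast
    show "pt_gen p \<in> carrier (restrict_scalars pr ?N)" using pt_gen_closed by simp
    have t1: "pr (t 1) = A.lin ?a" unfolding t_def pr_lin by (rule A.lin_cong) (simp add: th_def)
    show "pt_gen p \<triangleleft>\<^bsub>restrict_scalars pr ?N\<^esub> t 1 = \<zero>\<^bsub>restrict_scalars pr ?N\<^esub>"
    proof -
      have "\<exists>y\<in>carrier Aa. A.lin ?a = A.lin ?a \<otimes>\<^bsub>Aa\<^esub> y" by (rule bexI[of _ "\<one>\<^bsub>Aa\<^esub>"]) simp_all
      then show ?thesis using pt_gen_ann[of "A.lin ?a" p] by (simp only: restrict_scalars_simps t1 A.lin_closed)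
    qed
    fix m' assume "m' \<in> carrier (restrict_scalars pr ?N)"
    then obtain y where y: "y \<in> carrier Aa" "m' = pt_gen p \<triangleleft>\<^bsub>?N\<^esub> y" using pt_gen_gen by auto
    show "pt_gen p \<noteq> m' \<triangleleft>\<^bsub>restrict_scalars pr ?N\<^esub> t 0"
    proof
      let ?l = "A.lin (th i0 ?a (- 1))"
      assume "pt_gen p = m' \<triangleleft>\<^bsub>restrict_scalars pr ?N\<^esub> t 0"
      then have "pt_gen p = pt_gen p \<triangleleft>\<^bsub>?N\<^esub> (y \<otimes>\<^bsub>Aa\<^esub> ?l)"
        using y pt_gen_closed by (simp add: t_def pr_lin N.ract_assoc)
      then have "pt_gen p \<triangleleft>\<^bsub>?N\<^esub> (\<one>\<^bsub>Aa\<^esub> \<ominus>\<^bsub>Aa\<^esub> y \<otimes>\<^bsub>Aa\<^esub> ?l) = \<zero>\<^bsub>?N\<^esub>"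
        using y pt_gen_closed by (simp add: a_minus_def N.ract_add_right N.ract_minus_right N.ract_one N.M.r_neg)
      then obtain z where z: "z \<in> carrier Aa" "\<one>\<^bsub>Aa\<^esub> \<ominus>\<^bsub>Aa\<^esub> y \<otimes>\<^bsub>Aa\<^esub> ?l = A.lin ?a \<otimes>\<^bsub>Aa\<^esub> z"
        using pt_gen_ann[of "\<one>\<^bsub>Aa\<^esub> \<ominus>\<^bsub>Aa\<^esub> y \<otimes>\<^bsub>Aa\<^esub> ?l" p] y by auto
      \<comment> \<open>In degree 0 the left-hand side of the equation is 1, whereas multiples of
        linear forms have no component there.\<close>
      have "A.coord (\<one>\<^bsub>Aa\<^esub> \<ominus>\<^bsub>Aa\<^esub> y \<otimes>\<^bsub>Aa\<^esub> ?l) {#} = 1"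
        using y by (simp add: a_minus_def A.coord_add A.coord_minus A.coord_one A_lin_coord_zero)
      then show False unfolding z(2) using z(1) by (simp add: A_lin_coord_zero)
    qed
  qed
  then show ?thesis by (simp add: TR0_def)
qed

end

section \<open>From an extension of co-point modules to a filtered module\<close>

context skew_algebra
begin

text \<open>The conditions of \<open>filtered_module\<close> that concern one step of the
  filtration, bundled so that generators and chains can be chosen for all steps
  simultaneously.\<close>

definition layer :: "((nat list \<Rightarrow> 'k) set set set, 'm) gmod \<Rightarrow> 'm set \<Rightarrow> 'm set \<Rightarrow> 'm \<Rightarrow>
    (int \<Rightarrow> (nat list \<Rightarrow> 'k) set set) \<Rightarrow> bool" where
  "layer M Li Lj e \<Theta> \<longleftrightarrow> e \<in> Li \<and> e \<in> mpart M 0 \<and> chain \<Theta> \<and>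
    (\<forall>x\<in>Li. \<exists>a\<in>carrier Aa. x \<ominus>\<^bsub>M\<^esub> e \<triangleleft>\<^bsub>M\<^esub> a \<in> Lj) \<and>
    (\<forall>d. \<forall>x\<in>Li \<inter> mpart M d. \<exists>a\<in>rpart Aa d. x \<ominus>\<^bsub>M\<^esub> e \<triangleleft>\<^bsub>M\<^esub> a \<in> Lj) \<and>
    (\<forall>a\<in>carrier Aa. e \<triangleleft>\<^bsub>M\<^esub> a \<in> Lj \<longleftrightarrow> (\<exists>b\<in>carrier Aa. a = pr (\<Theta> 0) \<otimes>\<^bsub>Aa\<^esub> b))"

text \<open>The map \<open>k\<close>, projection followed by the given isomorphism, sends
  \<open>Li\<close> onto the point module with kernel \<open>Lj\<close>, and the conditions are
  those of the point module pulled back along \<open>k\<close>. The delicate point is a lift of the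
  generator in degree 0, since \<open>graded_iso\<close> only says that graded pieces are mapped
  into graded pieces.\<close>

lemma filtration_layer:
  fixes M :: "((nat list \<Rightarrow> 'k) set set set, 'm) gmod"
  assumes M: "graded_right_module Aa M" and Li: "graded_submodule Aa M Li" and Lj: "rsubmodule Aa M Lj" "Lj \<subseteq> Li"
    and q: "q \<in> copoint_locus n \<alpha> - vanishing_locus n"
    and iso: "graded_isomorphic Aa (quot_module (graded_submodule_of M Li) Lj) (point_module n \<alpha> q)"
  shows "\<exists>e \<Theta>. layer M Li Lj e \<Theta>"
proof -
  interpret M: graded_right_module Aa M by (rule M)
  let ?N = "point_module n \<alpha> q" and ?Q = "quot_module (graded_submodule_of M Li) Lj" and ?g = "pt_gen q"
  have qE: "q \<in> copoint_locus n \<alpha>" using q by simp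
  interpret N: graded_right_module Aa ?N by (rule copoint_graded[OF qE])
  define MS where "MS = graded_submodule_of M Li"
  have MS: "carrier MS = Li" "add MS = add M" "\<zero>\<^bsub>MS\<^esub> = \<zero>\<^bsub>M\<^esub>" "ract MS = ract M" "mpart MS i = Li \<inter> mpart M i" for i
    by (simp_all add: MS_def graded_submodule_of_def)
  interpret MS: graded_right_module Aa MS using Li by (simp add: graded_submodule_def MS_def)
  interpret Li: additive_subgroup Li M using Li by (simp add: graded_submodule_def rsubmodule_def)
  interpret Lj: additive_subgroup Lj M using Lj by (simp add: rsubmodule_def)
  have LjS: "additive_subgroup Lj MS"
  proof (rule additive_subgroupI, rule MS.M.add.subgroupI)
    show "Lj \<subseteq> carrier MS" using Lj by (simp add: MS)
    show "Lj \<noteq> {}" using Lj.zero_closed by blast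
    show "\<ominus>\<^bsub>MS\<^esub> x \<in> Lj" if x: "x \<in> Lj" for x
    proof -
      have "\<ominus>\<^bsub>MS\<^esub> x = \<ominus>\<^bsub>M\<^esub> x"
        using x Lj(2) by (intro MS.M.minus_equality) (auto simp: MS M.M.l_neg)
      then show ?thesis using x by simp
    qed
    show "x \<oplus>\<^bsub>MS\<^esub> y \<in> Lj" if "x \<in> Lj" "y \<in> Lj" for x y using that by (simp add: MS)
  qed
  note Qs = quot_module[OF MS.M.abelian_group_axioms LjS]
  obtain h where h: "h \<in> graded_iso Aa (quot_module MS Lj) ?N"
    using iso unfolding graded_isomorphic_def MS_def by blast
  then have hh: "h \<in> right_hom Aa (quot_module MS Lj) ?N" and hb: "bij_betw h (carrier (quot_module MS Lj)) (carrier ?N)"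
    and hd: "h ` mpart (quot_module MS Lj) d \<subseteq> mpart ?N d" for d
    by (auto simp: graded_iso_def graded_hom_def)
  define k where "k x = h (Lj +>\<^bsub>MS\<^esub> x)" for x
  have cos: "Lj +>\<^bsub>MS\<^esub> x \<in> carrier (quot_module MS Lj)" if "x \<in> Li" for x
    unfolding Qs(1) using that by (simp add: MS)
  have k_closed: "k x \<in> carrier ?N" if "x \<in> Li" for x
    unfolding k_def by (rule right_homD(1)[OF hh cos[OF that]])
  have k_add: "k (x \<oplus>\<^bsub>M\<^esub> y) = k x \<oplus>\<^bsub>?N\<^esub> k y" if "x \<in> Li" "y \<in> Li" for x y
    using that right_homD(2)[OF hh cos[OF that(1)] cos[OF that(2)]] Qs(3)[of x y] by (simp add: k_def MS)
  have k_ract: "k (x \<triangleleft>\<^bsub>M\<^esub> a) = k x \<triangleleft>\<^bsub>?N\<^esub> a" if x: "x \<in> Li" and a: "a \<in> carrier Aa" for x a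
  proof -
    have "(Lj +>\<^bsub>MS\<^esub> x) \<triangleleft>\<^bsub>quot_module MS Lj\<^esub> a = Lj +>\<^bsub>MS\<^esub> (x \<triangleleft>\<^bsub>MS\<^esub> a)"
    proof (rule Qs(6))
      show "x \<in> carrier MS" using x by (simp add: MS)
      show "z \<triangleleft>\<^bsub>MS\<^esub> a \<in> carrier MS" if "z \<in> carrier MS" for z using that a by (rule MS.ract_closed)
      show "(y \<oplus>\<^bsub>MS\<^esub> z) \<triangleleft>\<^bsub>MS\<^esub> a = y \<triangleleft>\<^bsub>MS\<^esub> a \<oplus>\<^bsub>MS\<^esub> z \<triangleleft>\<^bsub>MS\<^esub> a" if "y \<in> carrier MS" "z \<in> carrier MS" for y z
        using that a by (rule MS.ract_add_left)
      show "z \<triangleleft>\<^bsub>MS\<^esub> a \<in> Lj" if "z \<in> Lj" for z using that a Lj(1) by (simp add: rsubmodule_def MS)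
    qed
    then show ?thesis using right_homD(3)[OF hh cos[OF x] a] by (simp add: k_def MS)
  qed
  have Lia: "x \<triangleleft>\<^bsub>M\<^esub> a \<in> Li" if "x \<in> Li" "a \<in> carrier Aa" for x a
    using MS.ract_closed[of x a] that by (simp add: MS)
  have k_zero: "k \<zero>\<^bsub>M\<^esub> = \<zero>\<^bsub>?N\<^esub>"
    using k_add[OF Li.zero_closed Li.zero_closed] N.M.add.l_cancel_one[of "k \<zero>\<^bsub>M\<^esub>" "k \<zero>\<^bsub>M\<^esub>"] k_closed[OF Li.zero_closed] by simp
  have k_zero_iff: "k x = \<zero>\<^bsub>?N\<^esub> \<longleftrightarrow> x \<in> Lj" if x: "x \<in> Li" for x
  proof -
    have "k x = \<zero>\<^bsub>?N\<^esub> \<longleftrightarrow> k x = k \<zero>\<^bsub>M\<^esub>" by (simp add: k_zero)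
    also have "\<dots> \<longleftrightarrow> Lj +>\<^bsub>MS\<^esub> x = Lj +>\<^bsub>MS\<^esub> \<zero>\<^bsub>M\<^esub>"
      unfolding k_def by (rule inj_on_eq_iff[OF bij_betw_imp_inj_on[OF hb] cos[OF x] cos[OF Li.zero_closed]])
    also have "Lj +>\<^bsub>MS\<^esub> \<zero>\<^bsub>M\<^esub> = Lj" using Qs(5)[of "\<zero>\<^bsub>M\<^esub>"] by (simp add: MS)
    also have "Lj +>\<^bsub>MS\<^esub> x = Lj \<longleftrightarrow> x \<in> Lj" using Qs(5)[of x] x by (simp add: MS)
    finally show ?thesis .
  qed
  have k_deg: "k x \<in> mpart ?N d" if "x \<in> Li" "x \<in> mpart M d" for x d
    using hd[of d] that by (auto simp: k_def quot_module_simps MS)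
  have k_diff: "x \<ominus>\<^bsub>M\<^esub> y \<in> Lj" if xy: "x \<in> Li" "y \<in> Li" "k x = k y" for x y
  proof -
    have "k (x \<ominus>\<^bsub>M\<^esub> y) \<oplus>\<^bsub>?N\<^esub> k y = k x"
      using xy k_add[of "x \<ominus>\<^bsub>M\<^esub> y" y] by (simp add: a_minus_def M.M.a_assoc M.M.l_neg)
    then have "k (x \<ominus>\<^bsub>M\<^esub> y) \<oplus>\<^bsub>?N\<^esub> k y = k y" using xy by simp
    then have "k (x \<ominus>\<^bsub>M\<^esub> y) = \<zero>\<^bsub>?N\<^esub>"
      using xy k_closed[of "x \<ominus>\<^bsub>M\<^esub> y"] k_closed[of y] by (simp add: a_minus_def)
    then show ?thesis using k_zero_iff[of "x \<ominus>\<^bsub>M\<^esub> y"] xy by (simp add: a_minus_def)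
  qed
  obtain y where y: "y \<in> Li" "k y = ?g"
  proof -
    have "?g \<in> h ` carrier (quot_module MS Lj)" using hb pt_gen_closed by (simp add: bij_betw_def)
    then show ?thesis using that unfolding Qs(1) by (auto simp: k_def MS)
  qed
  \<comment> \<open>The preimage \<open>y\<close> need not be homogeneous. The images of its
    components decompose the generator, and such a decomposition is unique, so the component of
    degree 0 is itself a preimage.\<close>
  obtain c where c: "\<And>i. c i \<in> mpart MS i" "finite {i. c i \<noteq> \<zero>\<^bsub>MS\<^esub>}"
    "y = (\<Oplus>\<^bsub>MS\<^esub>i\<in>{i. c i \<noteq> \<zero>\<^bsub>MS\<^esub>}. c i)"
    using MS.mpart_decomp[of y] y(1) by (auto simp: MS(1))
  have cL: "c i \<in> Li" "c i \<in> mpart M i" for i using c(1)[of i] by (auto simp: MS)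
  let ?I = "{i. c i \<noteq> \<zero>\<^bsub>MS\<^esub>}"
  have "?g = k (\<Oplus>\<^bsub>MS\<^esub>i\<in>?I. c i)" using y(2) c(3) by simp
  also have "\<dots> = (\<Oplus>\<^bsub>?N\<^esub>i\<in>?I. k (c i))"
    using c(2) cL k_closed k_add
    by (intro MS.M.additive_map_finsum[OF N.M.abelian_group_axioms]) (auto simp: MS)
  also have "\<dots> = (\<Oplus>\<^bsub>?N\<^esub>i\<in>{i. k (c i) \<noteq> \<zero>\<^bsub>?N\<^esub>}. k (c i))"
    using c(2) cL k_closed k_zero by (intro N.M.add.finprod_mono_neutral_cong_right) (auto simp: MS)
  finally have g_sum: "?g = (\<Oplus>\<^bsub>?N\<^esub>i\<in>{i. k (c i) \<noteq> \<zero>\<^bsub>?N\<^esub>}. k (c i))" .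
  \<comment> \<open>The decomposition of the generator concentrated in degree 0, with which the
    images of the components of \<open>y\<close> are compared.\<close>
  let ?b = "\<lambda>i::int. if i = 0 then ?g else \<zero>\<^bsub>?N\<^esub>"
  have fin1: "finite {i. k (c i) \<noteq> \<zero>\<^bsub>?N\<^esub>}" by (rule finite_subset[OF _ c(2)]) (auto simp: k_zero MS)
  have fin2: "finite {i. ?b i \<noteq> \<zero>\<^bsub>?N\<^esub>}" by (rule finite_subset[of _ "{0}"]) auto
  have b_deg: "?b i \<in> mpart ?N i" for i
    using pt_gen_mpart[of q] additive_subgroup.zero_closed[OF N.mpart_subgroup] by simp
  have b_sum: "?g = (\<Oplus>\<^bsub>?N\<^esub>i\<in>{i. ?b i \<noteq> \<zero>\<^bsub>?N\<^esub>}. ?b i)"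
  proof (cases "?g = \<zero>\<^bsub>?N\<^esub>")
    case False
    then have "{i. ?b i \<noteq> \<zero>\<^bsub>?N\<^esub>} = {0}" by auto
    then show ?thesis using pt_gen_closed by simp
  qed simp
  define decomp where "decomp v \<longleftrightarrow> (\<forall>i. v i \<in> mpart ?N i) \<and> finite {i. v i \<noteq> \<zero>\<^bsub>?N\<^esub>} \<and>
    ?g = (\<Oplus>\<^bsub>?N\<^esub>i\<in>{i. v i \<noteq> \<zero>\<^bsub>?N\<^esub>}. v i)" for v
  have "\<exists>!v. decomp v" unfolding decomp_def by (rule N.mpart_decomp[OF pt_gen_closed])
  moreover have "decomp (\<lambda>i. k (c i))"
    unfolding decomp_def by (intro conjI allI fin1 g_sum k_deg cL)
  moreover have "decomp ?b"
    unfolding decomp_def by (intro conjI allI fin2 b_sum b_deg)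
  ultimately have "(\<lambda>i. k (c i)) = ?b" by blast
  then have e: "k (c 0) = ?g" by (simp add: fun_eq_iff)
  let ?e = "c 0"
  obtain \<Theta> where \<Theta>: "chain \<Theta>" "\<And>x. x \<in> carrier Aa \<Longrightarrow> ?g \<triangleleft>\<^bsub>?N\<^esub> x = \<zero>\<^bsub>?N\<^esub> \<longleftrightarrow>
      (\<exists>y\<in>carrier Aa. x = pr (\<Theta> 0) \<otimes>\<^bsub>Aa\<^esub> y)" using copoint_chain[OF q] by blast
  have ke: "k (?e \<triangleleft>\<^bsub>M\<^esub> a) = ?g \<triangleleft>\<^bsub>?N\<^esub> a" if "a \<in> carrier Aa" for a
    using k_ract[OF cL(1) that] e by simp
  have "\<forall>x\<in>Li. \<exists>a\<in>carrier Aa. x \<ominus>\<^bsub>M\<^esub> ?e \<triangleleft>\<^bsub>M\<^esub> a \<in> Lj"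
  proof
    fix x assume x: "x \<in> Li"
    obtain a where a: "a \<in> carrier Aa" "k x = ?g \<triangleleft>\<^bsub>?N\<^esub> a" using pt_gen_gen[OF k_closed[OF x]] by blast
    then show "\<exists>a\<in>carrier Aa. x \<ominus>\<^bsub>M\<^esub> ?e \<triangleleft>\<^bsub>M\<^esub> a \<in> Lj"
      using k_diff[OF x Lia[OF cL(1) a(1)]] ke[OF a(1)] by (intro bexI[of _ a]) simp_all
  qed
  moreover have "\<forall>d. \<forall>x\<in>Li \<inter> mpart M d. \<exists>a\<in>rpart Aa d. x \<ominus>\<^bsub>M\<^esub> ?e \<triangleleft>\<^bsub>M\<^esub> a \<in> Lj"
  proof (intro allI ballI)
    fix d x assume x: "x \<in> Li \<inter> mpart M d"
    then have x1: "x \<in> Li" by simp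
    obtain a where a: "a \<in> rpart Aa d" "k x = ?g \<triangleleft>\<^bsub>?N\<^esub> a" using pt_gen_mpart_gen[OF k_deg[of x d]] x by blast
    then have aA: "a \<in> carrier Aa" using A.rpart_iff by blast
    then show "\<exists>a\<in>rpart Aa d. x \<ominus>\<^bsub>M\<^esub> ?e \<triangleleft>\<^bsub>M\<^esub> a \<in> Lj"
      using k_diff[OF x1 Lia[OF cL(1) aA]] ke[OF aA] a by (intro bexI[of _ a]) simp_all
  qed
  moreover have "\<forall>a\<in>carrier Aa. ?e \<triangleleft>\<^bsub>M\<^esub> a \<in> Lj \<longleftrightarrow> (\<exists>b\<in>carrier Aa. a = pr (\<Theta> 0) \<otimes>\<^bsub>Aa\<^esub> b)"
  proof
    fix a assume a: "a \<in> carrier Aa"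
    have "?e \<triangleleft>\<^bsub>M\<^esub> a \<in> Lj \<longleftrightarrow> ?g \<triangleleft>\<^bsub>?N\<^esub> a = \<zero>\<^bsub>?N\<^esub>"
      using k_zero_iff[OF Lia[OF cL(1)[of 0] a]] ke[OF a] by simp
    then show "?e \<triangleleft>\<^bsub>M\<^esub> a \<in> Lj \<longleftrightarrow> (\<exists>b\<in>carrier Aa. a = pr (\<Theta> 0) \<otimes>\<^bsub>Aa\<^esub> b)"
      using \<Theta>(2)[OF a] by simp
  qed
  ultimately have "layer M Li Lj ?e \<Theta>" unfolding layer_def using cL \<Theta>(1) by (intro conjI)
  then show ?thesis by blast
qed

lemma extension_NMF0:
  fixes M :: "((nat list \<Rightarrow> 'k) set set set, 'm) gmod"
  assumes M: "M \<in> grmod Aa"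
    and ext: "is_extension Aa r (copoint_locus n \<alpha> - vanishing_locus n) (point_module n \<alpha>) M"
  shows "\<exists>\<phi> :: (int \<Rightarrow> ((nat list \<Rightarrow> 'k) set set, nat \<Rightarrow> (nat list \<Rightarrow> 'k) set set) gmod) \<times>
      (int \<Rightarrow> (nat \<Rightarrow> (nat list \<Rightarrow> 'k) set set) \<Rightarrow> (nat \<Rightarrow> (nat list \<Rightarrow> 'k) set set)).
    \<phi> \<in> NMF0 Sa 2 ff r \<and> graded_isomorphic Aa M (NMF_coker Sa Aa pr \<phi>)"
proof -
  have Mg: "graded_right_module Aa M" using M by (simp add: grmod_def)
  interpret M: graded_right_module Aa M by (rule Mg)
  obtain L where L: "L 0 = carrier M" "L r = {\<zero>\<^bsub>M\<^esub>}" "\<And>i. i \<le> r \<Longrightarrow> graded_submodule Aa M (L i)"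
    "\<And>i. i < r \<Longrightarrow> L (Suc i) \<subseteq> L i"
    "\<And>i. i < r \<Longrightarrow> \<exists>q\<in>copoint_locus n \<alpha> - vanishing_locus n.
       graded_isomorphic Aa (quot_module (graded_submodule_of M (L i)) (L (Suc i))) (point_module n \<alpha> q)"
    using ext unfolding is_extension_def by blast
  have Lsub: "rsubmodule Aa M (L i)" if "i \<le> r" for i using L(3)[OF that] by (simp add: graded_submodule_def)
  have "\<exists>e \<Theta>. layer M (L i) (L (Suc i)) e \<Theta>" if i: "i < r" for i
  proof -
    obtain q where "q \<in> copoint_locus n \<alpha> - vanishing_locus n"
      "graded_isomorphic Aa (quot_module (graded_submodule_of M (L i)) (L (Suc i))) (point_module n \<alpha> q)"
      using L(5)[OF i] by blast
    then show ?thesis using i by (intro filtration_layer[OF Mg L(3) Lsub L(4)]) simp_all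
  qed
  then obtain e \<Theta> where e\<Theta>: "\<And>i. i < r \<Longrightarrow> layer M (L i) (L (Suc i)) (e i) (\<Theta> i)" by metis
  interpret filtered_module Sa Aa pr ff tau S.comp M L r e \<Theta>
  proof (intro filtered_module.intro filtered_module_axioms.intro hypersurface_axioms M.right_module_axioms)
    show "additive_subgroup (mpart M d) M" for d by (rule M.mpart_subgroup)
    show "x \<triangleleft>\<^bsub>M\<^esub> a \<in> mpart M (d + d')" if "x \<in> mpart M d" "a \<in> rpart Aa d'" for x a d d'
      using that by (rule M.mpart_ract)
    show "L 0 = carrier M" "L r = {\<zero>\<^bsub>M\<^esub>}" by (rule L)+
    show "rsubmodule Aa M (L i)" if "i \<le> r" for i using that by (rule Lsub)
    show "L (Suc i) \<subseteq> L i" if "i < r" for i using that by (rule L)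
    fix i assume i: "i < r"
    note P = e\<Theta>[OF i, unfolded layer_def]
    show "e i \<in> L i" "e i \<in> mpart M 0" "chain (\<Theta> i)" using P by blast+
    show "\<exists>a\<in>carrier Aa. x \<ominus>\<^bsub>M\<^esub> e i \<triangleleft>\<^bsub>M\<^esub> a \<in> L (Suc i)" if "x \<in> L i" for x using P that by blast
    show "\<exists>a\<in>rpart Aa d. x \<ominus>\<^bsub>M\<^esub> e i \<triangleleft>\<^bsub>M\<^esub> a \<in> L (Suc i)" if "x \<in> L i" "x \<in> mpart M d" for x d using P that by blast
    show "e i \<triangleleft>\<^bsub>M\<^esub> a \<in> L (Suc i) \<longleftrightarrow> (\<exists>b\<in>carrier Aa. a = pr (\<Theta> i 0) \<otimes>\<^bsub>Aa\<^esub> b)" if "a \<in> carrier Aa" for a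
      using P that by blast
  qed
  show ?thesis using phi_NMF0 NMF_coker_iso by blast
qed

end

theorem theorem7p10:
  fixes n :: nat and \<alpha> :: "nat \<Rightarrow> nat \<Rightarrow> 'k::field"
  assumes "n \<ge> 1"
    and "\<And>i j. i \<in> {1..n} \<Longrightarrow> j \<in> {1..n} \<Longrightarrow> i \<noteq> j \<Longrightarrow> \<alpha> i j * \<alpha> j i = 1"
  shows "(\<forall>p \<in> copoint_locus n \<alpha>.
            point_module n \<alpha> p \<in> TR0 (algS n \<alpha>) (algA n \<alpha>) (S_to_A n \<alpha>) \<longleftrightarrow>
            p \<notin> vanishing_locus n) \<and>
         (\<forall>(M :: ((nat list \<Rightarrow> 'k) set set set, 'm) gmod) r.
            M \<in> grmod (algA n \<alpha>) \<longrightarrow>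
            is_extension (algA n \<alpha>) r (copoint_locus n \<alpha> - vanishing_locus n) (point_module n \<alpha>) M \<longrightarrow>
            (\<exists>\<phi> :: (int \<Rightarrow> ((nat list \<Rightarrow> 'k) set set, nat \<Rightarrow> (nat list \<Rightarrow> 'k) set set) gmod) \<times>
                   (int \<Rightarrow> (nat \<Rightarrow> (nat list \<Rightarrow> 'k) set set) \<Rightarrow> (nat \<Rightarrow> (nat list \<Rightarrow> 'k) set set)).
               \<phi> \<in> NMF0 (algS n \<alpha>) 2 (elem_f n \<alpha>) r \<and>
               graded_isomorphic (algA n \<alpha>) M
                 (NMF_coker (algS n \<alpha>) (algA n \<alpha>) (S_to_A n \<alpha>) \<phi>)))"
proof -
  interpret skew_algebra n \<alpha> by unfold_locales (use assms in auto)
  show ?thesis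
    using point_module_TR0 point_module_not_TR0 extension_NMF0 by blast
qed

end
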